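(* For a semantics $\sigma\in\{\mathtt{co},\mathtt{st},\mathtt{pr},\mathtt{sst}\}$, let $\mathsf{SF\text{-}CA}^{\sigma}$ be the following decision problem. Input: an argumentation framework $\Lambda=\langle A,R\rangle$, a goal argument $g\in A$, a $\sigma$-labelling $\mathcal{L}$ of $\Lambda$, and an argument $g'\in A$. Question: is there a semifactual $\mathcal{L}'\in\mathcal{SF}^{\sigma}(g,\mathcal{L})$ in which $g'$ is accepted, i.e. with $\mathcal{L}'(g')=\mathbf{in}$? Then $\mathsf{SF\text{-}CA}^{\sigma}$ is: (1) $NP$-hard and in $\Theta_2^p$ for $\sigma\in\{\mathtt{co},\mathtt{st}\}$; and (2) $\Sigma_2^p$-hard and in $\Theta_3^p$ for $\sigma\in\{\mathtt{pr},\mathtt{sst}\}$.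
   Context: An argumentation framework (AF) is a pair $\Lambda=\langle A,R\rangle$ with $A$ a (finite) set of arguments and $R\subseteq A\times A$ a set of attacks. For $S\subseteq A$ let $\mathit{Def}(S)=\{a\in A\mid \exists b\in S,\ (b,a)\in R\}$ and $\mathit{Acc}(S)=\{a\in A\mid \forall (b,a)\in R,\ b\in \mathit{Def}(S)\}$. $S$ is conflict-free iff $S\cap \mathit{Def}(S)=\emptyset$, and admissible iff it is conflict-free and $S\subseteq \mathit{Acc}(S)$. A set $S\subseteq A$ is an extension called: complete ($\mathtt{co}$) iff it is admissible and $S=\mathit{Acc}(S)$; preferred ($\mathtt{pr}$) iff it is a $\subseteq$-maximal complete extension; stable ($\mathtt{st}$) iff it is a preferred extension with $S\cup \mathit{Def}(S)=A$; semi-stable ($\mathtt{sst}$) iff it is a preferred extension such that $S\cup \mathit{Def}(S)$ is $\subseteq$-maximal (among preferred extensions). A labelling is a total function $\mathcal{L}:A\to\{\mathbf{in},\mathbf{out},\mathbf{und}\}$. The labelling corresponding to an extension $E$ assigns $\mathbf{in}$ to the elements of $E$, $\mathbf{out}$ to the elements of $\mathit{Def}(E)$, and $\mathbf{und}$ to all other arguments. A $\sigma$-labelling of $\Lambda$ is the labelling corresponding to a $\sigma$-extension of $\Lambda$; $\sigma(\Lambda)$ denotes the set of $\sigma$-labellings of $\Lambda$. The distance between labellings is $\delta(\mathcal{L},\mathcal{L}')=|\{a\in A\mid \mathcal{L}(a)\neq\mathcal{L}'(a)\}|$. Semifactuals: for $g\in A$ and $\mathcal{L}\in\sigma(\Lambda)$,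 a labelling $\mathcal{L}'\in\sigma(\Lambda)$ is a semifactual of $\mathcal{L}$ w.r.t. $g$ if (i) $\mathcal{L}(g)=\mathcal{L}'(g)$, and (ii) there is no $\mathcal{L}''\in\sigma(\Lambda)$ with $\mathcal{L}(g)=\mathcal{L}''(g)$ and $\delta(\mathcal{L},\mathcal{L}'')>\delta(\mathcal{L},\mathcal{L}')$. $\mathcal{SF}^{\sigma}(g,\mathcal{L})$ denotes the set of all of them. Complexity: $\Sigma_1^p=NP$, $\Sigma_2^p=NP^{NP}$; $\Theta_h^p$ is the class of problems decidable in polynomial time by a deterministic Turing machine performing $O(\log n)$ calls to an oracle in $\Sigma_{h-1}^p$. *)

theory Defs
  imports Complex_Main "HOL-Library.FuncSet" "HOL-Library.Landau_Symbols"
    "HOL-Computational_Algebra.Polynomial"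
begin

section \<open>Argumentation frameworks, labellings and semifactuals\<close>

type_synonym 'a af = "'a set \<times> ('a \<times> 'a) set"

definition is_af :: "'a af \<Rightarrow> bool" where
  "is_af F \<longleftrightarrow> (case F of (A, R) \<Rightarrow> finite A \<and> R \<subseteq> A \<times> A)"

definition Def :: "'a af \<Rightarrow> 'a set \<Rightarrow> 'a set" where
  "Def F S = (case F of (A, R) \<Rightarrow> {a \<in> A. \<exists>b\<in>S. (b, a) \<in> R})"

definition Acc :: "'a af \<Rightarrow> 'a set \<Rightarrow> 'a set" where
  "Acc F S = (case F of (A, R) \<Rightarrow> {a \<in> A. \<forall>b. (b, a) \<in> R \<longrightarrow> b \<in> Def F S})"

definition conflict_free :: "'a af \<Rightarrow> 'a set \<Rightarrow> bool" where
  "conflict_free F S \<longleftrightarrow> S \<inter> Def F S = {}"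

definition admissible :: "'a af \<Rightarrow> 'a set \<Rightarrow> bool" where
  "admissible F S \<longleftrightarrow> conflict_free F S \<and> S \<subseteq> Acc F S"

definition complete_ext :: "'a af \<Rightarrow> 'a set \<Rightarrow> bool" where
  "complete_ext F S \<longleftrightarrow> S \<subseteq> fst F \<and> admissible F S \<and> S = Acc F S"

definition preferred_ext :: "'a af \<Rightarrow> 'a set \<Rightarrow> bool" where
  "preferred_ext F S \<longleftrightarrow> complete_ext F S \<and> \<not> (\<exists>T. complete_ext F T \<and> S \<subset> T)"

definition stable_ext :: "'a af \<Rightarrow> 'a set \<Rightarrow> bool" where
  "stable_ext F S \<longleftrightarrow> preferred_ext F S \<and> S \<union> Def F S = fst F"

definition semi_stable_ext :: "'a af \<Rightarrow> 'a set \<Rightarrow> bool" where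
  "semi_stable_ext F S \<longleftrightarrow>
     preferred_ext F S \<and> \<not> (\<exists>T. preferred_ext F T \<and> S \<union> Def F S \<subset> T \<union> Def F T)"

datatype semantics = CO | ST | PR | SST

fun extension :: "semantics \<Rightarrow> 'a af \<Rightarrow> 'a set \<Rightarrow> bool" where
  "extension CO = complete_ext"
| "extension ST = stable_ext"
| "extension PR = preferred_ext"
| "extension SST = semi_stable_ext"

datatype label = In | Out | Und

text \<open>Labellings are functions on the set of arguments only, hence extensional
  (\<open>restrict\<close>): outside it they carry no information.\<close>

definition labelling_of :: "'a af \<Rightarrow> 'a set \<Rightarrow> 'a \<Rightarrow> label" where
  "labelling_of F E = (\<lambda>a\<in>fst F. if a \<in> E then In else if a \<in> Def F E then Out else Und)"

definition labellings :: "semantics \<Rightarrow> 'a af \<Rightarrow> ('a \<Rightarrow> label) set" where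
  "labellings \<sigma> F = {labelling_of F E | E. extension \<sigma> F E}"

definition distance :: "'a af \<Rightarrow> ('a \<Rightarrow> label) \<Rightarrow> ('a \<Rightarrow> label) \<Rightarrow> nat" where
  "distance F L L' = card {a \<in> fst F. L a \<noteq> L' a}"

definition semifactuals ::
    "semantics \<Rightarrow> 'a af \<Rightarrow> 'a \<Rightarrow> ('a \<Rightarrow> label) \<Rightarrow> ('a \<Rightarrow> label) set" where
  "semifactuals \<sigma> F g L =
     {L' \<in> labellings \<sigma> F. L g = L' g \<and>
        \<not> (\<exists>L''\<in>labellings \<sigma> F. L g = L'' g \<and> distance F L L'' > distance F L L')}"


section \<open>Multi-tape oracle Turing machines\<close>

text \<open>
  A machine is given by a finite table of (possibly nondeterministic) transitions, so that only
  finitely many states and tape symbols are relevant. Tapes are two-way infinite. Tape 0 holds the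
  input; tape 1 is the oracle query tape, and the output tape of machines computing functions.
\<close>

datatype sym = Blank | Bit bool | Mark nat

datatype move = Left | Stay | Right

type_synonym tape = "(int \<Rightarrow> sym) \<times> int"
type_synonym config = "nat \<times> tape list"

record machine =
  ntapes :: nat
  table :: "(nat \<times> sym list \<times> nat \<times> (sym \<times> move) list) set"
  start_state :: nat
  accept_state :: nat
  query_state :: nat
  yes_state :: nat
  no_state :: nat

definition well_formed :: "machine \<Rightarrow> bool" where
  "well_formed M \<longleftrightarrow> 2 \<le> ntapes M \<and> finite (table M) \<and>
     (\<forall>(q, rs, q', as) \<in> table M. length rs = ntapes M \<and> length as = ntapes M)"

definition deterministic :: "machine \<Rightarrow> bool" where
  "deterministic M \<longleftrightarrow>
     (\<forall>q rs q1 as1 q2 as2. (q, rs, q1, as1) \<in> table M \<and> (q, rs, q2, as2) \<in> table M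
        \<longrightarrow> q1 = q2 \<and> as1 = as2)"

fun read :: "tape \<Rightarrow> sym" where
  "read (t, h) = t h"

fun act :: "tape \<Rightarrow> sym \<times> move \<Rightarrow> tape" where
  "act (t, h) (s, m) =
     (t(h := s), case m of Left \<Rightarrow> h - 1 | Stay \<Rightarrow> h | Right \<Rightarrow> h + 1)"

text \<open>The word written on a tape: the bits from cell 0 up to the first cell not holding a bit.
  Only finitely many cells of a reachable tape are non-blank, so this cell exists.\<close>

fun tape_word :: "tape \<Rightarrow> bool list" where
  "tape_word (t, h) =
     map (\<lambda>i. t (int i) = Bit True) [0..<(LEAST n. t (int n) \<notin> range Bit)]"

definition word_tape :: "bool list \<Rightarrow> tape" where
  "word_tape w =
     (\<lambda>i. if 0 \<le> i \<and> i < int (length w) then Bit (w ! nat i) else Blank, 0)"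

definition init :: "machine \<Rightarrow> bool list \<Rightarrow> config" where
  "init M w = (start_state M, word_tape w # replicate (ntapes M - 1) (word_tape []))"

text \<open>\<open>step M B c k c'\<close>: with oracle \<open>B\<close>, the machine moves from \<open>c\<close> to \<open>c'\<close> in one step, asking
  \<open>k\<close> oracle queries (0 or 1). In the query state only the oracle acts.\<close>

inductive step :: "machine \<Rightarrow> bool list set \<Rightarrow> config \<Rightarrow> nat \<Rightarrow> config \<Rightarrow> bool"
  for M :: machine and B :: "bool list set" where
  trans: "\<lbrakk> q \<noteq> query_state M; (q, map read ts, q', as) \<in> table M \<rbrakk>
    \<Longrightarrow> step M B (q, ts) 0 (q', map2 act ts as)"
| ask: "step M B (query_state M, ts) 1
          (if tape_word (ts ! 1) \<in> B then yes_state M else no_state M, ts)"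

text \<open>\<open>run M B c n k c'\<close>: a computation from \<open>c\<close> to \<open>c'\<close> with \<open>n\<close> steps, \<open>k\<close> of them queries.\<close>

inductive run :: "machine \<Rightarrow> bool list set \<Rightarrow> config \<Rightarrow> nat \<Rightarrow> nat \<Rightarrow> config \<Rightarrow> bool"
  for M :: machine and B :: "bool list set" where
  run_refl: "run M B c 0 0 c"
| run_step: "\<lbrakk> step M B c k c'; run M B c' n m c'' \<rbrakk> \<Longrightarrow> run M B c (Suc n) (k + m) c''"

definition halted :: "machine \<Rightarrow> bool list set \<Rightarrow> config \<Rightarrow> bool" where
  "halted M B c \<longleftrightarrow> \<not> (\<exists>k c'. step M B c k c')"

definition poly_time :: "machine \<Rightarrow> bool list set \<Rightarrow> bool" where
  "poly_time M B \<longleftrightarrow>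
     (\<exists>p :: nat poly. \<forall>w n k c. run M B (init M w) n k c \<longrightarrow> n \<le> poly p (length w))"

definition accepts :: "machine \<Rightarrow> bool list set \<Rightarrow> bool list \<Rightarrow> bool" where
  "accepts M B w \<longleftrightarrow>
     (\<exists>n k c. run M B (init M w) n k c \<and> halted M B c \<and> fst c = accept_state M)"

definition recognizes :: "machine \<Rightarrow> bool list set \<Rightarrow> bool list set \<Rightarrow> bool" where
  "recognizes M B X \<longleftrightarrow> (\<forall>w. accepts M B w \<longleftrightarrow> w \<in> X)"

definition log_queries :: "machine \<Rightarrow> bool list set \<Rightarrow> bool" where
  "log_queries M B \<longleftrightarrow>
     (\<exists>f :: nat \<Rightarrow> real. f \<in> O(\<lambda>n. log 2 (real n)) \<and>
        (\<forall>w n k c. run M B (init M w) n k c \<longrightarrow> real k \<le> f (length w)))"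


section \<open>Complexity classes and hardness\<close>

definition NP_rel :: "bool list set \<Rightarrow> bool list set set" where
  "NP_rel B = {X. \<exists>M. well_formed M \<and> poly_time M B \<and> recognizes M B X}"

text \<open>Machines without an oracle are machines with the empty oracle: every query is answered no.\<close>

definition P :: "bool list set set" where
  "P = {X. \<exists>M. well_formed M \<and> deterministic M \<and> poly_time M {} \<and> recognizes M {} X}"

definition NP :: "bool list set set" where
  "NP = NP_rel {}"

fun Sigma_p :: "nat \<Rightarrow> bool list set set" where
  "Sigma_p 0 = P"
| "Sigma_p (Suc 0) = NP"
| "Sigma_p (Suc (Suc h)) = (\<Union>B\<in>Sigma_p (Suc h). NP_rel B)"

text \<open>Intended for \<open>h \<ge> 1\<close>.\<close>

definition Theta_p :: "nat \<Rightarrow> bool list set set" where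
  "Theta_p h = {X. \<exists>B\<in>Sigma_p (h - 1). \<exists>M. well_formed M \<and> deterministic M \<and>
     poly_time M B \<and> log_queries M B \<and> recognizes M B X}"

definition poly_time_computable :: "(bool list \<Rightarrow> bool list) \<Rightarrow> bool" where
  "poly_time_computable f \<longleftrightarrow>
     (\<exists>M. well_formed M \<and> deterministic M \<and> poly_time M {} \<and>
        (\<forall>w. \<exists>n k c. run M {} (init M w) n k c \<and> halted M {} c \<and> tape_word (snd c ! 1) = f w))"

text \<open>
  A decision problem is a set \<open>I\<close> of words encoding its inputs with the subset \<open>Y\<close> of the
  yes-inputs. Recognizing whether a word belongs to \<open>I\<close> need not be easy (being a preferred
  labelling is not known to be decidable in polynomial time). We therefore require reductions to
  produce proper inputs on all words, so that hardness is not owed to improper ones. In particular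
  the language \<open>Y\<close> is then hard in the usual sense. Membership in a class is that of the
  language \<open>Y\<close>, for which improper words have to be rejected.
\<close>

definition hard_for :: "bool list set set \<Rightarrow> bool list set \<Rightarrow> bool list set \<Rightarrow> bool" where
  "hard_for C I Y \<longleftrightarrow>
     (\<forall>X\<in>C. \<exists>f. poly_time_computable f \<and> (\<forall>w. f w \<in> I \<and> (w \<in> X \<longleftrightarrow> f w \<in> Y)))"


section \<open>Credulous acceptance under semifactual reasoning\<close>

type_synonym 'a sf_input = "'a af \<times> 'a \<times> ('a \<Rightarrow> label) \<times> 'a"

definition SF_CA_inputs :: "semantics \<Rightarrow> 'a sf_input set" where
  "SF_CA_inputs \<sigma> =
     {(F, g, L, g'). is_af F \<and> g \<in> fst F \<and> L \<in> labellings \<sigma> F \<and> g' \<in> fst F}"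

definition SF_CA_yes :: "semantics \<Rightarrow> 'a sf_input set" where
  "SF_CA_yes \<sigma> =
     {(F, g, L, g') \<in> SF_CA_inputs \<sigma>. \<exists>L'\<in>semifactuals \<sigma> F g L. L' g' = In}"

fun label_code :: "label \<Rightarrow> bool list" where
  "label_code In = [True, False]"
| "label_code Out = [False, True]"
| "label_code Und = [False, False]"

text \<open>
  Relative to an enumeration \<open>xs\<close> of the arguments: their number in unary, the adjacency matrix,
  the labels, and the characteristic vectors of the two distinguished arguments. An input has
  one encoding for each enumeration.
\<close>

fun encode :: "'a list \<Rightarrow> 'a sf_input \<Rightarrow> bool list" where
  "encode xs ((A, R), g, L, g') =
     replicate (length xs) True @ [False]
     @ map (\<lambda>ab. ab \<in> R) (List.product xs xs)
     @ concat (map (\<lambda>a. label_code (L a)) xs)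
     @ map (\<lambda>a. a = g) xs
     @ map (\<lambda>a. a = g') xs"

definition encodings :: "'a sf_input set \<Rightarrow> bool list set" where
  "encodings X = {encode xs x | xs x. x \<in> X \<and> distinct xs \<and> set xs = fst (fst x)}"

text \<open>Arguments are natural numbers, which loses no finite framework up to renaming.\<close>

definition SF_CA_input_words :: "semantics \<Rightarrow> bool list set" where
  "SF_CA_input_words \<sigma> = encodings (SF_CA_inputs \<sigma> :: nat sf_input set)"

definition SF_CA :: "semantics \<Rightarrow> bool list set" where
  "SF_CA \<sigma> = encodings (SF_CA_yes \<sigma> :: nat sf_input set)"

end

theory Submission imports Defs begin

text \<open>Membership: a binary search with an oracle finds the largest distance from the given labelling at
  which a labelling with the same goal label exists; one further query asks for such a labelling that
  accepts the target. The oracle guesses the labelling and, for the semantics based on maximality,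
  asks in turn for a larger extension.

  Hardness: the computations of a polynomial-time machine are described by clauses, as in the
  Cook-Levin theorem. For an oracle machine, the computations behind positive answers are guessed as
  well, while the negative answers become the universal part of a formula with one quantifier
  alternation. The framework contains the literals, the clauses and an argument for the whole formula.
  One pad per ordinary argument makes every extension deciding the target favourably farther from the
  given labelling than all others, so that credulous acceptance in semifactuals is existence.\<close>

text \<open>All machines built here come from one small language of expressions whose values have
  polynomial length by construction; verifiers, oracle queries and reductions are such expressions,
  so polynomial time is proved once, for a compiler. Hardness requires that the reduction also
  writes down a valid labelling, although finding an extension may itself be hard. A variable
  \<open>uvar\<close> removes this obstacle: making it true satisfies every clause, which yields an
  extension whose labels depend on the kind of argument alone, while the question concerns
  extensions with \<open>uvar\<close> false. For complete and stable semantics the goal is accepted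
  in every extension. For the other two it must carry information: among the preferred extensions
  with \<open>uvar\<close> false, the goal is undecided exactly when the formula argument is not
  accepted, and that expresses the universal part. Since preferred and semi-stable extensions differ
  in general, self-attacking arguments that copy the literals into the range make them coincide in
  this framework, so that one construction serves both.\<close>

abbreviation (input) iff :: "bool => bool => bool" (infixr "<->" 25) where
 "A <-> B == A = B"

section \<open>Structured programs for Turing machines\<close>

text \<open>Programs handle blanks (\<open>None\<close>) and bits only, never marks; this keeps the
  set of possible readings, and with it every transition table, finite.\<close>

type_synonym cells = "(int => bool option) \<times> int"

fun sym_of :: "bool option => sym" where
 "sym_of None = Blank"
| "sym_of (Some b) = Bit b"

fun shift :: "move => int => int" where
 "shift Left h = h - 1"
| "shift Stay h = h"
| "shift Right h = h + 1"

definition scan :: "cells => bool option" where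
 "scan t = fst t (snd t)"

definition update :: "cells => bool option => move => cells" where
 "update t b m = ((fst t)(snd t := b), shift m (snd t))"

definition tape_of :: "cells => tape" where
 "tape_of t = (sym_of \<circ> fst t, snd t)"

definition tapes :: "machine => (nat => cells) => tape list" where
 "tapes M s = map (%i. tape_of (s i)) [0..<ntapes M]"

lemma sym_of_inject [simp]: "sym_of a = sym_of b <-> a = b"
 by (cases a; cases b) auto

lemma sym_of_eq_Blank [simp]: "sym_of a = Blank <-> a = None"
 by (cases a) auto

lemma length_tapes [simp]: "length (tapes M s) = ntapes M"
 by (simp add: tapes_def)

lemma nth_tapes [simp]: "i < ntapes M ==> tapes M s ! i = tape_of (s i)"
 by (simp add: tapes_def)

lemma read_tape_of [simp]: "read (tape_of t) = sym_of (scan t)"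
 by (cases t) (simp add: tape_of_def scan_def)

lemma act_tape_of: "act (tape_of t) (sym_of b, m) = tape_of (update t b m)"
 by (cases m) (auto simp: tape_of_def update_def)

lemma update_scan_Stay [simp]: "update t (scan t) Stay = t"
 by (cases t) (simp add: scan_def update_def)

text \<open>\<open>Cond i b\<close> compares the cell scanned on tape i with b,
  \<open>While i\<close> repeats as long as tape i scans a bit, \<open>Choose\<close> is
  nondeterministic, and \<open>Ask\<close> branches on the oracle's answer to the word on tape
  1.\<close>

datatype prog =
  Skip
 | Move nat move
 | Write nat "bool option"
 | Seq prog prog
 | Cond nat "bool option" prog prog
 | While nat prog
 | Choose prog prog
 | Ask prog prog

text \<open>The number of states used. A branching construct needs one state for its test and one
  for a jump, either over the second branch or back to the test of the loop.\<close>

primrec psize :: "prog => nat" where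
 "psize Skip = 0"
| "psize (Move i m) = 1"
| "psize (Write i b) = 1"
| "psize (Seq p q) = psize p + psize q"
| "psize (Cond i b p q) = 2 + psize p + psize q"
| "psize (While i p) = 2 + psize p"
| "psize (Choose p q) = 2 + psize p + psize q"
| "psize (Ask p q) = 2 + psize p + psize q"

datatype node = Branch nat "sym => (nat \<times> sym \<times> move) list" | Query nat nat

abbreviation jump :: "nat => node" where
 "jump q \<equiv> Branch 0 (%s. [(q, s, Stay)])"

text \<open>The instruction in state q of a program placed at the states from l on. Control always
  leaves through \<open>l + psize p\<close>, so that \<open>Seq\<close> needs no state of its
  own.\<close>

primrec code :: "nat => prog => nat => node" where
 "code l Skip = (%q. jump 0)"
| "code l (Move i m) = (%q. Branch i (%s. [(l + 1, s, m)]))"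
| "code l (Write i b) = (%q. Branch i (%s. [(l + 1, sym_of b, Stay)]))"
| "code l (Seq p1 p2) = (%q. if q < l + psize p1 then code l p1 q else code (l + psize p1) p2 q)"
| "code l (Cond i b p1 p2) = (%q.
   if q = l then Branch i (%s. [(if s = sym_of b then l + 1 else l + 2 + psize p1, s, Stay)])
   else if q < l + 1 + psize p1 then code (l + 1) p1 q
   else if q = l + 1 + psize p1 then jump (l + 2 + psize p1 + psize p2)
   else code (l + 2 + psize p1) p2 q)"
| "code l (While i p1) = (%q.
   if q = l then Branch i (%s. [(if s = Blank then l + 2 + psize p1 else l + 1, s, Stay)])
   else if q < l + 1 + psize p1 then code (l + 1) p1 q
   else jump l)"
| "code l (Choose p1 p2) = (%q.
   if q = l then Branch 0 (%s. [(l + 1, s, Stay), (l + 2 + psize p1, s, Stay)])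
   else if q < l + 1 + psize p1 then code (l + 1) p1 q
   else if q = l + 1 + psize p1 then jump (l + 2 + psize p1 + psize p2)
   else code (l + 2 + psize p1) p2 q)"
| "code l (Ask p1 p2) = (%q.
   if q = l then Query (l + 1) (l + 2 + psize p1)
   else if q < l + 1 + psize p1 then code (l + 1) p1 q
   else if q = l + 1 + psize p1 then jump (l + 2 + psize p1 + psize p2)
   else code (l + 2 + psize p1) p2 q)"

definition stay :: "sym list => (sym \<times> move) list" where
 "stay = map (%s. (s, Stay))"

text \<open>An equivalence, because the table must have no further rows in state q: time bounds and
  soundness speak about all computations, not only about the intended one.\<close>

primrec behaves :: "machine => nat => node => bool" where
 "behaves M q (Branch i N) <-> i < ntapes M & q ~= query_state M &
   (\<forall>rs q' as. (q, rs, q', as) \<in> table M <-> length rs = ntapes M & set rs \<subseteq> range sym_of &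
    (\<exists>x m. (q', x, m) \<in> set (N (rs ! i)) & as = (stay rs)[i := (x, m)]))"
| "behaves M q (Query y n) <-> query_state M = q & yes_state M = y & no_state M = n"

definition located :: "machine => nat => prog => bool" where
 "located M l p <-> (\<forall>q. l <= q & q < l + psize p --> behaves M q (code l p q))"

section \<open>Single steps at a located instruction\<close>

lemma map2_act_stay:
 assumes "i < length ts"
 shows "map2 act ts ((stay (map read ts))[i := a]) = ts[i := act (ts ! i) a]"
proof (rule nth_equalityI)
 fix j assume "j < length (map2 act ts ((stay (map read ts))[i := a]))"
 then have j: "j < length ts" by (simp add: stay_def)
 obtain t h where th: "ts ! j = (t, h)" by fastforce
 show "map2 act ts ((stay (map read ts))[i := a]) ! j = ts[i := act (ts ! i) a] ! j"
  using j th by (cases "j = i") (auto simp: stay_def)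
qed (simp add: stay_def)

lemma tapes_update:
 assumes "i < ntapes M"
 shows "(tapes M s)[i := act (tapes M s ! i) (sym_of b, m)] = tapes M (s(i := update (s i) b m))"
 using assms by (intro nth_equalityI) (auto simp: nth_list_update act_tape_of)

lemma step_Branch:
 assumes "behaves M q (Branch i N)"
 shows "step M B (q, tapes M s) k c' <-> k = 0 &
  (\<exists>q' x m. (q', x, m) \<in> set (N (sym_of (scan (s i)))) &
    c' = (q', (tapes M s)[i := act (tapes M s ! i) (x, m)]))"
proof -
 have i: "i < ntapes M" and q: "q ~= query_state M"
  and t: "\<And>rs q' as. (q, rs, q', as) \<in> table M <-> length rs = ntapes M & set rs \<subseteq> range sym_of &
    (\<exists>x m. (q', x, m) \<in> set (N (rs ! i)) & as = (stay rs)[i := (x, m)])"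
  using assms by auto
 have r: "set (map read (tapes M s)) \<subseteq> range sym_of"
  by (auto simp: tapes_def)
 have m: "map2 act (tapes M s) ((stay (map read (tapes M s)))[i := a]) =
   (tapes M s)[i := act (tapes M s ! i) a]" for a
  using i by (intro map2_act_stay) simp
 have "step M B (q, tapes M s) k c' <-> k = 0 &
   (\<exists>q' as. (q, map read (tapes M s), q', as) \<in> table M & c' = (q', map2 act (tapes M s) as))"
  using q by (auto elim!: step.cases intro: step.trans)
 also have "\<dots> <-> k = 0 &
  (\<exists>q' x m. (q', x, m) \<in> set (N (sym_of (scan (s i)))) &
    c' = (q', map2 act (tapes M s) ((stay (map read (tapes M s)))[i := (x, m)])))"
  unfolding t using i r by (simp del: map_map) blast
 also have "\<dots> <-> k = 0 &
  (\<exists>q' x m. (q', x, m) \<in> set (N (sym_of (scan (s i)))) &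
    c' = (q', (tapes M s)[i := act (tapes M s ! i) (x, m)]))"
  unfolding m ..
 finally show ?thesis .
qed

lemma step_Query:
 assumes "behaves M q (Query y n)"
 shows "step M B (q, ts) k c' <-> k = 1 & c' = (if tape_word (ts ! 1) \<in> B then y else n, ts)"
proof
 assume "step M B (q, ts) k c'"
 then show "k = 1 & c' = (if tape_word (ts ! 1) \<in> B then y else n, ts)"
  using assms by (auto elim!: step.cases)
next
 assume "k = 1 & c' = (if tape_word (ts ! 1) \<in> B then y else n, ts)"
 then show "step M B (q, ts) k c'"
  using assms step.ask[of M B ts] by (simp split: if_splits)
qed

section \<open>Reachability within bounds on steps and queries\<close>

text \<open>From \<open>c\<close> the set \<open>Q\<close> is reached with \<open>n\<close> steps and \<open>k\<close> queries at most: on all computations if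
 \<open>d\<close> holds, and on some computation otherwise.\<close>

primrec reaches :: "bool => machine => bool list set => (config => bool) => nat => nat => config => bool"
where
 "reaches d M B Q 0 = (%k c. Q c)"
| "reaches d M B Q (Suc n) = (%k c. Q c \<or>
   (\<exists>i c'. step M B c i c' & i <= k & reaches d M B Q n (k - i) c') &
   (d --> (\<forall>i c'. step M B c i c' --> i <= k & reaches d M B Q n (k - i) c')))"

declare reaches.simps(2) [simp del]

lemma reachesI: "Q c ==> reaches d M B Q n k c"
 by (cases n) (simp_all add: reaches.simps)

lemma reaches_mono:
 "reaches d M B Q n k c ==> n <= n' ==> k <= k' ==> (\<And>c. Q c ==> Q' c) ==> reaches d M B Q' n' k' c"
proof (induction n arbitrary: n' k k' c)
 case 0
 then have "Q' c" unfolding reaches.simps by blast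
 then show ?case by (rule reachesI)
next
 case (Suc n)
 then obtain m where m: "n' = Suc m" "n <= m" by (cases n') auto
 have *: "reaches d M B Q' m (k' - i) c'" if "reaches d M B Q n (k - i) c'" for i c'
  using that Suc.IH[of "k - i" c' m "k' - i"] m Suc.prems by simp
 have le: "i <= k ==> i <= k'" for i using Suc.prems by simp
 show ?case using Suc.prems(1,4) m(1) * le unfolding m(1) reaches.simps by blast
qed

lemma reaches_trans:
 "reaches d M B R n k c ==> (\<And>c. R c ==> reaches d M B Q n' k' c) ==>
  reaches d M B Q (n + n') (k + k') c"
proof (induction n arbitrary: k c)
 case 0
 then have "reaches d M B Q n' k' c" by simp
 then show ?case by (rule reaches_mono) simp_all
next
 case (Suc n)
 show ?case
 proof (cases "R c")
  case True
  then have "reaches d M B Q n' k' c" by (rule Suc.prems(2))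
  then show ?thesis by (rule reaches_mono) simp_all
 next
  case False
  have *: "i <= k + k' & reaches d M B Q (n + n') (k + k' - i) c'"
   if "i <= k" "reaches d M B R n (k - i) c'" for i c'
   using Suc.IH[OF that(2) Suc.prems(2)] that(1) by simp
  have le: "i <= k ==> i <= k + k'" for i by simp
  show ?thesis using Suc.prems(1) False * unfolding reaches.simps add_Suc by blast
 qed
qed

lemma reaches_step:
 assumes "step M B c i c'" "\<And>j c''. step M B c j c'' ==> j = i & c'' = c'"
  and "reaches d M B Q n k c'"
 shows "reaches d M B Q (Suc n) (i + k) c"
proof -
 have "i <= i + k" "i + k - i = k" by simp_all
 then show ?thesis using assms unfolding reaches.simps by metis
qed

text \<open>A total correctness triple with budgets of n steps and k queries, independent of the
  machine and of the location, so that triples compose. With d it speaks about all computations,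
  which gives time bounds and soundness; without d about some computation, which gives
  acceptance.\<close>

definition spec ::
 "bool => bool list set => prog => (nat => cells) => nat => nat => ((nat => cells) => bool) => bool"
where
 "spec d B p s n k Q <-> (\<forall>M l. 2 <= ntapes M --> located M l p -->
   reaches d M B (%c. \<exists>s'. Q s' & c = (l + psize p, tapes M s')) n k (l, tapes M s))"

lemma specD:
 "spec d B p s n k Q ==> 2 <= ntapes M ==> located M l p ==> l' = l + psize p ==>
  reaches d M B (%c. \<exists>s'. Q s' & c = (l', tapes M s')) n k (l, tapes M s)"
 by (simp add: spec_def)

lemma spec_mono:
 "spec d B p s n k Q ==> n <= n' ==> k <= k' ==> (\<And>s. Q s ==> Q' s) ==> spec d B p s n' k' Q'"
 unfolding spec_def
 by (intro allI impI, rule reaches_mono[where n = n and k = k and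
  Q = "%c. \<exists>s'. Q s' & c = (_ + psize p, tapes _ s')"]) blast+

section \<open>Proof rules for the program constructs\<close>

lemma spec_Skip: "Q s ==> spec d B Skip s 0 0 Q"
 by (auto simp: spec_def)

lemma step_jump:
 assumes "behaves M q (Branch i N)" "N (sym_of (scan (s i))) = [(q', sym_of b, m)]"
  "reaches d M B Q n k (q', tapes M (s(i := update (s i) b m)))"
 shows "reaches d M B Q (Suc n) k (q, tapes M s)"
proof -
 have i: "i < ntapes M" using assms by simp
 have st: "step M B (q, tapes M s) j c' <->
   j = 0 & c' = (q', tapes M (s(i := update (s i) b m)))" for j c'
  by (simp add: step_Branch[OF assms(1)] assms(2) tapes_update[OF i] del: nth_tapes)
 have "reaches d M B Q (Suc n) (0 + k) (q, tapes M s)"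
  by (rule reaches_step[OF _ _ assms(3)]) (simp_all only: st simp_thms)
 then show ?thesis unfolding add_0 .
qed

lemma step_jump_stay:
 assumes "behaves M q (Branch i N)" "N (sym_of (scan (s i))) = [(q', sym_of (scan (s i)), Stay)]"
  "reaches d M B Q n k (q', tapes M s)"
 shows "reaches d M B Q (Suc n) k (q, tapes M s)"
 by (rule step_jump[where N = N and s = s and b = "scan (s i)" and m = Stay, OF assms(1,2)])
  (use assms(3) in simp)

lemma spec_Move:
 assumes "Q (s(i := (fst (s i), shift m (snd (s i)))))"
 shows "spec d B (Move i m) s 1 0 Q"
 unfolding spec_def
proof (intro allI impI)
 fix M l assume "located M l (Move i m)"
 then have b: "behaves M l (Branch i (%s. [(l + 1, s, m)]))"
  by (auto simp: located_def)
 have u: "update (s i) (scan (s i)) m = (fst (s i), shift m (snd (s i)))"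
  by (simp add: update_def scan_def)
 show "reaches d M B (%c. \<exists>s'. Q s' & c = (l + psize (Move i m), tapes M s')) 1 0 (l, tapes M s)"
  unfolding One_nat_def by (rule step_jump[where q' = "l + 1" and b = "scan (s i)" and m = m, OF b]) (use assms u in auto)
qed

lemma spec_Write:
 assumes "Q (s(i := ((fst (s i))(snd (s i) := b), snd (s i))))"
 shows "spec d B (Write i b) s 1 0 Q"
 unfolding spec_def
proof (intro allI impI)
 fix M l assume "located M l (Write i b)"
 then have b: "behaves M l (Branch i (%s. [(l + 1, sym_of b, Stay)]))"
  by (auto simp: located_def)
 show "reaches d M B (%c. \<exists>s'. Q s' & c = (l + psize (Write i b), tapes M s')) 1 0 (l, tapes M s)"
  unfolding One_nat_def by (rule step_jump[where q' = "l + 1" and b = b and m = Stay, OF b]) (use assms in \<open>auto simp: update_def\<close>)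
qed

lemma located_Seq:
 "located M l (Seq p q) ==> located M l p & located M (l + psize p) q"
 unfolding located_def
proof (intro conjI allI impI)
 fix x assume *: "\<forall>x. l <= x & x < l + psize (Seq p q) --> behaves M x (code l (Seq p q) x)"
 show "behaves M x (code l p x)" if "l <= x & x < l + psize p"
  using *[rule_format, of x] that by auto
 show "behaves M x (code (l + psize p) q x)" if "l + psize p <= x & x < l + psize p + psize q"
  using *[rule_format, of x] that by auto
qed

lemma located_bin:
 assumes "located M l r" "r = Cond i b p q \<or> r = Choose p q \<or> r = Ask p q"
 shows "located M (l + 1) p" "located M (l + 2 + psize p) q"
  "behaves M (l + 1 + psize p) (jump (l + 2 + psize p + psize q))"
  "behaves M l (code l r l)"
proof -
 have *: "behaves M x (code l r x)" if "l <= x" "x < l + 2 + psize p + psize q" for x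
  using that assms unfolding located_def by auto
 show "located M (l + 1) p" unfolding located_def
 proof (intro allI impI)
  fix x assume "l + 1 <= x & x < l + 1 + psize p"
  then show "behaves M x (code (l + 1) p x)" using *[of x] assms(2) by auto
 qed
 show "located M (l + 2 + psize p) q" unfolding located_def
 proof (intro allI impI)
  fix x assume "l + 2 + psize p <= x & x < l + 2 + psize p + psize q"
  then show "behaves M x (code (l + 2 + psize p) q x)" using *[of x] assms(2) by auto
 qed
 show "behaves M (l + 1 + psize p) (jump (l + 2 + psize p + psize q))"
  using *[of "l + 1 + psize p"] assms(2) by auto
 show "behaves M l (code l r l)"
  using *[of l] by auto
qed

lemma located_While:
 assumes "located M l (While i p)"
 shows "located M (l + 1) p" "behaves M (l + 1 + psize p) (jump l)"
  "behaves M l (Branch i (%s. [(if s = Blank then l + 2 + psize p else l + 1, s, Stay)]))"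
proof -
 have *: "behaves M x (code l (While i p) x)" if "l <= x" "x < l + 2 + psize p" for x
  using that assms unfolding located_def by auto
 show "located M (l + 1) p" unfolding located_def
 proof (intro allI impI)
  fix x assume "l + 1 <= x & x < l + 1 + psize p"
  then show "behaves M x (code (l + 1) p x)" using *[of x] by auto
 qed
 show "behaves M (l + 1 + psize p) (jump l)" using *[of "l + 1 + psize p"] by auto
 show "behaves M l (Branch i (%s. [(if s = Blank then l + 2 + psize p else l + 1, s, Stay)]))"
  using *[of l] by auto
qed

lemma spec_Seq:
 assumes "spec d B p s n k R" "\<And>s'. R s' ==> spec d B q s' n' k' Q"
 shows "spec d B (Seq p q) s (n + n') (k + k') Q"
 unfolding spec_def
proof (intro allI impI)
 fix M l assume M: "2 <= ntapes M" "located M l (Seq p q)"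
 note l = located_Seq[OF M(2)]
 show "reaches d M B (%c. \<exists>s'. Q s' & c = (l + psize (Seq p q), tapes M s')) (n + n') (k + k')
     (l, tapes M s)"
  by (rule reaches_trans[OF specD[OF assms(1) M(1) conjunct1[OF l] refl]])
   (use specD[OF assms(2) M(1) conjunct2[OF l]] in \<open>auto simp: add.assoc\<close>)
qed

lemma spec_branch_aux:
 assumes M: "2 <= ntapes M" and "located M l p" "spec d B p s n k Q" "behaves M (l + psize p) (jump q)"
 shows "reaches d M B (%c. \<exists>s'. Q s' & c = (q, tapes M s')) (n + 1) k (l, tapes M s)"
proof -
 have "reaches d M B (%c. \<exists>s'. Q s' & c = (q, tapes M s')) (Suc 0) 0 c"
  if "\<exists>s'. Q s' & c = (l + psize p, tapes M s')" for c
 proof -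
  from that obtain s' where s': "Q s'" "c = (l + psize p, tapes M s')" by blast
  show ?thesis unfolding s'(2)
   by (rule step_jump_stay[OF assms(4)]) (use s' in auto)
 qed
 from reaches_trans[OF specD[OF assms(3,1,2) refl] this] show ?thesis by simp
qed

lemma spec_Cond:
 assumes "scan (s i) = b ==> spec d B p s n k Q" "scan (s i) ~= b ==> spec d B q s n k Q"
 shows "spec d B (Cond i b p q) s (n + 2) k Q"
 unfolding spec_def
proof (intro allI impI)
 fix M l assume M: "2 <= ntapes M" "located M l (Cond i b p q)"
 note l = located_bin[OF M(2) disjI1[OF refl]]
 let ?Q = "%c. \<exists>s'. Q s' & c = (l + psize (Cond i b p q), tapes M s')"
 have e: "l + psize (Cond i b p q) = l + 2 + psize p + psize q" by simp
 have b: "behaves M l (Branch i (%s. [(if s = sym_of b then l + 1 else l + 2 + psize p, s, Stay)]))"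
  using l(4) by simp
 have "reaches d M B ?Q (Suc (n + 1)) k (l, tapes M s)"
 proof (cases "scan (s i) = b")
  case True
  have "reaches d M B ?Q (n + 1) k (l + 1, tapes M s)"
   unfolding e by (rule spec_branch_aux[OF M(1) l(1) assms(1)[OF True]]) (use l(3) in simp)
  with True show ?thesis
   by (intro step_jump_stay[OF b]) auto
 next
  case False
  have "reaches d M B ?Q (n + 1) k (l + 2 + psize p, tapes M s)"
   by (rule reaches_mono[OF specD[OF assms(2)[OF False] M(1) l(2) e]]) auto
  with False show ?thesis
   by (intro step_jump_stay[OF b]) auto
 qed
 then show "reaches d M B ?Q (n + 2) k (l, tapes M s)" by simp
qed

lemma spec_Ask:
 assumes "tape_word (tape_of (s 1)) \<in> B ==> spec d B p s n k Q"
  "tape_word (tape_of (s 1)) \<notin> B ==> spec d B q s n k Q"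
 shows "spec d B (Ask p q) s (n + 2) (k + 1) Q"
 unfolding spec_def
proof (intro allI impI)
 fix M l assume M: "2 <= ntapes M" "located M l (Ask p q)"
 note l = located_bin[OF M(2) disjI2[OF disjI2[OF refl]]]
 let ?Q = "%c. \<exists>s'. Q s' & c = (l + psize (Ask p q), tapes M s')"
 have e: "l + psize (Ask p q) = l + 2 + psize p + psize q" by simp
 have b: "behaves M l (Query (l + 1) (l + 2 + psize p))" using l(4) by simp
 have t1: "tapes M s ! 1 = tape_of (s 1)" using M by simp
 let ?c = "(if tape_word (tape_of (s 1)) \<in> B then l + 1 else l + 2 + psize p, tapes M s)"
 have "reaches d M B ?Q (n + 1) k ?c"
 proof (cases "tape_word (tape_of (s 1)) \<in> B")
  case True
  have "reaches d M B ?Q (n + 1) k (l + 1, tapes M s)"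
   unfolding e by (rule spec_branch_aux[OF M(1) l(1) assms(1)[OF True]]) (use l(3) in simp)
  with True show ?thesis by simp
 next
  case False
  have "reaches d M B ?Q (n + 1) k (l + 2 + psize p, tapes M s)"
   by (rule reaches_mono[OF specD[OF assms(2)[OF False] M(1) l(2) e]]) auto
  with False show ?thesis by simp
 qed
 moreover have "step M B (l, tapes M s) i c' <-> i = 1 & c' = ?c" for i c'
  unfolding step_Query[OF b] t1 ..
 ultimately have "reaches d M B ?Q (Suc (n + 1)) (1 + k) (l, tapes M s)"
  by (intro reaches_step[where c' = ?c]) blast+
 then show "reaches d M B ?Q (n + 2) (k + 1) (l, tapes M s)"
  by (simp add: numeral_2_eq_2)
qed

text \<open>If only one computation matters, x prescribes the branch to take; otherwise both
  branches have to be verified.\<close>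

lemma spec_Choose:
 assumes "d \<or> x ==> spec d B p s n k Q" "d \<or> ~ x ==> spec d B q s n k Q"
 shows "spec d B (Choose p q) s (n + 2) k Q"
 unfolding spec_def
proof (intro allI impI)
 fix M l assume M: "2 <= ntapes M" "located M l (Choose p q)"
 note l = located_bin[OF M(2) disjI2[OF disjI1[OF refl]]]
 let ?Q = "%c. \<exists>s'. Q s' & c = (l + psize (Choose p q), tapes M s')"
 have e: "l + psize (Choose p q) = l + 2 + psize p + psize q" by simp
 have b: "behaves M l (Branch 0 (%s. [(l + 1, s, Stay), (l + 2 + psize p, s, Stay)]))"
  using l(4) by simp
 have 1: "reaches d M B ?Q (n + 1) k (l + 1, tapes M s)" if "d \<or> x"
  unfolding e by (rule spec_branch_aux[OF M(1) l(1) assms(1)[OF that]]) (use l(3) in simp)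
 have 2: "reaches d M B ?Q (n + 1) k (l + 2 + psize p, tapes M s)" if "d \<or> ~ x"
  by (rule reaches_mono[OF specD[OF assms(2)[OF that] M(1) l(2) e]]) auto
 have stp: "step M B (l, tapes M s) i c' <->
   i = 0 & (c' = (l + 1, tapes M s) \<or> c' = (l + 2 + psize p, tapes M s))" for i c'
 proof -
  have t0: "(tapes M s)[0 := act (tape_of (s 0)) (sym_of (scan (s 0)), Stay)] = tapes M s"
   using tapes_update[of 0 M s "scan (s 0)" Stay] M(1) by simp
  have n0: "tapes M s ! 0 = tape_of (s 0)" using M(1) by simp
  show ?thesis unfolding step_Branch[OF b] n0 using t0 by auto
 qed
 have all: "i <= k & reaches d M B ?Q (n + 1) (k - i) c'"
  if d "step M B (l, tapes M s) i c'" for i c'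
  using that(2) 1[OF disjI1[OF that(1)]] 2[OF disjI1[OF that(1)]] unfolding stp
  by (elim conjE disjE) (simp_all only: diff_zero le0 simp_thms)
 have ex: "\<exists>i c'. step M B (l, tapes M s) i c' & i <= k & reaches d M B ?Q (n + 1) (k - i) c'"
 proof (cases x)
  case True
  show ?thesis unfolding stp
   by (intro exI[of _ 0] exI[of _ "(l + 1, tapes M s)"])
    (use 1[OF disjI2[OF True]] in \<open>simp only: diff_zero le0 simp_thms\<close>)
 next
  case False
  show ?thesis unfolding stp
   by (intro exI[of _ 0] exI[of _ "(l + 2 + psize p, tapes M s)"])
    (use 2[OF disjI2[OF False]] in \<open>simp only: diff_zero le0 simp_thms\<close>)
 qed
 have e2: "n + 2 = Suc (n + 1)" by simp
 show "reaches d M B ?Q (n + 2) k (l, tapes M s)"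
  unfolding e2 reaches.simps(2) by (rule disjI2[OF conjI[OF ex]]) (intro impI allI, rule all)
qed

text \<open>The index of the invariant is the number of remaining iterations. Each one pays for a
  test and a jump besides its body, and the test that leaves the loop adds one step.\<close>

lemma spec_While:
 assumes "I j s"
  and "\<And>s. I 0 s ==> scan (s i) = None"
  and "\<And>j s. I (Suc j) s ==> scan (s i) ~= None & spec d B p s n k (I j)"
 shows "spec d B (While i p) s (j * (n + 2) + 1) (j * k) (I 0)"
 unfolding spec_def
proof (intro allI impI)
 fix M l assume M: "2 <= ntapes M" "located M l (While i p)"
 note l = located_While[OF M(2)]
 let ?Q = "%c. \<exists>s'. I 0 s' & c = (l + psize (While i p), tapes M s')"
 from assms(1) show "reaches d M B ?Q (j * (n + 2) + 1) (j * k) (l, tapes M s)"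
 proof (induction j arbitrary: s)
  case 0
  have "reaches d M B ?Q (Suc 0) 0 (l, tapes M s)"
   by (rule step_jump_stay[where q' = "l + 2 + psize p", OF l(3)])
    (use assms(2)[OF 0] 0 in \<open>auto intro!: reachesI simp: add.assoc\<close>)
  then show ?case by simp
 next
  case (Suc j)
  have *: "reaches d M B (%c. \<exists>s'. I j s' & c = (l, tapes M s')) (n + 1) k (l + 1, tapes M s)"
   by (rule spec_branch_aux[OF M(1) l(1)]) (use conjunct2[OF assms(3)[OF Suc.prems]] l(2) in auto)
  have "reaches d M B (%c. \<exists>s'. I j s' & c = (l, tapes M s')) (Suc (n + 1)) k (l, tapes M s)"
   by (rule step_jump_stay[where q' = "l + 1", OF l(3)]) (use assms(3)[OF Suc.prems] * in auto)
  then have "reaches d M B ?Q (Suc (n + 1) + (j * (n + 2) + 1)) (k + j * k) (l, tapes M s)"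
  proof (rule reaches_trans)
   fix c assume "\<exists>s'. I j s' & c = (l, tapes M s')"
   then obtain s' where s': "I j s'" "c = (l, tapes M s')" by (elim exE conjE)
   show "reaches d M B ?Q (j * (n + 2) + 1) (j * k) c"
    unfolding s'(2) by (rule Suc.IH[OF s'(1)])
  qed
  moreover have e: "Suc j * (n + 2) + 1 = Suc (n + 1) + (j * (n + 2) + 1)" "Suc j * k = k + j * k"
   by simp_all
  ultimately show ?case unfolding e by simp
 qed
qed

section \<open>Finite transition tables for programs\<close>

primrec used :: "prog => nat set" where
 "used Skip = {}"
| "used (Move i m) = {i}"
| "used (Write i b) = {i}"
| "used (Seq p q) = used p \<union> used q"
| "used (Cond i b p q) = insert i (used p \<union> used q)"
| "used (While i p) = insert i (used p)"
| "used (Choose p q) = used p \<union> used q"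
| "used (Ask p q) = used p \<union> used q"

primrec asks :: "prog => nat" where
 "asks Skip = 0"
| "asks (Move i m) = 0"
| "asks (Write i b) = 0"
| "asks (Seq p q) = asks p + asks q"
| "asks (Cond i b p q) = asks p + asks q"
| "asks (While i p) = asks p"
| "asks (Choose p q) = asks p + asks q"
| "asks (Ask p q) = Suc (asks p + asks q)"

primrec choice_free :: "prog => bool" where
 "choice_free Skip = True"
| "choice_free (Move i m) = True"
| "choice_free (Write i b) = True"
| "choice_free (Seq p q) <-> choice_free p & choice_free q"
| "choice_free (Cond i b p q) <-> choice_free p & choice_free q"
| "choice_free (While i p) = choice_free p"
| "choice_free (Choose p q) = False"
| "choice_free (Ask p q) <-> choice_free p & choice_free q"

lemma code_used: "code l p q = Branch i N ==> i \<in> insert 0 (used p)"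
 by (induction p arbitrary: l) (auto split: if_splits)

lemma code_choice_free: "code l p q = Branch i N ==> choice_free p ==> length (N s) = 1"
 by (induction p arbitrary: l) (auto split: if_splits)

lemma code_no_Query: "asks p = 0 ==> code l p q ~= Query y n"
 by (induction p arbitrary: l) auto

text \<open>A machine has a single query state with fixed successors for both answers, so at most
  one \<open>Ask\<close> can be compiled; loops around it still allow many queries.\<close>

lemma code_Query_unique:
 "asks p <= 1 ==> l <= q ==> l <= q' ==> code l p q = Query y n ==> code l p q' = Query y' n' ==>
  q < l + psize p ==> q' < l + psize p ==> q = q'"
proof (induction p arbitrary: l)
 case (Seq p1 p2)
 then have "asks p1 = 0 \<or> asks p2 = 0" unfolding asks.simps by arith
 with Seq show ?case
  by (auto split: if_splits simp: code_no_Query dest: Seq.IH(1)[rotated 3] Seq.IH(2)[rotated 3])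
next
 case (Cond i b p1 p2)
 then have "asks p1 = 0 \<or> asks p2 = 0" unfolding asks.simps by arith
 with Cond show ?case
  by (auto split: if_splits simp: code_no_Query dest: Cond.IH(1)[rotated 3] Cond.IH(2)[rotated 3])
next
 case (Choose p1 p2)
 then have "asks p1 = 0 \<or> asks p2 = 0" unfolding asks.simps by arith
 with Choose show ?case
  by (auto split: if_splits simp: code_no_Query dest: Choose.IH(1)[rotated 3] Choose.IH(2)[rotated 3])
next
 case (Ask p1 p2)
 then have "asks p1 = 0" "asks p2 = 0" by simp_all
 with Ask show ?case by (auto split: if_splits simp: code_no_Query)
next
 case (While i p)
 then show ?case by (auto split: if_splits dest: While.IH[rotated 3])
qed auto

definition rows :: "nat => nat => nat => (sym => (nat \<times> sym \<times> move) list) => (nat \<times> sym list \<times> nat \<times> (sym \<times> move) list) set" where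
 "rows K q i N = (\<Union>rs \<in> {rs. set rs \<subseteq> range sym_of & length rs = K}.
   (%(q', x, m). (q, rs, q', (stay rs)[i := (x, m)])) ` set (N (rs ! i)))"

text \<open>The last test: on a blank the machine is stuck in a state that is not accepting, on a
  bit it enters the accepting state, which has no rows.\<close>

definition final_node :: "nat => sym => (nat \<times> sym \<times> move) list" where
 "final_node q s = (if s = Blank then [] else [(q + 1, s, Stay)])"

text \<open>A program without \<open>Ask\<close> gets a state beyond the two final ones,
  \<open>psize p\<close> and \<open>psize p + 1\<close>, as its query state, so that no computation
  arrives there.\<close>

definition query_of :: "prog => nat" where
 "query_of p = (if \<exists>q<psize p. \<exists>y n. code 0 p q = Query y n
   then SOME q. q < psize p & (\<exists>y n. code 0 p q = Query y n) else psize p + 2)"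

text \<open>Acceptance means that tape \<open>j\<close> finally scans a bit.\<close>

definition machine_of :: "nat => nat => prog => machine" where
 "machine_of K j p = \<lparr>
   ntapes = K,
   table = (\<Union>q<psize p. case code 0 p q of Branch i N => rows K q i N | Query y n => {})
       \<union> rows K (psize p) j (final_node (psize p)),
   start_state = 0,
   accept_state = psize p + 1,
   query_state = query_of p,
   yes_state = (case code 0 p (query_of p) of Query y n => y | _ => 0),
   no_state = (case code 0 p (query_of p) of Query y n => n | _ => 0)\<rparr>"

lemma finite_range_sym_of: "finite (range sym_of)"
 by simp

lemma finite_rows: "finite (rows K q i N)"
 unfolding rows_def by (intro finite_UN_I finite_lists_length_eq finite_range_sym_of) auto

lemma rows_iff:
 "(q, rs, q', as) \<in> rows K q0 i N <-> q = q0 & length rs = K & set rs \<subseteq> range sym_of &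
   (\<exists>x m. (q', x, m) \<in> set (N (rs ! i)) & as = (stay rs)[i := (x, m)])"
 unfolding rows_def by force

lemma well_formed_machine_of:
 assumes "2 <= K"
 shows "well_formed (machine_of K j p)"
 unfolding well_formed_def
proof (intro conjI)
 show "finite (table (machine_of K j p))"
  by (auto simp: machine_of_def finite_rows split: node.split)
 show "\<forall>(q, rs, q', as) \<in> table (machine_of K j p).
   length rs = ntapes (machine_of K j p) & length as = ntapes (machine_of K j p)"
  by (auto simp: machine_of_def rows_iff stay_def split: node.splits)
qed (use assms in \<open>simp add: machine_of_def\<close>)

lemma query_of:
 assumes "asks p <= 1" "q < psize p"
 shows "query_of p = q <-> (\<exists>y n. code 0 p q = Query y n)"
proof
 assume *: "\<exists>y n. code 0 p q = Query y n"
 then have "\<exists>q<psize p. \<exists>y n. code 0 p q = Query y n" using assms by blast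
 then have "query_of p < psize p & (\<exists>y n. code 0 p (query_of p) = Query y n)"
  using someI_ex[of "%q. q < psize p & (\<exists>y n. code 0 p q = Query y n)"] by (simp add: query_of_def)
 then show "query_of p = q"
  using * assms code_Query_unique[of p 0] by fastforce
next
 assume "query_of p = q"
 with assms show "\<exists>y n. code 0 p q = Query y n"
  using someI_ex[of "%q. q < psize p & (\<exists>y n. code 0 p q = Query y n)"]
  by (auto simp: query_of_def split: if_splits)
qed

lemma query_of_neq: "psize p <= q ==> q ~= psize p + 2 ==> query_of p ~= q"
proof (cases "\<exists>q<psize p. \<exists>y n. code 0 p q = Query y n")
 case True
 then have "query_of p < psize p"
  using someI_ex[of "%q. q < psize p & (\<exists>y n. code 0 p q = Query y n)"] by (simp add: query_of_def)
 then show "psize p <= q ==> query_of p ~= q" by simp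
next
 case False
 then have "query_of p = psize p + 2" unfolding query_of_def by (rule if_not_P)
 then show "q ~= psize p + 2 ==> query_of p ~= q" by simp
qed

lemma in_table:
 "(q, rs, q', as) \<in> table (machine_of K j p) <->
   q < psize p & (\<exists>i N. code 0 p q = Branch i N & (q, rs, q', as) \<in> rows K q i N) \<or>
   q = psize p & (q, rs, q', as) \<in> rows K q j (final_node q)"
proof -
 have "(q, rs, q', as) \<in> (case code 0 p x of Branch i N => rows K x i N | Query y n => {}) <->
   x = q & (\<exists>i N. code 0 p q = Branch i N & (q, rs, q', as) \<in> rows K q i N)" for x
  unfolding rows_iff by (cases "x = q"; cases "code 0 p x") (simp_all add: rows_iff)
 then show ?thesis by (auto simp: machine_of_def) (auto simp: rows_iff)
qed

lemma located_machine_of: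
 assumes "asks p <= 1" "used p \<subseteq> {..<K}" "2 <= K"
 shows "located (machine_of K j p) 0 p"
 unfolding located_def
proof (intro allI impI)
 fix q assume "0 <= q & q < 0 + psize p"
 then have q: "q < psize p" by simp
 show "behaves (machine_of K j p) q (code 0 p q)"
 proof (cases "code 0 p q")
  case (Branch i N)
  have "i < K" using code_used[OF Branch] assms by auto
  moreover have "q ~= query_of p" using query_of[OF assms(1) q] Branch by auto
  moreover have "(q, rs, q', as) \<in> table (machine_of K j p) <-> (q, rs, q', as) \<in> rows K q i N" for rs q' as
   using q Branch by (simp add: in_table)
  ultimately show ?thesis by (simp add: Branch rows_iff) (simp add: machine_of_def)
 next
  case (Query y n)
  then show ?thesis using query_of[OF assms(1) q] by (auto simp: machine_of_def)
 qed
qed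

lemma behaves_final:
 assumes "j < K"
 shows "behaves (machine_of K j p) (psize p) (Branch j (final_node (psize p)))"
proof -
 have "query_of p ~= psize p" by (rule query_of_neq) simp_all
 moreover have "(psize p, rs, q', as) \<in> table (machine_of K j p) <->
   (psize p, rs, q', as) \<in> rows K (psize p) j (final_node (psize p))" for rs q' as
  by (simp add: in_table)
 ultimately show ?thesis using assms
  by (simp add: rows_iff) (auto simp: machine_of_def)
qed

lemma final_halted: "halted (machine_of K j p) B (psize p + 1, ts)"
proof -
 have "query_of p ~= psize p + 1" by (rule query_of_neq) simp_all
 moreover have "(psize p + 1, rs, q', as) \<notin> table (machine_of K j p)" for rs q' as
  by (simp add: in_table)
 moreover have "query_state (machine_of K j p) = query_of p" by (simp add: machine_of_def)
 ultimately show ?thesis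
  unfolding halted_def
 proof (intro notI, elim exE)
  fix k c' assume "step (machine_of K j p) B (psize p + 1, ts) k c'"
  then show False
   using \<open>query_of p ~= psize p + 1\<close> \<open>query_state (machine_of K j p) = query_of p\<close>
    \<open>\<And>rs q' as. (psize p + 1, rs, q', as) \<notin> table (machine_of K j p)\<close>
   by cases simp_all
 qed
qed

lemma deterministic_machine_of:
 assumes "choice_free p"
 shows "deterministic (machine_of K j p)"
proof -
 have u: "x = y" if "length xs = 1" "x \<in> set xs" "y \<in> set xs" for x y and xs :: "(nat \<times> sym \<times> move) list"
  using that by (auto simp: length_Suc_conv)
 have "q1 = q2 & as1 = as2"
  if t: "(q, rs, q1, as1) \<in> table (machine_of K j p)" "(q, rs, q2, as2) \<in> table (machine_of K j p)"
  for q rs q1 as1 q2 as2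
 proof (cases "q < psize p")
  case True
  then obtain i N where iN: "code 0 p q = Branch i N"
   "(q, rs, q1, as1) \<in> rows K q i N" "(q, rs, q2, as2) \<in> rows K q i N"
   using t unfolding in_table by auto
  have "length (N (rs ! i)) = 1" using code_choice_free[OF iN(1) assms] .
  with iN(2,3) show ?thesis using u by (auto simp: rows_iff) blast+
 next
  case False
  then have "(q, rs, q1, as1) \<in> rows K (psize p) j (final_node (psize p))"
   "(q, rs, q2, as2) \<in> rows K (psize p) j (final_node (psize p))"
   using t unfolding in_table by auto
  then show ?thesis by (auto simp: rows_iff final_node_def split: if_splits)
 qed
 then show ?thesis unfolding deterministic_def by blast
qed

lemma accept_state_machine_of [simp]: "accept_state (machine_of K j p) = psize p + 1"
 by (simp add: machine_of_def)

section \<open>From reachability to runs and acceptance\<close>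

lemma reaches_run:
 assumes "reaches d M B Q n k c"
 shows "\<exists>m i c'. run M B c m i c' & Q c'"
 using assms
proof (induction n arbitrary: k c)
 case 0
 then show ?case using run_refl unfolding reaches.simps by blast
next
 case (Suc n)
 show ?case
 proof (cases "Q c")
  case True
  then show ?thesis using run_refl by blast
 next
  case False
  with Suc.prems obtain i c' where "step M B c i c'" "reaches d M B Q n (k - i) c'"
   unfolding reaches.simps by blast
  with Suc.IH run_step show ?thesis by blast
 qed
qed

text \<open>\<open>reaches\<close> is satisfied as soon as \<open>Q\<close> holds; demanding that
  such configurations are halted rules out runs that go on and exceed the budget.\<close>

lemma reaches_all_runs:
 assumes "run M B c m i c'" "reaches True M B Q n k c" "\<And>c. Q c ==> halted M B c"
 shows "m <= n & i <= k & (halted M B c' --> Q c')"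
 using assms(1,2)
proof (induction arbitrary: n k rule: run.induct)
 case (run_refl c)
 have "Q c" if "halted M B c"
  using run_refl that by (cases n) (auto simp: reaches.simps halted_def simp del: split_paired_Ex)
 then show ?case by simp
next
 case (run_step c i c' m j c'')
 have nQ: "~ Q c" using assms(3)[of c] run_step.hyps(1) unfolding halted_def by blast
 then obtain n' where n: "n = Suc n'" using run_step.prems by (cases n) auto
 have "i <= k" "reaches True M B Q n' (k - i) c'"
  using run_step.prems run_step.hyps(1) nQ unfolding n reaches.simps by blast+
 with run_step.IH[of n' "k - i"] n show ?case by auto
qed

definition word :: "bool list => int => cells" where
 "word w h = (%i. if 0 <= i & i < int (length w) then Some (w ! nat i) else None, h)"

lemma tape_word_word [simp]: "tape_word (tape_of (word w h)) = w"
proof -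
 have "(LEAST n. ~ n < length w) = length w"
  by (rule Least_equality) auto
 moreover have "sym_of (fst (word w h) (int n)) \<notin> range Bit <-> ~ n < length w" for n
  by (auto simp: word_def)
 ultimately show ?thesis
  unfolding tape_of_def tape_word.simps comp_def
  by (intro nth_equalityI) (auto simp: word_def)
qed

definition start :: "bool list => nat => cells" where
 "start w = (%i. word (if i = 0 then w else []) 0)"

lemma init_machine_of: "2 <= K ==> init (machine_of K j p) w = (0, tapes (machine_of K j p) (start w))"
 by (auto simp: init_def tapes_def start_def word_def word_tape_def tape_of_def machine_of_def fun_eq_iff
   nth_Cons intro!: nth_equalityI split: nat.split)

definition runs_on :: "nat => nat => prog => bool" where
 "runs_on K j p <-> 2 <= K & j < K & asks p <= 1 & used p \<subseteq> {..<K}"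

text \<open>A final configuration after the test of tape j: the state tells whether that tape scans
  a bit.\<close>

definition verdict :: "nat => nat => prog => ((nat => cells) => bool) => config => bool" where
 "verdict K j p Q c <-> (\<exists>s. Q s & snd c = tapes (machine_of K j p) s &
   fst c = (if scan (s j) = None then psize p else psize p + 1))"

lemma verdict_halted:
 assumes "runs_on K j p" "verdict K j p Q c"
 shows "halted (machine_of K j p) B c"
proof -
 obtain s where s: "snd c = tapes (machine_of K j p) s"
  "fst c = (if scan (s j) = None then psize p else psize p + 1)"
  using assms(2) by (auto simp: verdict_def)
 show ?thesis
 proof (cases "scan (s j) = None")
  case True
  have b: "behaves (machine_of K j p) (psize p) (Branch j (final_node (psize p)))"
   using behaves_final assms(1) by (simp add: runs_on_def)
  have "c = (psize p, tapes (machine_of K j p) s)" using s True by (cases c) simp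
  then show ?thesis unfolding halted_def by (simp add: step_Branch[OF b] True final_node_def)
 next
  case False
  then have "c = (psize p + 1, snd c)" using s by (cases c) simp
  then show ?thesis using final_halted by metis
 qed
qed

lemma machine_of_reaches:
 assumes r: "runs_on K j p" and sp: "spec d B p (start w) n k Q"
 shows "reaches d (machine_of K j p) B (verdict K j p Q) (n + 1) k (init (machine_of K j p) w)"
proof -
 let ?M = "machine_of K j p"
 have K: "2 <= K" "j < K" using r by (auto simp: runs_on_def)
 have nt: "ntapes ?M = K" by (simp add: machine_of_def)
 have 1: "reaches d ?M B (%c. \<exists>s'. Q s' & c = (psize p, tapes ?M s')) n k (0, tapes ?M (start w))"
  by (rule specD[OF sp]) (use r nt located_machine_of in \<open>auto simp: runs_on_def\<close>)
 have "reaches d ?M B (verdict K j p Q) 1 0 c" if e: "\<exists>s'. Q s' & c = (psize p, tapes ?M s')" for c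
 proof -
  obtain s where s: "Q s" "c = (psize p, tapes ?M s)" using e by (elim exE conjE)
  note b = behaves_final[OF K(2), of p]
  show ?thesis
  proof (cases "scan (s j) = None")
   case True
   then have "verdict K j p Q c" using s by (auto simp: verdict_def)
   then show ?thesis by (rule reachesI)
  next
   case False
   have "reaches d ?M B (verdict K j p Q) (Suc 0) 0 (psize p, tapes ?M s)"
    by (rule step_jump_stay[where q' = "psize p + 1", OF b])
     (use False s in \<open>auto simp: final_node_def verdict_def\<close>)
   then show ?thesis using s by simp
  qed
 qed
 from reaches_trans[OF 1 this] show ?thesis using init_machine_of[OF K(1)] by simp
qed

lemma machine_of_runs:
 assumes "runs_on K j p" "spec True B p (start w) n k Q"
  "run (machine_of K j p) B (init (machine_of K j p) w) m i c"
 shows "m <= n + 1" "i <= k" "halted (machine_of K j p) B c ==> verdict K j p Q c"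
 using reaches_all_runs[OF assms(3) machine_of_reaches[OF assms(1,2)] verdict_halted[OF assms(1)]]
 by auto

text \<open>Every halting run ends in a verdict satisfying \<open>Q\<close>, because the triple
  covers all computations; for the converse \<open>acceptsI\<close> a single computation
  suffices.\<close>

lemma accepts_imp:
 assumes "runs_on K j p" "spec True B p (start w) n k Q" "accepts (machine_of K j p) B w"
 shows "\<exists>s. Q s & scan (s j) ~= None"
proof -
 obtain m i c where c: "run (machine_of K j p) B (init (machine_of K j p) w) m i c"
  "halted (machine_of K j p) B c" "fst c = accept_state (machine_of K j p)"
  using assms(3) by (auto simp: accepts_def)
 from machine_of_runs(3)[OF assms(1,2) c(1,2)] c(3) show ?thesis
  by (auto simp: verdict_def split: if_splits)
qed

lemma acceptsI:
 assumes "runs_on K j p" "spec d B p (start w) n k Q" "\<And>s. Q s ==> scan (s j) ~= None"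
 shows "accepts (machine_of K j p) B w"
proof -
 obtain m i c where c: "run (machine_of K j p) B (init (machine_of K j p) w) m i c" "verdict K j p Q c"
  using reaches_run[OF machine_of_reaches[OF assms(1,2)]] by blast
 have "fst c = psize p + 1" using c(2) assms(3) by (auto simp: verdict_def)
 then show ?thesis using c(1) verdict_halted[OF assms(1) c(2)]
  unfolding accepts_def accept_state_machine_of by blast
qed

section \<open>Words on tapes\<close>

text \<open>A deterministic effect without queries, stated for both readings of \<open>spec\<close>
  and all oracles, so that one fact about a subprogram serves every machine.\<close>

definition exec :: "prog => (nat => cells) => nat => (nat => cells) => bool" where
 "exec p s n s' <-> (\<forall>d B. spec d B p s n 0 (%x. x = s'))"

lemma exec_mono: "exec p s n s' ==> n <= n' ==> exec p s n' s'"
 unfolding exec_def by (blast intro: spec_mono)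

lemma exec_Skip: "exec Skip s 0 s"
 by (simp add: exec_def spec_Skip)

lemma exec_Move: "exec (Move i m) s 1 (s(i := (fst (s i), shift m (snd (s i)))))"
 unfolding exec_def by (intro allI spec_Move refl)

lemma exec_Write: "exec (Write i b) s 1 (s(i := ((fst (s i))(snd (s i) := b), snd (s i))))"
 unfolding exec_def by (intro allI spec_Write refl)

lemma exec_Seq: "exec p s n t ==> exec q t n' t' ==> exec (Seq p q) s (n + n') t'"
 unfolding exec_def using spec_Seq[where k = 0 and k' = 0] by fastforce

lemma exec_Cond:
 "(scan (s i) = b ==> exec p s n t) ==> (scan (s i) ~= b ==> exec q s n t) ==>
  exec (Cond i b p q) s (n + 2) t"
 unfolding exec_def by (blast intro: spec_Cond)

lemma exec_While:
 assumes "\<And>j. j < N ==> scan (f j i) ~= None" "\<And>j. j < N ==> exec p (f j) n (f (Suc j))"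
  "scan (f N i) = None"
 shows "exec (While i p) (f 0) (N * (n + 2) + 1) (f N)"
 unfolding exec_def
proof (intro allI)
 fix d B
 \<comment> \<open>\<open>f\<close> counts the iterations done, whereas the rule for loops counts
   those remaining.\<close>
 define I where "I = (%j s. j <= N & s = f (N - j))"
 have "spec d B (While i p) (f 0) (N * (n + 2) + 1) (N * 0) (I 0)"
 proof (rule spec_While)
  show "I N (f 0)" by (simp add: I_def)
  show "scan (s i) = None" if "I 0 s" for s using that assms(3) by (simp add: I_def)
  show "scan (s i) ~= None & spec d B p s n 0 (I j)" if "I (Suc j) s" for j s
  proof
   have j: "N - Suc j < N" "Suc (N - Suc j) = N - j" "s = f (N - Suc j)" "j <= N" using that by (auto simp: I_def)
   show "scan (s i) ~= None" using assms(1)[OF j(1)] j by simp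
   have "spec d B p s n 0 (%x. x = f (N - j))" using assms(2)[OF j(1)] j by (simp add: exec_def)
   then show "spec d B p s n 0 (I j)" by (rule spec_mono) (use j in \<open>auto simp: I_def\<close>)
  qed
 qed
 then show "spec d B (While i p) (f 0) (N * (n + 2) + 1) 0 (%x. x = f N)"
  by (rule spec_mono) (auto simp: I_def)
qed

lemma exec_eq: "exec p s n t ==> s = s' ==> t = t' ==> n <= n' ==> exec p s' n' t'"
 using exec_mono by blast

lemma scan_word: "scan (word w h) = (if 0 <= h & h < int (length w) then Some (w ! nat h) else None)"
 by (simp add: scan_def word_def)

definition bits_of :: "bool list => int => bool option" where
 "bits_of w i = (if 0 <= i & i < int (length w) then Some (w ! nat i) else None)"

lemma fst_word [simp]: "fst (word w h) = bits_of w" and snd_word [simp]: "snd (word w h) = h"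
 by (simp_all add: word_def bits_of_def fun_eq_iff)

lemma word_eta [simp]: "(bits_of w, h) = word w h"
 by (simp add: word_def bits_of_def fun_eq_iff)

lemma word_snoc: "((bits_of w)(int (length w) := Some b), h) = word (w @ [b]) h"
 by (auto simp: word_def bits_of_def fun_eq_iff nth_append)

lemma word_butlast: "w ~= [] ==> ((bits_of w)(int (length w) - 1 := None), h) = word (butlast w) h"
 by (auto simp: word_def bits_of_def fun_eq_iff nth_butlast)

text \<open>The first move covers a head on the blank just behind the word; the loop then ends on
  the blank in cell -1, one cell too far to the left.\<close>

definition rewind :: "nat => prog" where
 "rewind i = Seq (Move i Left) (Seq (While i (Move i Left)) (Move i Right))"

lemma exec_Move_word:
 "s i = word w h ==> exec (Move i m) s 1 (s(i := word w (shift m h)))"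
 using exec_Move[of i m s] by simp

lemma exec_rewind:
 assumes "s i = word w (int h)" "h <= length w"
 shows "exec (rewind i) s (3 * length w + 3) (s(i := word w 0))"
proof -
 define f where "f = (%j. s(i := word w (int h - 1 - int j)))"
 have 1: "exec (Move i Left) s 1 (f 0)"
  using exec_Move_word[of s i w "int h" Left] assms by (simp add: f_def)
 have 2: "exec (While i (Move i Left)) (f 0) (h * (1 + 2) + 1) (f h)"
 proof (rule exec_While)
  show "scan (f j i) ~= None" if "j < h" for j
   using that assms by (simp add: f_def scan_word)
  show "exec (Move i Left) (f j) 1 (f (Suc j))" for j
   using exec_Move_word[of "f j" i w "int h - 1 - int j" Left] by (simp add: f_def algebra_simps)
 qed (simp add: f_def scan_word)
 have 3: "exec (Move i Right) (f h) 1 (s(i := word w 0))"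
  using exec_Move_word[of "f h" i w "-1" Right] by (simp add: f_def)
 show ?thesis unfolding rewind_def
  by (rule exec_mono[OF exec_Seq[OF 1 exec_Seq[OF 2 3]]]) (use assms in simp)
qed

definition to_end :: "nat => prog" where
 "to_end i = While i (Move i Right)"

lemma exec_to_end:
 assumes "s i = word w 0"
 shows "exec (to_end i) s (3 * length w + 1) (s(i := word w (int (length w))))"
proof -
 define f where "f = (%j. s(i := word w (int j)))"
 have "exec (While i (Move i Right)) (f 0) (length w * (1 + 2) + 1) (f (length w))"
 proof (rule exec_While)
  show "scan (f j i) ~= None" if "j < length w" for j
   using that by (simp add: f_def scan_word)
  show "exec (Move i Right) (f j) 1 (f (Suc j))" for j
   using exec_Move_word[of "f j" i w "int j" Right] by (simp add: f_def algebra_simps)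
 qed (simp add: f_def scan_word)
 moreover have "f 0 = s" using assms by (auto simp: f_def)
 ultimately show ?thesis unfolding to_end_def by (elim exec_eq) (simp_all add: f_def)
qed

definition push :: "nat => bool => prog" where
 "push i b = Seq (to_end i) (Seq (Write i (Some b)) (rewind i))"

lemma exec_push:
 assumes "s i = word w 0" "length w <= m"
 shows "exec (push i b) s (6 * m + 10) (s(i := word (w @ [b]) 0))"
proof -
 let ?s = "s(i := word w (int (length w)))"
 have 2: "exec (Write i (Some b)) ?s 1 (s(i := word (w @ [b]) (int (length w))))"
  using exec_Write[of i "Some b" ?s] by (simp add: word_snoc)
 have 3: "exec (rewind i) (s(i := word (w @ [b]) (int (length w)))) (3 * length (w @ [b]) + 3) (s(i := word (w @ [b]) 0))"
  using exec_rewind[of "s(i := word (w @ [b]) (int (length w)))" i "w @ [b]" "length w"] by simp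
 show ?thesis unfolding push_def
  by (rule exec_mono[OF exec_Seq[OF exec_to_end[of s i w, OF assms(1)] exec_Seq[OF 2 3]]]) (use assms in simp)
qed

text \<open>The empty word is treated separately: the general path would leave the head at cell
  -1.\<close>

definition pop :: "nat => prog" where
 "pop i = Cond i None Skip (Seq (to_end i) (Seq (Move i Left) (Seq (Write i None) (rewind i))))"

lemma exec_pop:
 assumes "s i = word w 0" "length w <= m"
 shows "exec (pop i) s (6 * m + 10) (s(i := word (butlast w) 0))"
proof (cases "w = []")
 case True
 then have "exec (pop i) s (0 + 2) s"
  unfolding pop_def by (intro exec_Cond exec_Skip) (use assms in \<open>simp add: scan_word\<close>)
 moreover have "s(i := word (butlast w) 0) = s" using assms True by (auto simp: fun_eq_iff)
 ultimately show ?thesis using exec_mono by simp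
next
 case False
 let ?s = "s(i := word w (int (length w)))" and ?t = "s(i := word w (int (length w) - 1))"
 have 2: "exec (Move i Left) ?s 1 ?t"
  using exec_Move_word[of ?s i w "int (length w)" Left] by simp
 have 3: "exec (Write i None) ?t 1 (s(i := word (butlast w) (int (length w) - 1)))"
  using exec_Write[of i None ?t] False by (simp add: word_butlast)
 have "int (length w - 1) = int (length w) - 1" using False by (cases w) auto
 then have 4: "exec (rewind i) (s(i := word (butlast w) (int (length w) - 1))) (3 * length (butlast w) + 3) (s(i := word (butlast w) 0))"
  using exec_rewind[of "s(i := word (butlast w) (int (length w) - 1))" i "butlast w" "length w - 1"] by simp
 have "exec (pop i) s ((3 * length w + 1 + (1 + (1 + (3 * length (butlast w) + 3)))) + 2) (s(i := word (butlast w) 0))"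
  unfolding pop_def
  using exec_Seq[OF exec_to_end[of s i w, OF assms(1)] exec_Seq[OF 2 exec_Seq[OF 3 4]]]
  by (intro exec_Cond) (use assms False in \<open>auto simp: scan_word\<close>)
 then show ?thesis by (rule exec_mono) (use assms in simp)
qed

definition clear :: "nat => prog" where
 "clear i = While i (pop i)"

lemma exec_clear:
 assumes "s i = word w 0" "length w <= m"
 shows "exec (clear i) s (m * (6 * m + 12) + 1) (s(i := word [] 0))"
proof -
 define f where "f = (%j. s(i := word (take (length w - j) w) 0))"
 have "exec (While i (pop i)) (f 0) (length w * ((6 * m + 10) + 2) + 1) (f (length w))"
 proof (rule exec_While)
  show "scan (f j i) ~= None" if "j < length w" for j
   using that by (simp add: f_def scan_word)
  show "exec (pop i) (f j) (6 * m + 10) (f (Suc j))" if "j < length w" for j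
   using exec_pop[of "f j" i "take (length w - j) w" m] that assms
   by (simp add: f_def butlast_take)
 qed (simp add: f_def scan_word)
 moreover have "f 0 = s" "f (length w) = s(i := word [] 0)" using assms by (auto simp: f_def)
 ultimately show ?thesis unfolding clear_def
  using assms(2) by (elim exec_eq) (simp_all add: mult_le_mono add.commute)
qed

abbreviation ones :: "nat => bool list" where
 "ones n \<equiv> replicate n True"

text \<open>The length of register i is appended in unary, not its contents: copying serves only
  registers used as numbers.\<close>

definition copy :: "nat => nat => prog" where
 "copy i j = Seq (to_end j) (Seq (While i (Seq (Write j (Some True)) (Seq (Move j Right) (Move i Right))))
   (Seq (rewind i) (rewind j)))"

lemma exec_copy:
 assumes "s i = word w 0" "s j = word v 0" "i ~= j" "length w <= m" "length v <= m"
 shows "exec (copy i j) s (20 * m + 20) (s(j := word (v @ ones (length w)) 0))"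
proof -
 define f where "f = (%x. s(i := word w (int x), j := word (v @ ones x) (int (length v) + int x)))"
 have ones: "(v @ ones x) @ [True] = v @ ones (Suc x)" for x
  by (simp add: replicate_append_same)
 have 1: "exec (to_end j) s (3 * length v + 1) (f 0)"
  by (rule exec_eq[OF exec_to_end[of s j v]]) (use assms in \<open>auto simp: f_def\<close>)
 have 2: "exec (While i (Seq (Write j (Some True)) (Seq (Move j Right) (Move i Right)))) (f 0)
   (length w * ((1 + (1 + 1)) + 2) + 1) (f (length w))"
 proof (rule exec_While)
  fix x assume x: "x < length w"
  show "scan (f x i) ~= None" using x assms by (simp add: f_def scan_word)
  let ?t = "s(i := word w (int x), j := word (v @ ones (Suc x)) (int (length v) + int x))"
  have a: "exec (Write j (Some True)) (f x) 1 ?t"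
   by (rule exec_eq[OF exec_Write[of j "Some True" "f x"]])
    (use word_snoc[of "v @ ones x" True] in \<open>auto simp: f_def ones simp del: append_assoc\<close>)
  let ?t' = "s(i := word w (int x), j := word (v @ ones (Suc x)) (int (length v) + int (Suc x)))"
  have b: "exec (Move j Right) ?t 1 ?t'"
   by (rule exec_eq[OF exec_Move_word[of ?t j "v @ ones (Suc x)" "int (length v) + int x" Right]]) (auto simp: algebra_simps)
  have c: "exec (Move i Right) ?t' 1 (f (Suc x))"
   by (rule exec_eq[OF exec_Move_word[of ?t' i w "int x" Right]]) (use assms in \<open>auto simp: f_def fun_eq_iff algebra_simps\<close>)
  show "exec (Seq (Write j (Some True)) (Seq (Move j Right) (Move i Right))) (f x) (1 + (1 + 1)) (f (Suc x))"
   by (rule exec_Seq[OF a exec_Seq[OF b c]])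
 qed (use assms in \<open>simp add: f_def scan_word\<close>)
 have 3: "exec (rewind i) (f (length w)) (3 * length w + 3) ((f (length w))(i := word w 0))"
  using exec_rewind[of "f (length w)" i w "length w"] assms by (simp add: f_def)
 have 4: "exec (rewind j) ((f (length w))(i := word w 0)) (3 * (length v + length w) + 3)
   (s(j := word (v @ ones (length w)) 0))"
  by (rule exec_eq[OF exec_rewind[of "(f (length w))(i := word w 0)" j "v @ ones (length w)" "length v + length w"]])
   (use assms in \<open>auto simp: f_def fun_eq_iff algebra_simps\<close>)
 show ?thesis unfolding copy_def
  by (rule exec_mono[OF exec_Seq[OF 1 exec_Seq[OF 2 exec_Seq[OF 3 4]]]]) (use assms in simp)
qed

text \<open>Register k holds a position in unary. Both heads advance together until k is exhausted,
  so that head i scans the wanted bit; afterwards both return together.\<close>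

definition lookup :: "nat => nat => nat => prog" where
 "lookup i k r = Seq (While k (Seq (Move k Right) (Move i Right)))
   (Seq (Cond i (Some True) (push r True) Skip)
   (Seq (Move k Left) (Seq (While k (Seq (Move k Left) (Move i Left))) (Move k Right))))"

lemma exec_lookup:
 assumes "s i = word w 0" "s k = word x 0" "s r = word v 0" "i ~= k" "i ~= r" "k ~= r"
  "length x <= m" "length v <= m"
 shows "exec (lookup i k r) s (20 * m + 20)
  (s(r := word (v @ (if length x < length w & w ! length x then [True] else [])) 0))"
proof -
 let ?n = "length x"
 define f where "f = (%t j. t(k := word x (int j), i := word w (int j)))" for t :: "nat => cells"
 let ?v = "v @ (if length x < length w & w ! length x then [True] else [])"
 let ?s = "s(r := word ?v 0)"
 have 1: "exec (While k (Seq (Move k Right) (Move i Right))) (f s 0) (?n * ((1 + 1) + 2) + 1) (f s ?n)"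
 proof (rule exec_While)
  fix j assume j: "j < ?n"
  show "scan (f s j k) ~= None" using j assms by (simp add: f_def scan_word)
  have a: "exec (Move k Right) (f s j) 1 ((f s j)(k := word x (int (Suc j))))"
   by (rule exec_eq[OF exec_Move_word[of "f s j" k x "int j" Right]]) (use assms in \<open>auto simp: f_def fun_eq_iff algebra_simps\<close>)
  have b: "exec (Move i Right) ((f s j)(k := word x (int (Suc j)))) 1 (f s (Suc j))"
   by (rule exec_eq[OF exec_Move_word[of "(f s j)(k := word x (int (Suc j)))" i w "int j" Right]]) (use assms in \<open>auto simp: f_def fun_eq_iff algebra_simps\<close>)
  show "exec (Seq (Move k Right) (Move i Right)) (f s j) (1 + 1) (f s (Suc j))"
   by (rule exec_Seq[OF a b])
 qed (use assms in \<open>simp add: f_def scan_word\<close>)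
 have 2: "exec (Cond i (Some True) (push r True) Skip) (f s ?n) ((6 * m + 10) + 2) (f ?s ?n)"
 proof (rule exec_Cond)
  assume "scan (f s ?n i) = Some True"
  then have "length x < length w & w ! length x"
   using assms by (auto simp: f_def scan_word split: if_splits)
  then show "exec (push r True) (f s ?n) (6 * m + 10) (f ?s ?n)"
   by (intro exec_eq[OF exec_push[of "f s ?n" r v m True]]) (use assms in \<open>auto simp: f_def fun_eq_iff algebra_simps\<close>)
 next
  assume "scan (f s ?n i) ~= Some True"
  then have "~ (length x < length w & w ! length x)"
   using assms by (auto simp: f_def scan_word split: if_splits)
  then show "exec Skip (f s ?n) (6 * m + 10) (f ?s ?n)"
   by (intro exec_eq[OF exec_Skip[of "f s ?n"]]) (use assms in \<open>auto simp: f_def fun_eq_iff algebra_simps\<close>)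
 qed
 \<comment> \<open>On the way back head k runs one cell ahead of head i: it must reach the blank in
   cell -1 just when head i is back in cell 0.\<close>
 define g where "g = (%j. ?s(k := word x (int ?n - 1 - int j), i := word w (int ?n - int j)))"
 have 3: "exec (Move k Left) (f ?s ?n) 1 (g 0)"
  by (rule exec_eq[OF exec_Move_word[of "f ?s ?n" k x "int ?n" Left]]) (use assms in \<open>auto simp: f_def g_def fun_eq_iff\<close>)
 have 4: "exec (While k (Seq (Move k Left) (Move i Left))) (g 0) (?n * ((1 + 1) + 2) + 1) (g ?n)"
 proof (rule exec_While)
  fix j assume j: "j < ?n"
  show "scan (g j k) ~= None" using j assms by (simp add: g_def scan_word)
  have a: "exec (Move k Left) (g j) 1 ((g j)(k := word x (int ?n - 1 - int (Suc j))))"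
   by (rule exec_eq[OF exec_Move_word[of "g j" k x "int ?n - 1 - int j" Left]])
    (use assms in \<open>auto simp: g_def algebra_simps\<close>)
  have b: "exec (Move i Left) ((g j)(k := word x (int ?n - 1 - int (Suc j)))) 1 (g (Suc j))"
   by (rule exec_eq[OF exec_Move_word[of "(g j)(k := word x (int ?n - 1 - int (Suc j)))" i w "int ?n - int j" Left]])
    (use assms in \<open>auto simp: g_def fun_eq_iff algebra_simps\<close>)
  show "exec (Seq (Move k Left) (Move i Left)) (g j) (1 + 1) (g (Suc j))"
   by (rule exec_Seq[OF a b])
 qed (use assms in \<open>simp add: g_def scan_word\<close>)
 have 5: "exec (Move k Right) (g ?n) 1 ?s"
  by (rule exec_eq[OF exec_Move_word[of "g ?n" k x "-1" Right]]) (use assms in \<open>auto simp: g_def fun_eq_iff\<close>)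
 have f0: "f s 0 = s" using assms by (auto simp: f_def fun_eq_iff)
 show ?thesis unfolding lookup_def
  by (rule exec_mono[OF exec_Seq[OF 1[unfolded f0] exec_Seq[OF 2 exec_Seq[OF 3 exec_Seq[OF 4 5]]]]])
   (use assms in simp)
qed

text \<open>Tapes as registers: each holds a word with the head at its beginning, a form that all
  primitive programs restore.\<close>

definition cells_of :: "(nat => bool list) => nat => cells" where
 "cells_of u i = word (u i) 0"

lemma cells_of_upd: "(cells_of u)(i := word w 0) = cells_of (u(i := w))"
 by (auto simp: cells_of_def)

lemma scan_cells_of: "scan (cells_of u i) = (if u i = [] then None else Some (hd (u i)))"
 by (auto simp: cells_of_def scan_word hd_conv_nth)

lemma push_word: "length (u i) <= m ==>
  exec (push i b) (cells_of u) (6 * m + 10) (cells_of (u(i := u i @ [b])))"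
 using exec_push[of "cells_of u" i "u i" m b] by (simp add: cells_of_upd) (simp add: cells_of_def)

lemma pop_word: "length (u i) <= m ==>
  exec (pop i) (cells_of u) (6 * m + 10) (cells_of (u(i := butlast (u i))))"
 using exec_pop[of "cells_of u" i "u i" m] by (simp add: cells_of_upd) (simp add: cells_of_def)

lemma clear_word: "length (u i) <= m ==>
  exec (clear i) (cells_of u) (m * (6 * m + 12) + 1) (cells_of (u(i := [])))"
 using exec_clear[of "cells_of u" i "u i" m] by (simp add: cells_of_upd) (simp add: cells_of_def)

lemma copy_word: "i ~= j ==> length (u i) <= m ==> length (u j) <= m ==>
  exec (copy i j) (cells_of u) (20 * m + 20) (cells_of (u(j := u j @ ones (length (u i)))))"
 using exec_copy[of "cells_of u" i "u i" j "u j" m] by (simp add: cells_of_upd) (simp add: cells_of_def)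

lemma lookup_word: "i ~= k ==> i ~= r ==> k ~= r ==> length (u k) <= m ==> length (u r) <= m ==>
  exec (lookup i k r) (cells_of u) (20 * m + 20)
   (cells_of (u(r := u r @ (if length (u k) < length (u i) & u i ! length (u k) then [True] else []))))"
 using exec_lookup[of "cells_of u" i "u i" k "u k" r "u r" m]
 unfolding cells_of_upd by (simp add: cells_of_def)

section \<open>A language of bounded expressions\<close>

text \<open>Values are words; a number is represented in unary, by the length of a word. Since
 iteration only concatenates, every value has polynomial length.\<close>

datatype expr =
  Const "bool list"
 | Size nat
 | Get nat expr
 | Add expr expr
 | Times expr expr
 | Minus expr expr
 | IfPos expr expr expr
 | Sum nat expr expr

text \<open>A word is true if it is nonempty. Reading behind the end of a register counts as false,
  so that no expression can fail.\<close>

primrec eval :: "expr => (nat => bool list) => bool list" where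
 "eval (Const w) u = w"
| "eval (Size i) u = ones (length (u i))"
| "eval (Get i a) u =
   (if length (eval a u) < length (u i) & u i ! length (eval a u) then [True] else [])"
| "eval (Add a b) u = eval a u @ eval b u"
| "eval (Times a b) u = concat (replicate (length (eval a u)) (eval b u))"
| "eval (Minus a b) u = ones (length (eval a u) - length (eval b u))"
| "eval (IfPos c a b) u = (if eval c u = [] then eval b u else eval a u)"
| "eval (Sum v a b) u = concat (map (%x. eval b (u(v := ones x))) [0..<length (eval a u)])"

primrec regs :: "expr => nat set" where
 "regs (Const w) = {}"
| "regs (Size i) = {i}"
| "regs (Get i a) = insert i (regs a)"
| "regs (Add a b) = regs a \<union> regs b"
| "regs (Times a b) = regs a \<union> regs b"
| "regs (Minus a b) = regs a \<union> regs b"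
| "regs (IfPos c a b) = regs c \<union> regs a \<union> regs b"
| "regs (Sum v a b) = insert v (regs a \<union> regs b)"

primrec bound_regs :: "expr => nat set" where
 "bound_regs (Const w) = {}"
| "bound_regs (Size i) = {}"
| "bound_regs (Get i a) = bound_regs a"
| "bound_regs (Add a b) = bound_regs a \<union> bound_regs b"
| "bound_regs (Times a b) = bound_regs a \<union> bound_regs b"
| "bound_regs (Minus a b) = bound_regs a \<union> bound_regs b"
| "bound_regs (IfPos c a b) = bound_regs c \<union> bound_regs a \<union> bound_regs b"
| "bound_regs (Sum v a b) = insert v (bound_regs a \<union> bound_regs b)"

lemma eval_cong: "(\<And>i. i \<in> regs e ==> u i = u' i) ==> eval e u = eval e u'"
proof (induction e arbitrary: u u')
 case (Sum v a b)
 have "eval b (u(v := ones x)) = eval b (u'(v := ones x))" for x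
  using Sum.prems by (intro Sum.IH(2)) auto
 moreover have "eval a u = eval a u'" using Sum.prems by (intro Sum.IH(1)) auto
 ultimately show ?case by simp
next
 case (Get i a)
 have "eval a u = eval a u'" using Get.prems by (intro Get.IH) auto
 then show ?case using Get.prems by simp
next
 case (Add a b)
 have "eval a u = eval a u'" "eval b u = eval b u'"
  using Add.prems by (intro Add.IH; auto)+
 then show ?case by simp
next
 case (Times a b)
 have "eval a u = eval a u'" "eval b u = eval b u'"
  using Times.prems by (intro Times.IH; auto)+
 then show ?case by simp
next
 case (Minus a b)
 have "eval a u = eval a u'" "eval b u = eval b u'"
  using Minus.prems by (intro Minus.IH; auto)+
 then show ?case by simp
next
 case (IfPos c a b)
 have "eval c u = eval c u'" "eval a u = eval a u'" "eval b u = eval b u'"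
  using IfPos.prems by (intro IfPos.IH; auto)+
 then show ?case by simp
qed auto

section \<open>Polynomial bounds on the length of values\<close>

type_synonym npoly = "nat poly"

abbreviation pX :: npoly where "pX \<equiv> [:0, 1:]"

text \<open>In a sum the bound register may grow as long as the value of a, hence the body is
  bounded at an argument enlarged by \<open>size_bound a\<close>.\<close>

primrec size_bound :: "expr => npoly" where
 "size_bound (Const w) = [:length w:]"
| "size_bound (Size i) = pX"
| "size_bound (Get i a) = 1"
| "size_bound (Add a b) = size_bound a + size_bound b"
| "size_bound (Times a b) = size_bound a * size_bound b"
| "size_bound (Minus a b) = size_bound a"
| "size_bound (IfPos c a b) = size_bound a + size_bound b"
| "size_bound (Sum v a b) = size_bound a * (size_bound b \<circ>\<^sub>p (pX + size_bound a))"

lemma poly_mono_nat: "m <= n ==> poly p m <= poly p (n :: nat)"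
 by (induction p) (auto intro!: add_mono mult_mono)

lemma length_concat_replicate: "length (concat (replicate n xs)) = n * length xs"
 by (induction n) auto

lemma length_eval_le: "(\<And>i. length (u i) <= m) ==> length (eval e u) <= poly (size_bound e) m"
proof (induction e arbitrary: u m)
 case (Times a b)
 then show ?case by (auto simp: length_concat_replicate intro!: mult_mono)
next
 case (Minus a b)
 have "length (eval a u) <= poly (size_bound a) m" by (rule Minus.IH(1)) (rule Minus.prems)
 then show ?case by simp
next
 case (Add a b)
 then show ?case by (auto intro!: add_mono)
next
 case (IfPos c a b)
 have "length (eval a u) <= poly (size_bound a) m" "length (eval b u) <= poly (size_bound b) m"
  by (rule IfPos.IH, rule IfPos.prems)+
 then show ?case by (simp add: trans_le_add1 trans_le_add2)
next
 case (Sum v a b)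
 let ?a = "poly (size_bound a) m"
 have a: "length (eval a u) <= ?a" using Sum.IH(1) Sum.prems by blast
 have b: "length (eval b (u(v := ones x))) <= poly (size_bound b) (m + ?a)" if "x < length (eval a u)" for x
  using that a Sum.prems by (intro Sum.IH(2)) (auto intro: trans_le_add1)
 have "length (eval (Sum v a b) u) <= (\<Sum>x<length (eval a u). poly (size_bound b) (m + ?a))"
  unfolding eval.simps length_concat map_map comp_def interv_sum_list_conv_sum_set_nat set_upt
   atLeast0LessThan[symmetric] by (intro sum_mono b) auto
 also have "\<dots> <= poly (size_bound (Sum v a b)) m"
  using a by (simp add: poly_pcompose mult_mono)
 finally show ?case .
qed (auto simp: one_poly_eq_simps)

section \<open>Compilation of expressions and its cost\<close>

primrec pushes :: "nat => bool list => prog" where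
 "pushes r [] = Skip"
| "pushes r (b # w) = Seq (push r b) (pushes r w)"

text \<open>The value is appended to register r, so that products and sums accumulate in place; the
  registers from k on are scratch space and are left empty. A sum saves the outer value of v in
  \<open>k + 1\<close> and restores it at the end.\<close>

primrec compile :: "expr => nat => nat => prog" where
 "compile (Const w) r k = pushes r w"
| "compile (Size i) r k = copy i r"
| "compile (Get i a) r k = Seq (compile a k (k + 1)) (Seq (lookup i k r) (clear k))"
| "compile (Add a b) r k = Seq (compile a r k) (compile b r k)"
| "compile (Times a b) r k =
   Seq (compile a k (k + 1)) (While k (Seq (compile b r (k + 1)) (pop k)))"
| "compile (Minus a b) r k =
   Seq (compile a k (k + 2)) (Seq (compile b (k + 1) (k + 2))
   (Seq (While (k + 1) (Seq (pop (k + 1)) (pop k))) (Seq (copy k r) (clear k))))"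
| "compile (IfPos c a b) r k =
   Seq (compile c k (k + 1)) (Cond k None (compile b r k) (Seq (clear k) (compile a r k)))"
| "compile (Sum v a b) r k =
   Seq (compile a k (k + 2)) (Seq (copy v (k + 1)) (Seq (clear v)
   (Seq (While k (Seq (compile b r (k + 2)) (Seq (push v True) (pop k))))
   (Seq (clear v) (Seq (copy (k + 1) v) (clear (k + 1)))))))"

text \<open>A common bound for all primitive programs on registers of length m. The quadratic term
  pays for \<open>clear\<close>, which rewinds after each deleted bit.\<close>

definition basic_cost :: npoly where
 "basic_cost = [:100, 100, 100:]"

primrec cost :: "expr => npoly" where
 "cost (Const w) = [:length w:] * (basic_cost \<circ>\<^sub>p (pX + [:length w:]))"
| "cost (Size i) = basic_cost"
| "cost (Get i a) = cost a + 2 * (basic_cost \<circ>\<^sub>p (pX + size_bound a))"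
| "cost (Add a b) = cost a + (cost b \<circ>\<^sub>p (pX + size_bound a))"
| "cost (Times a b) = (let X = pX + size_bound a + size_bound a * size_bound b in
   cost a + size_bound a * ((cost b \<circ>\<^sub>p X) + (basic_cost \<circ>\<^sub>p X) + 2) + 1)"
| "cost (Minus a b) = (let X = pX + size_bound a + size_bound b in
   cost a + (cost b \<circ>\<^sub>p X) + size_bound b * (2 * (basic_cost \<circ>\<^sub>p X) + 2) + 1
    + 2 * (basic_cost \<circ>\<^sub>p X))"
| "cost (IfPos c a b) = (let X = pX + size_bound c in
   cost c + (cost a \<circ>\<^sub>p X) + (cost b \<circ>\<^sub>p X) + (basic_cost \<circ>\<^sub>p X) + 2)"
| "cost (Sum v a b) = (let X = pX + size_bound a + size_bound (Sum v a b) in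
   cost a + size_bound a * ((cost b \<circ>\<^sub>p X) + 2 * (basic_cost \<circ>\<^sub>p X) + 2) + 1
    + 5 * (basic_cost \<circ>\<^sub>p X))"

definition basic :: "nat => nat" where
 "basic m = 100 + 100 * m + 100 * m * m"

lemma poly_basic_cost [simp]: "poly basic_cost m = basic m"
 by (simp add: basic_def basic_cost_def algebra_simps)

lemma basic_bounds:
 "6 * m + 10 <= basic m" "20 * m + 20 <= basic m" "m * (6 * m + 12) + 1 <= basic m"
 by (auto simp: basic_def algebra_simps)

lemmas exec_prims =
 exec_mono[OF push_word basic_bounds(1)] exec_mono[OF pop_word basic_bounds(1)]
 exec_mono[OF clear_word basic_bounds(3)] exec_mono[OF copy_word basic_bounds(2)]
 exec_mono[OF lookup_word basic_bounds(2)]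

text \<open>Bound registers must hold numbers in unary, since a sum saves and restores them with
  \<open>copy\<close>, which preserves only the length.\<close>

definition ready :: "expr => nat => nat => (nat => bool list) => bool" where
 "ready e r k u <-> r < k & regs e \<subseteq> {..<k} - {r} & (\<forall>i\<ge>k. u i = []) &
   (\<forall>v\<in>bound_regs e. u v = ones (length (u v)))"

lemma bound_regs_subset: "bound_regs e \<subseteq> regs e"
 by (induction e) auto

lemma exec_pushes: "length (u r) + length w <= m ==>
 exec (pushes r w) (cells_of u) (length w * basic m) (cells_of (u(r := u r @ w)))"
proof (induction w arbitrary: u)
 case Nil
 then show ?case using exec_Skip by simp
next
 case (Cons b w)
 have "exec (pushes r w) (cells_of (u(r := u r @ [b]))) (length w * basic m)
   (cells_of ((u(r := u r @ [b]))(r := (u(r := u r @ [b])) r @ w)))"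
  by (rule Cons.IH) (use Cons.prems in simp)
 then have "exec (pushes r w) (cells_of (u(r := u r @ [b]))) (length w * basic m)
   (cells_of (u(r := u r @ b # w)))" by simp
 from exec_Seq[OF exec_prims(1)[of u r m b, OF add_leD1[OF Cons.prems]] this]
 show ?case unfolding pushes.simps by (rule exec_eq) (simp_all add: fun_upd_def)
qed

lemma exec_word_eq:
 "exec p (cells_of u) n (cells_of v) ==> (\<And>i. v i = v' i) ==> n <= n' ==> exec p (cells_of u) n' (cells_of v')"
 using exec_mono[of p "cells_of u" n "cells_of v" n'] ext[of v v'] by simp

lemma concat_replicate_Suc: "concat (replicate (Suc j) w) = concat (replicate j w) @ w"
 by (induction j) auto

lemma exec_While_word:
 assumes "\<And>j. j < N ==> f j i ~= []" "\<And>j. j < N ==> exec p (cells_of (f j)) n (cells_of (f (Suc j)))"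
  "f N i = []"
 shows "exec (While i p) (cells_of (f 0)) (N * (n + 2) + 1) (cells_of (f N))"
 using exec_While[of N "%j. cells_of (f j)" i p n] assms by (simp add: scan_cells_of)

lemma exec_compile:
 assumes "ready e r k u" "\<And>i. length (u i) <= m"
 shows "exec (compile e r k) (cells_of u) (poly (cost e) m) (cells_of (u(r := u r @ eval e u)))"
 using assms
proof (induction e arbitrary: r k u m)
 case (Const w)
 have "length (u r) + length w <= m + length w" using Const.prems by simp
 from exec_pushes[of u r w, OF this] show ?case
  unfolding compile.simps by (rule exec_word_eq) (simp_all add: poly_pcompose fun_upd_def add.commute)
next
 case (Size i)
 then show ?case unfolding compile.simps
  by (intro exec_word_eq[OF exec_prims(4)[of i r u m]]) (auto simp: ready_def)
next
 case (Get i a)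
 let ?m = "m + poly (size_bound a) m" and ?u = "u(k := eval a u)"
 have len: "length (eval a u) <= poly (size_bound a) m" by (rule length_eval_le) fact
 have k: "u k = []" "i ~= k" "i ~= r" "k ~= r" using Get.prems by (auto simp: ready_def)
 have 1: "exec (compile a k (k + 1)) (cells_of u) (poly (cost a) m) (cells_of ?u)"
  by (rule exec_word_eq[OF Get.IH[of k "k + 1" u m]]) (use Get.prems k in \<open>auto simp: ready_def\<close>)
 have lm: "length (?u j) <= ?m" for j using len Get.prems(2)[of j] by auto
 let ?v = "?u(r := ?u r @ (if length (?u k) < length (?u i) & ?u i ! length (?u k) then [True] else []))"
 have 2: "exec (lookup i k r) (cells_of ?u) (basic ?m) (cells_of ?v)"
  by (rule exec_prims(5)) (rule k lm)+
 have 3: "exec (clear k) (cells_of ?v) (basic ?m) (cells_of (?v(k := [])))"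
  by (rule exec_prims(3)) (use k lm[of k] in auto)
 show ?case unfolding compile.simps
  by (rule exec_word_eq[OF exec_Seq[OF 1 exec_Seq[OF 2 3]]])
   (use k in \<open>auto simp: poly_pcompose\<close>)
next
 case (Add a b)
 let ?m = "m + poly (size_bound a) m" and ?u = "u(r := u r @ eval a u)"
 have len: "length (eval a u) <= poly (size_bound a) m" by (rule length_eval_le) fact
 have 1: "exec (compile a r k) (cells_of u) (poly (cost a) m) (cells_of ?u)"
  by (rule exec_word_eq[OF Add.IH(1)[of r k u m]]) (use Add.prems in \<open>auto simp: ready_def\<close>)
 have lm: "length (?u j) <= ?m" for j
  using len Add.prems(2)[of j] by (auto intro: add_mono)
 have e: "eval b ?u = eval b u" by (rule eval_cong) (use Add.prems in \<open>auto simp: ready_def\<close>)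
 have 2: "exec (compile b r k) (cells_of ?u) (poly (cost b) ?m) (cells_of (?u(r := ?u r @ eval b ?u)))"
  by (rule Add.IH(2)) (use lm Add.prems bound_regs_subset[of b] in \<open>auto simp: ready_def\<close>)
 show ?case unfolding compile.simps
  by (rule exec_word_eq[OF exec_Seq[OF 1 2]]) (auto simp: poly_pcompose e)
next
 case (Times a b)
 let ?a = "poly (size_bound a) m" and ?b = "poly (size_bound b) m"
 let ?m = "m + ?a + ?a * ?b" and ?N = "length (eval a u)"
 have la: "?N <= ?a" and lb: "length (eval b u) <= ?b" by (rule length_eval_le, fact)+
 have k: "u k = []" "k ~= r" "k \<notin> regs b" "r \<notin> regs b" using Times.prems by (auto simp: ready_def)
 define f where "f = (%j. u(r := u r @ concat (replicate j (eval b u)), k := take (?N - j) (eval a u)))"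
 have 1: "exec (compile a k (k + 1)) (cells_of u) (poly (cost a) m) (cells_of (f 0))"
  by (rule exec_word_eq[OF Times.IH(1)[of k "k + 1" u m]])
   (use Times.prems k in \<open>auto simp: ready_def f_def\<close>)
 have fm: "length (f j i) <= ?m" if "j <= ?N" for i j
 proof -
  have "j * length (eval b u) <= ?a * ?b" using that la lb by (intro mult_mono) auto
  then show ?thesis using Times.prems(2)[of i] la by (auto simp: f_def length_concat_replicate intro: add_mono)
 qed
 have 2: "exec (While k (Seq (compile b r (k + 1)) (pop k))) (cells_of (f 0))
   (?N * ((poly (cost b) ?m + basic ?m) + 2) + 1) (cells_of (f ?N))"
 proof (rule exec_While_word)
  fix j assume j: "j < ?N"
  show "f j k ~= []" using j by (auto simp: f_def)
  have e: "eval b (f j) = eval b u" by (rule eval_cong) (use k in \<open>auto simp: f_def\<close>)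
  have a: "exec (compile b r (k + 1)) (cells_of (f j)) (poly (cost b) ?m)
    (cells_of ((f j)(r := f j r @ eval b (f j))))"
   by (rule Times.IH(2)) (use fm j Times.prems k bound_regs_subset[of b] in \<open>auto simp: ready_def f_def\<close>)
  have b: "exec (pop k) (cells_of ((f j)(r := f j r @ eval b (f j)))) (basic ?m) (cells_of (f (Suc j)))"
   by (rule exec_word_eq[OF exec_prims(2)[of "(f j)(r := f j r @ eval b (f j))" k ?m]])
    (use k e j fm[of j k] in \<open>auto simp: f_def butlast_take concat_replicate_Suc
     simp del: replicate_Suc\<close>)
  show "exec (Seq (compile b r (k + 1)) (pop k)) (cells_of (f j)) (poly (cost b) ?m + basic ?m) (cells_of (f (Suc j)))"
   by (rule exec_Seq[OF a b])
 qed (simp add: f_def)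
 show ?case unfolding compile.simps
  by (rule exec_word_eq[OF exec_Seq[OF 1 2]])
   (use k la in \<open>auto simp: poly_pcompose f_def Let_def add.assoc intro!: add_mono mult_le_mono\<close>)
next
 case (Minus a b)
 let ?a = "poly (size_bound a) m" and ?b = "poly (size_bound b) m"
 let ?m = "m + ?a + ?b" and ?N = "length (eval b u)"
 have la: "length (eval a u) <= ?a" and lb: "?N <= ?b" by (rule length_eval_le, fact)+
 have k: "u k = []" "u (k + 1) = []" "k ~= r" "k + 1 ~= r" "k \<notin> regs b" using Minus.prems by (auto simp: ready_def)
 let ?u = "u(k := eval a u)"
 have e: "eval b ?u = eval b u" by (rule eval_cong) (use k in auto)
 have 1: "exec (compile a k (k + 2)) (cells_of u) (poly (cost a) m) (cells_of ?u)"
  by (rule exec_word_eq[OF Minus.IH(1)[of k "k + 2" u m]])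
   (use Minus.prems k in \<open>auto simp: ready_def\<close>)
 define f where "f = (%j. u(k := take (length (eval a u) - j) (eval a u), k + 1 := take (?N - j) (eval b u)))"
 have fm: "length (f j i) <= ?m" for i j
  using Minus.prems(2)[of i] la lb by (auto simp: f_def)
 have 2: "exec (compile b (k + 1) (k + 2)) (cells_of ?u) (poly (cost b) ?m) (cells_of (f 0))"
 proof (rule exec_word_eq[OF Minus.IH(2)[of "k + 1" "k + 2" ?u ?m]])
  show "length (?u i) <= ?m" for i using Minus.prems(2)[of i] la by auto
 qed (use Minus.prems k bound_regs_subset[of b] e e[unfolded fun_upd_def] in \<open>auto simp: ready_def f_def\<close>)
 have 3: "exec (While (k + 1) (Seq (pop (k + 1)) (pop k))) (cells_of (f 0))
   (?N * ((basic ?m + basic ?m) + 2) + 1) (cells_of (f ?N))"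
 proof (rule exec_While_word)
  fix j assume j: "j < ?N"
  show "f j (k + 1) ~= []" using j by (auto simp: f_def)
  let ?g = "(f j)(k + 1 := butlast (f j (k + 1)))"
  have a: "exec (pop (k + 1)) (cells_of (f j)) (basic ?m) (cells_of ?g)"
   by (rule exec_prims(2)) (rule fm)
  have b: "exec (pop k) (cells_of ?g) (basic ?m) (cells_of (f (Suc j)))"
  proof (rule exec_word_eq[OF exec_prims(2)[of ?g k ?m]])
   show "length (?g k) <= ?m" using fm[of j k] by simp
   \<comment> \<open>If register k is exhausted first, further pops leave it empty, in accordance
     with truncated subtraction.\<close>
   have "butlast (take (length (eval a u) - j) (eval a u)) = take (length (eval a u) - Suc j) (eval a u)"
    by (cases "length (eval a u) <= j") (auto simp: butlast_take)
   then show "(?g(k := butlast (?g k))) i = f (Suc j) i" for i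
    using j by (auto simp: f_def butlast_take)
  qed simp_all
  show "exec (Seq (pop (k + 1)) (pop k)) (cells_of (f j)) (basic ?m + basic ?m) (cells_of (f (Suc j)))"
   by (rule exec_Seq[OF a b])
 qed (simp add: f_def)
 let ?g = "(f ?N)(r := f ?N r @ ones (length (f ?N k)))"
 have 4: "exec (copy k r) (cells_of (f ?N)) (basic ?m) (cells_of ?g)"
  by (rule exec_prims(4)) (rule k fm)+
 have 5: "exec (clear k) (cells_of ?g) (basic ?m) (cells_of (?g(k := [])))"
  by (rule exec_prims(3)) (use k fm[of _ k] in simp)
 have n: "?N * ((basic ?m + basic ?m) + 2) <= ?b * (2 * basic ?m + 2)"
  using lb by (simp only: mult_2 mult_le_mono1)
 show ?case unfolding compile.simps
 proof (rule exec_word_eq[OF exec_Seq[OF 1 exec_Seq[OF 2 exec_Seq[OF 3 exec_Seq[OF 4 5]]]]])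
  show "poly (cost a) m + (poly (cost b) ?m + (?N * ((basic ?m + basic ?m) + 2) + 1 + (basic ?m + basic ?m)))
    <= poly (cost (Minus a b)) m"
   using n by (simp add: poly_pcompose Let_def add.assoc)
 qed (use k in \<open>auto simp: f_def\<close>)
next
 case (IfPos c a b)
 let ?c = "poly (size_bound c) m"
 let ?m = "m + ?c" and ?u = "u(k := eval c u)"
 have len: "length (eval c u) <= ?c" by (rule length_eval_le) fact
 have k: "u k = []" "k ~= r" using IfPos.prems by (auto simp: ready_def)
 have 1: "exec (compile c k (k + 1)) (cells_of u) (poly (cost c) m) (cells_of ?u)"
  by (rule exec_word_eq[OF IfPos.IH(1)[of k "k + 1" u m]])
   (use IfPos.prems k in \<open>auto simp: ready_def\<close>)
 have lu: "length (u i) <= ?m" for i using IfPos.prems(2)[of i] by simp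
 have lm: "length (?u i) <= ?m" for i using lu[of i] len by auto
 have u0: "(?u)(k := []) = u" using k by auto
 let ?n = "basic ?m + poly (cost a) ?m + poly (cost b) ?m"
 have 2: "exec (Cond k None (compile b r k) (Seq (clear k) (compile a r k))) (cells_of ?u)
   (?n + 2) (cells_of (u(r := u r @ eval (IfPos c a b) u)))"
 proof (rule exec_Cond)
  assume "scan (cells_of ?u k) = None"
  then have n: "eval c u = []" by (simp add: scan_cells_of split: if_splits)
  then have uu: "?u = u" using k by auto
  show "exec (compile b r k) (cells_of ?u) ?n (cells_of (u(r := u r @ eval (IfPos c a b) u)))"
   unfolding uu by (intro exec_word_eq[OF IfPos.IH(3)[of r k u ?m]])
    (use n IfPos.prems lu in \<open>auto simp: ready_def\<close>)
 next
  assume "scan (cells_of ?u k) ~= None"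
  then have n: "eval c u ~= []" by (auto simp: scan_cells_of)
  have c: "exec (clear k) (cells_of ?u) (basic ?m) (cells_of u)"
   using exec_prims(3)[of ?u k ?m, OF lm] unfolding u0 .
  have a: "exec (compile a r k) (cells_of u) (poly (cost a) ?m) (cells_of (u(r := u r @ eval a u)))"
   by (rule IfPos.IH(2)) (use IfPos.prems lu in \<open>auto simp: ready_def\<close>)
  show "exec (Seq (clear k) (compile a r k)) (cells_of ?u) ?n (cells_of (u(r := u r @ eval (IfPos c a b) u)))"
   by (rule exec_word_eq[OF exec_Seq[OF c a]]) (use n in auto)
 qed
 show ?case unfolding compile.simps
  by (rule exec_word_eq[OF exec_Seq[OF 1 2]]) (auto simp: poly_pcompose Let_def)
next
 case (Sum v a b)
 let ?a = "poly (size_bound a) m" and ?s = "poly (size_bound (Sum v a b)) m"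
 let ?m = "m + ?a + ?s" and ?N = "length (eval a u)"
 let ?c = "%j. concat (map (%x. eval b (u(v := ones x))) [0..<j])"
 have la: "?N <= ?a" and ls: "length (eval (Sum v a b) u) <= ?s" by (rule length_eval_le, fact)+
 have k: "u k = []" "u (k + 1) = []" "k ~= r" "k + 1 ~= r" "k \<notin> regs b" "r \<notin> regs b" "k + 1 \<notin> regs b"
   "v ~= k" "v ~= k + 1" "v ~= r" "u v = ones (length (u v))"
  using Sum.prems by (auto simp: ready_def)
 let ?u1 = "u(k := eval a u)"
 have 1: "exec (compile a k (k + 2)) (cells_of u) (poly (cost a) m) (cells_of ?u1)"
  by (rule exec_word_eq[OF Sum.IH(1)[of k "k + 2" u m]])
   (use Sum.prems k in \<open>auto simp: ready_def\<close>)
 have lu: "length (u i) <= ?m" for i using Sum.prems(2)[of i] by simp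
 let ?u2 = "?u1(k + 1 := u v)"
 have 2: "exec (copy v (k + 1)) (cells_of ?u1) (basic ?m) (cells_of ?u2)"
  by (rule exec_word_eq[OF exec_prims(4)[of v "k + 1" ?u1 ?m]]) (use k lu in auto)
 \<comment> \<open>State after j rounds: j summands are collected in r, k is the remaining counter,
   \<open>k + 1\<close> keeps the outer value of v, and v is the running index.\<close>
 define f where "f = (%j. u(r := u r @ ?c j, k := take (?N - j) (eval a u), k + 1 := u v, v := ones j))"
 have 3: "exec (clear v) (cells_of ?u2) (basic ?m) (cells_of (f 0))"
  by (rule exec_word_eq[OF exec_prims(3)[of ?u2 v ?m]])
   (use k lu in \<open>auto simp: f_def\<close>)
 have fm: "length (f j i) <= ?m" if "j <= ?N" for i j
 proof -
  have "length (?c j) <= length (?c ?N)"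
   using that by (metis concat_append le_add1 length_append map_append upt_add_eq_append[of 0 j "?N - j"] le_add_diff_inverse zero_le)
  then have "length (?c j) <= ?s" using ls by simp
  then show ?thesis using Sum.prems(2)[of i] Sum.prems(2)[of v] la that
   by (auto simp: f_def intro: add_mono)
 qed
 have 4: "exec (While k (Seq (compile b r (k + 2)) (Seq (push v True) (pop k)))) (cells_of (f 0))
   (?N * ((poly (cost b) ?m + (basic ?m + basic ?m)) + 2) + 1) (cells_of (f ?N))"
 proof (rule exec_While_word)
  fix j assume j: "j < ?N"
  show "f j k ~= []" using j k by (auto simp: f_def)
  have e: "eval b (f j) = eval b (u(v := ones j))" by (rule eval_cong) (use k in \<open>auto simp: f_def\<close>)
  let ?g = "(f j)(r := f j r @ eval b (f j))"
  have x: "exec (compile b r (k + 2)) (cells_of (f j)) (poly (cost b) ?m) (cells_of ?g)"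
   by (rule Sum.IH(2)) (use fm j Sum.prems k bound_regs_subset[of b] in \<open>auto simp: ready_def f_def\<close>)
  let ?h = "?g(v := ?g v @ [True])"
  have y: "exec (push v True) (cells_of ?g) (basic ?m) (cells_of ?h)"
   by (rule exec_prims(1)) (use k fm[of j v] j in simp)
  have z: "exec (pop k) (cells_of ?h) (basic ?m) (cells_of (f (Suc j)))"
   by (rule exec_word_eq[OF exec_prims(2)[of ?h k ?m]])
    (use k e j fm[of j k] in \<open>auto simp: f_def butlast_take replicate_append_same
     \<close>)
  show "exec (Seq (compile b r (k + 2)) (Seq (push v True) (pop k))) (cells_of (f j))
    (poly (cost b) ?m + (basic ?m + basic ?m)) (cells_of (f (Suc j)))"
   by (rule exec_Seq[OF x exec_Seq[OF y z]])
 qed (use k in \<open>simp add: f_def\<close>)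
 let ?w1 = "(f ?N)(v := [])"
 have 5: "exec (clear v) (cells_of (f ?N)) (basic ?m) (cells_of ?w1)"
  by (rule exec_prims(3)) (use fm in simp)
 let ?w2 = "?w1(v := u v)"
 have 6: "exec (copy (k + 1) v) (cells_of ?w1) (basic ?m) (cells_of ?w2)"
  by (rule exec_word_eq[OF exec_prims(4)[of "k + 1" v ?w1 ?m]]) (use k lu[of v] in \<open>auto simp: f_def\<close>)
 have 7: "exec (clear (k + 1)) (cells_of ?w2) (basic ?m) (cells_of (?w2(k + 1 := [])))"
  by (rule exec_prims(3)) (use k lu[of v] in \<open>auto simp: f_def\<close>)
 have "?N * ((poly (cost b) ?m + (basic ?m + basic ?m)) + 2) <= ?a * ((poly (cost b) ?m + (basic ?m + basic ?m)) + 2)"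
  using la by (rule mult_le_mono1)
 then have n: "?N * ((poly (cost b) ?m + (basic ?m + basic ?m)) + 2) <= ?a * ((poly (cost b) ?m + 2 * basic ?m) + 2)"
  by (simp only: mult_2)
 show ?case unfolding compile.simps
 proof (rule exec_word_eq[OF exec_Seq[OF 1 exec_Seq[OF 2 exec_Seq[OF 3 exec_Seq[OF 4 exec_Seq[OF 5 exec_Seq[OF 6 7]]]]]]])
  show "poly (cost a) m + (basic ?m + (basic ?m + (?N * ((poly (cost b) ?m + (basic ?m + basic ?m)) + 2) + 1
    + (basic ?m + (basic ?m + basic ?m))))) <= poly (cost (Sum v a b)) m"
   using n by (simp add: poly_pcompose Let_def add.assoc)
 qed (use k in \<open>auto simp: f_def\<close>)
qed

section \<open>Membership in complexity classes\<close>

lemma finite_used: "finite (used p)"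
 by (induction p) auto

lemma finite_regs: "finite (regs e)"
 by (induction e) auto

lemma runs_onI:
 assumes "asks p <= 1"
 obtains K where "runs_on K j p"
proof -
 define K where "K = Suc (Suc (j + Max (insert 0 (used p))))"
 have "used p \<subseteq> {..<K}"
  using finite_used[of p] by (auto simp: K_def less_Suc_eq_le intro!: le_SucI trans_le_add2 Max_ge)
 then have "runs_on K j p" using assms by (auto simp: runs_on_def K_def)
 then show ?thesis ..
qed

lemma primitive_programs [simp]:
 "asks (push i b) = 0" "choice_free (push i b)" "asks (pop i) = 0" "choice_free (pop i)"
 "asks (clear i) = 0" "choice_free (clear i)" "asks (copy i j) = 0" "choice_free (copy i j)"
 "asks (lookup i j k) = 0" "choice_free (lookup i j k)"
 by (simp_all add: push_def pop_def clear_def copy_def lookup_def to_end_def rewind_def)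

lemma pushes_simple [simp]: "asks (pushes r w) = 0" "choice_free (pushes r w)"
 by (induction w) auto

lemma compile_simple [simp]: "asks (compile e r k) = 0" "choice_free (compile e r k)"
 by (induction e arbitrary: r k) auto

definition base :: "bool list => nat => bool list" where
 "base w i = (if i = 0 then w else [])"

lemma base_eta [simp]: "(%i. if i = 0 then w else []) = base w"
 by (simp add: fun_eq_iff base_def)

lemma start_base: "start w = cells_of (base w)"
 by (auto simp: start_def cells_of_def base_def)

lemma length_base: "length (base w i) <= length w"
 by (simp add: base_def)

text \<open>Tape 1 is the output tape, so the value is compiled directly into register 1, which the
  expression must not mention. Register 0 holds the input, which need not be unary and hence must
  not be bound.\<close>

lemma computable_expr:
 assumes "0 \<notin> bound_regs e" "1 \<notin> regs e"
 shows "poly_time_computable (%w. eval e (base w))"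
proof -
 define k where "k = Suc (Suc (Max (insert 0 (regs e))))"
 define p where "p = compile e 1 k"
 obtain K where K: "runs_on K 0 p" by (rule runs_onI[of p]) (simp add: p_def)
 have k: "regs e \<subseteq> {..<k} - {1}" "1 < k"
  using assms finite_regs[of e] by (auto simp: k_def less_Suc_eq_le le_SucI)
 let ?Q = "%w s. s = cells_of ((base w)(1 := eval e (base w)))"
 have sp: "spec d B p (start w) (poly (cost e) (length w)) 0 (?Q w)" for d B w
 proof -
  have "ready e 1 k (base w)"
   using k assms by (auto simp: ready_def base_def)
  from exec_compile[OF this length_base] show ?thesis
   by (simp add: p_def start_base exec_def base_def)
 qed
 let ?M = "machine_of K 0 p"
 have "well_formed ?M" "deterministic ?M"
  using K by (auto simp: runs_on_def p_def intro: well_formed_machine_of deterministic_machine_of)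
 moreover have "poly_time ?M {}"
  unfolding poly_time_def
 proof (intro exI[of _ "cost e + 1"] allI impI)
  fix w n k c assume "run ?M {} (init ?M w) n k c"
  from machine_of_runs(1)[OF K sp this] show "n <= poly (cost e + 1) (length w)" by simp
 qed
 moreover have "\<exists>n k c. run ?M {} (init ?M w) n k c & halted ?M {} c &
   tape_word (snd c ! 1) = eval e (base w)" for w
 proof -
  obtain m i c where c: "run ?M {} (init ?M w) m i c" "verdict K 0 p (?Q w) c"
   using reaches_run[OF machine_of_reaches[OF K sp[of False]]] by blast
  have "1 < ntapes ?M" using K by (simp add: machine_of_def runs_on_def)
  then have "tape_word (snd c ! 1) = eval e (base w)"
   using c(2) by (auto simp: verdict_def cells_of_def simp del: One_nat_def)
  with c verdict_halted[OF K c(2)] show ?thesis by blast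
 qed
 ultimately show ?thesis unfolding poly_time_computable_def by blast
qed

text \<open>Time bound and soundness come from all computations. For completeness one accepting
  computation is enough, and its bounds are arbitrary, because every run is already covered.\<close>

lemma NP_relI:
 assumes "asks p <= 1"
  and "\<And>w. spec True B p (start w) (poly t (length w)) k (%s. scan (s j) ~= None --> w \<in> X)"
  and "\<And>w. w \<in> X ==> \<exists>n k. spec False B p (start w) n k (%s. scan (s j) ~= None)"
 shows "X \<in> NP_rel B"
proof -
 obtain K where K: "runs_on K j p" using assms(1) by (rule runs_onI)
 let ?M = "machine_of K j p"
 have "well_formed ?M" using K by (auto simp: runs_on_def intro: well_formed_machine_of)
 moreover have "poly_time ?M B"
  unfolding poly_time_def
 proof (intro exI[of _ "t + 1"] allI impI)
  fix w n i c assume "run ?M B (init ?M w) n i c"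
  from machine_of_runs(1)[OF K assms(2) this] show "n <= poly (t + 1) (length w)" by simp
 qed
 moreover have "recognizes ?M B X"
  unfolding recognizes_def
 proof (intro allI iffI)
  fix w assume "accepts ?M B w"
  from accepts_imp[OF K assms(2) this] show "w \<in> X" by blast
 next
  fix w assume "w \<in> X"
  then obtain n i where "spec False B p (start w) n i (%s. scan (s j) ~= None)" using assms(3) by blast
  from acceptsI[OF K this] show "accepts ?M B w" by simp
 qed
 ultimately show ?thesis unfolding NP_rel_def by blast
qed

section \<open>Guessing a word and testing it\<close>

lemma spec_exec: "exec p s n t ==> Q t ==> spec d B p s n 0 Q"
 unfolding exec_def by (blast intro: spec_mono)

lemma spec_exec_Seq: "exec p s n t ==> spec d B q t n' k Q ==> spec d B (Seq p q) s (n + n') k Q"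
 unfolding exec_def using spec_Seq[of d B p s n 0 "%x. x = t" q n' k Q] by simp

lemma spec_Seq_exec: "spec d B p s n k R ==> (\<And>t. R t ==> \<exists>t'. exec q t n' t' & Q t') ==>
  spec d B (Seq p q) s (n + n') k Q"
 using spec_Seq[of d B p s n k R q n' 0 Q] spec_exec by fastforce

definition guess :: "nat => nat => prog" where
 "guess i k = While k (Seq (Choose (push i True) (push i False)) (pop k))"

lemma spec_guess:
 assumes "u i = []" "i ~= k" "length (u k) <= m" "~ d ==> length y = length (u k)"
 shows "spec d B (guess i k) (cells_of u) (m * (2 * basic m + 4) + 1) 0
  (%s. \<exists>y'. length y' = length (u k) & (d \<or> y' = y) & s = cells_of (u(i := y', k := [])))"
proof -
 let ?N = "length (u k)"
 \<comment> \<open>If only one computation matters, the bits guessed so far form a prefix of the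
   intended word y; otherwise they are arbitrary.\<close>
 define I where "I = (%j s. j <= ?N & (\<exists>y'. length y' = ?N - j & (d \<or> y' = take (?N - j) y) &
  s = cells_of (u(i := y', k := take j (u k)))))"
 have "spec d B (guess i k) (cells_of u) (?N * ((basic m + 2 + basic m) + 2) + 1) (?N * 0) (I 0)"
  unfolding guess_def
 proof (rule spec_While)
  show "I ?N (cells_of u)" using assms by (auto simp: I_def fun_upd_idem)
  show "scan (s k) = None" if "I 0 s" for s using that by (auto simp: I_def scan_cells_of)
  show "scan (s k) ~= None & spec d B (Seq (Choose (push i True) (push i False)) (pop k)) s (basic m + 2 + basic m) 0 (I j)"
   if "I (Suc j) s" for j s
  proof
   from that obtain y' where y': "Suc j <= ?N" "length y' = ?N - Suc j" "d \<or> y' = take (?N - Suc j) y"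
    "s = cells_of (u(i := y', k := take (Suc j) (u k)))" by (auto simp: I_def)
   show "scan (s k) ~= None" using y' by (auto simp: scan_cells_of)
   let ?u = "%b. u(i := y' @ [b], k := take (Suc j) (u k))"
   have p: "exec (push i b) s (basic m) (cells_of (?u b))" for b
    unfolding y'(4) by (rule exec_word_eq[OF exec_prims(1)[of _ i m b]]) (use y' assms in auto)
   let ?x = "y ! (?N - Suc j)"
   let ?R = "%s. \<exists>b. (d \<or> b = ?x) & s = cells_of (?u b)"
   have 1: "spec d B (Choose (push i True) (push i False)) s (basic m + 2) 0 ?R"
   proof (rule spec_Choose[where x = ?x])
    show "spec d B (push i True) s (basic m) 0 ?R" if "d \<or> ?x"
     by (rule spec_exec[OF p[of True]], intro exI[of _ True] conjI refl) (use that in simp)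
    show "spec d B (push i False) s (basic m) 0 ?R" if "d \<or> ~ ?x"
     by (rule spec_exec[OF p[of False]], intro exI[of _ False] conjI refl) (use that in simp)
   qed
   have q: "exec (pop k) (cells_of (?u b)) (basic m) (cells_of (u(i := y' @ [b], k := take j (u k))))" for b
    by (rule exec_word_eq[OF exec_prims(2)[of _ k m]]) (use y' assms in \<open>auto simp: butlast_take\<close>)
   have "I j (cells_of (u(i := y' @ [b], k := take j (u k))))" if "d \<or> b = ?x" for b
   proof -
    have n: "?N - j = Suc (?N - Suc j)" using y' by simp
    have "d \<or> y' @ [b] = take (?N - j) y"
    proof (cases d)
     case False
     then have "?N - Suc j < length y" using assms(4) y' by simp
     from take_Suc_conv_app_nth[OF this] show ?thesis using False that y' n by simp
    qed simp
    moreover have "length (y' @ [b]) = ?N - j" using y' n by simp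
    ultimately show ?thesis using y'(1) unfolding I_def
     by (intro conjI exI[of _ "y' @ [b]"]) (assumption | simp)+
   qed
   then show "spec d B (Seq (Choose (push i True) (push i False)) (pop k)) s (basic m + 2 + basic m) 0 (I j)"
    using spec_Seq_exec[OF 1, of "pop k" "basic m" "I j"] q by blast
  qed
 qed
 moreover have "?N * ((basic m + 2 + basic m) + 2) + 1 <= m * (2 * basic m + 4) + 1"
  using mult_le_mono1[OF assms(3), of "2 * basic m + 4"] by (simp add: algebra_simps)
 moreover have "\<exists>y'. length y' = ?N & (d \<or> y' = y) & s = cells_of (u(i := y', k := []))" if "I 0 s" for s
 proof -
  from that obtain y' where y': "length y' = ?N - 0" "d \<or> y' = take (?N - 0) y"
   "s = cells_of (u(i := y', k := take 0 (u k)))" unfolding I_def by (elim conjE exE)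
  have "d \<or> y' = y" using y'(2) assms(4) by (cases d) simp_all
  then show ?thesis using y'(1,3) by (intro exI[of _ y'] conjI) simp_all
 qed
 ultimately show ?thesis by (elim spec_mono) simp_all
qed

text \<open>Registers 3 and 4 hold the two components of an encoded pair: the oracle for the second
  level receives both the input and the word guessed outside.\<close>

definition decoded :: "expr => expr => bool list => nat => bool list" where
 "decoded a b w = (base w)(3 := eval a (base w), 4 := eval b (base w))"

text \<open>Conventions for registers: 0 is the input, 3 and 4 its decoded parts, 2 the guess, bound
  registers start at 5. The register c lies above all of these; it first holds the length of the
  guess and later the verdict.\<close>

lemma NP_expr:
 assumes br: "bound_regs a \<union> bound_regs b \<union> bound_regs T \<union> bound_regs \<phi> \<subseteq> {5..}"
  and rg: "regs a \<inter> {3, 4} = {}" "regs b \<inter> {3, 4} = {}" "2 \<notin> regs T"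
 shows "{w. \<exists>y. length y = length (eval T (decoded a b w)) & eval \<phi> ((decoded a b w)(2 := y)) ~= []} \<in> NP"
proof -
 define c where "c = Suc (Max (insert 5 (regs a \<union> regs b \<union> regs T \<union> regs \<phi>)))"
 have c: "5 < c" "regs a \<union> regs b \<union> regs T \<union> regs \<phi> \<subseteq> {..<c}"
  using finite_regs by (auto simp: c_def less_Suc_eq_le)
 let ?k = "Suc c"
 define p where "p = Seq (compile a 3 ?k) (Seq (compile b 4 ?k) (Seq (compile T c ?k)
  (Seq (guess 2 c) (compile \<phi> c ?k))))"
 define X where "X = {w. \<exists>y. length y = length (eval T (decoded a b w)) & eval \<phi> ((decoded a b w)(2 := y)) ~= []}"
 define m1 where "m1 = pX + size_bound a"
 define m2 where "m2 = m1 + size_bound b"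
 define m3 where "m3 = m2 + (size_bound T \<circ>\<^sub>p m2)"
 define t where "t = cost a + ((cost b \<circ>\<^sub>p m1) + ((cost T \<circ>\<^sub>p m2) + ((m3 * (2 * (basic_cost \<circ>\<^sub>p m3) + 4) + 1)
   + (cost \<phi> \<circ>\<^sub>p m3))))"
 have sp: "spec d {} p (start w) (poly t (length w)) 0
   (%s. \<exists>y'. length y' = length (eval T (decoded a b w)) & (d \<or> y' = y) &
    s = cells_of ((decoded a b w)(2 := y', c := eval \<phi> ((decoded a b w)(2 := y')))))"
  if y: "~ d ==> length y = length (eval T (decoded a b w))" for d w y
 proof -
  let ?n = "length w"
  let ?u1 = "(base w)(3 := eval a (base w))" and ?u2 = "decoded a b w"
  have l1: "length (?u1 i) <= poly m1 ?n" for i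
   using length_base[of w i] length_eval_le[of "base w" ?n a, OF length_base]
   by (auto simp: m1_def trans_le_add1)
  have l2: "length (?u2 i) <= poly m2 ?n" for i
   using l1[of i] length_eval_le[of "base w" ?n b, OF length_base]
   by (auto simp: m2_def decoded_def trans_le_add1)
  have l3: "length (?u2 i) <= poly m3 ?n" "length (eval T ?u2) <= poly m3 ?n" for i
   using l2[of i] length_eval_le[of ?u2 "poly m2 ?n" T, OF l2]
   by (auto simp: m3_def poly_pcompose)
  have 1: "exec (compile a 3 ?k) (start w) (poly (cost a) ?n) (cells_of ?u1)"
   unfolding start_base
   by (rule exec_word_eq[OF exec_compile[OF _ length_base]])
    (use c br rg in \<open>auto simp: ready_def base_def\<close>)
  have eb: "eval b ?u1 = eval b (base w)" by (rule eval_cong) (use rg in auto)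
  have 2: "exec (compile b 4 ?k) (cells_of ?u1) (poly (cost b) (poly m1 ?n)) (cells_of ?u2)"
   by (rule exec_word_eq[OF exec_compile[OF _ l1]])
    (use c br rg eb eb[unfolded fun_upd_def] in \<open>auto simp: ready_def base_def decoded_def\<close>)
  have 3: "exec (compile T c ?k) (cells_of ?u2) (poly (cost T) (poly m2 ?n)) (cells_of (?u2(c := eval T ?u2)))"
   by (rule exec_word_eq[OF exec_compile[OF _ l2]])
    (use c br rg in \<open>auto simp: ready_def base_def decoded_def fun_upd_def\<close>)
  let ?u3 = "?u2(c := eval T ?u2)"
  have 4: "spec d {} (guess 2 c) (cells_of ?u3) (poly m3 ?n * (2 * basic (poly m3 ?n) + 4) + 1) 0
   (%s. \<exists>y'. length y' = length (?u3 c) & (d \<or> y' = y) & s = cells_of (?u3(2 := y', c := [])))"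
   by (rule spec_guess) (use c l3 y in \<open>auto simp: decoded_def base_def\<close>)
  have c0: "?u3(2 := y', c := []) = ?u2(2 := y')" for y'
   using c by (auto simp: decoded_def base_def)
  have 5: "exec (compile \<phi> c ?k) (cells_of (?u2(2 := y'))) (poly (cost \<phi>) (poly m3 ?n))
    (cells_of (?u2(2 := y', c := eval \<phi> (?u2(2 := y')))))" if "length y' = length (eval T ?u2)" for y'
  proof (rule exec_word_eq[OF exec_compile])
   show "length ((?u2(2 := y')) i) <= poly m3 ?n" for i using l3 that by auto
   show "ready \<phi> c ?k (?u2(2 := y'))" using c br by (auto simp: ready_def base_def decoded_def)
  qed (use c in \<open>auto simp: base_def decoded_def\<close>)
  have 45: "spec d {} (Seq (guess 2 c) (compile \<phi> c ?k)) (cells_of ?u3)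
    (poly m3 ?n * (2 * basic (poly m3 ?n) + 4) + 1 + poly (cost \<phi>) (poly m3 ?n)) 0
    (%s. \<exists>y'. length y' = length (eval T (decoded a b w)) & (d \<or> y' = y) &
    s = cells_of ((decoded a b w)(2 := y', c := eval \<phi> ((decoded a b w)(2 := y')))))"
   by (rule spec_Seq_exec[OF 4]) (use 5 c0 in auto)
  show ?thesis unfolding p_def
   by (rule spec_mono[OF spec_exec_Seq[OF 1 spec_exec_Seq[OF 2 spec_exec_Seq[OF 3 45]]]])
    (auto simp: t_def poly_pcompose)
 qed
 have "X \<in> NP_rel {}"
 proof (rule NP_relI[where p = p and t = t and j = c and k = 0])
  show "asks p <= 1" by (simp add: p_def guess_def)
  show "spec True {} p (start w) (poly t (length w)) 0 (%s. scan (s c) ~= None --> w \<in> X)" for w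
   by (rule spec_mono[OF sp[where d = True and w = w and y = "[]"]]) (auto simp: scan_cells_of X_def)
  show "\<exists>n k. spec False {} p (start w) n k (%s. scan (s c) ~= None)" if "w \<in> X" for w
  proof -
   from that obtain y where y: "length y = length (eval T (decoded a b w))" "eval \<phi> ((decoded a b w)(2 := y)) ~= []"
    by (auto simp: X_def)
   show ?thesis
    by (intro exI, rule spec_mono[OF sp[where d = False and w = w and y = y]]) (use y in \<open>auto simp: scan_cells_of\<close>)
  qed
 qed
 then show ?thesis by (simp add: NP_def X_def)
qed

text \<open>One query per computation is enough: after the guess the machine accepts on the answer
  no, and the complement of an NP oracle supplies the universal quantifier.\<close>

lemma Sigma2_expr:
 assumes B: "B \<in> NP" and br: "bound_regs T \<union> bound_regs q \<subseteq> {5..}"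
  and rg: "2 \<notin> regs T" "1 \<notin> regs q" "1 \<notin> regs T"
 shows "{w. \<exists>y. length y = length (eval T (base w)) & eval q ((base w)(2 := y)) \<notin> B} \<in> Sigma_p 2"
proof -
 define c where "c = Suc (Max (insert 5 (regs T \<union> regs q)))"
 have c: "5 < c" "regs T \<union> regs q \<subseteq> {..<c}"
  using finite_regs by (auto simp: c_def less_Suc_eq_le)
 let ?k = "Suc c"
 define p where "p = Seq (compile T c ?k) (Seq (guess 2 c) (Seq (compile q 1 ?k) (Ask Skip (push c True))))"
 define X where "X = {w. \<exists>y. length y = length (eval T (base w)) & eval q ((base w)(2 := y)) \<notin> B}"
 define m1 where "m1 = pX + size_bound T"
 define t where "t = cost T + ((m1 * (2 * (basic_cost \<circ>\<^sub>p m1) + 4) + 1) + ((cost q \<circ>\<^sub>p m1) + ([:basic 0:] + 2)))"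
 have sp: "spec d B p (start w) (poly t (length w)) 1
   (%s. \<exists>y'. length y' = length (eval T (base w)) & (d \<or> y' = y) &
    (scan (s c) ~= None <-> eval q ((base w)(2 := y')) \<notin> B))"
  if y: "~ d ==> length y = length (eval T (base w))" for d w y
 proof -
  let ?n = "length w" and ?u2 = "base w"
  have l1: "length (?u2 i) <= poly m1 ?n" "length (eval T ?u2) <= poly m1 ?n" for i
   using length_base[of w i] length_eval_le[of ?u2 ?n T, OF length_base]
   by (auto simp: m1_def)
  let ?u3 = "?u2(c := eval T ?u2)"
  have 3: "exec (compile T c ?k) (start w) (poly (cost T) ?n) (cells_of ?u3)"
   unfolding start_base by (rule exec_word_eq[OF exec_compile[OF _ length_base]])
    (use c br rg in \<open>auto simp: ready_def base_def\<close>)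
  have 4: "spec d B (guess 2 c) (cells_of ?u3) (poly m1 ?n * (2 * basic (poly m1 ?n) + 4) + 1) 0
   (%s. \<exists>y'. length y' = length (?u3 c) & (d \<or> y' = y) & s = cells_of (?u3(2 := y', c := [])))"
   by (rule spec_guess) (use c l1 y in \<open>auto simp: base_def\<close>)
  have c0: "?u3(2 := y', c := []) = ?u2(2 := y')" for y'
   using c by (auto simp: base_def)
  have 56: "spec d B (Seq (compile q 1 ?k) (Ask Skip (push c True))) (cells_of (?u2(2 := y')))
    (poly (cost q) (poly m1 ?n) + (basic 0 + 2)) 1 (%s. scan (s c) ~= None <-> eval q ((base w)(2 := y')) \<notin> B)"
   if l: "length y' = length (eval T ?u2)" for y'
  proof -
   let ?v = "?u2(2 := y', 1 := eval q (?u2(2 := y')))"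
   have 5: "exec (compile q 1 ?k) (cells_of (?u2(2 := y'))) (poly (cost q) (poly m1 ?n)) (cells_of ?v)"
   proof (rule exec_word_eq[OF exec_compile])
    show "length ((?u2(2 := y')) i) <= poly m1 ?n" for i using l1 l by auto
    show "ready q 1 ?k (?u2(2 := y'))" using c br rg by (auto simp: ready_def base_def)
   qed (use c in \<open>auto simp: base_def\<close>)
   have w: "tape_word (tape_of (cells_of ?v 1)) = eval q (?u2(2 := y'))"
    by (simp add: cells_of_def)
   have ec: "?v c = []" using c by (simp add: base_def)
   have 6: "spec d B (Ask Skip (push c True)) (cells_of ?v) (basic 0 + 2) (0 + 1)
     (%s. scan (s c) ~= None <-> eval q ((base w)(2 := y')) \<notin> B)"
   proof (rule spec_Ask)
    assume "tape_word (tape_of (cells_of ?v 1)) \<in> B"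
    then show "spec d B Skip (cells_of ?v) (basic 0) 0 (%s. scan (s c) ~= None <-> eval q ((base w)(2 := y')) \<notin> B)"
     using w ec by (intro spec_exec[OF exec_mono[OF exec_Skip]]) (auto simp: scan_cells_of)
   next
    assume "tape_word (tape_of (cells_of ?v 1)) \<notin> B"
    then show "spec d B (push c True) (cells_of ?v) (basic 0) 0 (%s. scan (s c) ~= None <-> eval q ((base w)(2 := y')) \<notin> B)"
     using w ec by (intro spec_exec[OF exec_prims(1)]) (auto simp: scan_cells_of)
   qed
   show ?thesis using spec_exec_Seq[OF 5 6] by simp
  qed
  have "spec d B (Seq (guess 2 c) (Seq (compile q 1 ?k) (Ask Skip (push c True)))) (cells_of ?u3)
   (poly m1 ?n * (2 * basic (poly m1 ?n) + 4) + 1 + (poly (cost q) (poly m1 ?n) + (basic 0 + 2))) (0 + 1)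
   (%s. \<exists>y'. length y' = length (eval T (base w)) & (d \<or> y' = y) &
    (scan (s c) ~= None <-> eval q ((base w)(2 := y')) \<notin> B))"
  proof (rule spec_Seq[OF 4])
   fix s assume "\<exists>y'. length y' = length (?u3 c) & (d \<or> y' = y) & s = cells_of (?u3(2 := y', c := []))"
   then obtain y' where y': "length y' = length (eval T ?u2)" "d \<or> y' = y" "s = cells_of (?u2(2 := y'))"
    using c0 by auto
   show "spec d B (Seq (compile q 1 ?k) (Ask Skip (push c True))) s
    (poly (cost q) (poly m1 ?n) + (basic 0 + 2)) 1
    (%s. \<exists>y'. length y' = length (eval T (base w)) & (d \<or> y' = y) &
    (scan (s c) ~= None <-> eval q ((base w)(2 := y')) \<notin> B))"
    unfolding y'(3) by (rule spec_mono[OF 56[OF y'(1)]]) (use y' in auto)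
  qed
  from spec_exec_Seq[OF 3 this] show ?thesis unfolding p_def
   by (rule spec_mono) (auto simp: t_def poly_pcompose)
 qed
 have "X \<in> NP_rel B"
 proof (rule NP_relI[where p = p and t = t and j = c and k = 1])
  show "asks p <= 1" by (simp add: p_def guess_def)
  show "spec True B p (start w) (poly t (length w)) 1 (%s. scan (s c) ~= None --> w \<in> X)" for w
   by (rule spec_mono[OF sp[where d = True and w = w and y = "[]"]]) (auto simp: X_def)
  show "\<exists>n k. spec False B p (start w) n k (%s. scan (s c) ~= None)" if "w \<in> X" for w
  proof -
   from that obtain y where y: "length y = length (eval T (base w))" "eval q ((base w)(2 := y)) \<notin> B"
    by (auto simp: X_def)
   show ?thesis
    by (intro exI, rule spec_mono[OF sp[where d = False and w = w and y = y]]) (use y in auto)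
  qed
 qed
 then show ?thesis using B by (auto simp: numeral_2_eq_2 X_def)
qed

section \<open>Binary search with an oracle\<close>

text \<open>The question for a labelling at distance at least d from the given one with the same
  goal label, required to accept the target if b is true. The distance in unary can be read off as a
  block of ones.\<close>

definition query :: "bool list => nat => bool => bool list" where
 "query w d b = b # ones d @ False # w"

function rounds :: "nat => nat" where
 "rounds r = (if r = 0 then 0 else if r = 1 then 1 else Suc (rounds (r - r div 2)))"
 by auto
termination by (relation "measure id") auto

text \<open>The largest feasible distance is sought in an interval of length r from d on, and the
  last query asks for the target there. Both answers continue with length
  \<open>r - r div 2\<close>, so that the number of queries does not depend on the answers.\<close>

function search :: "(nat => bool => bool) => nat => nat => bool" where
 "search ok r d = (if r <= 1 then ok d True
   else search ok (r - r div 2) (if ok (d + r div 2) False then d + r div 2 else d))"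
 by auto
termination by (relation "measure (%(ok, r, d). r)") auto

declare rounds.simps [simp del] search.simps [simp del]

lemma rounds_simps [simp]: "rounds 0 = 0" "rounds (Suc 0) = Suc 0"
 by (simp_all add: rounds.simps)

lemma search_1 [simp]: "search ok (Suc 0) d = ok d True"
 by (simp add: search.simps)

lemma rounds_eq_0 [simp]: "rounds n = 0 <-> n = 0"
 using rounds.simps[of n] by (auto split: if_splits)

lemma rounds_le: "r <= 2 ^ j ==> rounds r <= j + 1"
proof (induction r arbitrary: j rule: rounds.induct)
 case (1 r)
 show ?case
 proof (cases "r <= 1")
  case True
  then have "r = 0 \<or> r = Suc 0" by auto
  then show ?thesis by auto
 next
  case False
  then obtain i where j: "j = Suc i" using 1(2) by (cases j) auto
  have "r - r div 2 <= 2 ^ i" using 1(2) unfolding j power_Suc by linarith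
  with 1(1)[of i] False j show ?thesis using rounds.simps[of r] by simp
 qed
qed

lemma rounds_le_self: "rounds r <= r + 1"
 using rounds_le[of r r] less_exp[of r] by simp

lemma rounds_log: "real (rounds (n + 2)) <= log 2 (real n + 2) + 2"
proof -
 define j where "j = nat \<lceil>log 2 (real n + 2)\<rceil>"
 have l: "0 <= log 2 (real n + 2)" by simp
 have "log 2 (real n + 2) <= real j" using l unfolding j_def by linarith
 then have "real n + 2 <= 2 powr real j" by (simp add: log_le_iff)
 then have "real (n + 2) <= real (2 ^ j)" by (simp add: powr_realpow)
 then have "rounds (n + 2) <= j + 1" by (intro rounds_le) (simp only: of_nat_le_iff)
 moreover have "real j <= log 2 (real n + 2) + 1" using l unfolding j_def by linarith
 ultimately show ?thesis by linarith
qed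

text \<open>By monotonicity the interval always contains the largest feasible distance, if there is
  one. A witness e on the right must be this distance, as it is feasible while its successor is not;
  with no feasible distance at all the final query fails.\<close>

lemma search_correct:
 assumes "\<And>d. ok (Suc d) False ==> ok d False" "\<And>d. ok d True ==> ok d False"
 shows "1 <= r ==> d = 0 \<or> ok d False ==> ~ ok (d + r) False ==>
  search ok r d <-> (\<exists>e. ok e True & ~ ok (Suc e) False)"
proof (induction r arbitrary: d rule: less_induct)
 case (less r)
 have mono: "ok e False" if "ok e' False" "e <= e'" for e e'
  using that(2,1) by (induction rule: dec_induct) (use assms(1) in blast)+
 show ?case
 proof (cases "r <= 1")
  case True
  then have r: "r = 1" using less.prems by simp
  have "e = d" if e: "ok e True" "~ ok (Suc e) False" for e
  proof (rule antisym)
   show "d <= e" using less.prems(2) mono[of d "Suc e"] e(2) by (cases "d <= e") auto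
   show "e <= d" using less.prems(3) mono[of e "d + 1"] assms(2)[OF e(1)] r
    by (metis add.commute mono not_less_eq_eq plus_1_eq_Suc)
  qed
  then show ?thesis using r less.prems(3) by auto
 next
  case False
  let ?h = "r div 2"
  have "search ok (r - ?h) (if ok (d + ?h) False then d + ?h else d) <->
    (\<exists>e. ok e True & ~ ok (Suc e) False)"
  proof (rule less.IH)
   show "~ ok ((if ok (d + ?h) False then d + ?h else d) + (r - ?h)) False"
   proof -
    have "d + ?h <= d + (r - ?h)" "d + ?h + (r - ?h) = d + r" by linarith+
    then show ?thesis using less.prems(3) mono[of "d + (r - ?h)" "d + ?h"] by (cases "ok (d + ?h) False") (simp_all only: if_True if_False, blast+)
   qed
  qed (use False less.prems in auto)
  then show ?thesis using False search.simps[of ok r d] by simp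
 qed
qed

section \<open>Queries and search steps as expressions\<close>

abbreviation "eOne \<equiv> Const [True]"
abbreviation "eZero \<equiv> Const []"

definition Word :: "nat => nat => expr" where
 "Word v i = Sum v (Size i) (IfPos (Get i (Size v)) eOne (Const [False]))"

lemma concat_map_cong: "(\<And>x. x \<in> set xs ==> f x = g x) ==> concat (map f xs) = concat (map g xs)"
 by (metis map_cong)

lemma eval_Word: "v ~= i ==> eval (Word v i) u = u i"
proof -
 assume v: "v ~= i"
 have "eval (Word v i) u = concat (map (%x. [u i ! x]) [0..<length (u i)])"
  unfolding Word_def eval.simps length_replicate by (rule concat_map_cong) (use v in auto)
 then show ?thesis by (simp add: concat_map_singleton map_nth)
qed

text \<open>It counts the x with 2 * x + 1 < n, and these are exactly the x below n div 2.\<close>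

definition Half :: expr where
 "Half = Sum 6 (Size 3) (IfPos (Minus (Size 3) (Add (Size 6) (Add (Size 6) eOne))) eOne eZero)"

lemma concat_map_ones: "concat (map (%x. if x < m then [True] else []) [0..<n]) = ones (min m n)"
 by (induction n) (auto simp: min_def replicate_append_same le_Suc_eq)

lemma eval_Half: "eval Half u = ones (length (u 3) div 2)"
proof -
 have "eval Half u = concat (map (%x. if x < length (u 3) div 2 then [True] else []) [0..<length (u 3)])"
  unfolding Half_def eval.simps length_replicate by (rule concat_map_cong) auto
 then show ?thesis by (simp add: concat_map_ones min_def)
qed

text \<open>The bit b is true just when half of register 3 is zero, that is, in the final round;
  hence the same expression, and the same \<open>Ask\<close>, serves the probes and the final
  query.\<close>

definition Query_expr :: expr where
 "Query_expr = Add (IfPos Half (Const [False]) eOne) (Add (Size 2) (Add Half (Add (Const [False]) (Word 6 0))))"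

lemma eval_Query_expr:
 "eval Query_expr u = query (u 0) (length (u 2) + length (u 3) div 2) (length (u 3) div 2 = 0)"
 by (simp add: Query_expr_def query_def eval_Half eval_Word replicate_add)

text \<open>Register 2 is the lower end, 3 the length of the interval, 4 the last answer, 5 a buffer
  for the new length. After the final query the length becomes 0, which ends the loop with the
  result in register 4.\<close>

definition search_step :: prog where
 "search_step = Seq (clear 1) (Seq (clear 4) (Seq (compile Query_expr 1 8) (Seq (Ask (push 4 True) Skip)
   (Seq (compile (IfPos (Size 4) Half eZero) 2 8)
   (Seq (compile (IfPos Half (Minus (Size 3) Half) eZero) 5 8)
   (Seq (clear 3) (Seq (copy 5 3) (clear 5))))))))"

definition search_prog :: prog where
 "search_prog = Seq (compile (Add (Size 0) (Const [True, True])) 3 8) (While 3 search_step)"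

definition search_state :: "bool list => (nat => bool list) => bool" where
 "search_state w u <-> u 0 = w & (\<forall>i\<ge>5. u i = []) & length (u 2) + length (u 3) <= length w + 2 &
   length (u 1) <= 3 * length w + 10 & length (u 4) <= 1"

definition search_cost :: npoly where
 "search_cost = (cost Query_expr + cost (IfPos (Size 4) Half eZero) + cost (IfPos Half (Minus (Size 3) Half) eZero)
   + 6 * basic_cost + 2) \<circ>\<^sub>p [:10, 3:]"

lemma spec_search_step:
 fixes w u B
 defines "d \<equiv> length (u 2)" and "r \<equiv> length (u 3)"
 defines "h \<equiv> r div 2"
 defines "ans \<equiv> query w (d + h) (h = 0) \<in> B"
 assumes u: "search_state w u"
 shows "spec dm B search_step (cells_of u) (poly search_cost (length w)) 1
  (%s. \<exists>u'. s = cells_of u' & search_state w u' & length (u' 2) = (if ans then d + h else d) &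
    length (u' 3) = (if h = 0 then 0 else r - h) & u' 4 = (if ans then [True] else []))"
proof -
 let ?m = "3 * length w + 10"
 have e0: "u i = []" if "i \<ge> 5" for i using u that by (auto simp: search_state_def)
 have l: "length (u i) <= ?m" for i
 proof -
  consider "i = 0" | "i = 1" | "i = 2" | "i = 3" | "i = 4" | "i \<ge> 5" by linarith
  then show ?thesis using u by cases (auto simp: search_state_def)
 qed
 let ?u1 = "u(1 := [])" and ?u2 = "u(1 := [], 4 := [])"
 have 1: "exec (clear 1) (cells_of u) (basic ?m) (cells_of ?u1)"
  by (rule exec_prims(3)) (rule l)
 have 2: "exec (clear 4) (cells_of ?u1) (basic ?m) (cells_of ?u2)"
  by (rule exec_prims(3)) (use l in simp)
 have l2: "length (?u2 i) <= ?m" for i using l[of i] by simp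
 have r: "regs Query_expr = {0, 2, 3, 6}" "bound_regs Query_expr = {6}"
  by (auto simp: Query_expr_def Half_def Word_def)
 let ?q = "query w (d + h) (h = 0)"
 let ?u3 = "u(1 := ?q, 4 := [])"
 have q: "eval Query_expr ?u2 = ?q"
  using u by (simp add: eval_Query_expr d_def r_def h_def search_state_def)
 have 3: "exec (compile Query_expr 1 8) (cells_of ?u2) (poly (cost Query_expr) ?m) (cells_of ?u3)"
  by (rule exec_word_eq[OF exec_compile[OF _ l2]])
   (use r e0 q in \<open>auto simp: ready_def simp flip: fun_upd_def\<close>)
 have lq: "length ?q <= ?m"
  using u by (auto simp: query_def search_state_def d_def r_def h_def)
 have l3: "length (?u3 i) <= ?m" for i using l[of i] lq by simp
 let ?a = "if ans then [True] else []"
 let ?u4 = "u(1 := ?q, 4 := ?a)"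
 have tw: "tape_word (tape_of (cells_of ?u3 1)) = ?q" by (simp add: cells_of_def)
 have 4: "spec dm B (Ask (push 4 True) Skip) (cells_of ?u3) (basic ?m + 2) (0 + 1) (%s. s = cells_of ?u4)"
 proof (rule spec_Ask)
  assume "tape_word (tape_of (cells_of ?u3 1)) \<in> B"
  then have "ans" unfolding tw ans_def .
  then show "spec dm B (push 4 True) (cells_of ?u3) (basic ?m) 0 (%s. s = cells_of ?u4)"
   by (intro spec_exec[OF exec_word_eq[OF exec_prims(1)[of ?u3 4 ?m]]]) (use l3[of 4] in auto)
 next
  assume "tape_word (tape_of (cells_of ?u3 1)) \<notin> B"
  then have "~ ans" unfolding tw ans_def .
  then show "spec dm B Skip (cells_of ?u3) (basic ?m) 0 (%s. s = cells_of ?u4)"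
   by (intro spec_exec[OF exec_mono[OF exec_Skip]]) auto
 qed
 have l4: "length (?u4 i) <= ?m" for i using l[of i] lq by auto
 have rH: "regs Half = {3, 6}" "bound_regs Half = {6}" by (auto simp: Half_def)
 let ?x = "ones (if ans then h else 0)"
 let ?u5 = "?u4(2 := u 2 @ ?x)"
 have ev5: "eval (IfPos (Size 4) Half eZero) ?u4 = ?x"
  by (simp add: eval_Half h_def r_def)
 have 5: "exec (compile (IfPos (Size 4) Half eZero) 2 8) (cells_of ?u4)
   (poly (cost (IfPos (Size 4) Half eZero)) ?m) (cells_of ?u5)"
  by (rule exec_word_eq[OF exec_compile[OF _ l4]])
   (use rH e0 ev5 in \<open>auto simp: ready_def simp del: eval.simps simp flip: fun_upd_def\<close>)
 have hr: "h <= r" by (simp add: h_def)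
 have l5: "length (?u5 i) <= ?m" for i
  using l4[of i] u hr by (auto simp: search_state_def d_def r_def)
 let ?y = "ones (if h = 0 then 0 else r - h)"
 let ?u6 = "?u5(5 := ?y)"
 have ev6: "eval (IfPos Half (Minus (Size 3) Half) eZero) ?u5 = ?y"
  by (simp add: eval_Half h_def r_def)
 have 6: "exec (compile (IfPos Half (Minus (Size 3) Half) eZero) 5 8) (cells_of ?u5)
   (poly (cost (IfPos Half (Minus (Size 3) Half) eZero)) ?m) (cells_of ?u6)"
  by (rule exec_word_eq[OF exec_compile[OF _ l5]])
   (use rH e0 ev6 in \<open>auto simp: ready_def simp del: eval.simps simp flip: fun_upd_def\<close>)
 have l6: "length (?u6 i) <= ?m" for i
  using l5[of i] u by (auto simp: search_state_def r_def)
 let ?u7 = "?u6(3 := [])"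
 have 7: "exec (clear 3) (cells_of ?u6) (basic ?m) (cells_of ?u7)"
  by (rule exec_prims(3)) (rule l6)
 let ?u8 = "?u7(3 := ?y)"
 have 8: "exec (copy 5 3) (cells_of ?u7) (basic ?m) (cells_of ?u8)"
  by (rule exec_word_eq[OF exec_prims(4)[of 5 3 ?u7 ?m]]) (use l6[of 5] in auto)
 let ?u9 = "?u8(5 := [])"
 have 9: "exec (clear 5) (cells_of ?u8) (basic ?m) (cells_of ?u9)"
  by (rule exec_prims(3)) (use l6[of 5] in simp)
 have "spec dm B (Seq (Ask (push 4 True) Skip) (Seq (compile (IfPos (Size 4) Half eZero) 2 8)
   (Seq (compile (IfPos Half (Minus (Size 3) Half) eZero) 5 8)
   (Seq (clear 3) (Seq (copy 5 3) (clear 5)))))) (cells_of ?u3)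
   (basic ?m + 2 + (poly (cost (IfPos (Size 4) Half eZero)) ?m +
    (poly (cost (IfPos Half (Minus (Size 3) Half) eZero)) ?m + (basic ?m + (basic ?m + basic ?m)))))
   (0 + 1) (%s. s = cells_of ?u9)"
  by (rule spec_Seq_exec[OF 4]) (use exec_Seq[OF 5 exec_Seq[OF 6 exec_Seq[OF 7 exec_Seq[OF 8 9]]]] in blast)
 from spec_exec_Seq[OF 1 spec_exec_Seq[OF 2 spec_exec_Seq[OF 3 this]]]
 have "spec dm B search_step (cells_of u) (poly search_cost (length w)) 1 (%s. s = cells_of ?u9)"
  unfolding search_step_def[symmetric]
 proof (rule spec_mono)
  have pm: "poly [:10, 3:] (length w) = ?m" by simp
  show "basic ?m + (basic ?m + (poly (cost Query_expr) ?m +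
    (basic ?m + 2 + (poly (cost (IfPos (Size 4) Half eZero)) ?m +
    (poly (cost (IfPos Half (Minus (Size 3) Half) eZero)) ?m + (basic ?m + (basic ?m + basic ?m)))))))
    <= poly search_cost (length w)"
   unfolding search_cost_def poly_pcompose pm by (simp del: cost.simps)
 qed simp_all
 then show ?thesis
 proof (rule spec_mono)
  fix s assume s: "s = cells_of ?u9"
  have "search_state w ?u9"
   unfolding search_state_def using u hr lq by (auto simp: search_state_def d_def r_def)
  then show "\<exists>u'. s = cells_of u' & search_state w u' & length (u' 2) = (if ans then d + h else d) &
    length (u' 3) = (if h = 0 then 0 else r - h) & u' 4 = (if ans then [True] else [])"
   unfolding s by (intro exI[of _ ?u9] conjI) (simp_all add: d_def)
 qed simp_all
qed

definition total_search_cost :: npoly where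
 "total_search_cost = cost (Add (Size 0) (Const [True, True])) + ([:3, 1:] * (search_cost + 2) + 1)"

lemma spec_search_prog:
 "spec dm B search_prog (start w) (poly total_search_cost (length w)) (rounds (length w + 2))
  (%s. scan (s 4) ~= None <-> search (%d b. query w d b \<in> B) (length w + 2) 0)"
proof -
 let ?r = "length w + 2" and ?ok = "%d b. query w d b \<in> B"
 let ?u = "(base w)(3 := ones (length w) @ [True, True])"
 have 1: "exec (compile (Add (Size 0) (Const [True, True])) 3 8) (start w)
   (poly (cost (Add (Size 0) (Const [True, True]))) (length w)) (cells_of ?u)"
  unfolding start_base by (rule exec_word_eq[OF exec_compile[OF _ length_base]])
   (auto simp: ready_def base_def)
 \<comment> \<open>Once the interval is empty, the outcome of the search is the answer stored in
   register 4.\<close>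
 define I where "I = (%j s. \<exists>u. s = cells_of u & search_state w u & rounds (length (u 3)) = j &
  (if u 3 = [] then u 4 ~= [] else search ?ok (length (u 3)) (length (u 2))) = search ?ok ?r 0)"
 have 2: "spec dm B (While 3 search_step) (cells_of ?u) (rounds ?r * (poly search_cost (length w) + 2) + 1)
   (rounds ?r * 1) (I 0)"
 proof (rule spec_While)
  show "I (rounds ?r) (cells_of ?u)"
   unfolding I_def by (intro exI[of _ ?u]) (auto simp: search_state_def base_def)
  show "scan (s 3) = None" if "I 0 s" for s using that by (auto simp: I_def scan_cells_of)
  fix j s assume "I (Suc j) s"
  then obtain u where u: "s = cells_of u" "search_state w u" "rounds (length (u 3)) = Suc j"
   "(if u 3 = [] then u 4 ~= [] else search ?ok (length (u 3)) (length (u 2))) = search ?ok ?r 0"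
   unfolding I_def by (elim exE conjE)
  let ?d = "length (u 2)" and ?n = "length (u 3)"
  let ?h = "?n div 2"
  have n: "u 3 ~= []" using u(3) by auto
  have "spec dm B search_step s (poly search_cost (length w)) 1 (I j)"
   unfolding u(1)
  proof (rule spec_mono[OF spec_search_step[OF u(2)]])
   fix s' assume "\<exists>u'. s' = cells_of u' & search_state w u' &
     length (u' 2) = (if query w (?d + ?h) (?h = 0) \<in> B then ?d + ?h else ?d) &
     length (u' 3) = (if ?h = 0 then 0 else ?n - ?h) &
     u' 4 = (if query w (?d + ?h) (?h = 0) \<in> B then [True] else [])"
   then obtain u' where u': "s' = cells_of u'" "search_state w u'"
    "length (u' 2) = (if query w (?d + ?h) (?h = 0) \<in> B then ?d + ?h else ?d)"
    "length (u' 3) = (if ?h = 0 then 0 else ?n - ?h)"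
    "u' 4 = (if query w (?d + ?h) (?h = 0) \<in> B then [True] else [])" by (elim exE conjE)
   show "I j s'"
   proof (cases "?h = 0")
    case True
    moreover have "0 < ?n" using n by simp
    ultimately have n1: "?n = 1" by linarith
    then have "j = 0" using u(3) by simp
    then show ?thesis using u' n u(4) n1 True unfolding I_def
     by (intro exI[of _ u']) simp
   next
    case False
    then have n2: "~ ?n <= 1" by auto
    then have "rounds (?n - ?h) = j" using u(3) n rounds.simps[of ?n] by (simp split: if_splits)
    moreover have "search ?ok (length (u' 3)) (length (u' 2)) = search ?ok ?n ?d"
     unfolding search.simps[of ?ok ?n ?d] u'(3,4) if_not_P[OF n2] if_not_P[OF False]
     by (simp only: False)
    moreover have "u' 3 ~= []" using u'(4) False by auto
    ultimately show ?thesis using u' n u(4) False unfolding I_def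
     by (intro exI[of _ u']) simp
   qed
  qed simp_all
  moreover have "scan (s 3) ~= None" using n u(1) by (simp add: scan_cells_of)
  ultimately show "scan (s 3) ~= None & spec dm B search_step s (poly search_cost (length w)) 1 (I j)" by blast
 qed
 have "rounds ?r * (poly search_cost (length w) + 2) <= (length w + 3) * (poly search_cost (length w) + 2)"
  using rounds_le_self[of ?r] by (intro mult_le_mono1) simp
 then show ?thesis unfolding search_prog_def
  by (intro spec_mono[OF spec_exec_Seq[OF 1 2]])
   (auto simp: total_search_cost_def I_def scan_cells_of algebra_simps)
qed

text \<open>No distance reaches \<open>length w + 2\<close>, so the search starts with that length;
  it halves the interval in each round and asks one query per round, hence logarithmically
  many.\<close>

lemma Theta_search:
 assumes B: "B \<in> Sigma_p (h - 1)"
  and mono: "\<And>w d. query w (Suc d) False \<in> B ==> query w d False \<in> B"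
  and fin: "\<And>w d. query w d True \<in> B ==> query w d False \<in> B"
  and top: "\<And>w. query w (length w + 2) False \<notin> B"
 shows "{w. \<exists>d. query w d True \<in> B & query w (Suc d) False \<notin> B} \<in> Theta_p h"
proof -
 let ?X = "{w. \<exists>d. query w d True \<in> B & query w (Suc d) False \<notin> B}"
 have srch: "search (%d b. query w d b \<in> B) (length w + 2) 0 <-> w \<in> ?X" for w
  using search_correct[of "%d b. query w d b \<in> B" "length w + 2" 0] mono fin top by simp
 have asks: "asks search_prog <= 1" and cf: "choice_free search_prog"
  by (simp_all add: search_prog_def search_step_def del: compile.simps)
 obtain K where K: "runs_on K 4 search_prog" using asks by (rule runs_onI)
 let ?M = "machine_of K 4 search_prog"
 note sp = spec_search_prog[of _ B, unfolded srch]
 have "well_formed ?M" "deterministic ?M"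
  using K cf by (auto simp: runs_on_def intro: well_formed_machine_of deterministic_machine_of)
 moreover have "poly_time ?M B"
  unfolding poly_time_def
 proof (intro exI[of _ "total_search_cost + 1"] allI impI)
  fix w n i c assume "run ?M B (init ?M w) n i c"
  from machine_of_runs(1)[OF K sp this] show "n <= poly (total_search_cost + 1) (length w)" by simp
 qed
 moreover have "log_queries ?M B"
  unfolding log_queries_def
 proof (intro exI[of _ "%n. log 2 (real n + 2) + 2"] conjI allI impI)
  show "(%n. log 2 (real n + 2) + 2) \<in> O(%n. log 2 (real n))"
  \<comment> \<open>For n >= 2 the bound is at most 3 + log n, and 3 is at most 3 * log n.\<close>
  proof (rule bigoI[where c = 4], rule eventually_sequentiallyI[of 2])
   fix n :: nat assume n: "2 <= n"
   have "log 2 (real n + 2) <= log 2 (2 * real n)" using n by simp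
   also have "\<dots> = 1 + log 2 (real n)" using n by (simp add: log_mult)
   finally have "log 2 (real n + 2) <= 1 + log 2 (real n)" .
   moreover have "1 <= log 2 (real n)" using n by simp
   moreover have "0 <= log 2 (real n + 2)" by simp
   ultimately show "norm (log 2 (real n + 2) + 2) <= 4 * norm (log 2 (real n))" by simp
  qed
  fix w n i c assume "run ?M B (init ?M w) n i c"
  from machine_of_runs(2)[OF K sp this] have "i <= rounds (length w + 2)" .
  then show "real i <= log 2 (real (length w) + 2) + 2"
   using rounds_log[of "length w"] by (meson of_nat_le_iff order_trans)
 qed
 moreover have "recognizes ?M B ?X"
  unfolding recognizes_def
 proof (intro allI iffI)
  fix w assume "accepts ?M B w"
  from accepts_imp[OF K sp this] show "w \<in> ?X" by blast
 next
  fix w assume w: "w \<in> ?X"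
  show "accepts ?M B w" by (rule acceptsI[OF K sp[where dm = True]]) (use w in blast)
 qed
 ultimately show ?thesis using B unfolding Theta_p_def by blast
qed

section \<open>Renaming arguments\<close>

lemma Def_eq: "Def F S = {a \<in> fst F. \<exists>b\<in>S. (b, a) \<in> snd F}"
 by (simp add: Def_def split: prod.splits)

lemma Acc_eq: "Acc F S = {a \<in> fst F. \<forall>b. (b, a) \<in> snd F --> b \<in> Def F S}"
 by (simp add: Acc_def split: prod.splits)

text \<open>Words know arguments only as positions in an enumeration. Injective renamings relate
  these positions to arguments of any type, in particular to those of the frameworks for
  hardness.\<close>

definition rename :: "('a => 'b) => 'a af => 'b af" where
 "rename h F = (h ` fst F, map_prod h h ` snd F)"

locale renaming =
 fixes h :: "'a => 'b" and F :: "'a af"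
 assumes inj: "inj_on h (fst F)" and af: "is_af F"
begin

lemma edges: "(b, a) \<in> snd F ==> b \<in> fst F & a \<in> fst F"
 using af by (auto simp: is_af_def split: prod.splits)

lemma fst_rename: "fst (rename h F) = h ` fst F"
 by (simp add: rename_def)

lemma edge_rename_dest: "(x, y) \<in> snd (rename h F) ==> x \<in> h ` fst F"
 using edges by (auto simp: rename_def)

lemma edge_rename: "a \<in> fst F ==> b \<in> fst F ==> (h b, h a) \<in> snd (rename h F) <-> (b, a) \<in> snd F"
 using inj edges by (auto simp: rename_def inj_on_eq_iff)

lemma mem_rename: "a \<in> fst F ==> S \<subseteq> fst F ==> h a \<in> h ` S <-> a \<in> S"
 using inj by (auto simp: inj_on_def)

lemma Def_rename: "S \<subseteq> fst F ==> Def (rename h F) (h ` S) = h ` Def F S"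
proof -
 assume S: "S \<subseteq> fst F"
 have "Def (rename h F) (h ` S) = {x. \<exists>a\<in>fst F. x = h a & (\<exists>b\<in>S. (h b, h a) \<in> snd (rename h F))}"
  unfolding Def_eq fst_rename by blast
 also have "\<dots> = {x. \<exists>a\<in>fst F. x = h a & (\<exists>b\<in>S. (b, a) \<in> snd F)}"
  using edge_rename S by (intro Collect_cong bex_cong refl conj_cong) auto
 also have "\<dots> = h ` Def F S" unfolding Def_eq by auto
 finally show ?thesis .
qed

lemma Def_subset: "Def F S \<subseteq> fst F"
 by (auto simp: Def_def split: prod.splits)

lemma Acc_subset: "Acc F S \<subseteq> fst F"
 by (auto simp: Acc_def split: prod.splits)

lemma Acc_rename: "S \<subseteq> fst F ==> Acc (rename h F) (h ` S) = h ` Acc F S"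
proof -
 assume S: "S \<subseteq> fst F"
 have "h a \<in> Acc (rename h F) (h ` S) <-> a \<in> Acc F S" if a: "a \<in> fst F" for a
 proof -
  have "h a \<in> Acc (rename h F) (h ` S) <-> (\<forall>b. (b, h a) \<in> snd (rename h F) --> b \<in> h ` Def F S)"
   using a unfolding Acc_eq Def_rename[OF S] by (simp add: rename_def)
  also have "\<dots> <-> (\<forall>b\<in>fst F. (h b, h a) \<in> snd (rename h F) --> h b \<in> h ` Def F S)"
   using edge_rename_dest by blast
  also have "\<dots> <-> (\<forall>b. (b, a) \<in> snd F --> b \<in> Def F S)"
   using a edges edge_rename mem_rename[OF _ Def_subset] by blast
  finally show ?thesis using a by (simp add: Acc_eq)
 qed
 moreover have "Acc (rename h F) (h ` S) \<subseteq> h ` fst F"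
  by (auto simp: Acc_eq rename_def)
 ultimately show ?thesis using Acc_subset[of S] by blast
qed

lemma subset_rename: "S \<subseteq> fst F ==> T \<subseteq> fst F ==> h ` S \<subseteq> h ` T <-> S \<subseteq> T"
 using mem_rename by blast

lemma eq_rename: "S \<subseteq> fst F ==> T \<subseteq> fst F ==> h ` S = h ` T <-> S = T"
 by (simp only: set_eq_subset subset_rename)

lemma complete_rename: "S \<subseteq> fst F ==> complete_ext (rename h F) (h ` S) <-> complete_ext F S"
proof -
 assume S: "S \<subseteq> fst F"
 have "h ` S \<inter> h ` Def F S = {} <-> S \<inter> Def F S = {}"
  using mem_rename[OF _ Def_subset] S by blast
 moreover have "h ` S \<subseteq> fst (rename h F)" using S by (auto simp: rename_def)
 ultimately show ?thesis
  unfolding complete_ext_def admissible_def conflict_free_def Def_rename[OF S] Acc_rename[OF S]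
   subset_rename[OF S Acc_subset] eq_rename[OF S Acc_subset] using S by blast
qed

lemma complete_rename_subset: "complete_ext (rename h F) T ==> \<exists>S\<subseteq>fst F. T = h ` S"
 unfolding complete_ext_def rename_def by (auto simp: subset_image_iff)

lemma psubset_rename: "S \<subseteq> fst F ==> T \<subseteq> fst F ==> h ` S \<subset> h ` T <-> S \<subset> T"
 by (simp only: psubset_eq subset_rename eq_rename)

lemma complete_subset: "complete_ext F S ==> S \<subseteq> fst F"
 by (simp add: complete_ext_def)

text \<open>The predicate is left open because the two maximality conditions, for inclusion and for
  the range, are transported in the same way.\<close>

lemma ex_complete_rename: "(\<exists>T. complete_ext (rename h F) T & Q T) <-> (\<exists>T. complete_ext F T & Q (h ` T))"
proof
 assume "\<exists>T. complete_ext (rename h F) T & Q T"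
 then obtain T where T: "complete_ext (rename h F) T" "Q T" by blast
 obtain S where S: "S \<subseteq> fst F" "T = h ` S" using complete_rename_subset[OF T(1)] by blast
 have "complete_ext F S" using complete_rename[OF S(1)] T(1) S(2) by simp
 with T(2) S(2) show "\<exists>T. complete_ext F T & Q (h ` T)" by blast
next
 assume "\<exists>T. complete_ext F T & Q (h ` T)"
 then obtain T where T: "complete_ext F T" "Q (h ` T)" by blast
 have "complete_ext (rename h F) (h ` T)" using complete_rename[OF complete_subset[OF T(1)]] T(1) by simp
 with T(2) show "\<exists>T. complete_ext (rename h F) T & Q T" by blast
qed

lemma preferred_rename: "S \<subseteq> fst F ==> preferred_ext (rename h F) (h ` S) <-> preferred_ext F S"
proof -
 assume S: "S \<subseteq> fst F"
 have "(\<exists>T. complete_ext (rename h F) T & h ` S \<subset> T) <-> (\<exists>T. complete_ext F T & h ` S \<subset> h ` T)"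
  by (rule ex_complete_rename)
 also have "\<dots> <-> (\<exists>T. complete_ext F T & S \<subset> T)"
  by (intro ex_cong1 conj_cong refl psubset_rename S complete_subset)
 finally show ?thesis unfolding preferred_ext_def complete_rename[OF S] by simp
qed

lemma range_rename: "S \<subseteq> fst F ==> h ` S \<union> Def (rename h F) (h ` S) = h ` (S \<union> Def F S)"
 by (simp add: Def_rename image_Un)

lemma extension_rename: "S \<subseteq> fst F ==> extension \<sigma> (rename h F) (h ` S) <-> extension \<sigma> F S"
proof (cases \<sigma>)
 assume S: "S \<subseteq> fst F"
 have r: "U \<union> Def F U \<subseteq> fst F" if "U \<subseteq> fst F" for U using that Def_subset by auto
 {
  case CO
  then show ?thesis using complete_rename[OF S] by simp
 next
  case ST
  have "h ` (S \<union> Def F S) = fst (rename h F) <-> S \<union> Def F S = fst F"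
   using eq_rename[OF r[OF S], of "fst F"] by (simp add: rename_def)
  then show ?thesis using ST preferred_rename[OF S] range_rename[OF S] by (simp add: stable_ext_def)
 next
  case PR
  then show ?thesis using preferred_rename[OF S] by simp
 next
  case SST
  let ?Q = "%T. preferred_ext (rename h F) T & h ` S \<union> Def (rename h F) (h ` S) \<subset> T \<union> Def (rename h F) T"
  have "(\<exists>T. ?Q T) <-> (\<exists>T. complete_ext (rename h F) T & ?Q T)"
   unfolding preferred_ext_def by blast
  also have "\<dots> <-> (\<exists>T. complete_ext F T & ?Q (h ` T))"
   by (rule ex_complete_rename)
  also have "\<dots> <-> (\<exists>T. complete_ext F T & preferred_ext F T & S \<union> Def F S \<subset> T \<union> Def F T)"
  proof (intro ex_cong1 conj_cong refl)
   fix T assume "complete_ext F T"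
   note T = complete_subset[OF this]
   show "preferred_ext (rename h F) (h ` T) <-> preferred_ext F T" by (rule preferred_rename[OF T])
   show "h ` S \<union> Def (rename h F) (h ` S) \<subset> h ` T \<union> Def (rename h F) (h ` T) <->
     S \<union> Def F S \<subset> T \<union> Def F T"
    unfolding range_rename[OF S] range_rename[OF T] by (rule psubset_rename[OF r[OF S] r[OF T]])
  qed
  also have "\<dots> <-> (\<exists>T. preferred_ext F T & S \<union> Def F S \<subset> T \<union> Def F T)"
   unfolding preferred_ext_def by blast
  finally show ?thesis using SST preferred_rename[OF S] by (simp add: semi_stable_ext_def)
 }
qed

lemma extension_subset: "extension \<sigma> F S ==> S \<subseteq> fst F"
 by (cases \<sigma>) (auto simp: stable_ext_def semi_stable_ext_def preferred_ext_def complete_ext_def)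

lemma extension_rename_subset: "extension \<sigma> (rename h F) T ==> \<exists>S. extension \<sigma> F S & T = h ` S"
proof -
 assume T: "extension \<sigma> (rename h F) T"
 then have "complete_ext (rename h F) T"
  by (cases \<sigma>) (auto simp: stable_ext_def semi_stable_ext_def preferred_ext_def)
 then obtain S where "S \<subseteq> fst F" "T = h ` S" using complete_rename_subset by blast
 with T extension_rename show ?thesis by blast
qed

lemma labelling_rename:
 assumes S: "S \<subseteq> fst F" and a: "a \<in> fst F"
 shows "labelling_of (rename h F) (h ` S) (h a) = labelling_of F S a"
 unfolding labelling_of_def Def_rename[OF S] restrict_def fst_rename
  mem_rename[OF a subset_refl] mem_rename[OF a S] mem_rename[OF a Def_subset] ..

lemma labellings_agree:
 assumes "\<And>a. a \<in> fst F ==> L' (h a) = L a" "L' \<in> extensional (h ` fst F)" "L \<in> extensional (fst F)"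
 shows "L' \<in> labellings \<sigma> (rename h F) <-> L \<in> labellings \<sigma> F"
proof
 assume "L \<in> labellings \<sigma> F"
 then obtain S where S: "extension \<sigma> F S" "L = labelling_of F S" by (auto simp: labellings_def)
 have "L' = labelling_of (rename h F) (h ` S)"
 proof (rule extensionalityI[OF assms(2)])
  show "labelling_of (rename h F) (h ` S) \<in> extensional (h ` fst F)"
   by (simp add: labelling_of_def rename_def)
  show "L' b = labelling_of (rename h F) (h ` S) b" if "b \<in> h ` fst F" for b
   using that assms(1) S labelling_rename extension_subset by auto
 qed
 then show "L' \<in> labellings \<sigma> (rename h F)"
  using S extension_subset extension_rename by (auto simp: labellings_def)
next
 assume "L' \<in> labellings \<sigma> (rename h F)"
 then obtain S where S: "extension \<sigma> F S" "L' = labelling_of (rename h F) (h ` S)"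
  using extension_rename_subset by (auto simp: labellings_def)
 have "L = labelling_of F S"
 proof (rule extensionalityI[OF assms(3)])
  show "labelling_of F S \<in> extensional (fst F)" by (simp add: labelling_of_def)
  show "L b = labelling_of F S b" if "b \<in> fst F" for b
   using that assms(1)[symmetric] S labelling_rename extension_subset by auto
 qed
 then show "L \<in> labellings \<sigma> F" using S by (auto simp: labellings_def)
qed

lemma inputs_rename:
 assumes "\<And>a. a \<in> fst F ==> L' (h a) = L a" "L' \<in> extensional (h ` fst F)" "L \<in> extensional (fst F)"
  and "g \<in> fst F" "k \<in> fst F"
 shows "(rename h F, h g, L', h k) \<in> SF_CA_inputs \<sigma> <-> (F, g, L, k) \<in> SF_CA_inputs \<sigma>"
proof -
 have "is_af (rename h F)" using af edges by (auto simp: is_af_def rename_def split: prod.splits)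
 moreover have "h g \<in> fst (rename h F)" "h k \<in> fst (rename h F)" using assms by (auto simp: rename_def)
 ultimately show ?thesis using labellings_agree[OF assms(1-3)] assms(4,5) af
  by (auto simp: SF_CA_inputs_def)
qed

lemma yes_rename:
 assumes "\<And>a. a \<in> fst F ==> L' (h a) = L a" "L' \<in> extensional (h ` fst F)" "L \<in> extensional (fst F)"
  and g: "g \<in> fst F" and k: "k \<in> fst F"
 shows "(rename h F, h g, L', h k) \<in> SF_CA_yes \<sigma> <-> (F, g, L, k) \<in> SF_CA_yes \<sigma>"
proof -
 \<comment> \<open>Transports labellings to the renamed framework. It maps the labellings of one
   framework onto those of the other and keeps distances, so that semifactuals correspond.\<close>
 define t where "t = (%L :: 'a => label. restrict (L \<circ> inv_into (fst F) h) (h ` fst F))"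
 have t: "t L (h a) = L a" "t L \<in> extensional (h ` fst F)" if "a \<in> fst F" for L a
  using that inj by (auto simp: t_def)
 have t2: "t L \<in> extensional (h ` fst F)" for L by (simp add: t_def)
 have ext: "M \<in> extensional (fst F)" if "M \<in> labellings \<sigma> F" for M
  using that by (auto simp: labellings_def labelling_of_def)
 have ta: "t M \<in> labellings \<sigma> (rename h F) <-> M \<in> labellings \<sigma> F" if "M \<in> extensional (fst F)" for M
  by (rule labellings_agree) (use t t2 that in auto)
 have lab: "labellings \<sigma> (rename h F) = t ` labellings \<sigma> F"
 proof (intro equalityI subsetI)
  fix N assume N: "N \<in> labellings \<sigma> (rename h F)"
  define M where "M = restrict (N \<circ> h) (fst F)"
  have "N \<in> extensional (h ` fst F)" using N by (auto simp: labellings_def labelling_of_def rename_def)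
  then have "N = t M"
   by (rule extensionalityI[OF _ t2]) (auto simp: t(1) M_def)
  moreover have "M \<in> extensional (fst F)" by (simp add: M_def)
  from ta[OF this] N have "M \<in> labellings \<sigma> F" unfolding \<open>N = t M\<close>[symmetric] by iprover
  ultimately show "N \<in> t ` labellings \<sigma> F" by blast
 qed (use ta ext in auto)
 have dist: "distance (rename h F) L' (t M) = distance F L M" for M
 proof -
  have "{a \<in> fst (rename h F). L' a ~= t M a} = h ` {a \<in> fst F. L a ~= M a}"
   using assms(1) t(1) by (auto simp: rename_def)
  moreover have "inj_on h {a \<in> fst F. L a ~= M a}" using inj by (rule inj_on_subset) auto
  ultimately show ?thesis by (simp add: distance_def card_image)
 qed
 have "(\<exists>N\<in>semifactuals \<sigma> (rename h F) (h g) L'. N (h k) = In) <-> (\<exists>M\<in>semifactuals \<sigma> F g L. M k = In)"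
  unfolding semifactuals_def lab by (simp add: dist t(1) g k assms(1)) blast
 then show ?thesis using inputs_rename[OF assms] by (auto simp: SF_CA_yes_def)
qed

end

section \<open>Frameworks encoded by words\<close>

definition nargs :: "bool list => nat" where
 "nargs w = length (takeWhile id w)"

text \<open>The parts of an encoding lie at fixed offsets: n + 1 bits for the size, n * n for the
  attacks, 2 * n for the labels, and n each for goal and target.\<close>

definition word_af :: "bool list => nat af" where
 "word_af w = (let n = nargs w in
   ({..<n}, {(i, j). i < n & j < n & w ! (n + 1 + i * n + j)}))"

definition word_label :: "bool list => nat => label" where
 "word_label w = (let n = nargs w in
   (\<lambda>i\<in>{..<n}. if w ! (n + 1 + n * n + 2 * i) then In else if w ! (n + 1 + n * n + 2 * i + 1) then Out else Und))"

definition word_goal :: "bool list => nat => bool" where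
 "word_goal w i = (let n = nargs w in w ! (n + 1 + n * n + 2 * n + i))"

definition word_target :: "bool list => nat => bool" where
 "word_target w i = (let n = nargs w in w ! (n + 1 + n * n + 3 * n + i))"

lemma concat_map_nth2:
 assumes "\<And>x. x \<in> set xs ==> length (f x) = 2" "i < length xs"
 shows "concat (map f xs) ! (2 * i) = f (xs ! i) ! 0" "concat (map f xs) ! (2 * i + 1) = f (xs ! i) ! 1"
 using assms
proof (induction xs arbitrary: i)
 case (Cons x xs)
 { case 1 then show ?case using Cons.IH(1)[of "i - 1"] by (cases i) (auto simp: nth_append) }
 { case 2 then show ?case using Cons.IH(2)[of "i - 1"] by (cases i) (auto simp: nth_append) }
qed auto

lemma nth_product: "i < length xs ==> j < length ys ==>
  List.product xs ys ! (i * length ys + j) = (xs ! i, ys ! j)"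
proof (induction xs arbitrary: i)
 case (Cons x xs)
 then show ?case by (cases i) (auto simp: nth_append)
qed simp

lemma length_label_code [simp]: "length (label_code l) = 2"
 by (cases l) auto

lemma length_encode: "length (encode xs ((A, R), g, L, k)) =
  length xs + 1 + length xs * length xs + 2 * length xs + 2 * length xs"
proof -
 have "length (concat (map (%a. label_code (L a)) xs)) = 2 * length xs"
  by (induction xs) auto
 then show ?thesis by simp
qed

lemma encode_parts:
 fixes xs :: "'a list"
 assumes n: "n = length xs" and w_def: "w = encode xs ((A, R), g, L, k)"
 shows "nargs w = n"
  "i < n ==> j < n ==> w ! (n + 1 + i * n + j) <-> (xs ! i, xs ! j) \<in> R"
  "i < n ==> w ! (n + 1 + n * n + 2 * i) <-> L (xs ! i) = In"
  "i < n ==> w ! (n + 1 + n * n + 2 * i + 1) <-> L (xs ! i) = Out"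
  "i < n ==> w ! (n + 1 + n * n + 2 * n + i) <-> xs ! i = g"
  "i < n ==> w ! (n + 1 + n * n + 3 * n + i) <-> xs ! i = k"
proof -
 let ?m = "map (%ab. ab \<in> R) (List.product xs xs)"
 let ?l = "concat (map (%a. label_code (L a)) xs)"
 have w: "w = (replicate n True @ [False]) @ ?m @ ?l @ map (%a. a = g) xs @ map (%a. a = k) xs"
  by (simp add: w_def n)
 have l: "length (replicate n True @ [False]) = n + 1" "length ?m = n * n" "length ?l = 2 * n"
  by (simp_all add: n) (induction xs; simp)
 show "nargs w = n"
  unfolding nargs_def w by (simp add: takeWhile_append)
 have sk: "w ! (n + 1 + x) = (?m @ ?l @ map (%a. a = g) xs @ map (%a. a = k) xs) ! x" for x
  unfolding w using l(1) by (metis nth_append_length_plus)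
 have sk2: "w ! (n + 1 + (n * n + x)) = (?l @ map (%a. a = g) xs @ map (%a. a = k) xs) ! x" for x
  unfolding sk using l(2) by (metis nth_append_length_plus)
 have sk3: "w ! (n + 1 + (n * n + (2 * n + x))) = (map (%a. a = g) xs @ map (%a. a = k) xs) ! x" for x
  unfolding sk2 using l(3) by (metis nth_append_length_plus)
 {
  assume i: "i < n" and j: "j < n"
  have "i * n + j < Suc i * n" using j by simp
  also have "\<dots> <= n * n" using i by (intro mult_le_mono1) simp
  finally have "i * n + j < n * n" .
  then show "w ! (n + 1 + i * n + j) <-> (xs ! i, xs ! j) \<in> R"
   using sk[of "i * n + j"] nth_product[of i xs j xs] i j l(2) by (simp add: nth_append add.assoc n)
 }
 assume i: "i < n"
 show "w ! (n + 1 + n * n + 2 * i) <-> L (xs ! i) = In"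
  using sk2[of "2 * i"] i l(3) concat_map_nth2(1)[of xs "%a. label_code (L a)" i]
  by (cases "L (xs ! i)") (auto simp: nth_append add.assoc n)
 show "w ! (n + 1 + n * n + 2 * i + 1) <-> L (xs ! i) = Out"
  using sk2[of "2 * i + 1"] i l(3) concat_map_nth2(2)[of xs "%a. label_code (L a)" i]
  by (cases "L (xs ! i)") (auto simp: nth_append add.assoc n)
 show "w ! (n + 1 + n * n + 2 * n + i) <-> xs ! i = g"
  using sk3[of i] i by (simp add: nth_append add.assoc n)
 show "w ! (n + 1 + n * n + 3 * n + i) <-> xs ! i = k"
  using sk3[of "n + i"] i by (simp add: nth_append add.assoc n algebra_simps)
qed

text \<open>The second condition excludes the pair of two true bits, which encodes no label; the
  last ones demand that each vector marks exactly one argument.\<close>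

definition well_coded :: "bool list => bool" where
 "well_coded w <-> (let n = nargs w in
   length w = n + 1 + n * n + 2 * n + 2 * n &
   (\<forall>i<n. ~ (w ! (n + 1 + n * n + 2 * i) & w ! (n + 1 + n * n + 2 * i + 1))) &
   (\<exists>i<n. \<forall>j<n. word_goal w j <-> j = i) & (\<exists>i<n. \<forall>j<n. word_target w j <-> j = i))"

definition word_input :: "bool list => nat sf_input => bool" where
 "word_input w x <-> well_coded w & (\<exists>g k. x = (word_af w, g, word_label w, k) & g < nargs w & k < nargs w &
   word_goal w g & word_target w k)"

lemma is_af_word_af: "is_af (word_af w)"
 by (auto simp: is_af_def word_af_def Let_def)

text \<open>The given framework is the renaming of the framework of positions along
  \<open>(!) xs\<close>, so both inputs are valid, and positive, together.\<close>

lemma word_inputs_encode: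
 fixes F :: "'a af"
 assumes "distinct xs" "set xs = fst F" "is_af F" "g \<in> fst F" "k \<in> fst F" "L \<in> extensional (fst F)"
 defines "w \<equiv> encode xs (F, g, L, k)"
 obtains x where "word_input w x" "x \<in> SF_CA_inputs \<sigma> <-> (F, g, L, k) \<in> SF_CA_inputs \<sigma>"
  "x \<in> SF_CA_yes \<sigma> <-> (F, g, L, k) \<in> SF_CA_yes \<sigma>"
proof -
 obtain A R where F: "F = (A, R)" by (cases F)
 let ?n = "length xs"
 note parts = encode_parts[OF refl meta_eq_to_obj_eq[OF w_def[unfolded F]]]
 obtain i j where ij: "i < ?n" "xs ! i = g" "j < ?n" "xs ! j = k"
  using assms(2,4,5) by (metis in_set_conv_nth)
 have uniq: "a < ?n ==> b < ?n ==> xs ! a = xs ! b <-> a = b" for a b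
  using assms(1) by (simp add: nth_eq_iff_index_eq)
 have goal: "word_goal w a <-> a = i" and target: "word_target w a <-> a = j" if "a < ?n" for a
  using that ij uniq parts by (auto simp: word_goal_def word_target_def)
 have len: "length w = ?n + 1 + ?n * ?n + 2 * ?n + 2 * ?n"
  unfolding w_def F by (rule length_encode)
 have wc: "well_coded w"
  unfolding well_coded_def Let_def parts(1)
 proof (intro conjI allI impI)
  show "\<exists>a<?n. \<forall>b<?n. word_goal w b <-> b = a" using goal ij by blast
  show "\<exists>a<?n. \<forall>b<?n. word_target w b <-> b = a" using target ij by blast
  show "~ (w ! (?n + 1 + ?n * ?n + 2 * a) & w ! (?n + 1 + ?n * ?n + 2 * a + 1))" if "a < ?n" for a
   using parts(3,4)[OF that] by auto
 qed (rule len)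
 have h: "renaming ((!) xs) (word_af w)"
 proof (unfold_locales)
  show "inj_on ((!) xs) (fst (word_af w))"
   using assms(1) parts(1) by (auto simp: word_af_def Let_def inj_on_nth)
 qed (rule is_af_word_af)
 have fst: "fst (word_af w) = {..<?n}" by (simp add: word_af_def Let_def parts(1))
 have A: "(!) xs ` {..<?n} = A"
  using assms(2) F by (auto simp: in_set_conv_nth)
 have R: "map_prod ((!) xs) ((!) xs) ` {(a, b). a < ?n & b < ?n & w ! (?n + 1 + a * ?n + b)} = R"
 proof (intro equalityI subsetI)
  fix e assume "e \<in> R"
  moreover obtain x y where e: "e = (x, y)" by (cases e)
  ultimately have "x \<in> set xs" "y \<in> set xs" using assms(2,3) F by (auto simp: is_af_def)
  then obtain a b where "a < ?n" "b < ?n" "xs ! a = x" "xs ! b = y" by (metis in_set_conv_nth)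
  with \<open>e \<in> R\<close> e parts(2) show "e \<in> map_prod ((!) xs) ((!) xs) ` {(a, b). a < ?n & b < ?n & w ! (?n + 1 + a * ?n + b)}"
   by force
 qed (use parts(2) in auto)
 have ren: "rename ((!) xs) (word_af w) = F"
  unfolding rename_def fst using A R F by (simp add: word_af_def Let_def parts(1))
 have lab: "L (xs ! a) = word_label w a" if "a \<in> fst (word_af w)" for a
  using that parts(3,4)[of a] by (cases "L (xs ! a)") (auto simp: fst word_label_def Let_def parts(1))
 have ex: "L \<in> extensional ((!) xs ` fst (word_af w))" using assms(6) F A fst by simp
 have ex': "word_label w \<in> extensional (fst (word_af w))" by (simp add: fst word_label_def Let_def parts(1))
 have gk: "i \<in> fst (word_af w)" "j \<in> fst (word_af w)" using ij fst by auto
 show thesis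
 proof (rule that[of "(word_af w, i, word_label w, j)"])
  show "word_input w (word_af w, i, word_label w, j)"
   using wc goal target ij parts(1) by (auto simp: word_input_def)
  show "(word_af w, i, word_label w, j) \<in> SF_CA_inputs \<sigma> <-> (F, g, L, k) \<in> SF_CA_inputs \<sigma>"
   using renaming.inputs_rename[OF h lab ex ex' gk] ren ij by simp
  show "(word_af w, i, word_label w, j) \<in> SF_CA_yes \<sigma> <-> (F, g, L, k) \<in> SF_CA_yes \<sigma>"
   using renaming.yes_rename[OF h lab ex ex' gk] ren ij by simp
 qed
qed

lemma word_input_unique: "word_input w x ==> word_input w y ==> x = y"
 by (auto simp: word_input_def well_coded_def Let_def)

text \<open>A well-coded word is the encoding of the framework of its own positions under their
  natural order; this is checked bit by bit, section by section.\<close>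

lemma encode_word_input:
 assumes "word_input w (F, g, L, k)"
 shows "w = encode [0..<nargs w] (F, g, L, k)"
proof -
 let ?n = "nargs w"
 have FL: "F = word_af w" "L = word_label w" and gk: "g < ?n" "k < ?n" "word_goal w g" "word_target w k"
  and wc: "well_coded w" using assms by (auto simp: word_input_def)
 obtain A R where F: "F = (A, R)" by (cases F)
 let ?v = "encode [0..<?n] (F, g, L, k)"
 have len: "length w = ?n + 1 + ?n * ?n + 2 * ?n + 2 * ?n" using wc by (simp add: well_coded_def Let_def)
 have lv: "length ?v = ?n + 1 + ?n * ?n + 2 * ?n + 2 * ?n"
  unfolding F using length_encode[of "[0..<?n]"] by simp
 note parts = encode_parts[OF refl refl, where xs = "[0..<?n]" and A = A and R = R and g = g and L = L and k = k,
  folded F, unfolded length_upt diff_zero]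
 show ?thesis
 proof (rule nth_equalityI)
  show "length w = length ?v" using len lv by simp
  fix x assume x: "x < length w"
  have tw: "w ! y" if "y < ?n" for y
   using that set_takeWhileD[of "takeWhile id w ! y" id w] takeWhile_nth[of y id w]
    nth_mem[of y "takeWhile id w"] by (simp add: nargs_def)
  have nt: "?n < length w ==> ~ w ! ?n"
   using nth_length_takeWhile[of id w] unfolding nargs_def by simp
  consider "x < ?n" | "x = ?n" | i j where "i < ?n" "j < ?n" "x = ?n + 1 + i * ?n + j"
   | i where "i < ?n" "x = ?n + 1 + ?n * ?n + 2 * i" | i where "i < ?n" "x = ?n + 1 + ?n * ?n + 2 * i + 1"
   | i where "i < ?n" "x = ?n + 1 + ?n * ?n + 2 * ?n + i"
   | i where "i < ?n" "x = ?n + 1 + ?n * ?n + 3 * ?n + i"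
  proof -
   note cs = that
   consider "x < ?n" | "x = ?n" | y where "x = ?n + 1 + y" "y < ?n * ?n"
    | y where "x = ?n + 1 + ?n * ?n + y" "y < 2 * ?n" | y where "x = ?n + 1 + ?n * ?n + 2 * ?n + y" "y < ?n"
    | y where "x = ?n + 1 + ?n * ?n + 3 * ?n + y" "y < ?n"
   proof -
    note cs = that
    consider "x < ?n" | "x = ?n" | "?n < x" "x < ?n + 1 + ?n * ?n"
     | "?n + 1 + ?n * ?n <= x" "x < ?n + 1 + ?n * ?n + 2 * ?n"
     | "?n + 1 + ?n * ?n + 2 * ?n <= x" "x < ?n + 1 + ?n * ?n + 3 * ?n"
     | "?n + 1 + ?n * ?n + 3 * ?n <= x" using x by linarith
    then show thesis
    proof cases
     case 3 show thesis by (rule cs(3)[of "x - (?n + 1)"]) (use 3 in linarith)+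
    next
     case 4 show thesis by (rule cs(4)[of "x - (?n + 1 + ?n * ?n)"]) (use 4 in linarith)+
    next
     case 5 show thesis by (rule cs(5)[of "x - (?n + 1 + ?n * ?n + 2 * ?n)"]) (use 5 in linarith)+
    next
     case 6 show thesis by (rule cs(6)[of "x - (?n + 1 + ?n * ?n + 3 * ?n)"]) (use 6 x len in linarith)+
    qed (use cs in auto)
   qed
   then show thesis
   proof cases
    case (3 y)
    then have "0 < ?n" by (cases "?n = 0") auto
    then have "y div ?n < ?n" "y mod ?n < ?n" using 3 by (simp_all add: div_less_iff_less_mult)
    then show thesis using 3 by (intro cs(3)[of "y div ?n" "y mod ?n"]) (simp_all add: add.assoc)
   next
    case (4 y)
    then show thesis using cs(4)[of "y div 2"] cs(5)[of "y div 2"] by (cases "even y") auto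
   qed (use cs in auto)
  qed
  then show "w ! x = ?v ! x"
  proof cases
   case 1
   then show ?thesis using tw by (simp add: F nth_append)
  next
   case 2
   then show ?thesis using nt x by (simp add: F nth_append)
  next
   case (3 i j)
   have "R = {(i, j). i < ?n & j < ?n & w ! (?n + 1 + i * ?n + j)}"
    using F FL(1) by (simp add: word_af_def Let_def)
   then show ?thesis using parts(2)[of i j] 3 by simp
  next
   case (4 i)
   then show ?thesis using parts(3)[of i] FL(2) by (simp add: word_label_def Let_def)
  next
   case (5 i)
   have "~ (w ! (?n + 1 + ?n * ?n + 2 * i) & w ! (?n + 1 + ?n * ?n + 2 * i + 1))"
    using wc 5(1) by (simp add: well_coded_def Let_def)
   then show ?thesis using parts(4)[of i] FL(2) 5 by (auto simp: word_label_def Let_def)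
  next
   case (6 i)
   have "word_goal w i <-> i = g" using wc gk 6 by (auto simp: well_coded_def Let_def)
   then show ?thesis using parts(5)[of i] 6 by (simp add: word_goal_def Let_def)
  next
   case (7 i)
   have "word_target w i <-> i = k" using wc gk 7 by (auto simp: well_coded_def Let_def)
   then show ?thesis using parts(6)[of i] 7 by (simp add: word_target_def Let_def)
  qed
 qed
qed

text \<open>The quantification over frameworks and enumerations in \<open>encodings\<close> shrinks
  to the single input on positions that the word itself describes.\<close>

lemma SF_CA_words:
 "w \<in> SF_CA_input_words \<sigma> <-> (\<exists>x. word_input w x & x \<in> SF_CA_inputs \<sigma>)"
 "w \<in> SF_CA \<sigma> <-> (\<exists>x. word_input w x & x \<in> SF_CA_yes \<sigma>)"
proof -
 have 1: "w \<in> encodings X" if "word_input w x" "x \<in> X" for x and X :: "nat sf_input set"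
 proof -
  obtain F g L k where x: "x = (F, g, L, k)" by (cases x)
  have "w = encode [0..<nargs w] x" using encode_word_input that(1) x by simp
  moreover have "set [0..<nargs w] = fst (fst x)"
   using that(1) by (auto simp: word_input_def word_af_def Let_def)
  ultimately show ?thesis using that(2) unfolding encodings_def by (metis (mono_tags, lifting) distinct_upt mem_Collect_eq)
 qed
 have 2: "\<exists>y. word_input w y & y \<in> SF_CA_inputs \<sigma> & (x \<in> SF_CA_yes \<sigma> --> y \<in> SF_CA_yes \<sigma>)"
  if x: "x \<in> SF_CA_inputs \<sigma>" "w = encode xs x" "distinct xs" "set xs = fst (fst x)" for x :: "nat sf_input" and xs
 proof -
  obtain F g L k where e: "x = (F, g, L, k)" by (cases x)
  have *: "is_af F" "g \<in> fst F" "k \<in> fst F" "L \<in> extensional (fst F)"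
   using x(1) by (auto simp: e SF_CA_inputs_def labellings_def labelling_of_def)
  have s: "set xs = fst F" using x(4) e by simp
  obtain y where "word_input (encode xs (F, g, L, k)) y" "y \<in> SF_CA_inputs \<sigma> <-> (F, g, L, k) \<in> SF_CA_inputs \<sigma>"
   "y \<in> SF_CA_yes \<sigma> <-> (F, g, L, k) \<in> SF_CA_yes \<sigma>"
   by (rule word_inputs_encode[OF x(3) s *])
  then show ?thesis using x e by blast
 qed
 have 3: "(SF_CA_yes \<sigma> :: nat sf_input set) \<subseteq> SF_CA_inputs \<sigma>" by (auto simp: SF_CA_yes_def)
 show "w \<in> SF_CA_input_words \<sigma> <-> (\<exists>x. word_input w x & x \<in> SF_CA_inputs \<sigma>)"
 proof
  assume "w \<in> SF_CA_input_words \<sigma>"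
  then obtain xs and x :: "nat sf_input" where x: "w = encode xs x" "x \<in> SF_CA_inputs \<sigma>" "distinct xs" "set xs = fst (fst x)"
   unfolding SF_CA_input_words_def encodings_def by (elim CollectE exE conjE) (rule that)
  from 2[OF x(2) x(1,3,4)] x(2) show "\<exists>x. word_input w x & x \<in> SF_CA_inputs \<sigma>" by (elim exE conjE) (intro exI conjI, assumption, iprover)
 next
  assume "\<exists>x. word_input w x & x \<in> SF_CA_inputs \<sigma>"
  then obtain x where "word_input w x" "x \<in> SF_CA_inputs \<sigma>" by (elim exE conjE)
  then show "w \<in> SF_CA_input_words \<sigma>" unfolding SF_CA_input_words_def by (rule 1)
 qed
 show "w \<in> SF_CA \<sigma> <-> (\<exists>x. word_input w x & x \<in> SF_CA_yes \<sigma>)"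
 proof
  assume "w \<in> SF_CA \<sigma>"
  then obtain xs and x :: "nat sf_input" where x: "w = encode xs x" "x \<in> SF_CA_yes \<sigma>" "distinct xs" "set xs = fst (fst x)"
   unfolding SF_CA_def encodings_def by (elim CollectE exE conjE) (rule that)
  from 2[OF subsetD[OF 3 x(2)] x(1,3,4)] x(2) show "\<exists>x. word_input w x & x \<in> SF_CA_yes \<sigma>" by (elim exE conjE) (intro exI conjI, assumption, iprover)
 next
  assume "\<exists>x. word_input w x & x \<in> SF_CA_yes \<sigma>"
  then obtain x where "word_input w x" "x \<in> SF_CA_yes \<sigma>" by (elim exE conjE)
  then show "w \<in> SF_CA \<sigma>" unfolding SF_CA_def by (rule 1)
 qed
qed

lemma encode_in_words:
 fixes F :: "'a af"
 assumes "distinct xs" "set xs = fst F" "(F, g, L, k) \<in> SF_CA_inputs \<sigma>"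
 shows "encode xs (F, g, L, k) \<in> SF_CA_input_words \<sigma>"
  "encode xs (F, g, L, k) \<in> SF_CA \<sigma> <-> (F, g, L, k) \<in> SF_CA_yes \<sigma>"
proof -
 have *: "is_af F" "g \<in> fst F" "k \<in> fst F" "L \<in> extensional (fst F)"
  using assms(3) by (auto simp: SF_CA_inputs_def labellings_def labelling_of_def)
 obtain x where x: "word_input (encode xs (F, g, L, k)) x" "x \<in> SF_CA_inputs \<sigma> <-> (F, g, L, k) \<in> SF_CA_inputs \<sigma>"
  "x \<in> SF_CA_yes \<sigma> <-> (F, g, L, k) \<in> SF_CA_yes \<sigma>"
  by (rule word_inputs_encode[OF assms(1,2) *])
 show "encode xs (F, g, L, k) \<in> SF_CA_input_words \<sigma>"
  using x assms(3) SF_CA_words by blast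
 show "encode xs (F, g, L, k) \<in> SF_CA \<sigma> <-> (F, g, L, k) \<in> SF_CA_yes \<sigma>"
  using x word_input_unique SF_CA_words by blast
qed

section \<open>Formulas over bit words\<close>

definition num :: "expr => (nat => bool list) => nat" where
 "num e u = length (eval e u)"

definition tru :: "expr => (nat => bool list) => bool" where
 "tru e u <-> eval e u ~= []"

definition bit_at :: "bool list => nat => bool" where
 "bit_at w i <-> i < length w & w ! i"

definition eNot :: "expr => expr" where "eNot a = IfPos a eZero eOne"
definition eAnd :: "expr => expr => expr" where "eAnd a b = IfPos a b eZero"
definition eOr :: "expr => expr => expr" where "eOr a b = IfPos a eOne b"
definition eImp :: "expr => expr => expr" where "eImp a b = IfPos a b eOne"
definition eIff :: "expr => expr => expr" where "eIff a b = IfPos a b (eNot b)"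
definition eLe :: "expr => expr => expr" where "eLe a b = Minus (Add b eOne) a"
definition eEq :: "expr => expr => expr" where "eEq a b = eAnd (eLe a b) (eLe b a)"
definition eEx :: "nat => expr => expr => expr" where "eEx v t a = Sum v t a"
definition eAll :: "nat => expr => expr => expr" where "eAll v t a = eNot (Sum v t (eNot a))"

lemma num_simps [simp]:
 "num (Const w) u = length w"
 "num (Size i) u = length (u i)"
 "num (Add a b) u = num a u + num b u"
 "num (Times a b) u = num a u * num b u"
 "num (Minus a b) u = num a u - num b u"
 "num (IfPos c a b) u = (if tru c u then num a u else num b u)"
 "num (Sum v t a) u = (\<Sum>x<num t u. num a (u(v := ones x)))"
 "num (eNot a) u = (if tru a u then 0 else 1)"
 by (simp_all add: num_def tru_def length_concat_replicate length_concat interv_sum_list_conv_sum_set_nat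
   set_upt atLeast0LessThan comp_def eNot_def sum_list_replicate)

lemma tru_num: "tru e u <-> num e u ~= 0"
 by (simp add: tru_def num_def)

lemma tru_IfPos: "tru (IfPos c a b) u <-> (if tru c u then tru a u else tru b u)"
 by (simp add: tru_def)

lemma tru_Sum: "tru (Sum v t a) u <-> (\<exists>x<num t u. tru a (u(v := ones x)))"
 by (auto simp: tru_num)

lemma tru_simps [simp]:
 "tru (Const w) u <-> w ~= []"
 "tru (Get i a) u <-> bit_at (u i) (num a u)"
 "tru (eNot a) u <-> ~ tru a u"
 by (simp_all add: tru_def num_def bit_at_def eNot_def)

lemma tru_connectives [simp]:
 "tru (eAnd a b) u <-> tru a u & tru b u"
 "tru (eOr a b) u <-> tru a u \<or> tru b u"
 "tru (eImp a b) u <-> (tru a u --> tru b u)"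
 "tru (eIff a b) u <-> (tru a u <-> tru b u)"
 by (simp_all add: eAnd_def eOr_def eImp_def eIff_def tru_IfPos)

lemma tru_le [simp]: "tru (eLe a b) u <-> num a u <= num b u"
 by (auto simp: eLe_def tru_num)

lemma tru_eq_quant [simp]:
 "tru (eEq a b) u <-> num a u = num b u"
 "tru (eEx v t a) u <-> (\<exists>x<num t u. tru a (u(v := ones x)))"
 "tru (eAll v t a) u <-> (\<forall>x<num t u. tru a (u(v := ones x)))"
 by (auto simp: eEq_def eEx_def eAll_def tru_Sum)

lemma regs_macros [simp]:
 "regs (eNot a) = regs a" "regs (eAnd a b) = regs a \<union> regs b" "regs (eOr a b) = regs a \<union> regs b"
 "regs (eImp a b) = regs a \<union> regs b" "regs (eIff a b) = regs a \<union> regs b"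
 "regs (eLe a b) = regs a \<union> regs b" "regs (eEq a b) = regs a \<union> regs b"
 "regs (eEx v t a) = insert v (regs t \<union> regs a)" "regs (eAll v t a) = insert v (regs t \<union> regs a)"
 by (auto simp: eNot_def eAnd_def eOr_def eImp_def eIff_def eLe_def eEq_def eEx_def eAll_def)

lemma bound_regs_macros [simp]:
 "bound_regs (eNot a) = bound_regs a" "bound_regs (eAnd a b) = bound_regs a \<union> bound_regs b"
 "bound_regs (eOr a b) = bound_regs a \<union> bound_regs b" "bound_regs (eImp a b) = bound_regs a \<union> bound_regs b"
 "bound_regs (eIff a b) = bound_regs a \<union> bound_regs b"
 "bound_regs (eLe a b) = bound_regs a \<union> bound_regs b" "bound_regs (eEq a b) = bound_regs a \<union> bound_regs b"
 "bound_regs (eEx v t a) = insert v (bound_regs t \<union> bound_regs a)"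
 "bound_regs (eAll v t a) = insert v (bound_regs t \<union> bound_regs a)"
 by (auto simp: eNot_def eAnd_def eOr_def eImp_def eIff_def eLe_def eEq_def eEx_def eAll_def)

text \<open>The length of the block of ones that starts at position e in register r, obtained by
  counting the x for which the x + 1 bits from e on are all true.\<close>

definition Lead :: "nat => expr => expr" where
 "Lead r e = Sum 5 (Size r) (eNot (eNot (eAll 6 (Add (Size 5) eOne) (Get r (Add e (Size 6))))))"

lemma regs_Lead [simp]: "regs (Lead r e) = {5, 6, r} \<union> regs e" "bound_regs (Lead r e) = {5, 6} \<union> bound_regs e"
 by (auto simp: Lead_def)

lemma sum_01_card: "(\<Sum>x<(n::nat). if R x then 0 else 1) = card {x. x < n & ~ R x}"
proof -
 have "(\<Sum>x<n. if R x then 0 else 1) = (\<Sum>x\<in>{x. x < n & ~ R x}. 1 :: nat)"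
  by (rule sum.mono_neutral_cong_right) auto
 then show ?thesis by simp
qed

lemma num_Lead:
 assumes r: "r ~= 5" "r ~= 6" and e: "\<And>x y. num e (u(5 := x, 6 := y)) = o'"
  and w: "u r = xs @ ones m @ zs" "length xs = o'" "zs = [] \<or> ~ hd zs"
 shows "num (Lead r e) u = m"
proof -
 have b: "bit_at (u r) (o' + y) <-> bit_at (ones m @ zs) y" for y
  using w by (auto simp: bit_at_def nth_append)
 have z: "~ bit_at (ones m @ zs) m"
  using w(3) by (cases zs) (auto simp: bit_at_def nth_append)
 have "(\<forall>y<x + 1. bit_at (u r) (o' + y)) <-> x < m" for x
 proof
  assume "\<forall>y<x + 1. bit_at (u r) (o' + y)"
  then show "x < m" using b z by (metis add.commute less_Suc_eq_le not_less plus_1_eq_Suc)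
 next
  assume "x < m"
  then show "\<forall>y<x + 1. bit_at (u r) (o' + y)" unfolding b by (auto simp: bit_at_def nth_append)
 qed
 then have "num (Lead r e) u = (\<Sum>x<length (u r). if ~ x < m then 0 else 1)"
  using r e by (simp add: Lead_def)
 also have "\<dots> = card {x. x < length (u r) & x < m}" unfolding sum_01_card by simp
 also have "{x. x < length (u r) & x < m} = {..<m}" using w by auto
 finally show ?thesis by simp
qed

definition env :: "bool list => bool list => bool list => nat => bool list" where
 "env v y z = (%i. if i = 3 then v else if i = 4 then y else if i = 2 then z else [])"

lemma NP_formula:
 assumes "bound_regs \<phi> \<subseteq> {5..}" "regs \<phi> \<subseteq> {2..}"
 shows "{v. \<exists>z. length z = length v & tru \<phi> (env v [] z)} \<in> NP"
proof -
 have "tru \<phi> ((decoded (Word 5 0) eZero v)(2 := z)) <-> tru \<phi> (env v [] z)" for v z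
  unfolding tru_def
  by (rule arg_cong[where f = "%x. x ~= []"], rule eval_cong)
   (use assms in \<open>auto simp: decoded_def env_def eval_Word base_def\<close>)
 moreover have "length (eval (Size 3) (decoded (Word 5 0) eZero v)) = length v" for v
  by (simp add: decoded_def eval_Word base_def)
 moreover have "{w. \<exists>y. length y = length (eval (Size 3) (decoded (Word 5 0) eZero w)) &
   eval \<phi> ((decoded (Word 5 0) eZero w)(2 := y)) ~= []} \<in> NP"
  by (rule NP_expr) (use assms in \<open>auto simp: Word_def\<close>)
 ultimately show ?thesis by (simp add: tru_def)
qed

definition Slice :: "nat => expr => expr => expr" where
 "Slice r o' l = Sum 7 l (IfPos (Get r (Add o' (Size 7))) eOne (Const [False]))"

lemma eval_Slice:
 assumes "r ~= 7" "\<And>x. num o' (u(7 := x)) = length xs" "num l u = length ys" "u r = xs @ ys @ zs"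
 shows "eval (Slice r o' l) u = ys"
proof -
 have "eval (Slice r o' l) u = concat (map (%x. eval (IfPos (Get r (Add o' (Size 7))) eOne (Const [False]))
   (u(7 := ones x))) [0..<length ys])"
  unfolding Slice_def eval.simps(8) assms(3)[unfolded num_def] ..
 also have "\<dots> = concat (map (%x. [ys ! x]) [0..<length ys])"
 proof (rule concat_map_cong)
  fix x assume "x \<in> set [0..<length ys]"
  then have "bit_at (u r) (length xs + x) <-> ys ! x"
   using assms(4) by (auto simp: bit_at_def nth_append)
  then have "tru (Get r (Add o' (Size 7))) (u(7 := ones x)) <-> ys ! x"
   using assms(1,2) by simp
  then show "eval (IfPos (Get r (Add o' (Size 7))) eOne (Const [False])) (u(7 := ones x)) = [ys ! x]"
   unfolding eval.simps(7) tru_def by (cases "ys ! x") (simp_all del: eval.simps(3))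
 qed
 finally have "eval (Slice r o' l) u = concat (map (%x. [ys ! x]) [0..<length ys])" .
 then show ?thesis by (simp add: concat_map_singleton map_nth)
qed

text \<open>The outer machine sends the input v and its guess y as the query 1^n 0 v y with n the
  length of v; the leading ones tell the oracle where to cut. The oracle looks for a z refuting the
  formula, and the answer no means that all z satisfy it.\<close>

lemma Sigma2_formula:
 assumes "bound_regs \<phi> \<subseteq> {5..}" "regs \<phi> \<subseteq> {2..}"
 shows "{v. \<exists>y. length y = length v & (\<forall>z. length z = length v --> tru \<phi> (env v y z))} \<in> Sigma_p 2"
proof -
 define q where "q = Add (Size 0) (Add (Const [False]) (Add (Word 7 0) (Word 7 2)))"
 define m where "m = Lead 0 eZero"
 define a where "a = Slice 0 (Add m eOne) m"
 define b where "b = Slice 0 (Add m (Add m eOne)) (Minus (Size 0) (Add m (Add m eOne)))"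
 define B where "B = {w. \<exists>y. length y = length (eval (Size 3) (decoded a b w)) &
   eval (eNot \<phi>) ((decoded a b w)(2 := y)) ~= []}"
 have B: "B \<in> NP" unfolding B_def
  by (rule NP_expr) (use assms in \<open>auto simp: a_def b_def m_def Slice_def\<close>)
 have q: "eval q ((base v)(2 := y)) = ones (length v) @ False # v @ y" for v y
  by (simp add: q_def eval_Word base_def)
 have dec: "decoded a b p 3 = v" "decoded a b p 4 = y" if p: "p = ones (length v) @ False # v @ y" for p v y
 proof -
  have m: "num m ((base p)(7 := x)) = length v" for x
   unfolding m_def by (rule num_Lead[of _ _ _ 0 "[]" _ "False # v @ y"]) (auto simp: base_def p)
  have m': "num m (base p) = length v"
   unfolding m_def by (rule num_Lead[of _ _ _ 0 "[]" _ "False # v @ y"]) (auto simp: base_def p)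
  show "decoded a b p 3 = v" unfolding decoded_def a_def
   by (simp, rule eval_Slice[of _ _ _ "ones (length v) @ [False]" _ _ y]) (simp_all add: m m', simp_all add: base_def p)
  show "decoded a b p 4 = y" unfolding decoded_def b_def
   by (simp, rule eval_Slice[of _ _ _ "ones (length v) @ False # v" _ _ "[]"]) (simp_all add: m m', simp_all add: base_def p)
 qed
 have "tru \<phi> ((decoded a b p)(2 := z)) <-> tru \<phi> (env v y z)" if p: "p = ones (length v) @ False # v @ y" for p v y z
  unfolding tru_def
 proof (rule arg_cong[where f = "%x. x ~= []"], rule eval_cong)
  fix i assume "i \<in> regs \<phi>"
  then have "2 <= i" using assms(2) by auto
  then show "((decoded a b p)(2 := z)) i = env v y z i"
   using dec[OF p] by (auto simp: env_def decoded_def base_def)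
 qed
 then have mem: "eval q ((base v)(2 := y)) \<notin> B <-> (\<forall>z. length z = length v --> tru \<phi> (env v y z))" for v y
  using dec[OF refl, of v y] tru_simps(3)[of \<phi>] unfolding q by (auto simp: B_def tru_def)
 have "{w. \<exists>y. length y = length (eval (Size 0) (base w)) & eval q ((base w)(2 := y)) \<notin> B} \<in> Sigma_p 2"
  by (rule Sigma2_expr[OF B]) (auto simp: q_def Word_def)
 then show ?thesis unfolding mem by (simp add: base_def)
qed

section \<open>Membership of the acceptance problem\<close>

definition hits :: "nat => (nat => nat => bool) => (nat => bool) => nat => bool" where
 "hits n att S a <-> (\<exists>b<n. S b & att b a)"

definition is_complete :: "nat => (nat => nat => bool) => (nat => bool) => bool" where
 "is_complete n att S <-> (\<forall>a<n. S a <-> (\<forall>b<n. att b a --> hits n att S b)) &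
   (\<forall>a<n. ~ (S a & hits n att S a))"

definition proper_in :: "nat => (nat => bool) => (nat => bool) => bool" where
 "proper_in n S T <-> (\<forall>a<n. S a --> T a) & (\<exists>a<n. T a & ~ S a)"

definition with_range :: "nat => (nat => nat => bool) => (nat => bool) => nat => bool" where
 "with_range n att S a <-> S a \<or> hits n att S a"

text \<open>For preferred and semi-stable extensions, \<open>Z\<close> is a potential larger complete extension.\<close>

fun is_extension :: "semantics => nat => (nat => nat => bool) => (nat => bool) => (nat => bool) => bool" where
 "is_extension CO n att Z S <-> is_complete n att S"
| "is_extension ST n att Z S <-> is_complete n att S & (\<forall>a<n. with_range n att S a)"
| "is_extension PR n att Z S <-> is_complete n att S & ~ (is_complete n att Z & proper_in n S Z)"
| "is_extension SST n att Z S <-> is_complete n att S &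
   ~ (is_complete n att Z & proper_in n (with_range n att S) (with_range n att Z))"

section \<open>Maximality conditions with one competitor\<close>

lemma complete_imp_preferred:
 assumes "is_af F" "complete_ext F S"
 shows "\<exists>T. preferred_ext F T & S \<subseteq> T"
proof -
 have fin: "finite {T. complete_ext F T & S \<subseteq> T}"
  by (rule finite_subset[of _ "Pow (fst F)"]) (use assms(1) in \<open>auto simp: complete_ext_def is_af_def split: prod.splits\<close>)
 have "S \<in> {T. complete_ext F T & S \<subseteq> T}" using assms(2) by simp
 then obtain T where "T \<in> {T. complete_ext F T & S \<subseteq> T}" "\<forall>U\<in>{T. complete_ext F T & S \<subseteq> T}. T \<subseteq> U --> T = U"
  using finite_has_maximal2[OF fin] by blast
 then have "preferred_ext F T & S \<subseteq> T" unfolding preferred_ext_def by blast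
 then show ?thesis ..
qed

lemma Def_mono: "S \<subseteq> T ==> Def F S \<subseteq> Def F T"
 unfolding Def_eq by blast

text \<open>An argument gained by T is not attacked by S, as otherwise T would attack its own
  element; hence it is new in the range as well.\<close>

lemma complete_range_psubset:
 assumes "complete_ext F S" "complete_ext F T" "S \<subset> T"
 shows "S \<union> Def F S \<subset> T \<union> Def F T"
proof -
 obtain a where a: "a \<in> T" "a \<notin> S" using assms(3) by blast
 have "a \<notin> Def F S"
  using a assms Def_mono[of S T F] unfolding complete_ext_def admissible_def conflict_free_def by blast
 then show ?thesis using a assms(3) Def_mono[of S T F] by blast
qed

text \<open>A range that is already everything cannot grow, while a larger complete extension would
  enlarge it; so maximality is automatic and no competitor has to be considered.\<close>

lemma stable_iff: "stable_ext F S <-> complete_ext F S & S \<union> Def F S = fst F"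
proof -
 have "preferred_ext F S" if "complete_ext F S" "S \<union> Def F S = fst F"
 proof -
  have "~ S \<subset> T" if "complete_ext F T" for T
  proof
   assume "S \<subset> T"
   from complete_range_psubset[OF \<open>complete_ext F S\<close> that this]
   have "fst F \<subset> T \<union> Def F T" unfolding \<open>S \<union> Def F S = fst F\<close> .
   then show False using that by (auto simp: complete_ext_def Def_eq)
  qed
  with that(1) show ?thesis unfolding preferred_ext_def by blast
 qed
 then show ?thesis unfolding stable_ext_def preferred_ext_def by blast
qed

text \<open>A strictly larger complete extension has a strictly larger range, so maximality of the
  range among complete extensions already implies being preferred. This leaves a single universal
  quantifier instead of nested ones.\<close>

lemma semi_stable_iff:
 assumes "is_af F"
 shows "semi_stable_ext F S <-> complete_ext F S & ~ (\<exists>T. complete_ext F T & S \<union> Def F S \<subset> T \<union> Def F T)"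
proof
 assume s: "semi_stable_ext F S"
 have "~ S \<union> Def F S \<subset> T \<union> Def F T" if T: "complete_ext F T" for T
 proof
  assume st: "S \<union> Def F S \<subset> T \<union> Def F T"
  obtain U where U: "preferred_ext F U" "T \<subseteq> U" using complete_imp_preferred[OF assms T] by blast
  then have "S \<union> Def F S \<subset> U \<union> Def F U" using st Def_mono[OF U(2), of F] by blast
  then show False using s U(1) unfolding semi_stable_ext_def by blast
 qed
 moreover have "complete_ext F S" using s by (simp add: semi_stable_ext_def preferred_ext_def)
 ultimately show "complete_ext F S & ~ (\<exists>T. complete_ext F T & S \<union> Def F S \<subset> T \<union> Def F T)"
  by iprover
next
 assume s: "complete_ext F S & ~ (\<exists>T. complete_ext F T & S \<union> Def F S \<subset> T \<union> Def F T)"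
 have "~ (\<exists>T. complete_ext F T & S \<subset> T)"
 proof (intro notI, elim exE conjE)
  fix T assume T: "complete_ext F T" "S \<subset> T"
  from complete_range_psubset[OF conjunct1[OF s] T] s T(1) show False by iprover
 qed
 with s have "preferred_ext F S" unfolding preferred_ext_def by iprover
 moreover have "~ (\<exists>T. preferred_ext F T & S \<union> Def F S \<subset> T \<union> Def F T)"
  using s unfolding preferred_ext_def by iprover
 ultimately show "semi_stable_ext F S" unfolding semi_stable_ext_def by iprover
qed

definition word_att :: "bool list => nat => nat => bool" where
 "word_att w i j <-> bit_at w (nargs w + (1 + (i * nargs w + j)))"

text \<open>Behind the attacks the word is read in blocks of n bits: blocks 0 and 1 contain the
  labels, two bits per argument, block 2 the goal and block 3 the target.\<close>

definition word_field :: "bool list => nat => nat => bool" where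
 "word_field w k i <-> bit_at w (nargs w + (1 + nargs w * nargs w) + (k * nargs w + i))"

abbreviation "lab_in w i \<equiv> word_field w 0 (i + i)"
abbreviation "lab_out w i \<equiv> word_field w 0 (i + i + 1)"

section \<open>Extensions of the framework read off a word\<close>

definition set_of :: "nat => (nat => bool) => nat set" where
 "set_of n S = {a. a < n & S a}"

context
 fixes w :: "bool list" and n :: nat and F :: "nat af" and att :: "nat => nat => bool"
 assumes n: "n = nargs w" and len: "n + 1 + n * n <= length w"
  and F: "F = word_af w" and att: "att = word_att w"
begin

lemma fst_F [simp]: "fst F = {..<n}"
 by (simp add: F word_af_def Let_def n)

lemma att_iff: "i < n ==> j < n ==> att i j <-> (i, j) \<in> snd F"
proof -
 assume i: "i < n" and j: "j < n"
 have "i * n + j < Suc i * n" using j by simp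
 also have "\<dots> <= n * n" using i by (intro mult_le_mono1) simp
 finally have "n + (1 + (i * n + j)) < length w" using len by simp
 then show ?thesis using i j by (simp add: att word_att_def bit_at_def F word_af_def Let_def n add.assoc)
qed

lemma Def_word: "Def F (set_of n S) = set_of n (hits n att S)"
 unfolding Def_eq set_of_def hits_def fst_F using att_iff by auto

lemma complete_word: "complete_ext F (set_of n S) <-> is_complete n att S"
proof -
 have e: "b < n & a < n" if "(b, a) \<in> snd F" for a b
  using that by (auto simp: F word_af_def Let_def n)
 have "Acc F (set_of n S) = set_of n (%a. \<forall>b<n. att b a --> hits n att S b)"
  unfolding Acc_eq Def_word fst_F unfolding set_of_def using att_iff e by auto
 then have "complete_ext F (set_of n S) <->
   set_of n S = set_of n (%a. \<forall>b<n. att b a --> hits n att S b) & set_of n S \<inter> set_of n (hits n att S) = {}"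
  unfolding complete_ext_def admissible_def conflict_free_def Def_word by (auto simp: set_of_def)
 then show ?thesis unfolding is_complete_def set_of_def by auto
qed

lemma complete_is_set_of: "complete_ext F T ==> T = set_of n (%a. a \<in> T)"
 by (auto simp: complete_ext_def set_of_def)

lemma ex_complete_word: "(\<exists>T. complete_ext F T & Q T) <-> (\<exists>Z. is_complete n att Z & Q (set_of n Z))"
proof
 assume "\<exists>T. complete_ext F T & Q T"
 then obtain T where T: "complete_ext F T" "Q T" by blast
 then show "\<exists>Z. is_complete n att Z & Q (set_of n Z)"
  using complete_is_set_of[OF T(1)] complete_word[of "%a. a \<in> T"] by metis
qed (use complete_word in blast)

lemma range_word: "set_of n S \<union> Def F (set_of n S) = set_of n (with_range n att S)"
 unfolding Def_word by (auto simp: set_of_def with_range_def)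

lemma psubset_word: "set_of n S \<subset> set_of n T <-> proper_in n S T"
 unfolding proper_in_def set_of_def by auto

lemma extension_word: "extension \<sigma> F (set_of n S) <-> (\<forall>Z. is_extension \<sigma> n att Z S)"
proof (cases \<sigma>)
 case CO
 then show ?thesis by (simp add: complete_word)
next
 case ST
 have "set_of n (with_range n att S) = {..<n} <-> (\<forall>a<n. with_range n att S a)"
  by (auto simp: set_of_def)
 then show ?thesis using ST by (simp add: stable_iff complete_word range_word)
next
 case PR
 then show ?thesis by (simp add: preferred_ext_def complete_word ex_complete_word psubset_word)
next
 case SST
 have "is_af F" by (simp add: F is_af_word_af)
 then show ?thesis using SST
  by (simp add: semi_stable_iff complete_word ex_complete_word range_word psubset_word)
qed

lemma extension_is_set_of: "extension \<sigma> F T ==> T = set_of n (%a. a \<in> T)"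
 by (rule complete_is_set_of) (cases \<sigma>; auto simp: stable_ext_def semi_stable_ext_def preferred_ext_def)

lemma ex_extension_word: "(\<exists>T. extension \<sigma> F T & Q T) <-> (\<exists>S. (\<forall>Z. is_extension \<sigma> n att Z S) & Q (set_of n S))"
proof
 assume "\<exists>T. extension \<sigma> F T & Q T"
 then obtain T where T: "extension \<sigma> F T" "Q T" by blast
 then show "\<exists>S. (\<forall>Z. is_extension \<sigma> n att Z S) & Q (set_of n S)"
  using extension_is_set_of[OF T(1)] extension_word[of \<sigma> "%a. a \<in> T"] by metis
qed (use extension_word in blast)

end

text \<open>The label of a in the word is the one that the set S induces; comparing both label bits
  covers the undecided case.\<close>

definition agrees :: "bool list => (nat => bool) => nat => bool" where
 "agrees w S a <-> (lab_in w a <-> S a) & (lab_out w a <-> ~ S a & hits (nargs w) (word_att w) S a)"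

definition well_formed_word :: "bool list => bool" where
 "well_formed_word w <-> (let n = nargs w in
   length w = n + (1 + n * n) + (2 * n + 2 * n) &
   (\<exists>i<n. \<forall>j<n. word_field w 2 j <-> j = i) & (\<exists>i<n. \<forall>j<n. word_field w 3 j <-> j = i) &
   (\<forall>i<n. agrees w (lab_in w) i))"

text \<open>The competitor Z is tested against the given labelling as well: that the input is proper
  has to be verified, and for maximal extensions this too is a universal condition.\<close>

definition candidate :: "semantics => bool list => nat => bool => (nat => bool) => (nat => bool) => bool" where
 "candidate \<sigma> w d b Z S <-> (let n = nargs w in
   is_extension \<sigma> n (word_att w) Z (lab_in w) & is_extension \<sigma> n (word_att w) Z S &
   (\<forall>a<n. word_field w 2 a --> agrees w S a) & d <= (\<Sum>a<n. if agrees w S a then 0 else 1) &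
   (b --> (\<forall>a<n. word_field w 3 a --> S a)))"

definition feasible :: "semantics => bool list => nat => bool => bool" where
 "feasible \<sigma> w d b <-> well_formed_word w & (\<exists>S. \<forall>Z. candidate \<sigma> w d b Z S)"

lemma field_nth:
 assumes "length w = nargs w + (1 + nargs w * nargs w) + (2 * nargs w + 2 * nargs w)" "i < nargs w"
 shows "lab_in w i <-> w ! (nargs w + 1 + nargs w * nargs w + 2 * i)"
  "lab_out w i <-> w ! (nargs w + 1 + nargs w * nargs w + 2 * i + 1)"
  "word_field w 2 i <-> word_goal w i" "word_field w 3 i <-> word_target w i"
 using assms by (auto simp: word_field_def bit_at_def word_goal_def word_target_def Let_def mult_2 add.assoc)

text \<open>An extension with the target at distance at least d, while none at all reaches d + 1,
  has maximal distance and is thus a semifactual. Conversely d is the distance of the accepting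
  semifactual.\<close>

lemma feasible_iff:
 "w \<in> SF_CA \<sigma> <-> (\<exists>d. feasible \<sigma> w d True & ~ feasible \<sigma> w (Suc d) False)"
proof (cases "length w = nargs w + (1 + nargs w * nargs w) + (2 * nargs w + 2 * nargs w)")
 case False
 then have "~ well_coded w" "~ well_formed_word w" by (auto simp: well_coded_def well_formed_word_def Let_def)
 then show ?thesis by (simp add: SF_CA_words word_input_def feasible_def)
next
 case True
 let ?n = "nargs w" and ?F = "word_af w" and ?att = "word_att w" and ?L = "word_label w"
 note nth = field_nth[OF True]
 have le: "?n + 1 + ?n * ?n <= length w" using True by simp
 note ctx = refl[of ?n] le refl[of ?F] refl[of ?att]
 have fst [simp]: "fst ?F = {..<?n}" by (rule fst_F[OF ctx])
 have lab: "labelling_of ?F (set_of ?n S) a = ?L a <-> agrees w S a"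
  if a: "a < ?n" and wc: "~ (lab_in w a & lab_out w a)" for a S
  using a wc nth[OF a] unfolding labelling_of_def Def_word[OF ctx]
  by (auto simp: word_label_def Let_def agrees_def set_of_def)
 have wf: "well_formed_word w <-> well_coded w & (\<forall>i<?n. agrees w (lab_in w) i)"
  unfolding well_formed_word_def well_coded_def Let_def using True nth by (auto simp: agrees_def)
 show ?thesis
 proof (cases "well_coded w")
  case False
  then show ?thesis using wf by (simp add: SF_CA_words word_input_def feasible_def)
 next
  case wc: True
  have nb: "~ (lab_in w a & lab_out w a)" if "a < ?n" for a
   using wc nth[OF that] that by (auto simp: well_coded_def Let_def)
  note lab = lab[OF _ nb]
  obtain g k where g: "g < ?n" "\<And>j. j < ?n ==> word_goal w j <-> j = g" and k: "k < ?n" "\<And>j. j < ?n ==> word_target w j <-> j = k"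
   using wc unfolding well_coded_def Let_def by blast
  have wi: "word_input w x <-> x = (?F, g, ?L, k)" for x
   unfolding word_input_def using wc g k by auto
  have L: "?L = labelling_of ?F (set_of ?n S) <-> (\<forall>a<?n. agrees w S a)" for S
  proof
   assume "\<forall>a<?n. agrees w S a"
   then show "?L = labelling_of ?F (set_of ?n S)"
    using lab[symmetric] by (intro extensionalityI[of _ "{..<?n}"])
     (auto simp: word_label_def Let_def labelling_of_def)
  qed (use lab in auto)
  have "?L \<in> labellings \<sigma> ?F <-> (\<exists>T. extension \<sigma> ?F T & ?L = labelling_of ?F T)"
   by (auto simp: labellings_def)
  also have "\<dots> <-> (\<exists>S. (\<forall>Z. is_extension \<sigma> ?n ?att Z S) & (\<forall>a<?n. agrees w S a))"
   unfolding ex_extension_word[OF ctx] L ..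
  \<comment> \<open>A set inducing the given labelling consists of the arguments labelled in, so the
    existential quantifier disappears.\<close>
  also have "\<dots> <-> (\<forall>Z. is_extension \<sigma> ?n ?att Z (lab_in w)) & (\<forall>a<?n. agrees w (lab_in w) a)"
  proof
   assume "\<exists>S. (\<forall>Z. is_extension \<sigma> ?n ?att Z S) & (\<forall>a<?n. agrees w S a)"
   then obtain S where S: "\<And>Z. is_extension \<sigma> ?n ?att Z S" "\<And>a. a < ?n ==> agrees w S a" by blast
   have "set_of ?n S = set_of ?n (lab_in w)" using S(2) by (auto simp: set_of_def agrees_def)
   then have "extension \<sigma> ?F (set_of ?n (lab_in w))" "?L = labelling_of ?F (set_of ?n (lab_in w))"
    using S extension_word[OF ctx, of \<sigma> S] L[of S] by auto
   then show "(\<forall>Z. is_extension \<sigma> ?n ?att Z (lab_in w)) & (\<forall>a<?n. agrees w (lab_in w) a)"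
    using extension_word[OF ctx] L by blast
  qed blast
  finally have Lin: "?L \<in> labellings \<sigma> ?F <->
   (\<forall>Z. is_extension \<sigma> ?n ?att Z (lab_in w)) & (\<forall>a<?n. agrees w (lab_in w) a)" .
  have inp: "(?F, g, ?L, k) \<in> SF_CA_inputs \<sigma> <-> ?L \<in> labellings \<sigma> ?F"
   using g k is_af_word_af by (auto simp: SF_CA_inputs_def)
  have lab': "?L g = labelling_of ?F (set_of ?n S) g <-> agrees w S g" for S
   using lab[OF g(1) g(1), of S] by (auto simp: eq_commute)
  define far where "far = (%d b. \<exists>T. extension \<sigma> ?F T & ?L g = labelling_of ?F T g &
   d <= distance ?F ?L (labelling_of ?F T) & (b --> k \<in> T))"
  have feas: "feasible \<sigma> w d b <-> ?L \<in> labellings \<sigma> ?F & far d b" for d b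
  proof -
   have dist: "distance ?F ?L (labelling_of ?F (set_of ?n S)) = (\<Sum>a<?n. if agrees w S a then 0 else 1)" for S
    unfolding distance_def sum_01_card fst using lab[symmetric] by (intro arg_cong[where f = card]) (auto simp: eq_commute)
   have "far d b <-> (\<exists>S. (\<forall>Z. is_extension \<sigma> ?n ?att Z S) & (\<forall>a<?n. word_field w 2 a --> agrees w S a) &
     d <= (\<Sum>a<?n. if agrees w S a then 0 else 1) & (b --> (\<forall>a<?n. word_field w 3 a --> S a)))"
    unfolding far_def ex_extension_word[OF ctx] dist lab'
    using g k nth by (intro ex_cong1 conj_cong refl) (auto simp: set_of_def)
   then show ?thesis unfolding feasible_def wf Lin candidate_def Let_def using wc by blast
  qed
  have lk: "labelling_of ?F T k = In <-> k \<in> T" for T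
   using k by (simp add: labelling_of_def)
  have "(\<exists>L'\<in>semifactuals \<sigma> ?F g ?L. L' k = In) <-> (\<exists>d. far d True & ~ far (Suc d) False)"
  proof
   assume "\<exists>L'\<in>semifactuals \<sigma> ?F g ?L. L' k = In"
   then obtain L' where L': "L' \<in> labellings \<sigma> ?F" "?L g = L' g" "L' k = In"
    "\<And>M. M \<in> labellings \<sigma> ?F ==> ?L g = M g ==> distance ?F ?L M <= distance ?F ?L L'"
    unfolding semifactuals_def by (auto simp: not_less)
   then obtain T where T0: "extension \<sigma> ?F T" "L' = labelling_of ?F T" unfolding labellings_def by blast
   have T: "extension \<sigma> ?F T" "?L g = labelling_of ?F T g" "k \<in> T"
    using L' T0 lk by auto
   have T4: "distance ?F ?L (labelling_of ?F U) <= distance ?F ?L (labelling_of ?F T)"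
    if "extension \<sigma> ?F U" "?L g = labelling_of ?F U g" for U
    using L'(4)[of "labelling_of ?F U"] that T0(2) unfolding labellings_def by blast
   let ?d = "distance ?F ?L (labelling_of ?F T)"
   have "far ?d True" using T(1-3) unfolding far_def by blast
   moreover have "~ far (Suc ?d) False" using T4 unfolding far_def by (auto simp: not_le less_Suc_eq_le dest!: Suc_le_lessD)
   ultimately show "\<exists>d. far d True & ~ far (Suc d) False" by blast
  next
   assume "\<exists>d. far d True & ~ far (Suc d) False"
   then obtain d T where T: "extension \<sigma> ?F T" "?L g = labelling_of ?F T g" "k \<in> T"
    "d <= distance ?F ?L (labelling_of ?F T)" and n: "~ far (Suc d) False" unfolding far_def by blast
   have "labelling_of ?F T \<in> semifactuals \<sigma> ?F g ?L"
    unfolding semifactuals_def labellings_def using T n by (force simp: far_def not_le)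
   then show "\<exists>L'\<in>semifactuals \<sigma> ?F g ?L. L' k = In" using T(3) lk by blast
  qed
  then have "(?F, g, ?L, k) \<in> SF_CA_yes \<sigma> <-> ?L \<in> labellings \<sigma> ?F & (\<exists>d. far d True & ~ far (Suc d) False)"
   unfolding SF_CA_yes_def using inp by auto
  then show ?thesis unfolding SF_CA_words wi using feas by auto
 qed
qed

section \<open>The query language\<close>

definition lead :: "bool list => nat => nat" where
 "lead v i = length (takeWhile id (drop i v))"

definition tail_word :: "bool list => bool list" where
 "tail_word v = drop (lead v 1 + 2) v"

lemma takeWhile_id: "takeWhile id w = ones (length (takeWhile id w))"
 by (induction w) auto

lemma num_Lead_lead:
 assumes "r ~= 5" "r ~= 6" "\<And>x y. num e (u(5 := x, 6 := y)) = num e u" "num e u <= length (u r)"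
 shows "num (Lead r e) u = lead (u r) (num e u)"
proof -
 let ?v = "drop (num e u) (u r)"
 have "u r = take (num e u) (u r) @ ones (lead (u r) (num e u)) @ dropWhile id ?v"
  using takeWhile_id[of ?v] takeWhile_dropWhile_id[of id ?v] unfolding lead_def by (metis append_take_drop_id)
 moreover have "dropWhile id ?v = [] \<or> ~ hd (dropWhile id ?v)"
  using hd_dropWhile[of id ?v] by auto
 ultimately show ?thesis
  using num_Lead[OF assms(1,2,3)] assms(4) by (metis length_take min.absorb2)
qed

text \<open>These expressions dissect a query in register 3: the distance d is the block of ones
  from position 1 on, and the input word starts at d + 2, behind the leading bit and the separator;
  its own leading ones give the number of arguments.\<close>

definition eD :: expr where "eD = Lead 3 eOne"
definition eOff :: expr where "eOff = Add eD (Const [True, True])"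
definition eN :: expr where "eN = Lead 3 eOff"
definition eBit :: "expr => expr" where "eBit e = Get 3 (Add eOff e)"
definition eAtt :: "expr => expr => expr" where "eAtt i j = eBit (Add eN (Add eOne (Add (Times i eN) j)))"
definition eField :: "nat => expr => expr" where
 "eField k i = eBit (Add (Add eN (Add eOne (Times eN eN))) (Add (Times (Const (ones k)) eN) i))"

text \<open>The word in register 3 is assumed to be a query.\<close>

definition queried :: "(nat => bool list) => bool" where
 "queried u <-> (\<exists>w d b. u 3 = query w d b)"

lemma lead_query: "lead (query w d b) 1 = d" "tail_word (query w d b) = w"
proof -
 show l: "lead (query w d b) 1 = d" by (simp add: lead_def query_def takeWhile_append)
 show "tail_word (query w d b) = w" unfolding tail_word_def l by (simp add: query_def)
qed

lemma queried_upd [simp]: "i ~= 3 ==> queried (u(i := x)) = queried u"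
 by (simp add: queried_def)

lemma num_eD [simp]: "queried u ==> num eD u = lead (u 3) 1"
 unfolding eD_def by (subst num_Lead_lead) (auto simp: queried_def query_def)

lemma num_eOff [simp]: "queried u ==> num eOff u = lead (u 3) 1 + 2"
 unfolding eOff_def by simp

lemma num_eN [simp]: "queried u ==> num eN u = nargs (tail_word (u 3))"
proof -
 assume q: "queried u"
 then have "lead (u 3) 1 + 2 <= length (u 3)" using lead_query by (auto simp: queried_def) (simp add: query_def)
 with q show ?thesis
  unfolding eN_def by (subst num_Lead_lead) (auto simp: lead_def nargs_def tail_word_def)
qed

lemma tru_eBit [simp]: "queried u ==> tru (eBit e) u <-> bit_at (tail_word (u 3)) (num e u)"
 unfolding eBit_def by (auto simp: tail_word_def bit_at_def)

lemma tru_eAtt [simp]: "queried u ==> tru (eAtt i j) u <-> word_att (tail_word (u 3)) (num i u) (num j u)"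
 unfolding eAtt_def word_att_def by simp

lemma tru_eField [simp]: "queried u ==> tru (eField k i) u <-> word_field (tail_word (u 3)) k (num i u)"
 unfolding eField_def word_field_def by simp

lemma regs_query_exprs [simp]:
 "regs eD = {3, 5, 6}" "regs eOff = {3, 5, 6}" "regs eN = {3, 5, 6}" "regs (eBit e) = {3, 5, 6} \<union> regs e"
 "regs (eAtt i j) = {3, 5, 6} \<union> regs i \<union> regs j" "regs (eField k i) = {3, 5, 6} \<union> regs i"
 "bound_regs eD = {5, 6}" "bound_regs eOff = {5, 6}" "bound_regs eN = {5, 6}"
 "bound_regs (eBit e) = {5, 6} \<union> bound_regs e"
 "bound_regs (eAtt i j) = {5, 6} \<union> bound_regs i \<union> bound_regs j" "bound_regs (eField k i) = {5, 6} \<union> bound_regs i"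
 by (auto simp: eD_def eOff_def eN_def eBit_def eAtt_def eField_def)

text \<open>In the formulas below a set of arguments is given by a map \<open>S\<close> from index expressions to formulas.\<close>

definition eHits :: "(expr => expr) => expr => expr" where
 "eHits S i = eEx 9 eN (eAnd (S (Size 9)) (eAtt (Size 9) i))"

definition eComplete :: "(expr => expr) => expr" where
 "eComplete S = eAnd
   (eAll 7 eN (eIff (S (Size 7)) (eAll 8 eN (eImp (eAtt (Size 8) (Size 7)) (eHits S (Size 8))))))
   (eAll 7 eN (eNot (eAnd (S (Size 7)) (eHits S (Size 7)))))"

definition eProper :: "(expr => expr) => (expr => expr) => expr" where
 "eProper S T = eAnd (eAll 7 eN (eImp (S (Size 7)) (T (Size 7)))) (eEx 7 eN (eAnd (T (Size 7)) (eNot (S (Size 7)))))"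

definition eRange :: "(expr => expr) => expr => expr" where
 "eRange S i = eOr (S i) (eHits S i)"

fun eExtension :: "semantics => (expr => expr) => (expr => expr) => expr" where
 "eExtension CO Z S = eComplete S"
| "eExtension ST Z S = eAnd (eComplete S) (eAll 7 eN (eRange S (Size 7)))"
| "eExtension PR Z S = eAnd (eComplete S) (eNot (eAnd (eComplete Z) (eProper S Z)))"
| "eExtension SST Z S = eAnd (eComplete S) (eNot (eAnd (eComplete Z) (eProper (eRange S) (eRange Z))))"

definition eAgrees :: "(expr => expr) => expr => expr" where
 "eAgrees S a = eAnd (eIff (eField 0 (Add a a)) (S a))
   (eIff (eField 0 (Add (Add a a) eOne)) (eAnd (eNot (S a)) (eHits S a)))"

definition eUnique :: "nat => expr" where
 "eUnique k = eEx 7 eN (eAll 8 eN (eIff (eField k (Size 8)) (eEq (Size 8) (Size 7))))"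

text \<open>The register r holds the set S and register 2 the competitor Z. With r = 2 both
  coincide, which suits one existential quantifier; r = 4 keeps them apart for an existential and a
  universal one.\<close>

definition eQuery :: "semantics => nat => expr" where
 "eQuery \<sigma> r = (let S = Get r; Z = Get 2; I = (%i. eField 0 (Add i i)) in
   eAnd (eEq (Size 3) (Add eOff (Add (Add eN (Add eOne (Times eN eN))) (Add (Times (Const (ones 2)) eN) (Times (Const (ones 2)) eN)))))
   (eAnd (eAnd (eUnique 2) (eUnique 3))
   (eAnd (eAll 7 eN (eAgrees I (Size 7)))
   (eAnd (eExtension \<sigma> Z I)
   (eAnd (eExtension \<sigma> Z S)
   (eAnd (eAll 7 eN (eImp (eField 2 (Size 7)) (eAgrees S (Size 7))))
   (eAnd (eLe eD (Sum 7 eN (eNot (eAgrees S (Size 7)))))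
    (eImp (Get 3 eZero) (eAll 7 eN (eImp (eField 3 (Size 7)) (S (Size 7)))))))))))) "

text \<open>Quantifiers in the formulas bind registers 7 to 9, so S must denote the same predicate
  whatever these registers contain.\<close>

definition denotes :: "(expr => expr) => (nat => bool) => (nat => bool list) => bool" where
 "denotes S R u <-> (\<forall>x y z. \<forall>i\<in>{7, 8, 9}. let u' = u(7 := x, 8 := y, 9 := z) in
   tru (S (Size i)) u' <-> R (length (u' i)))"

lemma denotes_upd [simp]: "denotes S R (u(7 := x)) <-> denotes S R u" "denotes S R (u(8 := x)) <-> denotes S R u"
 "denotes S R (u(9 := x)) <-> denotes S R u"
proof -
 have e: "u(7 := a, 7 := b, 8 := c, 9 := d) = u(7 := b, 8 := c, 9 := d)"
  "u(8 := a, 7 := b, 8 := c, 9 := d) = u(7 := b, 8 := c, 9 := d)"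
  "u(9 := a, 7 := b, 8 := c, 9 := d) = u(7 := b, 8 := c, 9 := d)" for a b c d and u :: "nat => bool list"
  by (auto simp: fun_eq_iff)
 show "denotes S R (u(7 := x)) <-> denotes S R u" "denotes S R (u(8 := x)) <-> denotes S R u"
  "denotes S R (u(9 := x)) <-> denotes S R u"
  unfolding denotes_def e by simp_all
qed

lemma denotesD: "denotes S R u ==> i \<in> {7, 8, 9} ==> tru (S (Size i)) u <-> R (length (u i))"
proof -
 assume "denotes S R u" "i \<in> {7, 8, 9}"
 moreover have "u(7 := u 7, 8 := u 8, 9 := u 9) = u" by simp
 ultimately show ?thesis unfolding denotes_def Let_def by metis
qed

lemma denotes_Get: "r \<notin> {7, 8, 9} ==> denotes (Get r) (bit_at (u r)) u"
 unfolding denotes_def Let_def by auto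

lemma denotes_lab: "queried u ==> denotes (%i. eField 0 (Add i i)) (lab_in (tail_word (u 3))) u"
 unfolding denotes_def Let_def by auto

abbreviation (input) "qn u \<equiv> nargs (tail_word (u 3))"
abbreviation (input) "qatt u \<equiv> word_att (tail_word (u 3))"

lemma tru_eHits: "queried u ==> denotes S R u ==> i \<in> {7, 8} ==>
  tru (eHits S (Size i)) u <-> hits (qn u) (qatt u) R (length (u i))"
 unfolding eHits_def hits_def by (auto simp: denotesD)

lemma tru_eComplete: "queried u ==> denotes S R u ==>
  tru (eComplete S) u <-> is_complete (qn u) (qatt u) R"
 unfolding eComplete_def is_complete_def by (simp add: denotesD tru_eHits)

lemma tru_eRange: "queried u ==> denotes S R u ==>
  tru (eRange S (Size 7)) u <-> with_range (qn u) (qatt u) R (length (u 7))"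
 unfolding eRange_def with_range_def by (simp add: denotesD tru_eHits)

lemma tru_eProper:
 assumes "queried u" "\<And>x. tru (S (Size 7)) (u(7 := ones x)) <-> R x" "\<And>x. tru (T (Size 7)) (u(7 := ones x)) <-> R' x"
 shows "tru (eProper S T) u <-> proper_in (qn u) R R'"
 unfolding eProper_def proper_in_def using assms by simp

lemma tru_eExtension: "queried u ==> denotes S R u ==> denotes Z R' u ==>
  tru (eExtension \<sigma> Z S) u <-> is_extension \<sigma> (qn u) (qatt u) R' R"
 by (cases \<sigma>) (simp_all add: tru_eComplete tru_eRange denotesD
   tru_eProper[where R = R and R' = R']
   tru_eProper[where R = "with_range (qn u) (qatt u) R" and R' = "with_range (qn u) (qatt u) R'"])

lemma tru_eAgrees: "queried u ==> denotes S R u ==>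
  tru (eAgrees S (Size 7)) u <-> agrees (tail_word (u 3)) R (length (u 7))"
 unfolding eAgrees_def agrees_def by (simp add: denotesD tru_eHits)

lemma tru_eUnique: "queried u ==>
  tru (eUnique k) u <-> (\<exists>i<qn u. \<forall>j<qn u. word_field (tail_word (u 3)) k j <-> j = i)"
 unfolding eUnique_def by simp

lemma tru_eQuery:
 assumes u: "u 3 = query w d b" and r: "r \<notin> {7, 8, 9}"
 shows "tru (eQuery \<sigma> r) u <-> well_formed_word w & candidate \<sigma> w d b (bit_at (u 2)) (bit_at (u r))"
proof -
 have q: "queried u" using u by (auto simp: queried_def)
 have w: "tail_word (u 3) = w" "lead (u 3) 1 = d" using u lead_query by auto
 have l: "length (u 3) = d + 2 + length w" using u by (simp add: query_def)
 have b: "bit_at (u 3) 0 <-> b" using u by (simp add: query_def bit_at_def)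
 note S = denotes_Get[OF r, of u] and Z = denotes_Get[of 2 u] and I = denotes_lab[OF q]
 have ag: "tru (eAgrees (Get r) (Size 7)) (u(7 := ones x)) <-> agrees w (bit_at (u r)) x"
  "tru (eAgrees (%i. eField 0 (Add i i)) (Size 7)) (u(7 := ones x)) <-> agrees w (lab_in w) x" for x
  using tru_eAgrees[of "u(7 := ones x)"] q S I w by simp_all
 show ?thesis
  unfolding eQuery_def Let_def
  using q w l b r S I Z
  by (simp add: tru_eUnique tru_eExtension ag well_formed_word_def candidate_def Let_def denotesD)
qed

lemma regs_eQuery: "regs (eQuery \<sigma> r) \<subseteq> {2, 3, 5, 6, 7, 8, 9, r}" "bound_regs (eQuery \<sigma> r) \<subseteq> {5..}"
 unfolding eQuery_def Let_def
 by (cases \<sigma>; auto simp: eUnique_def eAgrees_def eHits_def eComplete_def eProper_def eRange_def)+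

lemma is_extension_cong:
 assumes "\<And>a. a < n ==> Z a = Z' a" "\<And>a. a < n ==> S a = S' a"
 shows "is_extension \<sigma> n att Z S = is_extension \<sigma> n att Z' S'"
proof -
 have h: "hits n att Z a = hits n att Z' a" "hits n att S a = hits n att S' a" for a
  using assms by (auto simp: hits_def)
 have c: "is_complete n att Z = is_complete n att Z'" "is_complete n att S = is_complete n att S'"
  using assms h by (auto simp: is_complete_def)
 show ?thesis using assms by (cases \<sigma>) (auto simp: c h with_range_def proper_in_def)
qed

lemma candidate_cong:
 assumes "\<And>a. a < nargs w ==> Z a = Z' a" "\<And>a. a < nargs w ==> S a = S' a"
 shows "candidate \<sigma> w d b Z S = candidate \<sigma> w d b Z' S'"
proof -
 have "hits (nargs w) (word_att w) S a = hits (nargs w) (word_att w) S' a" for a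
  using assms by (auto simp: hits_def)
 then have a: "agrees w S a = agrees w S' a" if "a < nargs w" for a
  using that assms by (simp add: agrees_def)
 have s: "(\<Sum>a<nargs w. if agrees w S a then 0 else 1) = (\<Sum>a<nargs w. if agrees w S' a then 0 else (1::nat))"
  using a by (intro sum.cong) auto
 show ?thesis
  unfolding candidate_def Let_def s
  using is_extension_cong[of "nargs w" Z Z' S S' \<sigma>] is_extension_cong[of "nargs w" Z Z' "lab_in w" "lab_in w" \<sigma>] assms a
  by simp
qed

lemma word_of_set: "n <= N ==> \<exists>z. length z = N & (\<forall>a<n. bit_at z a = S a)"
 by (rule exI[of _ "map S [0..<N]"]) (auto simp: bit_at_def)

text \<open>Only the first \<open>nargs w\<close> elements of a set matter, so sets can be exchanged
  for words of any sufficient length, in particular of the length of the query.\<close>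

lemma feasible_words:
 assumes "nargs w <= N"
 shows "feasible \<sigma> w d b <->
  (\<exists>y. length y = N & (\<forall>z. length z = N --> well_formed_word w & candidate \<sigma> w d b (bit_at z) (bit_at y)))"
proof -
 have Z: "(\<forall>Z. candidate \<sigma> w d b Z S) <-> (\<forall>z. length z = N --> candidate \<sigma> w d b (bit_at z) S)" for S
 proof (intro iffI allI)
  fix Z assume *: "\<forall>z. length z = N --> candidate \<sigma> w d b (bit_at z) S"
  obtain z where "length z = N" "\<forall>a<nargs w. bit_at z a = Z a" using word_of_set[OF assms] by blast
  moreover from * this(1) have "candidate \<sigma> w d b (bit_at z) S" by blast
  ultimately show "candidate \<sigma> w d b Z S" using candidate_cong[of w "bit_at z" Z S S] by simp
 qed simp
 have "(\<exists>S. \<forall>Z. candidate \<sigma> w d b Z S) <-> (\<exists>y. length y = N & (\<forall>Z. candidate \<sigma> w d b Z (bit_at y)))"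
 proof
  assume "\<exists>S. \<forall>Z. candidate \<sigma> w d b Z S"
  then obtain S where S: "\<And>Z. candidate \<sigma> w d b Z S" by auto
  obtain y where y: "length y = N" "\<forall>a<nargs w. bit_at y a = S a" using word_of_set[OF assms] by blast
  have "candidate \<sigma> w d b Z (bit_at y)" for Z
   using S[of Z] candidate_cong[of w Z Z "bit_at y" S] y(2) by simp
  with y(1) show "\<exists>y. length y = N & (\<forall>Z. candidate \<sigma> w d b Z (bit_at y))" by auto
 qed auto
 then have "feasible \<sigma> w d b <-> well_formed_word w &
   (\<exists>y. length y = N & (\<forall>z. length z = N --> candidate \<sigma> w d b (bit_at z) (bit_at y)))"
  unfolding feasible_def Z by simp
 moreover have "\<exists>z :: bool list. length z = N" by (rule exI[of _ "replicate N True"]) simp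
 ultimately show ?thesis by auto
qed

section \<open>Monotonicity of the oracle and membership\<close>

lemma nargs_le: "nargs w <= length (query w d b)"
 using length_takeWhile_le[of id w] by (simp add: nargs_def query_def)

lemma feasible_mono: "feasible \<sigma> w d b ==> d' <= d ==> (b' --> b) ==> feasible \<sigma> w d' b'"
 unfolding feasible_def candidate_def Let_def by (meson order_trans)

lemma feasible_bound: "feasible \<sigma> w d b ==> d <= length w"
proof -
 assume "feasible \<sigma> w d b"
 then obtain S where "d <= (\<Sum>a<nargs w. if agrees w S a then 0 else 1)"
  unfolding feasible_def candidate_def Let_def by blast
 also have "\<dots> <= (\<Sum>a<nargs w. 1)" by (rule sum_mono) simp
 also have "\<dots> <= length w" using length_takeWhile_le[of id w] by (simp add: nargs_def)
 finally show ?thesis .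
qed

lemma SF_CA_Theta:
 assumes B: "B \<in> Sigma_p (h - 1)" and q: "\<And>w d b. query w d b \<in> B <-> feasible \<sigma> w d b"
 shows "SF_CA \<sigma> \<in> Theta_p h"
proof -
 have "{w. \<exists>d. query w d True \<in> B & query w (Suc d) False \<notin> B} \<in> Theta_p h"
 proof (rule Theta_search[OF B])
  show "query w d False \<in> B" if "query w (Suc d) False \<in> B" for w d
   using that feasible_mono unfolding q by (metis le_SucI order_refl)
  show "query w d False \<in> B" if "query w d True \<in> B" for w d
   using that feasible_mono unfolding q by blast
  show "query w (length w + 2) False \<notin> B" for w
   unfolding q using feasible_bound[of \<sigma> w "length w + 2"] by fastforce
 qed
 moreover have "SF_CA \<sigma> = {w. \<exists>d. query w d True \<in> B & query w (Suc d) False \<notin> B}"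
  unfolding q using feasible_iff by blast
 ultimately show ?thesis by simp
qed

text \<open>Complete and stable extensions are recognized without a competitor, so the guessed word
  may stand for both sets and the oracle drops to NP.\<close>

lemma SF_CA_Theta_2:
 assumes \<sigma>: "\<sigma> \<in> {CO, ST}"
 shows "SF_CA \<sigma> \<in> Theta_p 2"
proof (rule SF_CA_Theta)
 let ?B = "{v. \<exists>z. length z = length v & tru (eQuery \<sigma> 2) (env v [] z)}"
 have "?B \<in> NP" using regs_eQuery[of \<sigma> 2] by (intro NP_formula) auto
 then show "?B \<in> Sigma_p (2 - 1)" by simp
 fix w d b
 have "candidate \<sigma> w d b Z S = candidate \<sigma> w d b Z' S" for Z Z' S
  using \<sigma> by (auto simp: candidate_def)
 then have c: "candidate \<sigma> w d b (bit_at z) (bit_at y) <-> candidate \<sigma> w d b (bit_at y) (bit_at y)" for z y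
  by blast
 have "feasible \<sigma> w d b <-> (\<exists>z. length z = length (query w d b) & well_formed_word w & candidate \<sigma> w d b (bit_at z) (bit_at z))"
  unfolding feasible_words[OF nargs_le[of w d b]]
 proof (intro ex_cong1 conj_cong refl)
  fix y :: "bool list" assume "length y = length (query w d b)"
  then show "(\<forall>z. length z = length (query w d b) --> well_formed_word w & candidate \<sigma> w d b (bit_at z) (bit_at y)) <->
    well_formed_word w & candidate \<sigma> w d b (bit_at y) (bit_at y)" using c[of _ y] by blast
 qed
 moreover have "tru (eQuery \<sigma> 2) (env (query w d b) [] z) <->
   well_formed_word w & candidate \<sigma> w d b (bit_at z) (bit_at z)" for z
  using tru_eQuery[of "env (query w d b) [] z" w d b 2] by (simp add: env_def)
 ultimately show "query w d b \<in> ?B <-> feasible \<sigma> w d b" by simp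
qed

lemma SF_CA_Theta_3: "SF_CA \<sigma> \<in> Theta_p 3"
proof (rule SF_CA_Theta)
 let ?B = "{v. \<exists>y. length y = length v & (\<forall>z. length z = length v --> tru (eQuery \<sigma> 4) (env v y z))}"
 have "?B \<in> Sigma_p 2" using regs_eQuery[of \<sigma> 4] by (intro Sigma2_formula) auto
 then show "?B \<in> Sigma_p (3 - 1)" by simp
 fix w d b
 have "tru (eQuery \<sigma> 4) (env (query w d b) y z) <->
   well_formed_word w & candidate \<sigma> w d b (bit_at z) (bit_at y)" for y z
  using tru_eQuery[of "env (query w d b) y z" w d b 4] by (simp add: env_def)
 then show "query w d b \<in> ?B <-> feasible \<sigma> w d b"
  unfolding feasible_words[OF nargs_le[of w d b]] by simp
qed

section \<open>Argumentation frameworks for satisfiability\<close>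

text \<open>A variable has the two literals \<open>Lit v True\<close> and \<open>Lit v False\<close>. The pads, one for each basic
 argument, outweigh all basic arguments in the distance.\<close>

datatype ('v, 'c) basic = Lit 'v bool | Cl 'c | Range 'v bool | Phi | NegPhi | Block | Escape | Goal

datatype ('v, 'c) arg = Base "('v, 'c) basic" | Pad "('v, 'c) basic"

type_synonym 'v lits = "('v \<times> bool) set"

definition satisfies :: "('v => bool) => 'v lits => bool" where
 "satisfies \<alpha> l <-> (\<exists>(v, b)\<in>l. \<alpha> v = b)"

definition basics :: "'v set => 'c set => ('v, 'c) basic set" where
 "basics V C = {Lit v b | v b. v \<in> V} \<union> {Range v b | v b. v \<in> V} \<union> Cl ` C \<union> {Phi, NegPhi, Block, Escape, Goal}"

definition gadget :: "'v set => 'c set => (('v, 'c) arg => ('v, 'c) arg => bool) => ('v, 'c) arg af" where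
 "gadget V C att = (Base ` basics V C \<union> Pad ` basics V C,
   {(x, y). x \<in> Base ` basics V C \<union> Pad ` basics V C & y \<in> Base ` basics V C \<union> Pad ` basics V C & att x y})"

text \<open>Clauses are accepted if violated; an accepted one attacks \<open>Phi\<close>. The
  positive literal of u attacks all clauses and \<open>Phi\<close>, so that making u true decides
  everything at once. The pads are attacked by \<open>Phi\<close>, and it is the pads that register
  whether \<open>Phi\<close> is accepted.\<close>

fun att1 :: "'v => ('c => 'v lits) => ('v, 'c) arg => ('v, 'c) arg => bool" where
 "att1 u lit x (Base (Lit v b)) <-> x = Base (Lit v (~ b))"
| "att1 u lit x (Base (Cl c)) <-> (\<exists>v b. x = Base (Lit v b) & ((v, b) \<in> lit c \<or> v = u & b))"
| "att1 u lit x (Base (Range v b)) <-> False"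
| "att1 u lit x (Base Phi) <-> x = Base (Lit u True) \<or> (\<exists>c. x = Base (Cl c))"
| "att1 u lit x (Base NegPhi) <-> False"
| "att1 u lit x (Base Block) <-> False"
| "att1 u lit x (Base Escape) <-> False"
| "att1 u lit x (Base Goal) <-> False"
| "att1 u lit x (Pad y) <-> x = Base Phi"

text \<open>The self-attacking \<open>Block\<close> attacks the universal literals and only
  \<open>Phi\<close> defeats it, so these literals are accepted only together with
  \<open>Phi\<close>. An accepted outer clause, that is, a violated one, defeats all inner clauses.
  \<open>Range\<close> arguments attack themselves and are attacked by their literals, which makes
  accepted literals visible in the range. \<open>Goal\<close> attacks itself: it is out if
  \<open>Escape\<close> is accepted and undecided otherwise.\<close>

fun att2 :: "'v => ('c => 'v lits) => ('v => bool) => ('c => bool) => ('v, 'c) arg => ('v, 'c) arg => bool" where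
 "att2 u lit ex outer x (Base (Lit v b)) <-> x = Base (Lit v (~ b)) \<or> ~ ex v & x = Base Block"
| "att2 u lit ex outer x (Base (Cl c)) <-> (\<exists>v b. x = Base (Lit v b) & ((v, b) \<in> lit c \<or> v = u & b)) \<or>
   (\<exists>c'. x = Base (Cl c') & outer c' & ~ outer c)"
| "att2 u lit ex outer x (Base (Range v b)) <-> x = Base (Lit v b) \<or> x = Base (Range v b)"
| "att2 u lit ex outer x (Base Phi) <-> (\<exists>c. x = Base (Cl c) & ~ outer c)"
| "att2 u lit ex outer x (Base NegPhi) <-> x = Base Phi"
| "att2 u lit ex outer x (Base Block) <-> x = Base Phi \<or> x = Base Block"
| "att2 u lit ex outer x (Base Escape) <-> x = Base (Lit u True) \<or> x = Base NegPhi"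
| "att2 u lit ex outer x (Base Goal) <-> x = Base Escape \<or> x = Base Goal"
| "att2 u lit ex outer x (Pad y) <-> x = Base (Lit u True)"

lemma finite_basics: "finite V ==> finite C ==> finite (basics V C)"
proof -
 assume f: "finite V" "finite C"
 have "basics V C \<subseteq> (%(v, b). Lit v b) ` (V \<times> UNIV) \<union> (%(v, b). Range v b) ` (V \<times> UNIV) \<union> Cl ` C \<union> {Phi, NegPhi, Block, Escape, Goal}"
  unfolding basics_def by auto
 then show ?thesis using f by (rule_tac finite_subset) auto
qed

lemma is_af_gadget: "finite V ==> finite C ==> is_af (gadget V C att)"
 by (auto simp: is_af_def gadget_def finite_basics)

lemma extension_complete: "extension \<sigma> F S ==> complete_ext F S"
 by (cases \<sigma>) (auto simp: stable_ext_def semi_stable_ext_def preferred_ext_def)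

lemma label_In: "a \<in> fst F ==> labelling_of F S a = In <-> a \<in> S"
 by (simp add: labelling_of_def)

text \<open>A farthest extension containing the target exists as soon as one extension with the target is
 at least as far away as all extensions without it.\<close>

lemma yes_iff:
 fixes F :: "'a af"
 assumes F: "is_af F" "g \<in> fst F" "k \<in> fst F" and E: "extension \<sigma> F E"
 defines "L \<equiv> labelling_of F E"
 shows "(F, g, L, k) \<in> SF_CA_inputs \<sigma>"
  and "(F, g, L, k) \<in> SF_CA_yes \<sigma> ==> \<exists>T. extension \<sigma> F T & L g = labelling_of F T g & k \<in> T"
  and "extension \<sigma> F T ==> L g = labelling_of F T g ==> k \<in> T ==>
   (\<And>U. extension \<sigma> F U ==> L g = labelling_of F U g ==> k \<notin> U ==>
    distance F L (labelling_of F U) <= distance F L (labelling_of F T)) ==> (F, g, L, k) \<in> SF_CA_yes \<sigma>"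
proof -
 show inp: "(F, g, L, k) \<in> SF_CA_inputs \<sigma>"
  using F E by (auto simp: SF_CA_inputs_def labellings_def L_def)
 {
  assume "(F, g, L, k) \<in> SF_CA_yes \<sigma>"
  then obtain M where "M \<in> labellings \<sigma> F" "L g = M g" "M k = In"
   unfolding SF_CA_yes_def semifactuals_def by auto
  then show "\<exists>T. extension \<sigma> F T & L g = labelling_of F T g & k \<in> T"
   using label_In[OF F(3)] unfolding labellings_def by auto
 }
 assume T: "extension \<sigma> F T" "L g = labelling_of F T g" "k \<in> T"
  and far: "\<And>U. extension \<sigma> F U ==> L g = labelling_of F U g ==> k \<notin> U ==>
    distance F L (labelling_of F U) <= distance F L (labelling_of F T)"
 let ?X = "{M \<in> labellings \<sigma> F. L g = M g}"
 have bound: "distance F L M <= card (fst F)" for M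
  unfolding distance_def using F(1) by (intro card_mono) (auto simp: is_af_def split: prod.splits)
 have "labelling_of F T \<in> ?X" using T by (auto simp: labellings_def)
 then have "\<exists>M. M \<in> ?X & (\<forall>N. N \<in> ?X --> distance F L N <= distance F L M)"
  by (rule ex_has_greatest_nat[where b = "Suc (card (fst F))" and P = "%M. M \<in> ?X" and f = "distance F L"])
   (use bound in \<open>simp add: less_Suc_eq_le\<close>)
 then obtain M where M: "M \<in> ?X" "\<And>N. N \<in> ?X ==> distance F L N <= distance F L M"
  by (elim exE conjE) (rule that, assumption, iprover)
 have "\<exists>M\<in>?X. (\<forall>N\<in>?X. distance F L N <= distance F L M) & M k = In"
 proof (cases "M k = In")
  case True
  then show ?thesis using M by blast
 next
  case False
  obtain U where U: "extension \<sigma> F U" "M = labelling_of F U" using M(1) by (auto simp: labellings_def)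
  have "distance F L M <= distance F L (labelling_of F T)"
   unfolding U(2) by (rule far) (use U M(1) False label_In[OF F(3)] in auto)
  then have "\<forall>N\<in>?X. distance F L N <= distance F L (labelling_of F T)" using M(2) order_trans by blast
  then show ?thesis using \<open>labelling_of F T \<in> ?X\<close> label_In[OF F(3)] T(3) by blast
 qed
 then have "\<exists>M\<in>semifactuals \<sigma> F g L. M k = In"
  unfolding semifactuals_def by (auto simp: not_less)
 then show "(F, g, L, k) \<in> SF_CA_yes \<sigma>" using inp by (simp add: SF_CA_yes_def)
qed

lemma completeI:
 assumes "S \<subseteq> fst F" "\<And>x. x \<in> S ==> x \<notin> Def F S"
  "\<And>x. x \<in> fst F ==> x \<in> S <-> (\<forall>y. (y, x) \<in> snd F --> y \<in> Def F S)"
 shows "complete_ext F S"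
 using assms unfolding complete_ext_def admissible_def conflict_free_def Acc_eq by blast

lemma completeD:
 assumes "complete_ext F S"
 shows "S \<subseteq> fst F" "x \<in> S ==> x \<notin> Def F S" "x \<in> S ==> (y, x) \<in> snd F ==> y \<in> Def F S"
  "x \<in> fst F ==> (\<And>y. (y, x) \<in> snd F ==> y \<in> Def F S) ==> x \<in> S"
 using assms unfolding complete_ext_def admissible_def conflict_free_def Acc_eq by blast+

text \<open>By the fundamental lemma of Dung an acceptable argument can be added to an admissible
  set; hence an admissible superset of maximal cardinality is complete, and every complete extension
  lies in a preferred one.\<close>

lemma admissible_in_preferred:
 assumes F: "is_af F" and S: "S \<subseteq> fst F" "admissible F S"
 shows "\<exists>T. preferred_ext F T & S \<subseteq> T"
proof -
 have fin: "finite (fst F)" using F by (auto simp: is_af_def split: prod.splits)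
 let ?Q = "%T. T \<subseteq> fst F & admissible F T & S \<subseteq> T"
 have "\<exists>T. ?Q T & (\<forall>U. ?Q U --> card U <= card T)"
  by (rule ex_has_greatest_nat[where k = S and b = "Suc (card (fst F))"])
   (use S fin card_mono in \<open>auto simp: less_Suc_eq_le\<close>)
 then obtain T where T: "T \<subseteq> fst F" "admissible F T" "S \<subseteq> T" and max: "\<And>U. ?Q U ==> card U <= card T"
  by (elim exE conjE) (rule that, assumption+, iprover)
 have cf: "x \<notin> Def F T" if "x \<in> T" for x using T(2) that unfolding admissible_def conflict_free_def by blast
 have def_mono: "Def F T \<subseteq> Def F (insert x T)" for x unfolding Def_eq by blast
 have "Acc F T \<subseteq> T"
 proof (rule ccontr)
  assume "~ Acc F T \<subseteq> T"
  then obtain x where x: "x \<in> Acc F T" "x \<notin> T" by blast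
  have sub: "insert x T \<subseteq> Acc F T" using T(2) x unfolding admissible_def by blast
  \<comment> \<open>An attacker in T of an acceptable argument would be attacked by T itself,
    against conflict-freeness.\<close>
  have no: "y \<notin> Def F T" if y: "y \<in> Acc F T" for y
  proof
   assume "y \<in> Def F T"
   then obtain z where "z \<in> T" "(z, y) \<in> snd F" unfolding Def_eq by blast
   then show False using y cf unfolding Acc_eq by blast
  qed
  have "insert x T \<inter> Def F (insert x T) = {}"
  proof (rule ccontr)
   assume "insert x T \<inter> Def F (insert x T) ~= {}"
   then obtain a b where "a \<in> insert x T" "b \<in> insert x T" "(b, a) \<in> snd F" unfolding Def_eq by blast
   then have "b \<in> Def F T" "b \<in> Acc F T" using sub unfolding Acc_eq[of F T] by blast+
   then show False using no by blast
  qed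
  moreover have "Acc F T \<subseteq> Acc F (insert x T)" unfolding Acc_eq using def_mono by blast
  ultimately have "admissible F (insert x T)" using sub unfolding admissible_def conflict_free_def by blast
  moreover have "insert x T \<subseteq> fst F" using sub unfolding Acc_eq by blast
  ultimately have "card (insert x T) <= card T" using T(3) max[of "insert x T"] by blast
  moreover have "finite T" using T(1) fin by (rule finite_subset)
  ultimately show False using x(2) by simp
 qed
 then have "complete_ext F T" using T unfolding complete_ext_def admissible_def by blast
 then show ?thesis using complete_imp_preferred[OF F] T(3) by blast
qed

context
 fixes V :: "'v set" and C :: "'c set" and u :: 'v and lit :: "'c => 'v lits"
 assumes fin: "finite V" "finite C" and u: "u \<in> V"
  and lit_subset: "\<Union> (lit ` C) \<subseteq> V \<times> UNIV"
begin

lemma lit: "c \<in> C ==> (v, b) \<in> lit c ==> v \<in> V"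
 using lit_subset by blast

abbreviation "basic_args \<equiv> basics V C"

lemma basic_simps [simp]:
 "Lit v b \<in> basic_args <-> v \<in> V" "Range v b \<in> basic_args <-> v \<in> V" "Cl c \<in> basic_args <-> c \<in> C"
 "Phi \<in> basic_args" "NegPhi \<in> basic_args" "Block \<in> basic_args" "Escape \<in> basic_args" "Goal \<in> basic_args"
 by (auto simp: basics_def)

lemma fst_gadget: "x \<in> fst (gadget V C att) <-> (case x of Base b => b \<in> basic_args | Pad b => b \<in> basic_args)"
 by (auto simp: gadget_def split: arg.splits)

lemma snd_gadget: "(x, y) \<in> snd (gadget V C att) <->
  x \<in> fst (gadget V C att) & y \<in> fst (gadget V C att) & att x y"
 by (auto simp: gadget_def)

text \<open>There are as many pads as basic arguments. A labelling differing on all pads is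
  therefore at least as far away as any labelling that agrees on them, whatever happens on the basic
  arguments.\<close>

lemma distance_pads:
 assumes "\<And>x. x \<in> basic_args ==> L (Pad x) ~= M (Pad x)"
 shows "card basic_args <= distance (gadget V C att) L M"
proof -
 have "card basic_args = card (Pad ` basic_args)" by (simp add: card_image inj_on_def)
 also have "\<dots> <= distance (gadget V C att) L M"
  unfolding distance_def using assms finite_basics[OF fin]
  by (intro card_mono) (auto simp: fst_gadget gadget_def)
 finally show ?thesis .
qed

lemma distance_no_pads:
 assumes "\<And>x. x \<in> basic_args ==> L (Pad x) = M (Pad x)"
 shows "distance (gadget V C att) L M <= card basic_args"
proof -
 have "distance (gadget V C att) L M <= card (Base ` basic_args)"
  unfolding distance_def using assms finite_basics[OF fin]
  by (intro card_mono) (auto simp: gadget_def)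
 also have "\<dots> = card basic_args" by (simp add: card_image inj_on_def)
 finally show ?thesis .
qed

subsection \<open>Complete and stable semantics\<close>

abbreviation "F1 \<equiv> gadget V C (att1 u lit)"

text \<open>Every assignment yields a stable extension: with u false the violated clauses are in,
  and \<open>Phi\<close> is in if there is none; the pads are the opposite of
  \<open>Phi\<close>.\<close>

definition ext1 :: "('v => bool) => ('v, 'c) arg set" where
 "ext1 \<alpha> = {x \<in> fst F1. case x of
   Base (Lit v b) => \<alpha> v = b
  | Base (Cl c) => ~ \<alpha> u & ~ satisfies \<alpha> (lit c)
  | Base Phi => ~ \<alpha> u & (\<forall>c\<in>C. satisfies \<alpha> (lit c))
  | Pad x => \<alpha> u \<or> (\<exists>c\<in>C. ~ satisfies \<alpha> (lit c))
  | _ => True}"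

lemma Def_ext1: "Def F1 (ext1 \<alpha>) = fst F1 - ext1 \<alpha>"
proof (intro set_eqI)
 fix x :: "('v, 'c) arg"
 have D: "x \<in> Def F1 (ext1 \<alpha>) <-> x \<in> fst F1 & (\<exists>y\<in>ext1 \<alpha>. att1 u lit y x)" for x
  unfolding Def_eq using snd_gadget by (auto simp: ext1_def)
 show "x \<in> Def F1 (ext1 \<alpha>) <-> x \<in> fst F1 - ext1 \<alpha>"
 proof (cases "x \<in> fst F1")
  case True
  have L: "Base (Lit v b) \<in> ext1 \<alpha> <-> v \<in> V & \<alpha> v = b" for v b by (simp add: ext1_def fst_gadget)
  have Cc: "Base (Cl c) \<in> ext1 \<alpha> <-> c \<in> C & ~ \<alpha> u & ~ satisfies \<alpha> (lit c)" for c by (simp add: ext1_def fst_gadget)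
  have I: "Base NegPhi \<in> ext1 \<alpha>" "Base Block \<in> ext1 \<alpha>" "Base Escape \<in> ext1 \<alpha>" "Base Goal \<in> ext1 \<alpha>"
   "Base (Range v b) \<in> ext1 \<alpha> <-> v \<in> V" for v b by (simp_all add: ext1_def fst_gadget)
  have P: "Base Phi \<in> ext1 \<alpha> <-> ~ \<alpha> u & (\<forall>c\<in>C. satisfies \<alpha> (lit c))" by (simp add: ext1_def fst_gadget)
  have Pd: "Pad b \<in> ext1 \<alpha> <-> b \<in> basic_args & (\<alpha> u \<or> (\<exists>c\<in>C. ~ satisfies \<alpha> (lit c)))" for b
   by (simp add: ext1_def fst_gadget)
  show ?thesis
  proof (cases x)
   case (Pad b)
   then show ?thesis using True unfolding D by (auto simp: P Pd fst_gadget)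
  next
   case (Base b)
   show ?thesis
   proof (cases b)
    case (Lit v c)
    show ?thesis using True unfolding D Base Lit by (auto simp: L fst_gadget)
   next
    case (Cl c)
    have c: "c \<in> C" using True Base Cl by (simp add: fst_gadget)
    have "(\<exists>y\<in>ext1 \<alpha>. att1 u lit y (Base (Cl c))) <-> (\<exists>v\<in>V. (v, \<alpha> v) \<in> lit c \<or> v = u & \<alpha> v)"
    proof
     assume "\<exists>y\<in>ext1 \<alpha>. att1 u lit y (Base (Cl c))"
     then obtain v b where "Base (Lit v b) \<in> ext1 \<alpha>" "(v, b) \<in> lit c \<or> v = u & b" by auto
     then show "\<exists>v\<in>V. (v, \<alpha> v) \<in> lit c \<or> v = u & \<alpha> v" using L by auto
    next
     assume "\<exists>v\<in>V. (v, \<alpha> v) \<in> lit c \<or> v = u & \<alpha> v"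
     then obtain v where "v \<in> V" "(v, \<alpha> v) \<in> lit c \<or> v = u & \<alpha> v" by blast
     then show "\<exists>y\<in>ext1 \<alpha>. att1 u lit y (Base (Cl c))"
      by (intro bexI[of _ "Base (Lit v (\<alpha> v))"]) (auto simp: L)
    qed
    also have "\<dots> <-> \<alpha> u \<or> satisfies \<alpha> (lit c)" using u lit[OF c] by (auto simp: satisfies_def)
    finally show ?thesis using True unfolding D Base Cl by (auto simp: Cc fst_gadget)
   next
    case Phi
    have "Base Phi \<in> Def F1 (ext1 \<alpha>) <-> Base (Lit u True) \<in> ext1 \<alpha> \<or> (\<exists>c. Base (Cl c) \<in> ext1 \<alpha>)"
     using True unfolding D Base Phi by auto
    then show ?thesis using True u unfolding Base Phi by (auto simp: L Cc P)
   qed (use True in \<open>auto simp: D Base I fst_gadget\<close>)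
  qed
 qed (auto simp: D)
qed

lemma stable_ext1: "stable_ext F1 (ext1 \<alpha>)"
proof -
 have s: "ext1 \<alpha> \<subseteq> fst F1" by (auto simp: ext1_def)
 have "complete_ext F1 (ext1 \<alpha>)"
 proof (rule completeI[OF s])
  show "x \<notin> Def F1 (ext1 \<alpha>)" if "x \<in> ext1 \<alpha>" for x using that by (simp add: Def_ext1)
  show "x \<in> ext1 \<alpha> <-> (\<forall>y. (y, x) \<in> snd F1 --> y \<in> Def F1 (ext1 \<alpha>))" if x: "x \<in> fst F1" for x
  proof
   assume "x \<in> ext1 \<alpha>"
   then have nd: "x \<notin> Def F1 (ext1 \<alpha>)" by (simp add: Def_ext1)
   show "\<forall>y. (y, x) \<in> snd F1 --> y \<in> Def F1 (ext1 \<alpha>)"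
   proof (intro allI impI)
    fix y assume y: "(y, x) \<in> snd F1"
    then have "y \<notin> ext1 \<alpha>" using nd x unfolding Def_eq by blast
    then show "y \<in> Def F1 (ext1 \<alpha>)" using y by (simp add: Def_ext1 snd_gadget)
   qed
  next
   assume *: "\<forall>y. (y, x) \<in> snd F1 --> y \<in> Def F1 (ext1 \<alpha>)"
   show "x \<in> ext1 \<alpha>"
   proof (rule ccontr)
    assume "x \<notin> ext1 \<alpha>"
    then have "x \<in> Def F1 (ext1 \<alpha>)" using x by (simp add: Def_ext1)
    then obtain y where "y \<in> ext1 \<alpha>" "(y, x) \<in> snd F1" unfolding Def_eq by blast
    with * show False by (auto simp: Def_ext1)
   qed
  qed
 qed
 then show ?thesis using s by (auto simp: stable_iff Def_ext1)
qed

text \<open>Accepting \<open>Phi\<close> requires that each clause is attacked by an accepted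
  literal, and that literal is not u. So variables left undecided by a complete extension may be set
  to false.\<close>

lemma Phi_imp_sat:
 assumes "complete_ext F1 E" "Base Phi \<in> E"
 shows "\<exists>\<alpha>. ~ \<alpha> u & (\<forall>c\<in>C. satisfies \<alpha> (lit c))"
proof -
 note cd = completeD[OF assms(1)]
 define \<alpha> where "\<alpha> v <-> Base (Lit v True) \<in> E" for v
 have a: "\<alpha> v = b" if "Base (Lit v b) \<in> E" for v b
 proof (cases b)
  case False
  have "v \<in> V" using cd(1) that by (auto simp: fst_gadget subset_iff)
  then have "Base (Lit v False) \<in> Def F1 E" if "Base (Lit v True) \<in> E"
   using that unfolding Def_eq by (auto simp: snd_gadget fst_gadget intro!: bexI[of _ "Base (Lit v True)"])
  then show ?thesis using cd(2) that False unfolding \<alpha>_def by auto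
 qed (use that in \<open>simp add: \<alpha>_def\<close>)
 have nu: "Base (Lit u True) \<notin> E"
 proof
  assume "Base (Lit u True) \<in> E"
  then have "Base Phi \<in> Def F1 E"
   using u unfolding Def_eq by (auto simp: snd_gadget fst_gadget intro!: bexI[of _ "Base (Lit u True)"])
  then show False using cd(2)[OF assms(2)] by blast
 qed
 have "satisfies \<alpha> (lit c)" if c: "c \<in> C" for c
 proof -
  have "Base (Cl c) \<in> Def F1 E"
   by (rule cd(3)[OF assms(2)]) (use c in \<open>simp add: snd_gadget fst_gadget\<close>)
  then obtain y where y: "y \<in> E" "att1 u lit y (Base (Cl c))" unfolding Def_eq by (auto simp: snd_gadget)
  then obtain v b where "y = Base (Lit v b)" "(v, b) \<in> lit c \<or> v = u & b" by auto
  with y(1) nu a show ?thesis by (auto simp: satisfies_def)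
 qed
 moreover have "~ \<alpha> u" using nu by (simp add: \<alpha>_def)
 ultimately show ?thesis by (intro exI[of _ \<alpha>]) simp
qed

text \<open>The goal has no attackers in this framework, so every extension gives it the same
  label.\<close>

lemma Goal_in_complete1: "complete_ext F1 E ==> Base Goal \<in> E"
 by (erule completeD(4)) (auto simp: fst_gadget snd_gadget)

definition ext_ST :: "('v, 'c) arg set" where "ext_ST = ext1 (%_. True)"

text \<open>The grounded extension: only isolated arguments are accepted and all others are
  undecided.\<close>

definition ext_CO :: "('v, 'c) arg set" where
 "ext_CO = {x \<in> fst F1. x \<in> Base ` ({NegPhi, Block, Escape, Goal} \<union> range (%(v, b). Range v b))}"

lemma isolated:
 assumes "x \<in> ext_CO"
 shows "~ att1 u lit y x" "~ att1 u lit x y"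
proof -
 obtain b where "x = Base b" "b \<in> {NegPhi, Block, Escape, Goal} \<union> range (%(v, b). Range v b)"
  using assms by (auto simp: ext_CO_def)
 then have x: "x = Base NegPhi \<or> x = Base Block \<or> x = Base Escape \<or> x = Base Goal \<or> (\<exists>v b. x = Base (Range v b))"
  by auto
 show "~ att1 u lit y x" using x by auto
 show "~ att1 u lit x y"
 proof (cases y)
  case (Base b)
  then show ?thesis using x by (cases b) auto
 qed (use x in auto)
qed

lemma Def_ext_CO: "Def F1 ext_CO = {}"
 unfolding Def_eq using isolated(2) by (auto simp: snd_gadget)

lemma complete_ext_CO: "complete_ext F1 ext_CO"
proof (rule completeI)
 show "x \<in> ext_CO <-> (\<forall>y. (y, x) \<in> snd F1 --> y \<in> Def F1 ext_CO)" if x: "x \<in> fst F1" for x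
 proof
  assume *: "\<forall>y. (y, x) \<in> snd F1 --> y \<in> Def F1 ext_CO"
  then have n: "~ att1 u lit y x" if "y \<in> fst F1" for y
   using that x unfolding Def_ext_CO snd_gadget by blast
  show "x \<in> ext_CO"
  proof (cases x)
   case (Pad b)
   then show ?thesis using n[of "Base Phi"] by (simp add: fst_gadget)
  next
   case (Base b)
   then show ?thesis
    using x n[of "Base (Lit u True)"] n[of "Base (Lit v (~ c))" for v c] u
    by (cases b) (force simp: ext_CO_def fst_gadget)+
  qed
 qed (use isolated(1) in \<open>auto simp: Def_ext_CO snd_gadget\<close>)
 show "ext_CO \<subseteq> fst F1" by (auto simp: ext_CO_def)
qed (simp add: Def_ext_CO)

definition ext_known :: "semantics => ('v, 'c) arg set" where
 "ext_known \<sigma> = (if \<sigma> = CO then ext_CO else ext_ST)"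

text \<open>For complete semantics the given labelling is the grounded one: all complete labellings
  agree with it on the isolated arguments, and a stable one differs from it everywhere else, so it
  is farthest. For stable semantics the given labelling accepts the pads; they stay accepted without
  \<open>Phi\<close> and are all rejected with it.\<close>

lemma gadget1_correct:
 assumes \<sigma>: "\<sigma> \<in> {CO, ST}"
 defines "x \<equiv> (F1, Base Goal, labelling_of F1 (ext_known \<sigma>), Base Phi)"
 shows "x \<in> SF_CA_inputs \<sigma>" "x \<in> SF_CA_yes \<sigma> <-> (\<exists>\<alpha>. ~ \<alpha> u & (\<forall>c\<in>C. satisfies \<alpha> (lit c)))"
proof -
 have af: "is_af F1" by (rule is_af_gadget[OF fin])
 have gk: "Base Goal \<in> fst F1" "Base Phi \<in> fst F1" by (simp_all add: fst_gadget)
 have E: "extension \<sigma> F1 (ext_known \<sigma>)"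
  using \<sigma> complete_ext_CO stable_ext1 by (auto simp: ext_known_def ext_ST_def)
 note yes = yes_iff[OF af gk E, folded x_def]
 show "x \<in> SF_CA_inputs \<sigma>" by (rule yes(1))
 have goal: "labelling_of F1 (ext_known \<sigma>) (Base Goal) = labelling_of F1 T (Base Goal)" if "extension \<sigma> F1 T" for T
  using Goal_in_complete1[OF extension_complete[OF that]] Goal_in_complete1[OF extension_complete[OF E]]
  by (simp add: labelling_of_def fst_gadget)
 show "x \<in> SF_CA_yes \<sigma> <-> (\<exists>\<alpha>. ~ \<alpha> u & (\<forall>c\<in>C. satisfies \<alpha> (lit c)))"
 proof
  assume "x \<in> SF_CA_yes \<sigma>"
  then obtain T where "extension \<sigma> F1 T" "Base Phi \<in> T" using yes(2) by blast
  then show "\<exists>\<alpha>. ~ \<alpha> u & (\<forall>c\<in>C. satisfies \<alpha> (lit c))" using Phi_imp_sat extension_complete by blast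
 next
  assume "\<exists>\<alpha>. ~ \<alpha> u & (\<forall>c\<in>C. satisfies \<alpha> (lit c))"
  then obtain \<alpha> where \<alpha>: "~ \<alpha> u" "\<And>c. c \<in> C ==> satisfies \<alpha> (lit c)" by blast
  let ?T = "ext1 \<alpha>"
  have T: "extension \<sigma> F1 ?T" using \<sigma> stable_ext1[of \<alpha>] by (auto simp: stable_iff)
  have k: "Base Phi \<in> ?T" using \<alpha> by (simp add: ext1_def fst_gadget)
  show "x \<in> SF_CA_yes \<sigma>"
  proof (rule yes(3)[OF T goal[OF T] k])
   fix U assume U: "extension \<sigma> F1 U" "Base Phi \<notin> U"
   let ?L = "labelling_of F1 (ext_known \<sigma>)"
   show "distance F1 ?L (labelling_of F1 U) <= distance F1 ?L (labelling_of F1 ?T)"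
   proof (cases "\<sigma> = CO")
    case True
    show ?thesis unfolding distance_def
    proof (rule card_mono)
     show "finite {a \<in> fst F1. ?L a ~= labelling_of F1 ?T a}" using af by (auto simp: is_af_def split: prod.splits)
     have "?L a ~= labelling_of F1 ?T a" if a: "a \<in> fst F1" "?L a ~= labelling_of F1 U a" for a
     proof -
      have "a \<notin> ext_CO"
      proof
       assume ai: "a \<in> ext_CO"
       have "a \<in> U" by (rule completeD(4)[OF extension_complete[OF U(1)] a(1)]) (use ai isolated in \<open>auto simp: snd_gadget\<close>)
       then show False using a ai True by (simp add: labelling_of_def ext_known_def)
      qed
      then have "?L a = Und" using a(1) True by (simp add: labelling_of_def ext_known_def Def_ext_CO)
      moreover have "labelling_of F1 ?T a ~= Und" using a(1) by (simp add: labelling_of_def Def_ext1)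
      ultimately show ?thesis by simp
     qed
     then show "{a \<in> fst F1. ?L a ~= labelling_of F1 U a} \<subseteq> {a \<in> fst F1. ?L a ~= labelling_of F1 ?T a}" by blast
    qed
   next
    case False
    then have st: "\<sigma> = ST" using \<sigma> by simp
    have Lp: "?L (Pad b) = In" if "b \<in> basic_args" for b
     using that False by (simp add: labelling_of_def ext_known_def ext_ST_def ext1_def fst_gadget)
    have "distance F1 ?L (labelling_of F1 U) <= card basic_args"
    proof (rule distance_no_pads)
     fix b assume b: "b \<in> basic_args"
     have "Base Phi \<in> Def F1 U" using U st gk by (auto simp: stable_iff)
     then have "Pad b \<in> U"
      by (intro completeD(4)[OF extension_complete[OF U(1)]])
       (use b in \<open>auto simp: fst_gadget snd_gadget\<close>)
     then show "?L (Pad b) = labelling_of F1 U (Pad b)" using Lp[OF b] b by (simp add: labelling_of_def fst_gadget)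
    qed
    also have "\<dots> <= distance F1 ?L (labelling_of F1 ?T)"
    proof (rule distance_pads)
     fix b assume b: "b \<in> basic_args"
     have "Pad b \<notin> ?T" using \<alpha> by (auto simp: ext1_def)
     then show "?L (Pad b) ~= labelling_of F1 ?T (Pad b)" using Lp[OF b] b by (auto simp: labelling_of_def fst_gadget)
    qed
    finally show ?thesis .
   qed
  qed
 qed
qed

subsection \<open>Preferred and semi-stable semantics\<close>

context
 fixes ex :: "'v => bool" and outer :: "'c => bool"
 assumes ex_u: "ex u" and outer_subset: "\<Union> (lit ` {c \<in> C. outer c}) \<subseteq> Collect ex \<times> UNIV"
begin

lemma outer_ex: "c \<in> C ==> outer c ==> (v, b) \<in> lit c ==> ex v"
 using outer_subset by blast

abbreviation "beats \<equiv> att2 u lit ex outer"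
abbreviation "F2 \<equiv> gadget V C beats"

lemma fst_F2: "x \<in> fst F2 <-> (case x of Base b => b \<in> basic_args | Pad b => b \<in> basic_args)"
 by (rule fst_gadget)

lemma mem_Def2: "x \<in> Def F2 S <-> x \<in> fst F2 & (\<exists>y\<in>S. y \<in> fst F2 & beats y x)"
 unfolding Def_eq by (auto simp: snd_gadget)

lemma complete2D:
 assumes "complete_ext F2 S"
 shows "x \<in> S ==> x \<in> fst F2"
  "x \<in> S ==> y \<in> S ==> ~ beats y x"
  "x \<in> S ==> y \<in> fst F2 ==> beats y x ==> \<exists>z\<in>S. beats z y"
  "x \<in> fst F2 ==> (\<And>y. y \<in> fst F2 ==> beats y x ==> \<exists>z\<in>S. beats z y) ==> x \<in> S"
proof -
 note cd = completeD[OF assms]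
 show m: "x \<in> fst F2" if "x \<in> S" for x using cd(1) that by blast
 show "~ beats y x" if "x \<in> S" "y \<in> S"
  using cd(2)[OF that(1)] that m by (auto simp: mem_Def2)
 show "\<exists>z\<in>S. beats z y" if "x \<in> S" "y \<in> fst F2" "beats y x"
  using cd(3)[OF that(1), of y] that m by (auto simp: mem_Def2 snd_gadget)
 show "x \<in> S" if "x \<in> fst F2" "\<And>y. y \<in> fst F2 ==> beats y x ==> \<exists>z\<in>S. beats z y"
  by (rule cd(4)[OF that(1)]) (use that(2) m in \<open>auto simp: mem_Def2 snd_gadget\<close>)
qed

lemma no_self_attack:
 assumes "complete_ext F2 S"
 shows "Base Block \<notin> S" "Base Goal \<notin> S" "Base (Range v b) \<notin> S"
 using complete2D(2)[OF assms] by fastforce+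

lemma consistent2:
 assumes "complete_ext F2 S" "Base (Lit v b) \<in> S"
 shows "Base (Lit v (~ b)) \<notin> S"
 using complete2D(2)[OF assms(1) assms(2), of "Base (Lit v (~ b))"] by auto

text \<open>Beyond the literals the attacks proceed without cycles, apart from self-attackers, which
  are never accepted: outer clauses, inner clauses, \<open>Phi\<close>, \<open>NegPhi\<close>,
  \<open>Escape\<close>, and the pads directly from the literal of u. Along this order acceptance is
  monotone in the accepted literals.\<close>

lemma literals_determine:
 assumes S: "complete_ext F2 S" and T: "complete_ext F2 T"
  and sub: "\<And>v b. Base (Lit v b) \<in> S ==> Base (Lit v b) \<in> T"
 shows "S \<subseteq> T"
proof
 note S' = complete2D[OF S] and T' = complete2D[OF T]
 \<comment> \<open>A literal is attacked by its opposite and possibly by \<open>Block\<close>; the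
   latter is never accepted, so only a literal can attack from S.\<close>
 have lit_att: "\<exists>z\<in>T. beats z (Base (Lit v b))"
  if "\<exists>z\<in>S. beats z (Base (Lit v b))" for v b
  using that sub no_self_attack[OF S] by auto
 have outer: "Base (Cl c) \<in> T" if c: "Base (Cl c) \<in> S" and o: "outer c" for c
 proof (rule T'(4))
  show "Base (Cl c) \<in> fst F2" using S'(1)[OF c] .
  fix y assume y: "y \<in> fst F2" "beats y (Base (Cl c))"
  then obtain v b where "y = Base (Lit v b)" using o by auto
  then show "\<exists>z\<in>T. beats z y" using S'(3)[OF c y] lit_att by blast
 qed
 have cl_att: "\<exists>z\<in>T. beats z (Base (Cl c))"
  if e: "\<exists>z\<in>S. beats z (Base (Cl c))" for c
 proof -
  obtain z where z: "z \<in> S" "beats z (Base (Cl c))" using e by blast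
  then consider v b where "z = Base (Lit v b)" | c' where "z = Base (Cl c')" "outer c'" by auto
  then have "z \<in> T" by cases (use z(1) sub outer in blast)+
  with z(2) show ?thesis by blast
 qed
 have cl: "Base (Cl c) \<in> T" if c: "Base (Cl c) \<in> S" for c
 proof (rule T'(4))
  show "Base (Cl c) \<in> fst F2" using S'(1)[OF c] .
  fix y assume y: "y \<in> fst F2" "beats y (Base (Cl c))"
  then consider v b where "y = Base (Lit v b)" | c' where "y = Base (Cl c')" by auto
  then show "\<exists>z\<in>T. beats z y"
   by cases (use S'(3)[OF c y] lit_att cl_att in blast)+
 qed
 have phi: "Base Phi \<in> T" if p: "Base Phi \<in> S"
 proof (rule T'(4)[OF S'(1)[OF p]])
  fix y assume y: "y \<in> fst F2" "beats y (Base Phi)"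
  then have "\<exists>c. y = Base (Cl c)" by auto
  then show "\<exists>z\<in>T. beats z y" using S'(3)[OF p y] cl_att by blast
 qed
 have phi_att: "\<exists>z\<in>T. beats z (Base Phi)" if "\<exists>z\<in>S. beats z (Base Phi)"
  using that cl by auto
 have neg: "Base NegPhi \<in> T" if p: "Base NegPhi \<in> S"
 proof (rule T'(4)[OF S'(1)[OF p]])
  fix y assume y: "y \<in> fst F2" "beats y (Base NegPhi)"
  then have "y = Base Phi" by auto
  then show "\<exists>z\<in>T. beats z y" using S'(3)[OF p y] phi_att by blast
 qed
 have neg_att: "\<exists>z\<in>T. beats z (Base NegPhi)" if "\<exists>z\<in>S. beats z (Base NegPhi)"
  using that phi by auto
 have esc: "Base Escape \<in> T" if p: "Base Escape \<in> S"
 proof (rule T'(4)[OF S'(1)[OF p]])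
  fix y assume y: "y \<in> fst F2" "beats y (Base Escape)"
  then have "y = Base (Lit u True) \<or> y = Base NegPhi" by auto
  then show "\<exists>z\<in>T. beats z y" using S'(3)[OF p y] lit_att neg_att by blast
 qed
 have pad: "Pad b \<in> T" if p: "Pad b \<in> S" for b
 proof (rule T'(4)[OF S'(1)[OF p]])
  fix y assume y: "y \<in> fst F2" "beats y (Pad b)"
  then have "y = Base (Lit u True)" by auto
  then show "\<exists>z\<in>T. beats z y" using S'(3)[OF p y] lit_att by blast
 qed
 fix x assume x: "x \<in> S"
 show "x \<in> T"
 proof (cases x)
  case (Base b)
  then show ?thesis using x sub cl phi neg esc no_self_attack[OF S] by (cases b) auto
 qed (use x pad in auto)
qed

text \<open>A \<open>Range\<close> argument lies in the range of an extension only if its literal is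
  accepted. So a larger range contains all literals of S, hence all of S, which is impossible above
  a preferred extension.\<close>

lemma preferred_semi_stable: "semi_stable_ext F2 S <-> preferred_ext F2 S"
proof
 assume S: "preferred_ext F2 S"
 have "~ S \<union> Def F2 S \<subset> T \<union> Def F2 T" if T: "preferred_ext F2 T" for T
 proof
  assume sub: "S \<union> Def F2 S \<subset> T \<union> Def F2 T"
  have c: "complete_ext F2 S" "complete_ext F2 T" using S T by (auto simp: preferred_ext_def)
  have "S \<subseteq> T"
  proof (rule literals_determine[OF c])
   fix v b assume l: "Base (Lit v b) \<in> S"
   have "v \<in> V" using complete2D(1)[OF c(1) l] by (simp add: fst_F2)
   then have "Base (Range v b) \<in> Def F2 S"
    unfolding mem_Def2 using l by (auto simp: fst_F2 intro!: bexI[of _ "Base (Lit v b)"])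
   then have "Base (Range v b) \<in> Def F2 T" using sub no_self_attack[OF c(2)] by blast
   then show "Base (Lit v b) \<in> T" unfolding mem_Def2 using no_self_attack[OF c(2)] by auto
  qed
  then have "S = T" using S c unfolding preferred_ext_def by blast
  with sub show False by blast
 qed
 with S show "semi_stable_ext F2 S" unfolding semi_stable_ext_def by iprover
qed (simp add: semi_stable_ext_def)

text \<open>The condition under which a total assignment defends \<open>Phi\<close>: u attacks all
  clauses, or a violated outer clause attacks the inner ones, or all inner clauses are
  satisfied.\<close>

definition phi_holds :: "('v => bool) => bool" where
 "phi_holds \<gamma> <-> \<gamma> u \<or> (\<exists>c\<in>C. outer c & ~ satisfies \<gamma> (lit c)) \<or> (\<forall>c\<in>C. outer c \<or> satisfies \<gamma> (lit c))"

definition ext2 :: "('v => bool) => ('v, 'c) arg set" where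
 "ext2 \<gamma> = {x \<in> fst F2. case x of
   Base (Lit v b) => \<gamma> v = b
  | Base (Cl c) => outer c & ~ \<gamma> u & ~ satisfies \<gamma> (lit c)
  | Base Phi => True
  | Base Escape => ~ \<gamma> u
  | Pad x => ~ \<gamma> u
  | _ => False}"

lemma mem_ext2 [simp]:
 "Base (Lit v b) \<in> ext2 \<gamma> <-> v \<in> V & \<gamma> v = b"
 "Base (Cl c) \<in> ext2 \<gamma> <-> c \<in> C & outer c & ~ \<gamma> u & ~ satisfies \<gamma> (lit c)"
 "Base Phi \<in> ext2 \<gamma>" "Base Escape \<in> ext2 \<gamma> <-> ~ \<gamma> u" "Pad x \<in> ext2 \<gamma> <-> x \<in> basic_args & ~ \<gamma> u"
 "Base NegPhi \<notin> ext2 \<gamma>" "Base Block \<notin> ext2 \<gamma>" "Base Goal \<notin> ext2 \<gamma>" "Base (Range v b) \<notin> ext2 \<gamma>"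
 by (auto simp: ext2_def fst_F2)

lemma Def_ext2 [simp]:
 assumes "phi_holds \<gamma>"
 shows "Base (Lit v b) \<in> Def F2 (ext2 \<gamma>) <-> v \<in> V & \<gamma> v ~= b"
  "Base (Cl c) \<in> Def F2 (ext2 \<gamma>) <-> c \<in> C & (\<gamma> u \<or> satisfies \<gamma> (lit c) \<or> ~ outer c)"
  "Base Phi \<notin> Def F2 (ext2 \<gamma>)" "Base NegPhi \<in> Def F2 (ext2 \<gamma>)" "Base Block \<in> Def F2 (ext2 \<gamma>)"
  "Base Escape \<in> Def F2 (ext2 \<gamma>) <-> \<gamma> u" "Base Goal \<in> Def F2 (ext2 \<gamma>) <-> ~ \<gamma> u"
  "Pad x \<in> Def F2 (ext2 \<gamma>) <-> x \<in> basic_args & \<gamma> u"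
  "Base (Range v b) \<in> Def F2 (ext2 \<gamma>) <-> v \<in> V & \<gamma> v = b"
proof -
 have s: "y \<in> ext2 \<gamma> ==> y \<in> fst F2" for y by (auto simp: ext2_def)
 have D: "x \<in> Def F2 (ext2 \<gamma>) <-> x \<in> fst F2 & (\<exists>y. y \<in> ext2 \<gamma> & beats y x)" for x
  unfolding mem_Def2 using s by blast
 show "Base (Cl c) \<in> Def F2 (ext2 \<gamma>) <-> c \<in> C & (\<gamma> u \<or> satisfies \<gamma> (lit c) \<or> ~ outer c)"
 proof (cases "c \<in> C")
  case True
  have "(\<exists>y. y \<in> ext2 \<gamma> & beats y (Base (Cl c))) <->
    (\<exists>v b. v \<in> V & \<gamma> v = b & ((v, b) \<in> lit c \<or> v = u & b)) \<or>
    (\<exists>c'\<in>C. outer c' & ~ \<gamma> u & ~ satisfies \<gamma> (lit c') & ~ outer c)" (is "?L <-> ?R1 \<or> ?R2")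
  proof
   assume ?L
   then obtain y where y: "y \<in> ext2 \<gamma>" "beats y (Base (Cl c))" by blast
   from y(2) consider v b where "y = Base (Lit v b)" "(v, b) \<in> lit c \<or> v = u & b"
    | c' where "y = Base (Cl c')" "outer c'" "~ outer c" by auto
   then show "?R1 \<or> ?R2"
   proof cases
    case 1
    then show ?thesis using y(1) by auto
   next
    case 2
    then show ?thesis using y(1) by auto
   qed
  next
   assume "?R1 \<or> ?R2"
   then show ?L
   proof
    assume ?R1
    then obtain v where "v \<in> V" "(v, \<gamma> v) \<in> lit c \<or> v = u & \<gamma> v" by blast
    then show ?L by (intro exI[of _ "Base (Lit v (\<gamma> v))"]) simp
   next
    assume ?R2
    then obtain c' where "c' \<in> C" "outer c'" "~ \<gamma> u" "~ satisfies \<gamma> (lit c')" "~ outer c" by blast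
    then show ?L by (intro exI[of _ "Base (Cl c')"]) simp
   qed
  qed
  also have "(\<exists>v b. v \<in> V & \<gamma> v = b & ((v, b) \<in> lit c \<or> v = u & b)) <-> \<gamma> u \<or> satisfies \<gamma> (lit c)"
   using lit[OF True] u by (auto simp: satisfies_def)
  finally show ?thesis using True assms unfolding D phi_holds_def by (auto simp: fst_F2)
 qed (simp add: D fst_F2)
 show "Base (Lit v b) \<in> Def F2 (ext2 \<gamma>) <-> v \<in> V & \<gamma> v ~= b"
  "Base Phi \<notin> Def F2 (ext2 \<gamma>)" "Base NegPhi \<in> Def F2 (ext2 \<gamma>)" "Base Block \<in> Def F2 (ext2 \<gamma>)"
  "Base Escape \<in> Def F2 (ext2 \<gamma>) <-> \<gamma> u" "Base Goal \<in> Def F2 (ext2 \<gamma>) <-> ~ \<gamma> u"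
  "Pad x \<in> Def F2 (ext2 \<gamma>) <-> x \<in> basic_args & \<gamma> u"
  "Base (Range v b) \<in> Def F2 (ext2 \<gamma>) <-> v \<in> V & \<gamma> v = b"
  unfolding D using u by (auto simp: fst_F2 conj_disj_distribL ex_disj_distrib)
qed

lemma complete_ext2:
 assumes "phi_holds \<gamma>"
 shows "complete_ext F2 (ext2 \<gamma>)"
proof (rule completeI)
 show "ext2 \<gamma> \<subseteq> fst F2" by (auto simp: ext2_def)
 show "x \<notin> Def F2 (ext2 \<gamma>)" if "x \<in> ext2 \<gamma>" for x
 proof (cases x)
  case (Base b)
  then show ?thesis using that assms by (cases b) auto
 qed (use that assms in auto)
 show "x \<in> ext2 \<gamma> <-> (\<forall>y. (y, x) \<in> snd F2 --> y \<in> Def F2 (ext2 \<gamma>))" if x: "x \<in> fst F2" for x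
 proof -
  have e: "(\<forall>y. (y, x) \<in> snd F2 --> y \<in> Def F2 (ext2 \<gamma>)) <->
    (\<forall>y. beats y x --> y \<in> fst F2 --> y \<in> Def F2 (ext2 \<gamma>))" if "x \<in> fst F2" for x
   using that by (auto simp: snd_gadget)
  show ?thesis
  proof (cases x)
   case (Pad b)
   then show ?thesis unfolding e[OF x] using x u assms by (auto simp: fst_F2)
  next
   case (Base b)
   show ?thesis
   proof (cases b)
    case (Cl c)
    have c: "c \<in> C" using x Base Cl by (simp add: fst_F2)
    have "(\<forall>y. beats y x --> y \<in> fst F2 --> y \<in> Def F2 (ext2 \<gamma>)) <->
      (\<forall>v b. (v, b) \<in> lit c \<or> v = u & b --> v \<in> V --> \<gamma> v ~= b) &
      (\<forall>c'\<in>C. outer c' & ~ outer c --> \<gamma> u \<or> satisfies \<gamma> (lit c'))"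
    proof (intro iffI conjI allI ballI impI)
     fix v b
     assume *: "\<forall>y. beats y x --> y \<in> fst F2 --> y \<in> Def F2 (ext2 \<gamma>)"
      and "(v, b) \<in> lit c \<or> v = u & b" "v \<in> V"
     then have "Base (Lit v b) \<in> Def F2 (ext2 \<gamma>)"
      by (intro *[rule_format]) (auto simp: Base Cl fst_F2)
     then show "\<gamma> v ~= b" using assms by simp
    next
     fix c'
     assume *: "\<forall>y. beats y x --> y \<in> fst F2 --> y \<in> Def F2 (ext2 \<gamma>)"
      and "c' \<in> C" "outer c' & ~ outer c"
     then have "Base (Cl c') \<in> Def F2 (ext2 \<gamma>)"
      by (intro *[rule_format]) (auto simp: Base Cl fst_F2)
     then show "\<gamma> u \<or> satisfies \<gamma> (lit c')" using assms \<open>outer c' & ~ outer c\<close> by simp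
    next
     fix y
     assume *: "(\<forall>v b. (v, b) \<in> lit c \<or> v = u & b --> v \<in> V --> \<gamma> v ~= b) &
      (\<forall>c'\<in>C. outer c' & ~ outer c --> \<gamma> u \<or> satisfies \<gamma> (lit c'))"
      and y: "beats y x" "y \<in> fst F2"
     from y(1) consider v b where "y = Base (Lit v b)" "(v, b) \<in> lit c \<or> v = u & b"
      | c' where "y = Base (Cl c')" "outer c'" "~ outer c" by (auto simp: Base Cl)
     then show "y \<in> Def F2 (ext2 \<gamma>)"
     proof cases
      case 1
      then have v: "v \<in> V" using y(2) by (simp add: fst_F2)
      then have "\<gamma> v ~= b" using * 1(2) by blast
      then show ?thesis using 1(1) v assms by simp
     next
      case 2
      then show ?thesis using * y(2) assms by (simp add: fst_F2)
     qed
    qed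
    also have "(\<forall>v b. (v, b) \<in> lit c \<or> v = u & b --> v \<in> V --> \<gamma> v ~= b) <-> ~ \<gamma> u & ~ satisfies \<gamma> (lit c)"
     using lit[OF c] u by (auto simp: satisfies_def)
    finally show ?thesis unfolding e[OF x] using c assms by (auto simp: Base Cl phi_holds_def)
   qed (use x u assms in \<open>auto simp: e Base fst_F2 imp_disjL all_conj_distrib imp_conjL\<close>)
  qed
 qed
qed

text \<open>For each variable one literal is already accepted, so by consistency a larger complete
  extension has no further literals and, being determined by them, nothing else either.\<close>

lemma preferred_ext2:
 assumes "phi_holds \<gamma>"
 shows "preferred_ext F2 (ext2 \<gamma>)"
proof -
 note c = complete_ext2[OF assms]
 have "~ ext2 \<gamma> \<subset> T" if T: "complete_ext F2 T" for T
 proof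
  assume sub: "ext2 \<gamma> \<subset> T"
  have "T \<subseteq> ext2 \<gamma>"
  proof (rule literals_determine[OF T c])
   fix v b assume l: "Base (Lit v b) \<in> T"
   then have "v \<in> V" using complete2D(1)[OF T l] by (simp add: fst_F2)
   moreover have "Base (Lit v (~ b)) \<notin> ext2 \<gamma>" using consistent2[OF T l] sub by blast
   ultimately show "Base (Lit v b) \<in> ext2 \<gamma>" by auto
  qed
  with sub show False by blast
 qed
 with c show ?thesis unfolding preferred_ext_def by iprover
qed

definition sigma2_true :: bool where
 "sigma2_true <-> (\<exists>\<alpha>. ~ \<alpha> u & (\<forall>c\<in>C. outer c --> satisfies \<alpha> (lit c)) &
   (\<forall>\<beta>. (\<forall>v. ex v --> \<beta> v = \<alpha> v) --> ~ (\<forall>c\<in>C. ~ outer c --> satisfies \<beta> (lit c))))"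

text \<open>Without \<open>Phi\<close> the universal literals stay blocked, so the extension fixes
  existential variables only. If the formula were false, its existential part could be completed to
  a total assignment that defends \<open>Phi\<close>, and the resulting extension would be strictly
  larger.\<close>

lemma preferred_without_Phi:
 assumes E: "preferred_ext F2 E" and phi: "Base Phi \<notin> E" and nu: "Base (Lit u False) \<in> E"
 shows sigma2_true
proof (rule ccontr)
 assume "~ sigma2_true"
 define \<alpha> where "\<alpha> v <-> Base (Lit v True) \<in> E" for v
 have c: "complete_ext F2 E" using E by (simp add: preferred_ext_def)
 have au: "~ \<alpha> u" using consistent2[OF c nu] by (simp add: \<alpha>_def)
 have "\<exists>\<gamma>. (\<forall>v. ex v --> \<gamma> v = \<alpha> v) & phi_holds \<gamma>"
 proof (cases "\<forall>c\<in>C. outer c --> satisfies \<alpha> (lit c)")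
  case True
  have "\<exists>\<beta>. (\<forall>v. ex v --> \<beta> v = \<alpha> v) & (\<forall>c\<in>C. ~ outer c --> satisfies \<beta> (lit c))"
  proof (rule ccontr)
   assume none: "~ ?thesis"
   have sigma2_true unfolding sigma2_true_def by (intro exI[of _ \<alpha>] conjI au True) (use none in iprover)
   with \<open>~ sigma2_true\<close> show False ..
  qed
  then obtain \<beta> where "\<forall>v. ex v --> \<beta> v = \<alpha> v" "\<forall>c\<in>C. ~ outer c --> satisfies \<beta> (lit c)"
   by (elim exE conjE)
  then show ?thesis by (intro exI[of _ \<beta>]) (auto simp: phi_holds_def)
 next
  case False
  then show ?thesis by (intro exI[of _ \<alpha>]) (auto simp: phi_holds_def)
 qed
 then obtain \<gamma> where g: "\<forall>v. ex v --> \<gamma> v = \<alpha> v" "phi_holds \<gamma>"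
  by (elim exE conjE)
 have "E \<subseteq> ext2 \<gamma>"
 proof (rule literals_determine[OF c complete_ext2[OF g(2)]])
  fix v b assume l: "Base (Lit v b) \<in> E"
  have v: "v \<in> V" using complete2D(1)[OF c l] by (simp add: fst_F2)
  have "ex v"
  proof (rule ccontr)
   assume "~ ex v"
   then obtain z where "z \<in> E" "beats z (Base Block)"
    using complete2D(3)[OF c l, of "Base Block"] by (auto simp: fst_F2)
   then show False using phi no_self_attack[OF c] by auto
  qed
  moreover have "\<alpha> v = b"
   using l consistent2[OF c l] by (cases b) (auto simp: \<alpha>_def)
  ultimately show "Base (Lit v b) \<in> ext2 \<gamma>" using v g(1) by simp
 qed
 moreover have "Base Phi \<in> ext2 \<gamma>" by simp
 ultimately have "E \<subset> ext2 \<gamma>" using phi by blast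
 then show False using E complete_ext2[OF g(2)] unfolding preferred_ext_def by iprover
qed

text \<open>The existential literals of \<alpha> form an admissible set, and a preferred extension
  above it cannot accept \<open>Phi\<close>: some inner clause is violated by the assignment it
  induces, and no accepted argument attacks that clause, since the outer clauses are all attacked by
  accepted literals.\<close>

lemma Phi_free_preferred:
 assumes sigma2_true
 shows "\<exists>E. preferred_ext F2 E & Base (Lit u False) \<in> E & Base Phi \<notin> E"
proof -
 obtain \<alpha> where nu: "~ \<alpha> u" and o: "\<forall>c\<in>C. outer c --> satisfies \<alpha> (lit c)"
  and i: "\<forall>\<beta>. (\<forall>v. ex v --> \<beta> v = \<alpha> v) --> ~ (\<forall>c\<in>C. ~ outer c --> satisfies \<beta> (lit c))"
  using assms unfolding sigma2_true_def by (elim exE conjE)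
 define S where "S = {Base (Lit v (\<alpha> v)) :: ('v, 'c) arg | v. v \<in> V & ex v}"
 have S: "Base (Lit v b) \<in> S <-> v \<in> V & ex v & b = \<alpha> v" for v b by (auto simp: S_def)
 have sub: "S \<subseteq> fst F2" by (auto simp: S_def fst_F2)
 have att: "\<exists>v b. x = Base (Lit v (~ b)) & y = Base (Lit v b) & b = \<alpha> v & y \<in> S"
  if "y \<in> S" "beats x y" for x y
  using that by (auto simp: S_def)
 have "admissible F2 S"
  unfolding admissible_def conflict_free_def
 proof
  show "S \<inter> Def F2 S = {}"
  proof (rule ccontr)
   assume "S \<inter> Def F2 S ~= {}"
   then obtain x y where "y \<in> S" "x \<in> S" "beats x y" unfolding mem_Def2 disjoint_iff by blast
   then show False using att[of y x] S by auto
  qed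
  show "S \<subseteq> Acc F2 S"
  proof
   fix y assume y: "y \<in> S"
   have "x \<in> Def F2 S" if "(x, y) \<in> snd F2" for x
   proof -
    obtain v b where "x = Base (Lit v (~ b))" "y = Base (Lit v b)"
     using att[OF y, of x] \<open>(x, y) \<in> snd F2\<close> by (auto simp: snd_gadget)
    then show ?thesis using that y sub unfolding mem_Def2
     by (auto simp: snd_gadget intro!: bexI[of _ y])
   qed
   then show "y \<in> Acc F2 S" using y sub by (auto simp: Acc_eq)
  qed
 qed
 then obtain E where E: "preferred_ext F2 E" "S \<subseteq> E"
  using admissible_in_preferred[OF is_af_gadget[OF fin] sub] by blast
 have c: "complete_ext F2 E" using E(1) by (simp add: preferred_ext_def)
 have u': "Base (Lit u False) \<in> E" using E(2) S u ex_u nu by auto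
 have "Base Phi \<notin> E"
 proof
  assume phi: "Base Phi \<in> E"
  \<comment> \<open>Outside V the values are taken from \<alpha>, because agreement is demanded for
    all existential variables, not only those in V.\<close>
  define \<beta> where "\<beta> v <-> (if v \<in> V then Base (Lit v True) \<in> E else \<alpha> v)" for v
  have \<beta>: "\<beta> v = b" if "Base (Lit v b) \<in> E" for v b
  proof -
   have "v \<in> V" using complete2D(1)[OF c that] by (simp add: fst_F2)
   then show ?thesis using that consistent2[OF c that] by (cases b) (simp_all add: \<beta>_def)
  qed
  have "\<beta> v = \<alpha> v" if "ex v" for v
  proof (cases "v \<in> V")
   case True
   then show ?thesis using \<beta>[of v "\<alpha> v"] S that E(2) by blast
  qed (simp add: \<beta>_def)
  then have "~ (\<forall>c\<in>C. ~ outer c --> satisfies \<beta> (lit c))" by (intro i[rule_format]) simp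
  then obtain d where d: "d \<in> C" "~ outer d" "~ satisfies \<beta> (lit d)" by blast
  obtain z where z: "z \<in> E" "beats z (Base (Cl d))"
   using complete2D(3)[OF c phi, of "Base (Cl d)"] d by (auto simp: fst_F2)
  from z(2) consider v b where "z = Base (Lit v b)" "(v, b) \<in> lit d" | "z = Base (Lit u True)"
   | c' where "z = Base (Cl c')" "outer c'" by auto
  then show False
  proof cases
   case 1
   then show False using \<beta> z(1) d(3) by (auto simp: satisfies_def)
  next
   case 2
   then show False using z(1) consistent2[OF c u'] by simp
  next
   case (3 c')
   have c': "c' \<in> C" using complete2D(1)[OF c z(1)] 3(1) by (simp add: fst_F2)
   obtain v where v: "(v, \<alpha> v) \<in> lit c'" using o c' 3(2) by (auto simp: satisfies_def)
   have "Base (Lit v (\<alpha> v)) \<in> E" using lit[OF c' v] outer_ex[OF c' 3(2) v] S E(2) by blast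
   then show False using complete2D(2)[OF c z(1)] 3(1) v by auto
  qed
 qed
 with E(1) u' show ?thesis by blast
qed

text \<open>Since u is existential, \<open>Block\<close> does not attack its literals; if the
  negative literal is not accepted, the positive one can be added to an admissible set, which a
  preferred extension does not permit.\<close>

lemma preferred_decides:
 assumes U: "preferred_ext F2 U" and nu: "Base (Lit u False) \<notin> U"
 shows "Base (Lit u True) \<in> U"
proof (rule ccontr)
 assume not_in: "Base (Lit u True) \<notin> U"
 have c: "complete_ext F2 U" using U by (simp add: preferred_ext_def)
 let ?l = "Base (Lit u True) :: ('v, 'c) arg"
 have sub: "insert ?l U \<subseteq> fst F2" using complete2D(1)[OF c] u by (auto simp: fst_F2)
 have att: "x = Base (Lit u False)" if "beats x ?l" for x using that ex_u by simp
 have free: "~ beats ?l y" if "y \<in> U" for y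
  using complete2D(3)[OF c that, of ?l] att nu sub by blast
 have "admissible F2 (insert ?l U)"
  unfolding admissible_def conflict_free_def
 proof
  have "~ beats x y" if "x \<in> insert ?l U" "y \<in> insert ?l U" for x y
   using that complete2D(2)[OF c] free att nu by blast
  then show "insert ?l U \<inter> Def F2 (insert ?l U) = {}" unfolding disjoint_iff mem_Def2 by blast
  show "insert ?l U \<subseteq> Acc F2 (insert ?l U)"
  proof
   fix y assume y: "y \<in> insert ?l U"
   have "x \<in> Def F2 (insert ?l U)" if x: "(x, y) \<in> snd F2" for x
   proof (cases "y \<in> U")
    case True
    then show ?thesis using completeD(3)[OF c True x] unfolding mem_Def2 by blast
   next
    case False
    then have "x = Base (Lit u False)" using x y att by (auto simp: snd_gadget)
    then show ?thesis using x sub unfolding mem_Def2 by (auto simp: snd_gadget)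
   qed
   then show "y \<in> Acc F2 (insert ?l U)" using y sub by (auto simp: Acc_eq)
  qed
 qed
 then obtain E where "preferred_ext F2 E" "insert ?l U \<subseteq> E"
  using admissible_in_preferred[OF is_af_gadget[OF fin] sub] by blast
 then have "complete_ext F2 E" "U \<subset> E" using not_in by (auto simp: preferred_ext_def)
 then show False using U unfolding preferred_ext_def by blast
qed

text \<open>With u true \<open>Escape\<close> is out and \<open>Goal\<close> undecided, as in the
  given labelling. With u false the goal keeps this label only if \<open>Escape\<close> is not
  accepted, that is, without \<open>Phi\<close>. Extensions lacking the target contain the positive
  literal of u and agree on all pads, whereas those with the target differ on all of them.\<close>

lemma gadget2_correct:
 assumes \<sigma>: "\<sigma> \<in> {PR, SST}"
 defines "x \<equiv> (F2, Base Goal, labelling_of F2 (ext2 (%_. True)), Base (Lit u False))"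
 shows "x \<in> SF_CA_inputs \<sigma>" "x \<in> SF_CA_yes \<sigma> <-> sigma2_true"
proof -
 let ?A = "ext2 (%_. True)" and ?L = "labelling_of F2 (ext2 (%_. True))"
 have af: "is_af F2" by (rule is_af_gadget[OF fin])
 have gk: "Base Goal \<in> fst F2" "Base (Lit u False) \<in> fst F2" using u by (simp_all add: fst_F2)
 have pref: "extension \<sigma> F2 T <-> preferred_ext F2 T" for T
  using \<sigma> preferred_semi_stable[of T] by (elim insertE emptyE) simp_all
 have true: "phi_holds (%_. True)" by (simp add: phi_holds_def)
 have E: "extension \<sigma> F2 ?A" unfolding pref by (rule preferred_ext2[OF true])
 note yes = yes_iff[OF af gk E, folded x_def]
 show "x \<in> SF_CA_inputs \<sigma>" by (rule yes(1))
 have LG: "?L (Base Goal) = Und" using gk Def_ext2(7)[OF true] by (simp add: labelling_of_def)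
 have goal: "?L (Base Goal) = labelling_of F2 T (Base Goal) <-> Base Escape \<notin> T" if "preferred_ext F2 T" for T
 proof -
  have c: "complete_ext F2 T" using that by (simp add: preferred_ext_def)
  have "Base Goal \<in> Def F2 T <-> Base Escape \<in> T"
   unfolding mem_Def2 using no_self_attack[OF c]
   by (auto simp: fst_F2 intro!: bexI[of _ "Base Escape"])
  then show ?thesis unfolding LG using no_self_attack[OF c] gk by (simp add: labelling_of_def)
 qed
 have Lp: "?L (Pad b) = Out" if "b \<in> basic_args" for b
  using that Def_ext2(8)[OF true] by (simp add: labelling_of_def fst_F2)
 show "x \<in> SF_CA_yes \<sigma> <-> sigma2_true"
 proof
  assume "x \<in> SF_CA_yes \<sigma>"
  then obtain T where T: "preferred_ext F2 T" "?L (Base Goal) = labelling_of F2 T (Base Goal)" "Base (Lit u False) \<in> T"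
   using yes(2) pref by blast
  have c: "complete_ext F2 T" using T(1) by (simp add: preferred_ext_def)
  have "Base Phi \<notin> T"
  proof
   assume phi: "Base Phi \<in> T"
   have "Base Escape \<in> T"
   proof (rule complete2D(4)[OF c])
    fix y assume "beats y (Base Escape)"
    then consider "y = Base (Lit u True)" | "y = Base NegPhi" by auto
    then show "\<exists>z\<in>T. beats z y"
    proof cases
     case 1
     then show ?thesis using T(3) by (intro bexI[of _ "Base (Lit u False)"]) auto
    next
     case 2
     then show ?thesis using phi by (intro bexI[of _ "Base Phi"]) auto
    qed
   qed (simp add: fst_F2)
   then show False using goal[OF T(1)] T(2) by blast
  qed
  then show sigma2_true by (rule preferred_without_Phi[OF T(1) _ T(3)])
 next
  assume sigma2_true
  then obtain T where T: "preferred_ext F2 T" "Base (Lit u False) \<in> T" "Base Phi \<notin> T"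
   using Phi_free_preferred by blast
  have c: "complete_ext F2 T" using T(1) by (simp add: preferred_ext_def)
  have "Base Escape \<notin> T"
  proof
   assume "Base Escape \<in> T"
   then obtain z where "z \<in> T" "beats z (Base NegPhi)"
    using complete2D(3)[OF c, of "Base Escape" "Base NegPhi"] by (auto simp: fst_F2)
   then show False using T(3) by simp
  qed
  then have g: "?L (Base Goal) = labelling_of F2 T (Base Goal)" using goal[OF T(1)] by blast
  have T': "extension \<sigma> F2 T" using T(1) pref by blast
  show "x \<in> SF_CA_yes \<sigma>"
  proof (rule yes(3)[OF T' g T(2)])
   fix U assume "extension \<sigma> F2 U" and nu: "Base (Lit u False) \<notin> U"
   then have U: "preferred_ext F2 U" by (simp add: pref)
   have cU: "complete_ext F2 U" using U by (simp add: preferred_ext_def)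
   have ut: "Base (Lit u True) \<in> U" by (rule preferred_decides[OF U nu])
   have "distance F2 ?L (labelling_of F2 U) <= card basic_args"
   proof (rule distance_no_pads)
    fix b assume b: "b \<in> basic_args"
    have d: "Pad b \<in> Def F2 U" unfolding mem_Def2 using ut b u
     by (auto simp: fst_F2 intro!: bexI[of _ "Base (Lit u True)"])
    then have "Pad b \<notin> U" using completeD(2)[OF cU] by blast
    then show "?L (Pad b) = labelling_of F2 U (Pad b)" using Lp[OF b] d b by (simp add: labelling_of_def fst_F2)
   qed
   also have "\<dots> <= distance F2 ?L (labelling_of F2 T)"
   proof (rule distance_pads)
    fix b assume b: "b \<in> basic_args"
    have "Pad b \<in> T"
     by (rule complete2D(4)[OF c])
      (use b T(2) in \<open>auto simp: fst_F2 intro!: bexI[of _ "Base (Lit u False)"]\<close>)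
    then show "?L (Pad b) ~= labelling_of F2 T (Pad b)" using Lp[OF b] b by (simp add: labelling_of_def fst_F2)
   qed
   finally show "distance F2 ?L (labelling_of F2 U) <= distance F2 ?L (labelling_of F2 T)" .
  qed
 qed
qed

end

end

section \<open>Writing down a framework\<close>

abbreviation tuples :: "nat => nat => nat list list" where
 "tuples n k \<equiv> List.n_lists k [0..<n]"

fun assign :: "nat list => nat list => (nat => bool list) => nat => bool list" where
 "assign (r # rs) (x # xs) u = (assign rs xs u)(r := ones x)"
| "assign _ _ u = u"

lemma assign_other [simp]: "r \<notin> set rs ==> assign rs xs u r = u r"
 by (induction rs xs u rule: assign.induct) auto

lemma assign_values: "distinct rs ==> length xs = length rs ==> map (%r. length (assign rs xs u r)) rs = xs"
proof (induction rs xs u rule: assign.induct)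
 case (1 r rs x xs u)
 have "map (%r'. length (((assign rs xs u)(r := ones x)) r')) rs = map (%r. length (assign rs xs u r)) rs"
  using 1 by (intro map_cong) auto
 then show ?case using 1 by (simp del: map_eq_conv)
qed auto

text \<open>The first register becomes the innermost loop, because \<open>List.n_lists\<close> lets
  the first component vary fastest.\<close>

fun loops :: "nat list => expr => expr => expr" where
 "loops [] b e = e"
| "loops (r # rs) b e = loops rs b (Sum r b e)"

lemma concat_map_concat: "concat (map f (concat xss)) = concat (map (%xs. concat (map f xs)) xss)"
 by (induction xss) auto

lemma eval_loops:
 assumes "regs b \<inter> set rs = {}" "distinct rs"
 shows "eval (loops rs b e) u = concat (map (%xs. eval e (assign rs xs u)) (tuples (num b u) (length rs)))"
 using assms
proof (induction rs arbitrary: e)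
 case (Cons r rs)
 have "eval (loops (r # rs) b e) u =
   concat (map (%xs. eval (Sum r b e) (assign rs xs u)) (tuples (num b u) (length rs)))"
  using Cons by simp
 also have "\<dots> = concat (map (%xs. concat (map (%x. eval e (assign (r # rs) (x # xs) u)) [0..<num b u]))
   (tuples (num b u) (length rs)))"
 proof (rule concat_map_cong)
  fix xs
  have "eval b (assign rs xs u) = eval b u" using Cons.prems by (intro eval_cong assign_other) auto
  then show "eval (Sum r b e) (assign rs xs u) = concat (map (%x. eval e (assign (r # rs) (x # xs) u)) [0..<num b u])"
   by (simp add: num_def)
 qed
 finally show ?case by (simp add: concat_map_concat comp_def)
qed simp

fun cat :: "expr list => expr" where
 "cat [] = eZero" | "cat (e # es) = Add e (cat es)"

lemma eval_cat: "eval (cat es) u = concat (map (%e. eval e u) es)"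
 by (induction es) auto

definition Flag :: "expr => expr" where "Flag e = IfPos e eOne (Const [False])"

lemma eval_Flag: "eval (Flag e) u = [tru e u]"
 by (simp add: Flag_def tru_def)

definition ok :: "expr => bool" where "ok e <-> 0 \<notin> bound_regs e & 1 \<notin> regs e"

lemma ok_simps [simp]:
 "ok (Const w)" "ok (Size i) <-> i ~= 1" "ok (Get i e) <-> i ~= 1 & ok e" "ok (Add a b) <-> ok a & ok b"
 "ok (IfPos c a b) <-> ok c & ok a & ok b" "ok (Flag e) <-> ok e" "ok (Sum r b e) <-> r ~= 0 & r ~= 1 & ok b & ok e"
 "ok (eAnd a b) <-> ok a & ok b" "ok (eOr a b) <-> ok a & ok b" "ok (eEq a b) <-> ok a & ok b"
 by (auto simp: ok_def Flag_def)

lemma ok_loops: "0 \<notin> set rs ==> 1 \<notin> set rs ==> ok b ==> ok e ==> ok (loops rs b e)"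
 by (induction rs arbitrary: e) auto

lemma ok_cat: "(\<And>e. e \<in> set es ==> ok e) ==> ok (cat es)"
 by (induction es) auto

fun conj_expr :: "expr list => expr" where
 "conj_expr [] = eOne" | "conj_expr (e # es) = eAnd e (conj_expr es)"

fun disj_expr :: "expr list => expr" where
 "disj_expr [] = eZero" | "disj_expr (e # es) = eOr e (disj_expr es)"

lemma tru_disj_expr: "tru (disj_expr es) u <-> (\<exists>e\<in>set es. tru e u)"
 by (induction es) auto

lemma ok_disj_expr: "(\<And>e. e \<in> set es ==> ok e) ==> ok (disj_expr es)"
 by (induction es) auto

definition same :: "nat list => expr list => expr" where
 "same rs es = conj_expr (map2 (%r e. eEq (Size r) e) rs es)"

lemma tru_same: "length rs = length es ==> tru (same rs es) u <-> map (%r. length (u r)) rs = map (%e. num e u) es"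
 unfolding same_def by (induction rs es rule: list_induct2) auto

lemma ok_same: "1 \<notin> set rs ==> (\<And>e. e \<in> set es ==> ok e) ==> ok (same rs es)"
 unfolding same_def
proof (induction rs arbitrary: es)
 case (Cons r rs)
 then show ?case by (cases es) auto
qed simp

section \<open>Clause schemas and their instances\<close>

text \<open>A clause schema consists of a side condition, a list of literals and a flag telling whether it
 belongs to the outer part of the formula. Registers 20 to 23 hold the indices of an instance. A
 variable is a tag with three indices.\<close>

type_synonym 't schema = "expr \<times> (bool \<times> 't \<times> expr list) list \<times> bool"

abbreviation clause_env :: "bool list => nat list => nat => bool list" where
 "clause_env w xs \<equiv> assign [20, 21, 22, 23] xs (base w)"

definition holds :: "('t \<times> nat list => bool) => bool list => nat => 't schema => bool" where
 "holds \<alpha> w y S <-> (case S of (s, ls, out) => \<forall>xs\<in>set (tuples y 4). tru s (clause_env w xs) -->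
   (\<exists>(b, t, es)\<in>set ls. \<alpha> (t, map (%e. num e (clause_env w xs)) es) = b))"

fun content :: "('v, 'c) arg => ('v, 'c) basic" where
 "content (Base b) = b" | "content (Pad b) = b"

fun arity :: "('v, 'c) basic => nat" where
 "arity (Lit v b) = 3" | "arity (Range v b) = 3" | "arity (Cl c) = 4" | "arity _ = 0"

text \<open>The framework has finitely many shapes of arguments, each with tuples of indices. A
  program treats the shapes one by one and loops over the tuples.\<close>

definition inst :: "('t, nat) arg => nat list => ('t \<times> nat list, nat \<times> nat list) arg" where
 "inst s xs = map_arg (%t. (t, xs)) (%j. (j, xs)) s"

lemma inst_eq [simp]:
 "inst s xs = Base (Lit v b) <-> s = Base (Lit (fst v) b) & xs = snd v"
 "inst s xs = Base (Range v b) <-> s = Base (Range (fst v) b) & xs = snd v"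
 "inst s xs = Base (Cl c) <-> s = Base (Cl (fst c)) & xs = snd c"
 "inst s xs = Base Phi <-> s = Base Phi" "inst s xs = Base NegPhi <-> s = Base NegPhi"
 "inst s xs = Base Block <-> s = Base Block" "inst s xs = Base Escape <-> s = Base Escape"
 "inst s xs = Base Goal <-> s = Base Goal"
 by (cases s; cases "content s"; auto simp: inst_def)+

lemma inst_simps:
 "inst (Base (Lit t b)) xs = Base (Lit (t, xs) b)" "inst (Base (Range t b)) xs = Base (Range (t, xs) b)"
 "inst (Base (Cl j)) xs = Base (Cl (j, xs))" "inst (Base Phi) xs = Base Phi" "inst (Base NegPhi) xs = Base NegPhi"
 "inst (Base Block) xs = Base Block" "inst (Base Escape) xs = Base Escape" "inst (Base Goal) xs = Base Goal"
 "inst (Pad p) xs = Pad (map_basic (%t. (t, xs)) (%j. (j, xs)) p)"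
 by (auto simp: inst_def)

lemma inst_shape: "inst s xs = inst s' ys ==> s = s'"
proof -
 assume "inst s xs = inst s' ys"
 then have "map_arg fst fst (inst s xs) = map_arg fst fst (inst s' ys)" by simp
 then show ?thesis by (simp add: inst_def arg.map_comp comp_def arg.map_ident)
qed

lemma inst_inj: "length xs = arity (content s) ==> length ys = arity (content s) ==> inst s xs = inst s ys ==> xs = ys"
 by (cases s; cases "content s") (auto simp: inst_def)

lemma distinct_concat_map:
 assumes "distinct xs" "\<And>x. x \<in> set xs ==> distinct (f x)"
  "\<And>x y z. z \<in> set (f x) ==> z \<in> set (f y) ==> x = y"
 shows "distinct (concat (map f xs))"
 using assms by (induction xs) auto

text \<open>\<open>Y\<close> bounds the indices of clause instances and \<open>Z\<close> those of
  variables; the second bound has to be larger, as a literal may apply an index expression such as a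
  successor or a shifted cell.\<close>

locale schemas =
 fixes Ss :: "'t schema list" and tags :: "'t list" and dummy :: 't and ex :: "'t => bool" and Y Z :: expr
 assumes tags: "distinct tags" "dummy \<in> set tags" and ex_dummy: "ex dummy"
  and bounds: "regs Y \<subseteq> {0}" "regs Z \<subseteq> {0}" "0 \<notin> bound_regs Y" "0 \<notin> bound_regs Z" "num Z (base w) > 0"
  and side: "(s, ls, out) \<in> set Ss ==> regs s \<subseteq> {0, 20, 21, 22, 23} & 0 \<notin> bound_regs s"
  and literal: "(s, ls, out) \<in> set Ss ==> (b, t, es) \<in> set ls ==> t \<in> set tags & length es = 3 & (out --> ex t)"
  and index: "(s, ls, out) \<in> set Ss ==> (b, t, es) \<in> set ls ==> e \<in> set es ==>
   regs e \<subseteq> {0, 20, 21, 22, 23} & 0 \<notin> bound_regs e"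
  and index_bound: "(s, ls, out) \<in> set Ss ==> (b, t, es) \<in> set ls ==> e \<in> set es ==>
   xs \<in> set (tuples (num Y (base w)) 4) ==> num e (clause_env w xs) < num Z (base w)"
begin

abbreviation m :: nat where "m \<equiv> length Ss"
abbreviation side_of where "side_of j \<equiv> fst (Ss ! j)"
abbreviation lits_of where "lits_of j \<equiv> fst (snd (Ss ! j))"
abbreviation outer_of where "outer_of j \<equiv> snd (snd (Ss ! j))"

definition vars :: "bool list => ('t \<times> nat list) set" where
 "vars w = set tags \<times> set (tuples (num Z (base w)) 3)"

definition clauses :: "bool list => (nat \<times> nat list) set" where
 "clauses w = {..<m} \<times> set (tuples (num Y (base w)) 4)"

definition uvar :: "'t \<times> nat list" where "uvar = (dummy, [0, 0, 0])"

text \<open>Instances with a false side condition hold trivially, since \<open>uvar\<close> has to be false anyway.\<close>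

definition lit :: "bool list => nat \<times> nat list => ('t \<times> nat list) lits" where
 "lit w = (%(j, xs). if tru (side_of j) (clause_env w xs)
   then (%(b, t, es). ((t, map (%e. num e (clause_env w xs)) es), b)) ` set (lits_of j) else {(uvar, False)})"

definition exv :: "'t \<times> nat list => bool" where "exv v <-> ex (fst v)"

definition outer :: "nat \<times> nat list => bool" where "outer c <-> outer_of (fst c)"

lemma schema_at: "j < m ==> (side_of j, lits_of j, outer_of j) \<in> set Ss"
 by simp

lemma set_tuples: "xs \<in> set (tuples n k) <-> length xs = k & set xs \<subseteq> {..<n}"
 by (auto simp: set_n_lists)

lemma uvar_in: "uvar \<in> vars w"
 using tags bounds by (auto simp: uvar_def vars_def set_tuples)

lemma lit_vars: "c \<in> clauses w ==> (v, b) \<in> lit w c ==> v \<in> vars w"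
proof -
 assume c: "c \<in> clauses w" and v: "(v, b) \<in> lit w c"
 obtain j xs where j: "c = (j, xs)" "j < m" "xs \<in> set (tuples (num Y (base w)) 4)" using c by (auto simp: clauses_def)
 show ?thesis
 proof (cases "tru (side_of j) (clause_env w xs)")
  case True
  then obtain b t es where l: "(b, t, es) \<in> set (lits_of j)" "v = (t, map (%e. num e (clause_env w xs)) es)"
   using v j by (auto simp: lit_def)
  then show ?thesis using literal[OF schema_at[OF j(2)] l(1)] index_bound[OF schema_at[OF j(2)] l(1) _ j(3)]
   by (auto simp: vars_def set_tuples)
 next
  case False
  then show ?thesis using v j uvar_in by (auto simp: lit_def)
 qed
qed

lemma lit_ex: "c \<in> clauses w ==> outer c ==> (v, b) \<in> lit w c ==> exv v"
 using literal[OF schema_at] ex_dummy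
 by (fastforce simp: clauses_def outer_def lit_def exv_def uvar_def split: if_splits)

lemma satisfies_lit:
 assumes "~ \<alpha> uvar"
 shows "(\<forall>c\<in>clauses w. Q (outer c) --> satisfies \<alpha> (lit w c)) <->
  (\<forall>S\<in>set Ss. Q (snd (snd S)) --> holds \<alpha> w (num Y (base w)) S)"
proof -
 have s: "satisfies \<alpha> (lit w (j, xs)) <-> (tru (side_of j) (clause_env w xs) -->
   (\<exists>(b, t, es)\<in>set (lits_of j). \<alpha> (t, map (%e. num e (clause_env w xs)) es) = b))" for j xs
  using assms by (simp add: lit_def satisfies_def case_prod_beta)
 have h: "holds \<alpha> w (num Y (base w)) (Ss ! j) <->
   (\<forall>xs\<in>set (tuples (num Y (base w)) 4). satisfies \<alpha> (lit w (j, xs)))" for j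
  unfolding s holds_def by (simp add: case_prod_beta)
 have "(\<forall>c\<in>clauses w. Q (outer c) --> satisfies \<alpha> (lit w c)) <->
   (\<forall>j\<in>{..<m}. \<forall>xs\<in>set (tuples (num Y (base w)) 4). Q (outer_of j) --> satisfies \<alpha> (lit w (j, xs)))"
  unfolding clauses_def outer_def split_paired_Ball_Sigma fst_conv ..
 also have "\<dots> <-> (\<forall>j<m. Q (outer_of j) --> holds \<alpha> w (num Y (base w)) (Ss ! j))"
  unfolding h by blast
 finally show ?thesis unfolding all_set_conv_all_nth .
qed

section \<open>Enumerating the arguments and writing the encoding\<close>

definition shapes :: "('t, nat) arg list" where
 "shapes = (let bs = concat (map (%t. [Lit t True, Lit t False, Range t True, Range t False]) tags)
   @ map Cl [0..<m] @ [Phi, NegPhi, Block, Escape, Goal] in map Base bs @ map Pad bs)"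

definition bound :: "('t, nat) arg => expr" where
 "bound s = (if arity (content s) = 4 then Y else Z)"

definition insts :: "bool list => ('t, nat) arg => nat list list" where
 "insts w s = tuples (num (bound s) (base w)) (arity (content s))"

definition args :: "bool list => ('t \<times> nat list, nat \<times> nat list) arg list" where
 "args w = concat (map (%s. map (inst s) (insts w s)) shapes)"

lemma shapes_iff: "Base b \<in> set shapes <-> b \<in> basics (set tags) {..<m}"
 "Pad b \<in> set shapes <-> b \<in> basics (set tags) {..<m}"
 by (auto simp: shapes_def basics_def Let_def; metis (full_types))+

lemma distinct_args: "distinct (args w)"
 unfolding args_def
proof (rule distinct_concat_map)
 have "distinct (concat (map (%t. [Lit t True, Lit t False, Range t True, Range t False :: ('t, nat) basic]) tags))"
  by (rule distinct_concat_map) (use tags in auto)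
 then show "distinct shapes"
  by (auto simp: shapes_def Let_def distinct_map inj_on_def)
 show "distinct (map (inst s) (insts w s))" for s
  unfolding distinct_map insts_def
  by (intro conjI distinct_n_lists inj_onI) (auto simp: set_tuples intro: inst_inj)
 show "s = s'" if "z \<in> set (map (inst s) (insts w s))" "z \<in> set (map (inst s') (insts w s'))" for s s' z
  using that inst_shape by auto
qed

lemma set_args: "set (args w) = fst (gadget (vars w) (clauses w) att)"
proof -
 have "x \<in> set (args w) <-> (\<exists>s\<in>set shapes. \<exists>xs\<in>set (insts w s). x = inst s xs)" for x
  by (auto simp: args_def)
 moreover have "(\<exists>s\<in>set shapes. \<exists>xs\<in>set (insts w s). Base b = inst s xs) <-> b \<in> basics (vars w) (clauses w)" for b
 proof -
  have "(\<exists>s\<in>set shapes. \<exists>xs\<in>set (insts w s). Base b = inst s xs) <->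
    (\<exists>b'\<in>basics (set tags) {..<m}. \<exists>xs\<in>set (insts w (Base b')). b = map_basic (%t. (t, xs)) (%j. (j, xs)) b')"
  proof
   assume "\<exists>s\<in>set shapes. \<exists>xs\<in>set (insts w s). Base b = inst s xs"
   then obtain s xs where s: "s \<in> set shapes" "xs \<in> set (insts w s)" "Base b = inst s xs" by blast
   obtain b' where "s = Base b'" using s(3) by (cases s) (auto simp: inst_def)
   then show "\<exists>b'\<in>basics (set tags) {..<m}. \<exists>xs\<in>set (insts w (Base b')). b = map_basic (%t. (t, xs)) (%j. (j, xs)) b'"
    using s shapes_iff by (auto simp: inst_def)
  next
   assume "\<exists>b'\<in>basics (set tags) {..<m}. \<exists>xs\<in>set (insts w (Base b')). b = map_basic (%t. (t, xs)) (%j. (j, xs)) b'"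
   then obtain b' xs where "Base b' \<in> set shapes" "xs \<in> set (insts w (Base b'))" "b = map_basic (%t. (t, xs)) (%j. (j, xs)) b'"
    using shapes_iff by blast
   then show "\<exists>s\<in>set shapes. \<exists>xs\<in>set (insts w s). Base b = inst s xs"
    by (intro bexI[of _ "Base b'"] bexI[of _ xs]) (auto simp: inst_def)
  qed
  also have "\<dots> <-> b \<in> basics (vars w) (clauses w)"
  proof
   assume "b \<in> basics (vars w) (clauses w)"
   then show "\<exists>b'\<in>basics (set tags) {..<m}. \<exists>xs\<in>set (insts w (Base b')). b = map_basic (%t. (t, xs)) (%j. (j, xs)) b'"
   proof (cases b)
    case (Lit v c)
    show ?thesis by (rule bexI[of _ "Lit (fst v) c"], rule bexI[of _ "snd v"])
     (use \<open>b \<in> _\<close> Lit in \<open>auto simp: basics_def insts_def bound_def vars_def\<close>)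
   next
    case (Range v c)
    show ?thesis by (rule bexI[of _ "Range (fst v) c"], rule bexI[of _ "snd v"])
     (use \<open>b \<in> _\<close> Range in \<open>auto simp: basics_def insts_def bound_def vars_def\<close>)
   next
    case (Cl c)
    show ?thesis by (rule bexI[of _ "Cl (fst c)"], rule bexI[of _ "snd c"])
     (use \<open>b \<in> _\<close> Cl in \<open>auto simp: basics_def insts_def bound_def clauses_def\<close>)
   qed (auto simp: basics_def insts_def bound_def)
  qed (auto simp: basics_def insts_def bound_def vars_def clauses_def)
  finally show ?thesis .
 qed
 moreover have "(\<exists>s\<in>set shapes. \<exists>xs\<in>set (insts w s). Pad b = inst s xs) <-> (\<exists>s\<in>set shapes. \<exists>xs\<in>set (insts w s). Base b = inst s xs)" for b
 proof
  assume "\<exists>s\<in>set shapes. \<exists>xs\<in>set (insts w s). Pad b = inst s xs"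
  then obtain s xs where s: "s \<in> set shapes" "xs \<in> set (insts w s)" "Pad b = inst s xs" by blast
  obtain b' where "s = Pad b'" using s(3) by (cases s) (auto simp: inst_def)
  then show "\<exists>s\<in>set shapes. \<exists>xs\<in>set (insts w s). Base b = inst s xs"
   using s by (intro bexI[of _ "Base b'"] bexI[of _ xs]) (auto simp: inst_def shapes_iff insts_def bound_def)
 next
  assume "\<exists>s\<in>set shapes. \<exists>xs\<in>set (insts w s). Base b = inst s xs"
  then obtain s xs where s: "s \<in> set shapes" "xs \<in> set (insts w s)" "Base b = inst s xs" by blast
  obtain b' where "s = Base b'" using s(3) by (cases s) (auto simp: inst_def)
  then show "\<exists>s\<in>set shapes. \<exists>xs\<in>set (insts w s). Pad b = inst s xs"
   using s by (intro bexI[of _ "Pad b'"] bexI[of _ xs]) (auto simp: inst_def shapes_iff insts_def bound_def)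
 qed
 ultimately have "x \<in> set (args w) <-> x \<in> fst (gadget (vars w) (clauses w) att)" for x
  by (cases x) (auto simp: gadget_def)
 then show ?thesis by blast
qed

definition over_args :: "nat list => (('t, nat) arg => expr) => expr" where
 "over_args rs f = cat (map (%s. loops (take (arity (content s)) rs) (bound s) (f s)) shapes)"

lemma arity_le: "arity b <= 4"
 by (cases b) auto

lemma regs_bound: "regs (bound s) \<subseteq> {0}" "0 \<notin> bound_regs (bound s)"
 using bounds by (auto simp: bound_def)

lemma eval_over_args:
 assumes rs: "length rs = 4" "distinct rs" "0 \<notin> set rs" and u: "u 0 = w"
  and f: "\<And>s xs. s \<in> set shapes ==> xs \<in> set (insts w s) ==>
   eval (f s) (assign (take (arity (content s)) rs) xs u) = G (inst s xs)"
 shows "eval (over_args rs f) u = concat (map G (args w))"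
proof -
 have b: "num (bound s) u = num (bound s) (base w)" for s
  unfolding num_def by (rule arg_cong[where f = length], rule eval_cong) (use regs_bound u in \<open>auto simp: base_def\<close>)
 have l: "length (take (arity b) rs) = arity b" for b :: "('t, nat) basic" using rs arity_le[of b] by simp
 have disj: "regs (bound s) \<inter> set (take k rs) = {}" for s k
  using regs_bound[of s] rs(3) set_take_subset[of k rs] by blast
 have "eval (over_args rs f) u = concat (map (%s. concat (map (%xs. G (inst s xs)) (insts w s))) shapes)"
  unfolding over_args_def eval_cat map_map comp_def
 proof (rule concat_map_cong)
  fix s assume s: "s \<in> set shapes"
  show "eval (loops (take (arity (content s)) rs) (bound s) (f s)) u = concat (map (%xs. G (inst s xs)) (insts w s))"
   unfolding eval_loops[OF disj distinct_take[OF rs(2)]] l b insts_def[symmetric]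
   by (rule concat_map_cong) (rule f[OF s])
 qed
 then show ?thesis by (simp add: args_def concat_map_concat comp_def)
qed

lemma ok_over_args:
 assumes "0 \<notin> set rs" "1 \<notin> set rs" "\<And>s. s \<in> set shapes ==> ok (f s)"
 shows "ok (over_args rs f)"
 unfolding over_args_def
proof (rule ok_cat)
 fix e assume "e \<in> set (map (%s. loops (take (arity (content s)) rs) (bound s) (f s)) shapes)"
 then obtain s where s: "s \<in> set shapes" "e = loops (take (arity (content s)) rs) (bound s) (f s)" by auto
 have "ok (bound s)" using regs_bound[of s] by (auto simp: ok_def)
 then show "ok e" unfolding s(2) using assms s(1) set_take_subset[of "arity (content s)" rs] by (intro ok_loops) auto
qed

text \<open>The attacker is indexed by registers 10 to 13, the attacked argument by 20 to 23. The
  latter are the registers for which schemas are written, so side conditions and index expressions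
  of an attacked clause can be evaluated as they stand.\<close>

abbreviation "row_regs \<equiv> [10, 11, 12, 13 :: nat]"
abbreviation "col_regs \<equiv> [20, 21, 22, 23 :: nat]"

abbreviation row_env where
 "row_env w s xs \<equiv> assign (take (arity (content s)) row_regs) xs (base w)"

abbreviation pair_env where
 "pair_env w s xs s' ys \<equiv> assign (take (arity (content s')) col_regs) ys (row_env w s xs)"

definition framework :: "(('t, nat) arg => ('t, nat) arg => expr) => (('t, nat) arg => label) =>
  (('t, nat) arg => expr) => expr" where
 "framework attE lab target = Add (over_args row_regs (%s. eOne)) (Add (Const [False])
   (Add (over_args row_regs (%s. over_args col_regs (%s'. Flag (attE s s'))))
   (Add (over_args row_regs (%s. Const (label_code (lab s))))
   (Add (over_args row_regs (%s. Const [s = Base Goal]))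
   (over_args row_regs (%s. Flag (target s)))))))"

lemma map_product: "map f (List.product xs ys) = concat (map (%x. map (%y. f (x, y)) ys) xs)"
 by (induction xs) auto

lemma eval_framework:
 assumes att: "\<And>s xs s' ys. s \<in> set shapes ==> xs \<in> set (insts w s) ==> s' \<in> set shapes ==> ys \<in> set (insts w s') ==>
   tru (attE s s') (pair_env w s xs s' ys) <-> att (inst s xs) (inst s' ys)"
  and lab: "\<And>s xs. s \<in> set shapes ==> xs \<in> set (insts w s) ==> L (inst s xs) = lab s"
  and target: "\<And>s xs. s \<in> set shapes ==> xs \<in> set (insts w s) ==>
   tru (target s) (row_env w s xs) <-> inst s xs = k"
 shows "eval (framework attE lab target) (base w) =
  encode (args w) (gadget (vars w) (clauses w) att, Base Goal, L, k)"
proof -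
 have b0: "base w 0 = w" by (simp add: base_def)
 have a0: "assign (take n row_regs) xs (base w) 0 = w" for n xs
  by (subst assign_other) (use set_take_subset[of n row_regs] in \<open>auto simp: b0\<close>)
 have 1: "eval (over_args row_regs (%s. eOne)) (base w) = ones (length (args w))"
  by (subst eval_over_args[where G = "%_. [True]" and w = w]) (auto simp: b0 concat_map_singleton map_replicate_const)
 have 2: "eval (over_args row_regs (%s. over_args col_regs (%s'. Flag (attE s s')))) (base w) =
   concat (map (%x. map (%y. att x y) (args w)) (args w))"
 proof (rule eval_over_args)
  fix s xs assume s: "s \<in> set shapes" "xs \<in> set (insts w s)"
  have "eval (over_args col_regs (%s'. Flag (attE s s'))) (row_env w s xs) =
    concat (map (%y. [att (inst s xs) y]) (args w))"
   by (rule eval_over_args) (auto simp: a0 eval_Flag att[OF s])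
  then show "eval (over_args col_regs (%s'. Flag (attE s s'))) (row_env w s xs) =
    map (%y. att (inst s xs) y) (args w)" by (simp add: concat_map_singleton)
 qed (auto simp: b0)
 have 3: "eval (over_args row_regs (%s. Const (label_code (lab s)))) (base w) = concat (map (%x. label_code (L x)) (args w))"
  by (rule eval_over_args) (auto simp: b0 lab)
 have 4: "eval (over_args row_regs (%s. Const [s = Base Goal])) (base w) = map (%x. x = Base Goal) (args w)"
  by (subst eval_over_args[where G = "%x. [x = Base Goal]" and w = w]) (auto simp: b0 concat_map_singleton)
 have 5: "eval (over_args row_regs (%s. Flag (target s))) (base w) = map (%x. x = k) (args w)"
  by (subst eval_over_args[where G = "%x. [x = k]" and w = w])
   (auto simp: b0 eval_Flag target concat_map_singleton)
 obtain A R where AR: "gadget (vars w) (clauses w) att = (A, R)" by (cases "gadget (vars w) (clauses w) att")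
 have R: "(x, y) \<in> R <-> att x y" if "x \<in> set (args w)" "y \<in> set (args w)" for x y
  using that AR unfolding set_args[of w att] by (auto simp: gadget_def)
 have "map (%ab. ab \<in> R) (List.product (args w) (args w)) = concat (map (%x. map (%y. att x y) (args w)) (args w))"
  unfolding map_product by (intro concat_map_cong map_cong refl R)
 then show ?thesis unfolding framework_def AR by (simp add: 1 2 3 4 5)
qed

lemma ok_framework:
 assumes "\<And>s s'. s \<in> set shapes ==> s' \<in> set shapes ==> ok (attE s s')" "\<And>s. s \<in> set shapes ==> ok (target s)"
 shows "poly_time_computable (%w. eval (framework attE lab target) (base w))"
proof -
 have "ok (framework attE lab target)"
  unfolding framework_def ok_simps by (intro conjI ok_over_args) (use assms in auto)
 then show ?thesis by (intro computable_expr) (auto simp: ok_def)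
qed

section \<open>The attack relation as expressions\<close>

definition from_lit :: "('t, nat) arg => ('t => bool => expr) => expr" where
 "from_lit s f = (case s of Base (Lit t b) => f t b | _ => eZero)"

lemma tru_from_lit: "tru (from_lit s f) u <-> (\<exists>t b. s = Base (Lit t b) & tru (f t b) u)"
 by (auto simp: from_lit_def split: arg.splits basic.splits)

lemma ok_from_lit: "(\<And>t b. ok (f t b)) ==> ok (from_lit s f)"
 by (auto simp: from_lit_def split: arg.splits basic.splits)

definition static :: "bool => expr" where "static q = (if q then eOne else eZero)"

lemma static_simps [simp]: "tru (static q) u <-> q" "ok (static q)"
 by (auto simp: static_def)

abbreviation "var_rows \<equiv> [10, 11, 12 :: nat]"

definition is_uvar :: "'t => expr" where
 "is_uvar t = eAnd (static (t = dummy)) (same var_rows [eZero, eZero, eZero])"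

text \<open>Whether the literal in the row attacks the instance of clause j in the column: either it
  is the positive literal of \<open>uvar\<close>, or it occurs in the clause, where an instance with
  a false side condition consists of the negative literal of \<open>uvar\<close>.\<close>

definition is_literal :: "'t => bool => nat => expr" where
 "is_literal t b j = eOr (eAnd (static b) (is_uvar t)) (IfPos (side_of j)
   (disj_expr (map (%(b', t', es). eAnd (static (b = b' & t = t')) (same var_rows es)) (lits_of j)))
   (eAnd (static (~ b)) (is_uvar t)))"

fun attE1 :: "('t, nat) arg => ('t, nat) arg => expr" where
 "attE1 s (Base (Lit t b)) = from_lit s (%t' b'. eAnd (static (t' = t & b' = (~ b))) (same var_rows [Size 20, Size 21, Size 22]))"
| "attE1 s (Base (Cl j)) = from_lit s (%t b. is_literal t b j)"
| "attE1 s (Base Phi) = eOr (from_lit s (%t b. eAnd (static b) (is_uvar t))) (static (\<exists>j. s = Base (Cl j)))"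
| "attE1 s (Pad y) = static (s = Base Phi)"
| "attE1 s (Base _) = eZero"

fun attE2 :: "('t, nat) arg => ('t, nat) arg => expr" where
 "attE2 s (Base (Lit t b)) = eOr (from_lit s (%t' b'. eAnd (static (t' = t & b' = (~ b))) (same var_rows [Size 20, Size 21, Size 22])))
   (static (~ ex t & s = Base Block))"
| "attE2 s (Base (Cl j)) = eOr (from_lit s (%t b. is_literal t b j)) (static (\<exists>j'. s = Base (Cl j') & outer_of j' & ~ outer_of j))"
| "attE2 s (Base (Range t b)) = (case s of
   Base (Lit t' b') => eAnd (static (t' = t & b' = b)) (same var_rows [Size 20, Size 21, Size 22])
  | Base (Range t' b') => eAnd (static (t' = t & b' = b)) (same var_rows [Size 20, Size 21, Size 22])
  | _ => eZero)"
| "attE2 s (Base Phi) = static (\<exists>j. s = Base (Cl j) & ~ outer_of j)"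
| "attE2 s (Base NegPhi) = static (s = Base Phi)"
| "attE2 s (Base Block) = static (s = Base Phi \<or> s = Base Block)"
| "attE2 s (Base Escape) = eOr (from_lit s (%t b. eAnd (static b) (is_uvar t))) (static (s = Base NegPhi))"
| "attE2 s (Base Goal) = static (s = Base Escape \<or> s = Base Goal)"
| "attE2 s (Pad y) = from_lit s (%t b. eAnd (static b) (is_uvar t))"

lemma row_values:
 assumes "length xs = 3"
 shows "map (%r. length (assign (take n col_regs) ys (assign (take 3 row_regs) xs u) r)) var_rows = xs"
  "map (%r. length (assign (take 3 row_regs) xs u r)) var_rows = xs"
proof -
 show *: "map (%r. length (assign (take 3 row_regs) xs u r)) var_rows = xs"
  using assign_values[of var_rows xs u] assms by simp
 have "assign (take n col_regs) ys v r = v r" if "r \<in> set var_rows" for v r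
  by (rule assign_other) (use that set_take_subset[of n col_regs] in auto)
 then show "map (%r. length (assign (take n col_regs) ys (assign (take 3 row_regs) xs u) r)) var_rows = xs"
  using * by simp
qed

lemma insts_length: "xs \<in> set (insts w s) ==> length xs = arity (content s)"
 by (simp add: insts_def set_tuples)

lemma is_uvar_correct:
 assumes "length xs = 3"
 shows "tru (is_uvar t) (assign (take n col_regs) ys (assign (take 3 row_regs) xs u)) <-> (t, xs) = uvar"
  "tru (is_uvar t) (assign (take 3 row_regs) xs u) <-> (t, xs) = uvar"
 unfolding is_uvar_def tru_connectives by (simp_all only: tru_same list.size row_values[OF assms]) (auto simp: uvar_def)

lemma is_literal_correct:
 assumes xs: "length xs = 3" and ys: "length ys = 4" and j: "j < m"
 shows "tru (is_literal t b j) (assign col_regs ys (assign (take 3 row_regs) xs (base w))) <->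
  ((t, xs), b) \<in> lit w (j, ys) \<or> (t, xs) = uvar & b"
proof -
 let ?u = "assign col_regs ys (assign (take 3 row_regs) xs (base w))"
 \<comment> \<open>The row registers do not occur in the expressions of a schema, so its environment
   is recovered on the registers that matter.\<close>
 have low: "?u r = clause_env w ys r" if "r \<in> {0, 20, 21, 22, 23}" for r
 proof -
  obtain a b c d where "ys = [a, b, c, d]" using ys by (auto simp: length_Suc_conv numeral_eq_Suc)
  then show ?thesis using that assign_other[of r "take 3 row_regs" xs "base w"] by auto
 qed
 have e: "eval e ?u = eval e (clause_env w ys)" if "regs e \<subseteq> {0, 20, 21, 22, 23}" for e
  by (rule eval_cong) (use that low in blast)
 note s = side[OF schema_at[OF j]]
 have side: "tru (side_of j) ?u <-> tru (side_of j) (clause_env w ys)"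
  unfolding tru_def using e s by simp
 have u: "tru (is_uvar t) ?u <-> (t, xs) = uvar"
  using is_uvar_correct(1)[OF xs, of t 4 ys] by simp
 have row: "map (%r. length (?u r)) var_rows = xs" using row_values(1)[OF xs, of 4 ys] by simp
 have l: "tru (same var_rows es) ?u <-> xs = map (%e. num e (clause_env w ys)) es"
  if "(b', t', es) \<in> set (lits_of j)" for b' t' es
 proof -
  have "length es = 3" using literal[OF schema_at[OF j] that] by simp
  moreover have "num e ?u = num e (clause_env w ys)" if "e \<in> set es" for e
   unfolding num_def using e index[OF schema_at[OF j] \<open>(b', t', es) \<in> set (lits_of j)\<close> that] by simp
  ultimately show ?thesis by (subst tru_same) (simp_all only: row, auto cong: map_cong)
 qed
 have d: "tru (disj_expr (map (%(b', t', es). eAnd (static (b = b' & t = t')) (same var_rows es)) (lits_of j))) ?u <->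
   ((t, xs), b) \<in> (%(b, t, es). ((t, map (%e. num e (clause_env w ys)) es), b)) ` set (lits_of j)"
  unfolding tru_disj_expr using l by (force simp: image_iff)
 show ?thesis unfolding is_literal_def tru_connectives tru_IfPos static_simps side u d by (auto simp: lit_def)
qed

lemma is_literal_ok: "j < m ==> ok (is_literal t b j)"
proof -
 assume j: "j < m"
 have "ok (side_of j)" using side[OF schema_at[OF j]] by (auto simp: ok_def)
 moreover have "ok e" if "(b', t', es) \<in> set (lits_of j)" "e \<in> set es" for b' t' es e
  using index[OF schema_at[OF j] that] by (auto simp: ok_def)
 ultimately show ?thesis
  by (auto simp: is_literal_def is_uvar_def intro!: ok_same ok_disj_expr)
qed

lemma shapes_Cl: "Base (Cl j) \<in> set shapes ==> j < m"
 by (auto simp: shapes_iff basics_def)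

lemma ok_att:
 assumes "s' \<in> set shapes"
 shows "ok (attE1 s s')" "ok (attE2 s s')"
proof -
 have 1: "ok (from_lit s (%t' b'. eAnd (static (Q t' b')) (same var_rows [Size 20, Size 21, Size 22])))" for Q
  by (auto intro!: ok_from_lit ok_same)
 have 2: "ok (from_lit s (%t b. eAnd (static b) (is_uvar t)))"
  by (auto simp: is_uvar_def intro!: ok_from_lit ok_same)
 have 3: "ok (from_lit s (%t b. is_literal t b j))" if "s' = Base (Cl j)" for j
  by (rule ok_from_lit) (use that assms shapes_Cl is_literal_ok in blast)
 have 4: "ok (same var_rows [Size 20, Size 21, Size 22])" by (rule ok_same) auto
 show "ok (attE1 s s')"
 proof (cases s')
  case (Base b)
  then show ?thesis using 1 2 3 by (cases b) simp_all
 qed simp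
 show "ok (attE2 s s')"
 proof (cases s')
  case (Base b)
  then show ?thesis using 1 2 3 4 by (cases b) (auto split: arg.splits basic.splits)
 qed (simp add: 2)
qed

lemma same_indices:
 assumes "length xs = 3" "length ys = 3"
 shows "tru (same var_rows [Size 20, Size 21, Size 22])
  (assign (take 3 col_regs) ys (assign (take 3 row_regs) xs u)) <-> xs = ys"
proof -
 let ?u = "assign (take 3 col_regs) ys (assign (take 3 row_regs) xs u)"
 have "map (%e. num e ?u) [Size 20, Size 21, Size 22] = ys"
  using assign_values[of "take 3 col_regs" ys "assign (take 3 row_regs) xs u"] assms(2) by simp
 moreover have "map (%r. length (?u r)) var_rows = xs" by (rule row_values(1)[OF assms(1)])
 ultimately show ?thesis by (subst tru_same) simp_all
qed

context
 fixes w :: "bool list" and s s' :: "('t, nat) arg" and xs ys :: "nat list"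
 assumes s: "xs \<in> set (insts w s)" and s': "s' \<in> set shapes" "ys \<in> set (insts w s')"
begin

lemma lit_source:
 "tru (from_lit s f) (pair_env w s xs s' ys) <-> (\<exists>t b. inst s xs = Base (Lit (t, xs) b) & length xs = 3 &
   tru (f t b) (assign (take (arity (content s')) col_regs) ys (assign (take 3 row_regs) xs (base w))))"
 unfolding tru_from_lit using insts_length[OF s] by auto

lemma uvar_source:
 "tru (from_lit s (%t b. eAnd (static b) (is_uvar t))) (pair_env w s xs s' ys) <-> inst s xs = Base (Lit uvar True)"
proof -
 have "tru (from_lit s (%t b. eAnd (static b) (is_uvar t))) (pair_env w s xs s' ys) <->
   (\<exists>t b. inst s xs = Base (Lit (t, xs) b) & length xs = 3 & b & (t, xs) = uvar)"
  unfolding lit_source tru_connectives static_simps using is_uvar_correct(1) by blast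
 also have "\<dots> <-> inst s xs = Base (Lit uvar True)"
 proof
  assume "inst s xs = Base (Lit uvar True)"
  then have "s = Base (Lit dummy True)" "xs = [0, 0, 0]" by (simp_all add: uvar_def)
  then show "\<exists>t b. inst s xs = Base (Lit (t, xs) b) & length xs = 3 & b & (t, xs) = uvar"
   by (intro exI[of _ dummy] exI[of _ True]) (simp add: uvar_def)
 qed (elim exE conjE, simp only:)
 finally show ?thesis .
qed

lemma var_source:
 assumes "arity (content s') = 3"
 shows "tru (from_lit s (%t' b'. eAnd (static (t' = t & b' = c)) (same var_rows [Size 20, Size 21, Size 22])))
  (pair_env w s xs s' ys) <-> inst s xs = Base (Lit (t, ys) c)"
proof -
 have "length ys = 3" using insts_length[OF s'(2)] assms by simp
 then have "tru (from_lit s (%t' b'. eAnd (static (t' = t & b' = c)) (same var_rows [Size 20, Size 21, Size 22])))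
   (pair_env w s xs s' ys) <->
   (\<exists>t' b. inst s xs = Base (Lit (t', xs) b) & length xs = 3 & (t' = t & b = c) & xs = ys)"
  unfolding lit_source unfolding tru_connectives static_simps assms
  by (intro ex_cong1 conj_cong refl same_indices) assumption+
 also have "\<dots> <-> inst s xs = Base (Lit (t, ys) c)"
 proof
  assume "inst s xs = Base (Lit (t, ys) c)"
  then have "s = Base (Lit t c)" "xs = ys" by simp_all
  then show "\<exists>t' b. inst s xs = Base (Lit (t', xs) b) & length xs = 3 & (t' = t & b = c) & xs = ys"
   using \<open>length ys = 3\<close> by simp
 qed (elim exE conjE, simp only:)
 finally show ?thesis .
qed

lemma clause_source:
 assumes "s' = Base (Cl j)"
 shows "tru (from_lit s (%t b. is_literal t b j)) (pair_env w s xs s' ys) <->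
  (\<exists>v b. inst s xs = Base (Lit v b) & ((v, b) \<in> lit w (j, ys) \<or> v = uvar & b))"
proof -
 have j: "j < m" using s'(1) shapes_Cl assms by blast
 have ys: "length ys = 4" using insts_length[OF s'(2)] assms by simp
 have c: "take (arity (content s')) col_regs = col_regs" using assms by simp
 have "tru (from_lit s (%t b. is_literal t b j)) (pair_env w s xs s' ys) <->
   (\<exists>t b. inst s xs = Base (Lit (t, xs) b) & length xs = 3 & (((t, xs), b) \<in> lit w (j, ys) \<or> (t, xs) = uvar & b))"
  unfolding lit_source unfolding c by (intro ex_cong1 conj_cong refl is_literal_correct[OF _ ys j]) assumption+
 also have "\<dots> <-> (\<exists>v b. inst s xs = Base (Lit v b) & ((v, b) \<in> lit w (j, ys) \<or> v = uvar & b))"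
 proof
  assume "\<exists>v b. inst s xs = Base (Lit v b) & ((v, b) \<in> lit w (j, ys) \<or> v = uvar & b)"
  then obtain v b where v: "inst s xs = Base (Lit v b)" "(v, b) \<in> lit w (j, ys) \<or> v = uvar & b" by iprover
  then have "v = (fst v, xs)" "length xs = 3" using insts_length[OF s] by simp_all
  with v show "\<exists>t b. inst s xs = Base (Lit (t, xs) b) & length xs = 3 & (((t, xs), b) \<in> lit w (j, ys) \<or> (t, xs) = uvar & b)"
   by (intro exI[of _ "fst v"] exI[of _ b]) simp
 qed iprover
 finally show ?thesis .
qed

lemma attE1_correct: "tru (attE1 s s') (pair_env w s xs s' ys) <-> att1 uvar (lit w) (inst s xs) (inst s' ys)"
proof (cases s')
 case (Base b)
 show ?thesis
 proof (cases b)
  case (Lit t c)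
  show ?thesis using var_source[of t "~ c"] by (simp add: Base Lit inst_simps)
 next
  case (Cl j)
  show ?thesis using clause_source[of j] by (simp add: Base Cl inst_simps)
 next
  case Phi
  show ?thesis using uvar_source by (simp add: Base Phi inst_simps)
 qed (simp_all add: Base inst_simps)
qed (simp add: inst_simps)

lemma attE2_correct: "tru (attE2 s s') (pair_env w s xs s' ys) <-> att2 uvar (lit w) exv outer (inst s xs) (inst s' ys)"
proof (cases s')
 case (Base b)
 show ?thesis
 proof (cases b)
  case (Lit t c)
  show ?thesis using var_source[of t "~ c"] by (simp add: Base Lit inst_simps exv_def)
 next
  case (Cl j)
  show ?thesis using clause_source[of j] by (auto simp: Base Cl inst_simps outer_def)
 next
  case (Range t c)
  have ys: "length ys = 3" using insts_length[OF s'(2)] by (simp add: Base Range)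
  show ?thesis
  proof (cases "\<exists>t' b'. s = Base (Lit t' b') \<or> s = Base (Range t' b')")
   case True
   then have xs: "length xs = 3" using insts_length[OF s] by auto
   show ?thesis using True same_indices[OF xs ys, of "base w"] by (auto simp: Base Range inst_simps)
  next
   case False
   then have "attE2 s s' = eZero" by (auto simp: Base Range split: arg.splits basic.splits)
   moreover have "~ att2 uvar (lit w) exv outer (inst s xs) (inst s' ys)"
    using False by (auto simp: Base Range inst_simps)
   ultimately show ?thesis by simp
  qed
 next
  case Phi
  show ?thesis by (auto simp: Base Phi inst_simps outer_def)
 next
  case Escape
  show ?thesis using uvar_source by (simp add: Base Escape inst_simps)
 qed (simp_all add: Base inst_simps)
next
 case (Pad p)
 show ?thesis using uvar_source by (simp add: Pad inst_simps)
qed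

end

text \<open>The given labelling makes all variables true, or leaves them all undecided for
  \<open>CO\<close>; therefore a label depends on the shape alone and is written as a constant. The
  same holds for \<open>label2\<close>.\<close>

fun label1 :: "semantics => ('t, nat) arg => label" where
 "label1 \<sigma> (Base (Lit t b)) = (if \<sigma> = CO then Und else if b then In else Out)"
| "label1 \<sigma> (Base (Cl j)) = (if \<sigma> = CO then Und else Out)"
| "label1 \<sigma> (Base Phi) = (if \<sigma> = CO then Und else Out)"
| "label1 \<sigma> (Pad b) = (if \<sigma> = CO then Und else In)"
| "label1 \<sigma> (Base _) = In"

fun label2 :: "('t, nat) arg => label" where
 "label2 (Base (Lit t b)) = (if b then In else Out)"
| "label2 (Base (Range t b)) = (if b then Out else Und)"
| "label2 (Base Phi) = In"
| "label2 (Base Goal) = Und"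
| "label2 _ = Out"

section \<open>The two reductions\<close>

lemma finite_vars: "finite (vars w)" "finite (clauses w)"
 by (auto simp: vars_def clauses_def)

lemma inst_args: "s \<in> set shapes ==> xs \<in> set (insts w s) ==> inst s xs \<in> fst (gadget (vars w) (clauses w) att)"
 unfolding set_args[symmetric] args_def by auto

lemma reduction1:
 assumes \<sigma>: "\<sigma> \<in> {CO, ST}"
 shows "\<exists>f. poly_time_computable f & (\<forall>w. f w \<in> SF_CA_input_words \<sigma> & (f w \<in> SF_CA \<sigma> <->
  (\<exists>\<alpha>. ~ \<alpha> uvar & (\<forall>S\<in>set Ss. holds \<alpha> w (num Y (base w)) S))))"
proof -
 define f where "f w = eval (framework attE1 (label1 \<sigma>) (%s. static (s = Base Phi))) (base w)" for w
 have "poly_time_computable f"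
  unfolding f_def by (rule ok_framework) (use ok_att in auto)
 moreover have "f w \<in> SF_CA_input_words \<sigma> & (f w \<in> SF_CA \<sigma> <->
  (\<exists>\<alpha>. ~ \<alpha> uvar & (\<forall>S\<in>set Ss. holds \<alpha> w (num Y (base w)) S)))" for w
 proof -
  let ?F = "gadget (vars w) (clauses w) (att1 uvar (lit w))"
  let ?L = "labelling_of ?F (ext_known (vars w) (clauses w) uvar (lit w) \<sigma>)"
  have ls: "\<Union> (lit w ` clauses w) \<subseteq> vars w \<times> UNIV" by (auto dest: lit_vars)
  note ctx = finite_vars[of w] uvar_in[of w] ls
  note g = gadget1_correct[OF ctx \<sigma>]
  have L: "?L (inst s xs) = label1 \<sigma> s" if a: "s \<in> set shapes" "xs \<in> set (insts w s)" for s xs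
  proof (cases "\<sigma> = CO")
   case True
   have E: "ext_known (vars w) (clauses w) uvar (lit w) \<sigma> = ext_CO (vars w) (clauses w) uvar (lit w)"
    using True by (simp add: ext_known_def[OF ctx])
   have "inst s xs \<in> ext_CO (vars w) (clauses w) uvar (lit w) <->
     inst s xs \<in> Base ` ({NegPhi, Block, Escape, Goal} \<union> range (%(v, b). Range v b))"
    using inst_args[OF a] by (simp add: ext_CO_def[OF ctx])
   also have "\<dots> <-> label1 \<sigma> s = In"
    using True by (cases s; cases "content s") (auto simp: inst_simps)
   finally have m: "inst s xs \<in> ext_CO (vars w) (clauses w) uvar (lit w) <-> label1 \<sigma> s = In" .
   have "label1 \<sigma> s = In \<or> label1 \<sigma> s = Und" using True by (cases s; cases "content s") auto
   then show ?thesis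
    using inst_args[OF a] m by (auto simp: labelling_of_def E Def_ext_CO[OF ctx])
  next
   case False
   let ?E = "ext1 (vars w) (clauses w) uvar (lit w) (%_. True)"
   have E: "ext_known (vars w) (clauses w) uvar (lit w) \<sigma> = ?E"
    using False by (simp add: ext_known_def[OF ctx] ext_ST_def[OF ctx])
   have "inst s xs \<in> ?E <-> label1 \<sigma> s = In"
    using inst_args[OF a, of "att1 uvar (lit w)"] False unfolding ext1_def[OF ctx]
    by (cases s; cases "content s") (auto simp: inst_simps)
   moreover have "label1 \<sigma> s ~= Und" using False by (cases s; cases "content s") auto
   ultimately show ?thesis
    using inst_args[OF a, of "att1 uvar (lit w)"] by (cases "label1 \<sigma> s") (auto simp: labelling_of_def E Def_ext1[OF ctx])
  qed
  have e: "f w = encode (args w) (?F, Base Goal, ?L, Base Phi)"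
   unfolding f_def by (rule eval_framework) (simp_all add: attE1_correct L)
  have "(\<exists>\<alpha>. ~ \<alpha> uvar & (\<forall>c\<in>clauses w. satisfies \<alpha> (lit w c))) <->
    (\<exists>\<alpha>. ~ \<alpha> uvar & (\<forall>S\<in>set Ss. holds \<alpha> w (num Y (base w)) S))"
   using satisfies_lit[where Q = "%_. True"] by (intro ex_cong1 conj_cong refl) simp
  then show ?thesis unfolding e using encode_in_words[OF distinct_args set_args g(1)] g(2) by simp
 qed
 ultimately show ?thesis by blast
qed

text \<open>The tag of \<open>uvar\<close> counts as existential, so \<beta> makes it false together
  with \<alpha>, and the translation between clauses and schemas applies to both
  assignments.\<close>

lemma reduction2:
 assumes \<sigma>: "\<sigma> \<in> {PR, SST}"
 shows "\<exists>f. poly_time_computable f & (\<forall>w. f w \<in> SF_CA_input_words \<sigma> & (f w \<in> SF_CA \<sigma> <->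
  (\<exists>\<alpha>. ~ \<alpha> uvar & (\<forall>S\<in>set Ss. snd (snd S) --> holds \<alpha> w (num Y (base w)) S) &
   (\<forall>\<beta>. (\<forall>v. exv v --> \<beta> v = \<alpha> v) --> ~ (\<forall>S\<in>set Ss. ~ snd (snd S) --> holds \<beta> w (num Y (base w)) S)))))"
proof -
 define target where "target s = from_lit s (%t b. eAnd (static (~ b)) (is_uvar t))" for s
 define f where "f w = eval (framework attE2 label2 target) (base w)" for w
 have "ok (target s)" for s unfolding target_def by (auto simp: is_uvar_def intro!: ok_from_lit ok_same)
 then have "poly_time_computable f"
  unfolding f_def by (intro ok_framework) (use ok_att in auto)
 moreover have "f w \<in> SF_CA_input_words \<sigma> & (f w \<in> SF_CA \<sigma> <->
  (\<exists>\<alpha>. ~ \<alpha> uvar & (\<forall>S\<in>set Ss. snd (snd S) --> holds \<alpha> w (num Y (base w)) S) &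
   (\<forall>\<beta>. (\<forall>v. exv v --> \<beta> v = \<alpha> v) --> ~ (\<forall>S\<in>set Ss. ~ snd (snd S) --> holds \<beta> w (num Y (base w)) S))))" for w
 proof -
  have exu: "exv uvar" by (simp add: exv_def uvar_def ex_dummy)
  let ?F = "gadget (vars w) (clauses w) (att2 uvar (lit w) exv outer)"
  let ?E = "ext2 (vars w) (clauses w) uvar (lit w) exv outer (%_. True)"
  let ?L = "labelling_of ?F ?E"
  have ls: "\<Union> (lit w ` clauses w) \<subseteq> vars w \<times> UNIV" by (auto dest: lit_vars)
  have os: "\<Union> (lit w ` {c \<in> clauses w. outer c}) \<subseteq> Collect exv \<times> UNIV" by (auto dest: lit_ex)
  note ctx = finite_vars[of w] uvar_in[of w] ls exu os
  note g = gadget2_correct[OF ctx \<sigma>]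
  have L: "?L (inst s xs) = label2 s" if a: "s \<in> set shapes" "xs \<in> set (insts w s)" for s xs
  proof -
   have true: "phi_holds (clauses w) uvar (lit w) outer (%_. True)" by (simp add: phi_holds_def[OF ctx])
   show ?thesis
    using inst_args[OF a, of "att2 uvar (lit w) exv outer"] unfolding labelling_of_def
    by (cases s; cases "content s")
     (auto simp: inst_simps mem_ext2[OF ctx] Def_ext2[OF ctx true] fst_F2[OF ctx] basic_simps[OF finite_vars[of w] uvar_in[of w] ls])
  qed
  have t: "tru (target s) (row_env w s xs) <-> inst s xs = Base (Lit uvar False)"
   if "xs \<in> set (insts w s)" for s xs
  proof -
   have "tru (target s) (row_env w s xs) <->
     (\<exists>t. s = Base (Lit t False) & (t, xs) = uvar)"
    unfolding target_def tru_from_lit tru_connectives static_simps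
    using insts_length[OF that] is_uvar_correct(2)[of xs] by auto
   then show ?thesis by (auto simp: uvar_def)
  qed
  have e: "f w = encode (args w) (?F, Base Goal, ?L, Base (Lit uvar False))"
   unfolding f_def by (rule eval_framework) (simp_all add: attE2_correct L t)
  have "sigma2_true (clauses w) uvar (lit w) exv outer <->
   (\<exists>\<alpha>. ~ \<alpha> uvar & (\<forall>S\<in>set Ss. snd (snd S) --> holds \<alpha> w (num Y (base w)) S) &
   (\<forall>\<beta>. (\<forall>v. exv v --> \<beta> v = \<alpha> v) --> ~ (\<forall>S\<in>set Ss. ~ snd (snd S) --> holds \<beta> w (num Y (base w)) S)))"
   unfolding sigma2_true_def[OF ctx]
  proof (intro ex_cong1 conj_cong refl all_cong1 imp_cong)
   fix \<alpha> assume "~ \<alpha> uvar"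
   then show "(\<forall>c\<in>clauses w. outer c --> satisfies \<alpha> (lit w c)) <->
     (\<forall>S\<in>set Ss. snd (snd S) --> holds \<alpha> w (num Y (base w)) S)"
    by (rule satisfies_lit[where Q = "%b. b"])
  next
   fix \<alpha> \<beta> :: "'t \<times> nat list => bool" assume "~ \<alpha> uvar" "\<forall>v. exv v --> \<beta> v = \<alpha> v"
   then have "~ \<beta> uvar" using exu by blast
   from satisfies_lit[where \<alpha> = \<beta> and Q = "%b. ~ b", OF this, of w]
   show "(~ (\<forall>c\<in>clauses w. ~ outer c --> satisfies \<beta> (lit w c))) <->
     (~ (\<forall>S\<in>set Ss. ~ snd (snd S) --> holds \<beta> w (num Y (base w)) S))" by simp
  qed
  then show ?thesis unfolding e using encode_in_words[OF distinct_args set_args g(1)] g(2) by simp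
 qed
 ultimately show ?thesis by blast
qed

end

section \<open>Computations of fixed length\<close>

text \<open>A machine is completed by a fresh halting state, entered from accepting configurations without
 successor and never left. The last component of an entry is 1 for an oracle answer yes, 2 for an
 oracle answer no, 3 for the added entries and 0 otherwise.\<close>

type_synonym entry = "nat \<times> sym list \<times> nat \<times> (sym \<times> move) list \<times> nat"

abbreviation flag :: "entry => nat" where "flag e \<equiv> snd (snd (snd (snd e)))"

definition symbols :: "machine => sym set" where
 "symbols M = {Blank, Bit True, Bit False} \<union> (\<Union>(q, rs, q', as)\<in>table M. fst ` set as)"

definition states :: "machine => nat set" where
 "states M = {start_state M, accept_state M, query_state M, yes_state M, no_state M} \<union> (\<Union>(q, rs, q', as)\<in>table M. {q, q'})"

definition halting :: "machine => nat" where
 "halting M = Suc (Max (states M))"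

definition stay_put :: "sym list => (sym \<times> move) list" where
 "stay_put rs = map (%s. (s, Stay)) rs"

definition reads :: "machine => sym list set" where
 "reads M = {rs. set rs \<subseteq> symbols M & length rs = ntapes M}"

definition entries :: "machine => nat set => entry set" where
 "entries M A = {(q, rs, q', as, 0) | q rs q' as. (q, rs, q', as) \<in> table M & rs \<in> reads M & q ~= query_state M}
   \<union> {(query_state M, rs, if a = 1 then yes_state M else no_state M, stay_put rs, a) | rs a. rs \<in> reads M & a \<in> A \<inter> {1, 2}}
   \<union> {(accept_state M, rs, halting M, stay_put rs, 3) | rs. rs \<in> reads M & accept_state M ~= query_state M &
     (\<forall>q' as. (accept_state M, rs, q', as) \<notin> table M)}
   \<union> {(halting M, rs, halting M, stay_put rs, 3) | rs. rs \<in> reads M}"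

fun moves :: "entry => config => config => bool" where
 "moves (q, rs, q', as, f) c c' <-> fst c = q & map read (snd c) = rs & c' = (q', map2 act (snd c) as)"

definition trace :: "entry set => nat => (nat => config) => (nat => entry) => bool" where
 "trace E T c e <-> (\<forall>t<T. e t \<in> E & moves (e t) (c t) (c (Suc t)))"

text \<open>A trace may contain arbitrary answers. Their truth is kept apart, because it is no local
  condition on consecutive configurations and is enforced by tableaux of another machine.\<close>

definition answers :: "bool list set => nat => (nat => config) => (nat => entry) => bool" where
 "answers B T c e <-> (\<forall>t<T. (flag (e t) = 1 --> tape_word (snd (c t) ! 1) \<in> B) &
   (flag (e t) = 2 --> tape_word (snd (c t) ! 1) \<notin> B))"

lemma finite_symbols: "well_formed M ==> finite (symbols M)"
 by (auto simp: symbols_def well_formed_def)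

lemma finite_states: "well_formed M ==> finite (states M)"
 by (auto simp: states_def well_formed_def)

lemma finite_reads: "well_formed M ==> finite (reads M)"
 unfolding reads_def by (rule finite_lists_length_eq) (rule finite_symbols)

lemma finite_entries:
 assumes "well_formed M"
 shows "finite (entries M A)"
proof -
 have t: "finite (table M)" using assms by (simp add: well_formed_def)
 have "entries M A \<subseteq> (%(q, rs, q', as). (q, rs, q', as, 0)) ` table M
   \<union> (%(rs, a). (query_state M, rs, if a = 1 then yes_state M else no_state M, stay_put rs, a)) ` (reads M \<times> {1, 2})
   \<union> (%rs. (accept_state M, rs, halting M, stay_put rs, 3)) ` reads M \<union> (%rs. (halting M, rs, halting M, stay_put rs, 3)) ` reads M"
  unfolding entries_def by (fastforce simp: image_iff)
 then show ?thesis by (rule finite_subset) (use t finite_reads[OF assms] in auto)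
qed

lemma states_not_halting: "well_formed M ==> q \<in> states M ==> q ~= halting M"
 using Max_ge[OF finite_states, of M q] by (auto simp: halting_def)

lemma table_states: "(q, rs, q', as) \<in> table M ==> q \<in> states M & q' \<in> states M"
 by (fastforce simp: states_def)

lemma table_symbols: "(q, rs, q', as) \<in> table M ==> fst ` set as \<subseteq> symbols M"
 unfolding symbols_def by (rule subsetI, rule UnI2, rule UN_I) auto

lemma special_states:
 "start_state M \<in> states M" "accept_state M \<in> states M" "query_state M \<in> states M" "yes_state M \<in> states M" "no_state M \<in> states M"
 by (auto simp: states_def)

lemma entries_shape:
 assumes M: "well_formed M" and e: "(q, rs, q', as, f) \<in> entries M A"
 shows "length rs = ntapes M" "length as = ntapes M" "set rs \<subseteq> symbols M" "fst ` set as \<subseteq> symbols M"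
  "q \<in> insert (halting M) (states M)" "q' \<in> insert (halting M) (states M)"
proof -
 have 1: "rs \<in> reads M" using e by (auto simp: entries_def)
 then show "length rs = ntapes M" "set rs \<subseteq> symbols M" by (auto simp: reads_def)
 show "length as = ntapes M" using e M by (auto simp: entries_def stay_put_def reads_def well_formed_def)
 have "(q, rs, q', as) \<in> table M \<or> as = stay_put rs" using e by (auto simp: entries_def)
 then show "fst ` set as \<subseteq> symbols M"
  using table_symbols[of q rs q' as M] 1 by (auto simp: stay_put_def reads_def)
 show "q \<in> insert (halting M) (states M)" "q' \<in> insert (halting M) (states M)"
  using e special_states[of M] table_states by (auto simp: entries_def split: if_splits)
qed

lemma stay_act: "map2 act ts (stay_put (map read ts)) = ts"
proof (rule nth_equalityI)
 fix i assume i: "i < length (map2 act ts (stay_put (map read ts)))"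
 obtain t h where "ts ! i = (t, h)" by (cases "ts ! i")
 then show "map2 act ts (stay_put (map read ts)) ! i = ts ! i" using i by (simp add: stay_put_def)
qed (simp add: stay_put_def)

lemma run_from_steps: "(\<And>t. t < m ==> \<exists>j. step M B (c t) j (c (Suc t))) ==> \<exists>k. run M B (c 0) m k (c m)"
proof (induction m arbitrary: c)
 case 0
 then show ?case by (auto intro: run_refl)
next
 case (Suc m)
 obtain k where "run M B (c (Suc 0)) m k (c (Suc m))" using Suc.IH[of "%t. c (Suc t)"] Suc.prems by auto
 moreover obtain j where "step M B (c 0) j (c (Suc 0))" using Suc.prems[of 0] by auto
 ultimately show ?case by (blast intro: run_step)
qed

lemma steps_from_run: "run M B a n k b ==> \<exists>c. c 0 = a & c n = b & (\<forall>t<n. \<exists>j. step M B (c t) j (c (Suc t)))"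
proof (induction rule: run.induct)
 case (run_refl c)
 then show ?case by auto
next
 case (run_step c k c' n m c'')
 then obtain d where "d 0 = c'" "d n = c''" "\<forall>t<n. \<exists>j. step M B (d t) j (d (Suc t))" by blast
 then show ?case using run_step(1)
  by (intro exI[of _ "case_nat c d"]) (auto split: nat.splits simp: less_Suc_eq_0_disj)
qed

lemma moves_step:
 assumes "moves e a b" "e \<in> entries M A" "flag e ~= 3"
  "flag e = 1 --> tape_word (snd a ! 1) \<in> B" "flag e = 2 --> tape_word (snd a ! 1) \<notin> B"
 shows "\<exists>j. step M B a j b"
proof -
 obtain q ts where a: "a = (q, ts)" by (cases a)
 obtain q0 rs q' as f where e: "e = (q0, rs, q', as, f)" by (cases e)
 have m: "q = q0" "map read ts = rs" "b = (q', map2 act ts as)" using assms(1) by (auto simp: a e)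
 consider "(q, rs, q', as) \<in> table M" "q ~= query_state M" | "q = query_state M" "as = stay_put rs"
   "f = 1 & q' = yes_state M \<or> f = 2 & q' = no_state M"
  using assms(2,3) m(1) by (auto simp: entries_def e)
 then show ?thesis
 proof cases
  case 1
  then show ?thesis using step.trans[of q M ts q' as B] m a by auto
 next
  case 2
  then have "b = (if tape_word (ts ! 1) \<in> B then yes_state M else no_state M, ts)"
   using m(2,3) stay_act[of ts] assms(4,5) by (auto simp: a e)
  then show ?thesis using step.ask[of M B ts] a 2(1) by auto
 qed
qed

text \<open>Up to the first visit of the halting state all moves are genuine steps, and that state
  is first entered from an accepting configuration without successor. Cutting the trace there leaves
  an accepting run.\<close>

lemma trace_accepts:
 assumes M: "well_formed M" and tr: "trace (entries M A) T c e" and c: "c 0 = init M w" "fst (c T) = halting M"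
  and ans: "answers B T c e"
 shows "accepts M B w"
proof -
 define n where "n = (LEAST t. fst (c t) = halting M)"
 have n: "fst (c n) = halting M" unfolding n_def by (rule LeastI[of _ T]) (rule c(2))
 have least: "fst (c t) ~= halting M" if "t < n" for t using not_less_Least that unfolding n_def by blast
 have nT: "n <= T" unfolding n_def by (rule Least_le) (rule c(2))
 have "fst (c 0) ~= halting M" using c(1) states_not_halting[OF M special_states(1)] by (simp add: init_def)
 then obtain m where m: "n = Suc m" using n by (cases n) auto
 have at: "e t \<in> entries M A" "moves (e t) (c t) (c (Suc t))" if "t < n" for t
  using tr that nT by (auto simp: trace_def)
 have "\<exists>k. run M B (c 0) m k (c m)"
 proof (rule run_from_steps)
  fix t assume t: "t < m"
  have "flag (e t) ~= 3"
  proof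
   assume "flag (e t) = 3"
   then have "fst (c (Suc t)) = halting M" using at[of t] t m by (auto simp: entries_def)
   then show False using least[of "Suc t"] t m by auto
  qed
  then show "\<exists>j. step M B (c t) j (c (Suc t))"
   using moves_step[OF at(2) at(1)] ans t m nT unfolding answers_def by auto
 qed
 then obtain k where run: "run M B (init M w) m k (c m)" using c(1) by auto
 obtain q rs q' as f where em: "e m = (q, rs, q', as, f)" by (cases "e m")
 have "q' = halting M" "fst (c m) = q" "map read (snd (c m)) = rs" using at[of m] n m em by auto
 moreover have "q ~= halting M" using least[of m] m calculation by auto
 moreover have "q' \<notin> states M" using states_not_halting[OF M] calculation by blast
 ultimately have acc: "fst (c m) = accept_state M" "accept_state M ~= query_state M"
  "\<forall>q' as. (accept_state M, map read (snd (c m)), q', as) \<notin> table M"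
  using at(1)[of m] m em special_states[of M] table_states[of q rs q' as M]
  by (auto simp: entries_def split: if_splits)
 have "halted M B (c m)"
  unfolding halted_def
 proof
  assume "\<exists>k c'. step M B (c m) k c'"
  then show False using acc by (auto elim!: step.cases)
 qed
 with run acc(1) show ?thesis unfolding accepts_def by blast
qed

section \<open>Accepting runs as traces\<close>

definition proper :: "machine => config => bool" where
 "proper M c <-> length (snd c) = ntapes M & (\<forall>tp\<in>set (snd c). range (fst tp) \<subseteq> symbols M)"

lemma proper_reads: "proper M c ==> map read (snd c) \<in> reads M"
 by (fastforce simp: proper_def reads_def)

lemma proper_init: "well_formed M ==> proper M (init M w)"
proof -
 assume M: "well_formed M"
 have "fst (word_tape v) i \<in> symbols M" for v i
  by (cases "v ! nat i") (auto simp: word_tape_def symbols_def)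
 then have "range (fst (word_tape v)) \<subseteq> symbols M" for v by blast
 then show ?thesis using M by (auto simp: proper_def init_def well_formed_def)
qed

lemma fst_act: "fst (act tp a) = (fst tp)(snd tp := fst a)"
 by (cases tp; cases a) auto

lemma proper_act:
 assumes "proper M c" "length as = ntapes M" "fst ` set as \<subseteq> symbols M"
 shows "proper M (q, map2 act (snd c) as)"
proof -
 have "range (fst tp) \<subseteq> symbols M" if tp: "tp \<in> set (map2 act (snd c) as)" for tp
 proof -
  obtain p where p: "p \<in> set (zip (snd c) as)" "tp = act (fst p) (snd p)" using tp by auto
  define tp' a where "tp' = fst p" and "a = snd p"
  have "tp' \<in> set (snd c)" "a \<in> set as" "tp = act tp' a"
   using p set_zip_leftD[of tp' a "snd c" as] set_zip_rightD[of tp' a "snd c" as] by (simp_all add: tp'_def a_def)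
  moreover have "range (fst tp') \<subseteq> symbols M" using assms(1) calculation(1) by (auto simp: proper_def)
  moreover have "fst a \<in> symbols M" using assms(3) calculation(2) by auto
  ultimately show ?thesis by (auto simp: fst_act)
 qed
 then show ?thesis using assms by (auto simp: proper_def)
qed

lemma proper_step:
 assumes M: "well_formed M" and "step M B c j c'" "proper M c"
 shows "proper M c'"
 using assms(2)
proof cases
 case (trans q ts q' as)
 have "length as = ntapes M" using M trans by (auto simp: well_formed_def)
 moreover have "fst ` set as \<subseteq> symbols M" using trans table_symbols by blast
 ultimately show ?thesis using proper_act[OF assms(3), of as q'] trans by simp
next
 case (ask ts)
 then show ?thesis using assms(3) by (simp add: proper_def)
qed

lemma step_moves:
 assumes M: "well_formed M" and s: "step M B a j b" and p: "proper M a"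
 shows "\<exists>e\<in>entries M {1, 2}. moves e a b & (flag e = 1 --> tape_word (snd a ! 1) \<in> B) &
   (flag e = 2 --> tape_word (snd a ! 1) \<notin> B)"
 using s
proof cases
 case (trans q ts q' as)
 then show ?thesis using proper_reads[OF p]
  by (intro bexI[of _ "(q, map read ts, q', as, 0)"]) (auto simp: entries_def)
next
 case (ask ts)
 let ?a = "if tape_word (ts ! 1) \<in> B then 1 else 2 :: nat"
 show ?thesis using ask proper_reads[OF p] stay_act[of ts]
  by (intro bexI[of _ "(query_state M, map read ts, if ?a = 1 then yes_state M else no_state M, stay_put (map read ts), ?a)"])
   (auto simp: entries_def)
qed

lemma accepts_trace:
 assumes M: "well_formed M" and acc: "accepts M B w" and T: "\<And>n k c. run M B (init M w) n k c ==> n < T"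
 shows "\<exists>c e. trace (entries M {1, 2}) T c e & c 0 = init M w & fst (c T) = halting M & answers B T c e"
proof -
 obtain n k f where f: "run M B (init M w) n k f" "halted M B f" "fst f = accept_state M"
  using acc unfolding accepts_def by (elim exE conjE)
 obtain s where s: "s 0 = init M w" "s n = f" "\<And>t. t < n ==> \<exists>j. step M B (s t) j (s (Suc t))"
  using steps_from_run[OF f(1)] by (elim exE conjE) (rule that, assumption+, iprover)
 have n: "n < T" by (rule T[OF f(1)])
 have p: "proper M (s t)" if "t <= n" for t
  using that
 proof (induction t)
  case (Suc t)
  then obtain j where "step M B (s t) j (s (Suc t))" using s(3)[of t] by auto
  then show ?case using proper_step[OF M] Suc by auto
 qed (simp add: s(1) proper_init[OF M])
 \<comment> \<open>Beyond time n the final tapes are frozen in the halting state, which stretches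
   the run to length T.\<close>
 define c where "c t = (if t <= n then s t else (halting M, snd f))" for t
 let ?ok = "%t e. e \<in> entries M {1, 2} & moves e (c t) (c (Suc t)) & (flag e = 1 --> tape_word (snd (c t) ! 1) \<in> B) &
   (flag e = 2 --> tape_word (snd (c t) ! 1) \<notin> B)"
 have "\<exists>e. ?ok t e" for t
 proof -
  have rf: "map read (snd f) \<in> reads M" using proper_reads[OF p[of n]] s(2) by simp
  consider "t < n" | "t = n" | "n < t" by linarith
  then show ?thesis
  proof cases
   case 1
   then show ?thesis using step_moves[OF M _ p[of t]] s(3)[of t] by (fastforce simp: c_def)
  next
   case 2
   have "accept_state M ~= query_state M" "(accept_state M, map read (snd f), q', as) \<notin> table M" for q' as
    using f(2,3) step.ask[of M B "snd f"] step.trans[of "fst f" M "snd f" q' as B]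
    unfolding halted_def by (metis prod.collapse)+
   then show ?thesis using 2 rf f(3) s(2) stay_act[of "snd f"]
    by (intro exI[of _ "(accept_state M, map read (snd f), halting M, stay_put (map read (snd f)), 3)"])
     (auto simp: entries_def c_def)
  next
   case 3
   then show ?thesis using rf stay_act[of "snd f"]
    by (intro exI[of _ "(halting M, map read (snd f), halting M, stay_put (map read (snd f)), 3)"])
     (auto simp: entries_def c_def)
  qed
 qed
 then have "\<exists>e. \<forall>t. ?ok t (e t)" by (intro choice allI)
 then obtain e where "\<forall>t. ?ok t (e t)" by (elim exE)
 then have "trace (entries M {1, 2}) T c e" "answers B T c e" unfolding trace_def answers_def by iprover+
 moreover have "c 0 = init M w" "fst (c T) = halting M" using s(1) n by (auto simp: c_def)
 ultimately show ?thesis by iprover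
qed

lemma trace_no_answers: "trace (entries M {1, 2}) T c e ==> answers {} T c e ==> trace (entries M {2}) T c e"
proof -
 assume tr: "trace (entries M {1, 2}) T c e" and ans: "answers {} T c e"
 have "x \<in> entries M {2}" if "x \<in> entries M {1, 2}" "flag x ~= 1" for x
  using that unfolding entries_def by auto
 moreover have "flag (e t) ~= 1" if "t < T" for t using ans that unfolding answers_def by blast
 ultimately show ?thesis using tr unfolding trace_def by blast
qed

lemma entries_no_answers: "e \<in> entries M {2} ==> flag e ~= 1"
 by (auto simp: entries_def)

lemma snd_act: "\<bar>snd (act tp a) - snd tp\<bar> <= 1"
 by (cases tp; cases a; cases "snd a") auto

text \<open>A head moves by at most one cell per step, so before time t it has visited only cells at
  distance below t from the origin; all others still hold their initial symbols.\<close>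

lemma trace_extent:
 assumes "trace E T c e" and E: "\<And>q rs q' as f. (q, rs, q', as, f) \<in> E ==> length as = K"
  and "length (snd (c 0)) = K" "\<And>k. k < K ==> snd (snd (c 0) ! k) = 0" "t <= T" "k < K"
 shows "length (snd (c t)) = K & \<bar>snd (snd (c t) ! k)\<bar> <= int t &
  (\<forall>i. int t <= \<bar>i\<bar> --> fst (snd (c t) ! k) i = fst (snd (c 0) ! k) i)"
 using assms(5)
proof (induction t)
 case 0
 then show ?case using assms(3,4,6) by auto
next
 case (Suc t)
 obtain q rs q' as f where e: "e t = (q, rs, q', as, f)" by (cases "e t")
 have "e t \<in> E" and c: "c (Suc t) = (q', map2 act (snd (c t)) as)" using assms(1)[unfolded trace_def, rule_format, of t] Suc.prems e by simp_all
 then have as: "length as = K" using E e by auto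
 have IH: "length (snd (c t)) = K" "\<bar>snd (snd (c t) ! k)\<bar> <= int t"
  "\<And>i. int t <= \<bar>i\<bar> ==> fst (snd (c t) ! k) i = fst (snd (c 0) ! k) i" using Suc by auto
 have k: "snd (c (Suc t)) ! k = act (snd (c t) ! k) (as ! k)" using c as IH(1) assms(6) by simp
 have "\<bar>snd (snd (c (Suc t)) ! k)\<bar> <= int (Suc t)" unfolding k using snd_act[of "snd (c t) ! k" "as ! k"] IH(2) by linarith
 moreover have "fst (snd (c (Suc t)) ! k) i = fst (snd (c 0) ! k) i" if "int (Suc t) <= \<bar>i\<bar>" for i
  unfolding k fst_act using IH(2) IH(3)[of i] that by auto
 ultimately show ?case using c as IH(1) by auto
qed

lemma word_tape_word:
 assumes "t (int n) \<notin> range Bit"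
 defines "L \<equiv> LEAST n. t (int n) \<notin> range Bit"
 shows "length (tape_word (t, h)) = L" "L <= n" "t (int L) \<notin> range Bit" "j < L ==> t (int j) \<in> range Bit"
  "fst (word_tape (tape_word (t, h))) i = (if 0 <= i & i < int L then t i else Blank)"
proof -
 show "length (tape_word (t, h)) = L" by (simp add: L_def)
 show "L <= n" unfolding L_def by (rule Least_le) (rule assms(1))
 show "t (int L) \<notin> range Bit" unfolding L_def by (rule LeastI[of _ n]) (rule assms(1))
 have b: "t (int j) \<in> range Bit" if "j < L" for j using not_less_Least[of j] that unfolding L_def by blast
 then show "j < L ==> t (int j) \<in> range Bit" .
 show "fst (word_tape (tape_word (t, h))) i = (if 0 <= i & i < int L then t i else Blank)"
 proof (cases "0 <= i & i < int L")
  case True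
  then have "nat i < L" "int (nat i) = i" by auto
  then obtain b where "t i = Bit b" using b[of "nat i"] by auto
  then show ?thesis using True by (auto simp: word_tape_def simp flip: L_def)
 qed (auto simp: word_tape_def simp flip: L_def)
qed

section \<open>Tableaux\<close>

text \<open>There are three kinds of tableaux: that of the given machine, and those of the machine deciding
 the oracle, for queries answered yes and, universally, for queries answered no. The latter two are
 indexed by the time of the query. A variable is indexed by query time, time and cell.\<close>

datatype blk = Main_run | Yes_run | No_run

datatype tag = Sym blk nat sym | Head blk nat | State blk nat | Entry blk entry | Guard blk
 | In_word blk | Past blk | Neg_answer | Chain | Dummy

abbreviation "eu \<equiv> Size 20"
abbreviation "et \<equiv> Size 21"
abbreviation "ei \<equiv> Size 22"
abbreviation "ej \<equiv> Size 23"
abbreviation "plus_one e \<equiv> Add e eOne"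
abbreviation "less_expr a b \<equiv> eLe (Add a eOne) b"

definition renv :: "bool list => nat => nat => nat => nat => nat => bool list" where
 "renv w u t i j = clause_env w [u, t, i, j]"

lemma renv_simps [simp]: "renv w u t i j 20 = ones u" "renv w u t i j 21 = ones t" "renv w u t i j 22 = ones i"
 "renv w u t i j 23 = ones j" "renv w u t i j 0 = w"
 by (simp_all add: renv_def base_def)

lemma num_renv: "regs e \<subseteq> {0} ==> num e (renv w u t i j) = num e (base w)"
 unfolding num_def by (rule arg_cong[where f = length], rule eval_cong) (auto simp: base_def)

lemma ball_tuples4: "(\<forall>xs\<in>set (tuples y 4). Q xs) <-> (\<forall>u<y. \<forall>t<y. \<forall>i<y. \<forall>j<y. Q [u, t, i, j])"
 by (auto simp: set_n_lists length_Suc_conv numeral_eq_Suc)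

lemma holds_iff: "holds \<alpha> w y (s, ls, out) <-> (\<forall>u<y. \<forall>t<y. \<forall>i<y. \<forall>j<y. tru s (renv w u t i j) -->
  (\<exists>(b, g, es)\<in>set ls. \<alpha> (g, map (%e. num e (renv w u t i j)) es) = b))"
 unfolding holds_def by (simp add: ball_tuples4 renv_def)

lemma holdsD: "holds \<alpha> w y (s, ls, out) ==> u < y ==> t < y ==> i < y ==> j < y ==> tru s (renv w u t i j) ==>
  \<exists>(b, g, es)\<in>set ls. \<alpha> (g, map (%e. num e (renv w u t i j)) es) = b"
 unfolding holds_iff by blast

text \<open>Head indices before and after a move, expressed in i without subtraction: a move to the
  left leads from i + 1 to i.\<close>

fun shifted :: "move => expr \<times> expr" where
 "shifted Left = (plus_one ei, ei)" | "shifted Stay = (ei, ei)" | "shifted Right = (ei, plus_one ei)"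

text \<open>Tapes extend to the left as well, whereas indices are natural numbers; so index i stands
  for position i - z.\<close>

definition cell :: "nat => tape => nat => sym" where
 "cell z tp i = fst tp (int i - int z)"

locale block =
 fixes b :: blk and E :: "entry list" and K :: nat and G :: "sym list" and Qs :: "nat list" and q0 qH :: nat and T Z0 :: expr
 assumes entry_shape: "(q, rs, q', as, f) \<in> set E ==> length rs = K & length as = K & fst ` set as \<subseteq> set G &
   q \<in> set Qs & q' \<in> set Qs"
  and q0: "q0 \<in> set Qs" and closed: "regs T \<subseteq> {0}" "regs Z0 \<subseteq> {0}" "bound_regs T \<subseteq> {1..}" "bound_regs Z0 \<subseteq> {1..}"
  and Blank_in: "Blank \<in> set G" and tapes: "2 <= K"
begin

abbreviation "isout \<equiv> b ~= No_run"

text \<open>The guard at query time u switches the tableau with that index on. Within a tableau only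
  this rule and the initial ones mention it; all others follow from the chosen entries.\<close>

definition choice_rule :: "tag schema" where
 "choice_rule = (less_expr et T, (False, Guard b, [eu, eZero, eZero]) # map (%e. (True, Entry b e, [eu, et, eZero])) E, isout)"

abbreviation "not_entry e \<equiv> (False, Entry b e, [eu, et, eZero])"

definition state_rule :: "entry => nat => tag schema" where
 "state_rule e q = (less_expr et T, [not_entry e, (False, State b q, [eu, et, eZero])], isout)"

definition next_rule :: "entry => tag schema" where
 "next_rule e = (less_expr et T, [not_entry e, (True, State b (fst (snd (snd e))), [eu, plus_one et, eZero])], isout)"

definition read_rule :: "entry => nat => sym => tag schema" where
 "read_rule e k s = (less_expr et T, [not_entry e, (False, Head b k, [eu, et, ei]), (False, Sym b k s, [eu, et, ei])], isout)"

definition move_rule :: "entry => nat => tag schema" where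
 "move_rule e k = (let (x, x') = shifted (snd (fst (snd (snd (snd e))) ! k)) in
   (less_expr et T, [not_entry e, (False, Head b k, [eu, et, x]), (True, Head b k, [eu, plus_one et, x'])], isout))"

definition write_rule :: "entry => nat => tag schema" where
 "write_rule e k = (less_expr et T, [not_entry e, (False, Head b k, [eu, et, ei]),
   (True, Sym b k (fst (fst (snd (snd (snd e))) ! k)), [eu, plus_one et, ei])], isout)"

definition copy_rule :: "nat => sym => tag schema" where
 "copy_rule k s = (eAnd (less_expr et T) (eNot (eEq ei ej)), [(False, Head b k, [eu, et, ei]), (False, Sym b k s, [eu, et, ej]),
   (True, Sym b k s, [eu, plus_one et, ej])], isout)"

definition final_rule :: "nat => tag schema" where
 "final_rule q = (eEq et T, [(False, State b q, [eu, et, eZero])], isout)"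

definition init_rule :: "expr => tag => expr => tag schema" where
 "init_rule s g x = (s, [(False, Guard b, [eu, eZero, eZero]), (True, g, [eu, eZero, x])], isout)"

definition "state_rules = concat (map (%e. map (state_rule e) (filter (%q. q ~= fst e) Qs)) E)"
definition "read_rules = concat (map (%e. concat (map (%k. map (read_rule e k) (filter (%s. s ~= fst (snd e) ! k) G)) [0..<K])) E)"
definition "move_rules = concat (map (%e. map (move_rule e) [0..<K]) E)"
definition "write_rules = concat (map (%e. map (write_rule e) [0..<K]) E)"
definition "copy_rules = concat (map (%k. map (copy_rule k) G) [0..<K])"
definition "final_rules = map final_rule (filter (%q. q ~= qH) Qs)"
definition "init_rules = init_rule eOne (State b q0) eZero # init_rule (less_expr ei Z0) (Sym b 0 Blank) ei
 # map (%k. init_rule (eEq ei Z0) (Head b k) ei) [0..<K] @ map (%k. init_rule eOne (Sym b k Blank) ei) [1..<K]"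

text \<open>No rule demands that a cell holds only one symbol or that a head has only one position.
  The rules carry forward everything that is true of the computation, and what holds in addition
  does no harm to soundness, because an entry must fit all asserted symbols and states.\<close>

definition rules :: "tag schema list" where
 "rules = concat [[choice_rule], state_rules, map next_rule E, read_rules, move_rules, write_rules, copy_rules, final_rules, init_rules]"

lemma set_rules: "set rules = {choice_rule} \<union> set state_rules \<union> next_rule ` set E \<union> set read_rules \<union> set move_rules
  \<union> set write_rules \<union> set copy_rules \<union> set final_rules \<union> set init_rules"
 by (simp add: rules_def Un_assoc)

lemma mem_rules:
 "choice_rule \<in> set rules"
 "e \<in> set E ==> q \<in> set Qs ==> q ~= fst e ==> state_rule e q \<in> set rules"
 "e \<in> set E ==> next_rule e \<in> set rules"
 "e \<in> set E ==> k < K ==> s \<in> set G ==> s ~= fst (snd e) ! k ==> read_rule e k s \<in> set rules"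
 "e \<in> set E ==> k < K ==> move_rule e k \<in> set rules"
 "e \<in> set E ==> k < K ==> write_rule e k \<in> set rules"
 "s \<in> set G ==> k < K ==> copy_rule k s \<in> set rules"
 "q \<in> set Qs ==> q ~= qH ==> final_rule q \<in> set rules"
 "S \<in> set init_rules ==> S \<in> set rules"
proof -
 show "choice_rule \<in> set rules" by (simp add: set_rules)
 show "next_rule e \<in> set rules" if "e \<in> set E" using that by (simp add: set_rules)
 show "S \<in> set rules" if "S \<in> set init_rules" using that by (simp add: set_rules)
 have sub: "set state_rules \<subseteq> set rules" "set read_rules \<subseteq> set rules" "set move_rules \<subseteq> set rules"
  "set write_rules \<subseteq> set rules" "set copy_rules \<subseteq> set rules" "set final_rules \<subseteq> set rules"
  unfolding set_rules by blast+
 show "state_rule e q \<in> set rules" if "e \<in> set E" "q \<in> set Qs" "q ~= fst e"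
  by (rule subsetD[OF sub(1)]) (use that in \<open>auto simp: state_rules_def\<close>)
 show "read_rule e k s \<in> set rules" if "e \<in> set E" "k < K" "s \<in> set G" "s ~= fst (snd e) ! k"
  by (rule subsetD[OF sub(2)]) (use that in \<open>auto simp: read_rules_def intro!: bexI[of _ e] bexI[of _ k]\<close>)
 show "move_rule e k \<in> set rules" if "e \<in> set E" "k < K"
  by (rule subsetD[OF sub(3)]) (use that in \<open>auto simp: move_rules_def intro!: bexI[of _ e] imageI\<close>)
 show "write_rule e k \<in> set rules" if "e \<in> set E" "k < K"
  by (rule subsetD[OF sub(4)]) (use that in \<open>auto simp: write_rules_def intro!: bexI[of _ e] imageI\<close>)
 show "copy_rule k s \<in> set rules" if "s \<in> set G" "k < K"
  by (rule subsetD[OF sub(5)]) (use that in \<open>auto simp: copy_rules_def intro!: bexI[of _ k] imageI\<close>)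
 show "final_rule q \<in> set rules" if "q \<in> set Qs" "q ~= qH"
  by (rule subsetD[OF sub(6)]) (use that in \<open>auto simp: final_rules_def\<close>)
qed

lemma rules_cases:
 assumes "S \<in> set rules"
 obtains "S = choice_rule" | e q where "S = state_rule e q" "e \<in> set E" "q \<in> set Qs" "q ~= fst e" | e where "S = next_rule e" "e \<in> set E"
  | e k s where "S = read_rule e k s" "e \<in> set E" "k < K" "s \<in> set G" "s ~= fst (snd e) ! k"
  | e k where "S = move_rule e k" "e \<in> set E" "k < K"
  | e k where "S = write_rule e k" "e \<in> set E" "k < K" | k s where "S = copy_rule k s" "k < K" "s \<in> set G"
  | q where "S = final_rule q" "q \<in> set Qs" "q ~= qH"
  | "S = init_rule eOne (State b q0) eZero" | k where "S = init_rule (eEq ei Z0) (Head b k) ei" "k < K"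
  | k where "S = init_rule eOne (Sym b k Blank) ei" "1 <= k" "k < K" | "S = init_rule (less_expr ei Z0) (Sym b 0 Blank) ei"
proof -
 note cs = that
 consider "S = choice_rule" | "S \<in> set state_rules" | "S \<in> next_rule ` set E" | "S \<in> set read_rules"
  | "S \<in> set move_rules" | "S \<in> set write_rules" | "S \<in> set copy_rules" | "S \<in> set final_rules" | "S \<in> set init_rules"
  using assms unfolding set_rules by blast
 then show thesis
 proof cases
  case 2 then show thesis using cs(2) unfolding state_rules_def by auto
 next
  case 3 then show thesis using cs(3) by auto
 next
  case 4 then show thesis using cs(4) unfolding read_rules_def by auto
 next
  case 5 then show thesis using cs(5) unfolding move_rules_def by auto
 next
  case 6 then show thesis using cs(6) unfolding write_rules_def by auto
 next
  case 7 then show thesis using cs(7) unfolding copy_rules_def by auto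
 next
  case 8 then show thesis using cs(8) unfolding final_rules_def by auto
 next
  case 9 then show thesis using cs(9-12) unfolding init_rules_def by auto
 qed (rule cs(1))
qed

context
 fixes \<alpha> :: "tag \<times> nat list => bool" and w :: "bool list"
begin

abbreviation "tmax \<equiv> num T (base w)"
abbreviation "zero \<equiv> num Z0 (base w)"
abbreviation "width \<equiv> Suc (2 * zero)"

lemma num_closed [simp]: "num T (renv w u t i j) = tmax" "num Z0 (renv w u t i j) = zero"
 by (rule num_renv[OF closed(1)], rule num_renv[OF closed(2)])

context
 assumes H: "\<And>S. S \<in> set rules ==> holds \<alpha> w width S" and long: "tmax <= zero"
begin

lemma choice_D:
 assumes a: "u < width" "t < tmax" "\<alpha> (Guard b, [u, 0, 0])"
 shows "\<exists>e\<in>set E. \<alpha> (Entry b e, [u, t, 0])"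
proof -
 have "holds \<alpha> w width choice_rule" by (rule H) (rule mem_rules(1))
 from holdsD[OF this[unfolded choice_rule_def], of u t 0 0] show ?thesis using a long by auto
qed

lemma state_D:
 assumes a: "e \<in> set E" "q \<in> set Qs" "u < width" "t < tmax"
  "\<alpha> (Entry b e, [u, t, 0])" "\<alpha> (State b q, [u, t, 0])"
 shows "fst e = q"
proof (rule ccontr)
 assume n: "fst e ~= q"
 have "holds \<alpha> w width (state_rule e q)" by (rule H) (rule mem_rules(2), use a n in auto)
 from holdsD[OF this[unfolded state_rule_def], of u t 0 0] show False using a n long by auto
qed

lemma next_D:
 assumes a: "e \<in> set E" "u < width" "t < tmax" "\<alpha> (Entry b e, [u, t, 0])"
 shows "\<alpha> (State b (fst (snd (snd e))), [u, Suc t, 0])"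
proof -
 have "holds \<alpha> w width (next_rule e)" by (rule H) (rule mem_rules(3), use a in auto)
 from holdsD[OF this[unfolded next_rule_def], of u t 0 0] show ?thesis using a long by auto
qed

lemma read_D:
 assumes a: "e \<in> set E" "k < K" "s \<in> set G" "u < width" "t < tmax" "i < width"
  "\<alpha> (Entry b e, [u, t, 0])" "\<alpha> (Head b k, [u, t, i])"
  "\<alpha> (Sym b k s, [u, t, i])"
 shows "s = fst (snd e) ! k"
proof (rule ccontr)
 assume n: "s ~= fst (snd e) ! k"
 have "holds \<alpha> w width (read_rule e k s)" by (rule H) (rule mem_rules(4), use a n in auto)
 from holdsD[OF this[unfolded read_rule_def], of u t i 0] show False using a n long by auto
qed

lemma move_D:
 assumes a: "e \<in> set E" "k < K" "u < width" "t < tmax" "i < width"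
  "\<alpha> (Entry b e, [u, t, 0])"
  "\<alpha> (Head b k, [u, t, num (fst (shifted (snd (fst (snd (snd (snd e))) ! k)))) (renv w u t i 0)])"
 shows "\<alpha> (Head b k, [u, Suc t, num (snd (shifted (snd (fst (snd (snd (snd e))) ! k)))) (renv w u t i 0)])"
proof -
 have "holds \<alpha> w width (move_rule e k)" by (rule H) (rule mem_rules(5), use a in auto)
 from holdsD[OF this[unfolded move_rule_def Let_def case_prod_beta], of u t i 0] show ?thesis using a long by auto
qed

lemma write_D:
 assumes a: "e \<in> set E" "k < K" "u < width" "t < tmax" "i < width"
  "\<alpha> (Entry b e, [u, t, 0])" "\<alpha> (Head b k, [u, t, i])"
 shows "\<alpha> (Sym b k (fst (fst (snd (snd (snd e))) ! k)), [u, Suc t, i])"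
proof -
 have "holds \<alpha> w width (write_rule e k)" by (rule H) (rule mem_rules(6), use a in auto)
 from holdsD[OF this[unfolded write_rule_def], of u t i 0] show ?thesis using a long by auto
qed

lemma copy_D:
 assumes a: "k < K" "s \<in> set G" "u < width" "t < tmax" "i < width" "j < width" "i ~= j"
  "\<alpha> (Head b k, [u, t, i])" "\<alpha> (Sym b k s, [u, t, j])"
 shows "\<alpha> (Sym b k s, [u, Suc t, j])"
proof -
 have "holds \<alpha> w width (copy_rule k s)" by (rule H) (rule mem_rules(7), use a in auto)
 from holdsD[OF this[unfolded copy_rule_def], of u t i j] show ?thesis using a long by auto
qed

lemma final_D:
 assumes a: "q \<in> set Qs" "u < width" "\<alpha> (State b q, [u, tmax, 0])"
 shows "q = qH"
proof (rule ccontr)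
 assume n: "q ~= qH"
 have "holds \<alpha> w width (final_rule q)" by (rule H) (rule mem_rules(8), use a n in auto)
 from holdsD[OF this[unfolded final_rule_def], of u tmax 0 0] show False using a n long by auto
qed

lemma initial:
 assumes "u < width" "\<alpha> (Guard b, [u, 0, 0])"
 shows "\<alpha> (State b q0, [u, 0, 0])" "k < K ==> \<alpha> (Head b k, [u, 0, zero])"
  "1 <= k ==> k < K ==> i < width ==> \<alpha> (Sym b k Blank, [u, 0, i])" "i < zero ==> \<alpha> (Sym b 0 Blank, [u, 0, i])"
proof -
 have r: "\<alpha> (g, [u, 0, num x (renv w u 0 i 0)])"
  if "init_rule s g x \<in> set rules" "i < width" "tru s (renv w u 0 i 0)" for s g x i
  using holdsD[OF H[OF that(1), unfolded init_rule_def], of u 0 i 0] that assms by auto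
 show "\<alpha> (State b q0, [u, 0, 0])" using r[of eOne "State b q0" eZero 0, OF mem_rules(9)] by (simp add: init_rules_def)
 show "\<alpha> (Head b k, [u, 0, zero])" if "k < K" using that r[of "eEq ei Z0" "Head b k" ei zero, OF mem_rules(9)] by (simp add: init_rules_def)
 show "\<alpha> (Sym b k Blank, [u, 0, i])" if "1 <= k" "k < K" "i < width"
  using that r[of eOne "Sym b k Blank" ei i, OF mem_rules(9)] by (simp add: init_rules_def)
 show "\<alpha> (Sym b 0 Blank, [u, 0, i])" if "i < zero"
  using that r[of "less_expr ei Z0" "Sym b 0 Blank" ei i, OF mem_rules(9)] by (simp add: init_rules_def)
qed

text \<open>Only positive facts: the assignment makes true whatever describes c, and possibly
  more.\<close>

definition invariant :: "nat => nat => config => bool" where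
 "invariant u t c <-> length (snd c) = K & fst c \<in> set Qs & \<alpha> (State b (fst c), [u, t, 0]) &
   (\<forall>k<K. range (fst (snd c ! k)) \<subseteq> set G & \<bar>snd (snd c ! k)\<bar> <= int t &
    \<alpha> (Head b k, [u, t, nat (snd (snd c ! k) + int zero)]) &
    (\<forall>i<width. \<alpha> (Sym b k (cell zero (snd c ! k) i), [u, t, i])))"

lemma invariant_step:
 assumes inv: "invariant u t c" and t: "t < tmax" and u: "u < width" and e: "(q, rs, q', as, f) \<in> set E"
  and a: "\<alpha> (Entry b (q, rs, q', as, f), [u, t, 0])"
 shows "moves (q, rs, q', as, f) c (q', map2 act (snd c) as)" "invariant u (Suc t) (q', map2 act (snd c) as)"
proof -
 note I = inv[unfolded invariant_def]
 have len: "length rs = K" "length as = K" "fst ` set as \<subseteq> set G" "q' \<in> set Qs" using entry_shape[OF e] by auto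
 have lc: "length (snd c) = K" using I by blast
 \<comment> \<open>As |position| <= t < \<open>zero\<close>, the head index stays strictly inside
   the tableau, and a move to the left is not cut off at 0.\<close>
 have pos: "nat (snd (snd c ! k) + int zero) < width" "int (nat (snd (snd c ! k) + int zero)) = snd (snd c ! k) + int zero"
  "1 <= nat (snd (snd c ! k) + int zero)" if "k < K" for k
 proof -
  have "\<bar>snd (snd c ! k)\<bar> <= int t" using I that by blast
  then show "nat (snd (snd c ! k) + int zero) < width" "int (nat (snd (snd c ! k) + int zero)) = snd (snd c ! k) + int zero"
   "1 <= nat (snd (snd c ! k) + int zero)" using t long by auto
 qed
 have rd: "cell zero (snd c ! k) (nat (snd (snd c ! k) + int zero)) = read (snd c ! k)" if "k < K" for k
  using pos(2)[OF that] by (cases "snd c ! k") (simp add: cell_def)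
 have "read (snd c ! k) = rs ! k" if k: "k < K" for k
 proof -
  have "read (snd c ! k) \<in> set G" using I k by (cases "snd c ! k") fastforce
  moreover have "\<alpha> (Sym b k (read (snd c ! k)), [u, t, nat (snd (snd c ! k) + int zero)])"
   using I k pos(1)[OF k] rd[OF k] by metis
  ultimately show ?thesis using read_D[OF e k _ u t pos(1)[OF k] a] I k by auto
 qed
 then have "map read (snd c) = rs" using len(1) lc by (intro nth_equalityI) auto
 moreover have "fst c = q" using state_D[OF e _ u t a] I by auto
 ultimately show "moves (q, rs, q', as, f) c (q', map2 act (snd c) as)" by simp
 show "invariant u (Suc t) (q', map2 act (snd c) as)"
  unfolding invariant_def fst_conv snd_conv
 proof (intro conjI allI impI)
  show "length (map2 act (snd c) as) = K" using lc len by simp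
  show "q' \<in> set Qs" by fact
  show "\<alpha> (State b q', [u, Suc t, 0])" using next_D[OF e u t a] by simp
  fix k assume k: "k < K"
  let ?tp = "snd c ! k" and ?p = "nat (snd (snd c ! k) + int zero)"
  have nth: "map2 act (snd c) as ! k = act ?tp (as ! k)" using k lc len by simp
  have ak: "fst (as ! k) \<in> set G" using len(2,3) k by (metis image_subset_iff nth_mem)
  have hd: "\<alpha> (Head b k, [u, t, ?p])" using I k by blast
  show "range (fst (map2 act (snd c) as ! k)) \<subseteq> set G"
   unfolding nth fst_act using I k ak by (auto simp: image_subset_iff)
  have "\<bar>snd ?tp\<bar> <= int t" using I k by blast
  then show "\<bar>snd (map2 act (snd c) as ! k)\<bar> <= int (Suc t)"
   unfolding nth using snd_act[of ?tp "as ! k"] by linarith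
  show "\<alpha> (Head b k, [u, Suc t, nat (snd (map2 act (snd c) as ! k) + int zero)])"
  proof (cases "snd (as ! k)")
   case Left
   have "snd (act ?tp (as ! k)) = snd ?tp - 1" using Left by (cases ?tp; cases "as ! k") auto
   then have "nat (snd (act ?tp (as ! k)) + int zero) = ?p - 1" by simp
   then show ?thesis unfolding nth using move_D[OF e k u t, of "?p - 1"] a hd Left pos[OF k] by simp
  next
   case Stay
   have "snd (act ?tp (as ! k)) = snd ?tp" using Stay by (cases ?tp; cases "as ! k") auto
   then show ?thesis unfolding nth using move_D[OF e k u t, of ?p] a hd Stay pos[OF k] by simp
  next
   case Right
   have "snd (act ?tp (as ! k)) = snd ?tp + 1" using Right by (cases ?tp; cases "as ! k") auto
   then have "nat (snd (act ?tp (as ! k)) + int zero) = Suc ?p" using pos[OF k] by simp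
   then show ?thesis unfolding nth using move_D[OF e k u t, of ?p] a hd Right pos[OF k] by simp
  qed
  fix i assume i: "i < width"
  show "\<alpha> (Sym b k (cell zero (map2 act (snd c) as ! k) i), [u, Suc t, i])"
  proof (cases "i = ?p")
   case True
   then have "cell zero (act ?tp (as ! k)) i = fst (as ! k)"
    using pos(2)[OF k] by (simp add: cell_def fst_act)
   then show ?thesis unfolding nth using write_D[OF e k u t i] a hd True by simp
  next
   case False
   then have "int i - int zero ~= snd ?tp" using pos(2)[OF k] by auto
   then have "cell zero (act ?tp (as ! k)) i = cell zero ?tp i"
    by (simp add: cell_def fst_act)
   moreover have "cell zero ?tp i \<in> set G" using I k unfolding cell_def by blast
   moreover have "\<alpha> (Sym b k (cell zero ?tp i), [u, t, i])" using I k i by blast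
   ultimately show ?thesis unfolding nth using copy_D[OF k _ u t pos(1)[OF k] i _ hd] False by metis
  qed
 qed
qed

text \<open>The assignment is only asked for the entries. The configurations are recomputed from
  them, and the invariant shows that each chosen entry applies to the configuration reached so
  far.\<close>

lemma sound:
 assumes u: "u < width" and g: "\<alpha> (Guard b, [u, 0, 0])" and c0: "length ts = K"
  "\<And>k. k < K ==> range (fst (ts ! k)) \<subseteq> set G & snd (ts ! k) = 0"
  "\<And>k. 1 <= k ==> k < K ==> fst (ts ! k) = (%_. Blank)" "\<And>i. i < 0 ==> fst (ts ! 0) i = Blank"
  "\<And>i. zero <= i ==> i < width ==> \<alpha> (Sym b 0 (cell zero (ts ! 0) i), [u, 0, i])"
 shows "\<exists>c e. trace (set E) tmax c e & c 0 = (q0, ts) & fst (c tmax) = qH &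
  (\<forall>t<tmax. \<alpha> (Entry b (e t), [u, t, 0])) &
  (\<forall>t\<le>tmax. \<forall>k<K. \<forall>i<width. \<alpha> (Sym b k (cell zero (snd (c t) ! k) i), [u, t, i]))"
proof -
 have "\<exists>e. t < tmax --> e \<in> set E & \<alpha> (Entry b e, [u, t, 0])" for t using choice_D[OF u _ g] by blast
 then have "\<exists>e. \<forall>t. t < tmax --> e t \<in> set E & \<alpha> (Entry b (e t), [u, t, 0])" by (intro Hilbert_Choice.choice allI)
 then obtain e where e: "\<forall>t. t < tmax --> e t \<in> set E & \<alpha> (Entry b (e t), [u, t, 0])" by (elim exE)
 \<comment> \<open>Each configuration results from the previous one by the actions of the chosen
   entry, regardless of what else the assignment asserts.\<close>
 define c where "c = rec_nat (q0, ts) (%t c. (fst (snd (snd (e t))), map2 act (snd c) (fst (snd (snd (snd (e t)))))))"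
 have c: "c 0 = (q0, ts)" "c (Suc t) = (fst (snd (snd (e t))), map2 act (snd (c t)) (fst (snd (snd (snd (e t))))))" for t
  by (simp_all add: c_def)
 have i0: "invariant u 0 (c 0)"
  unfolding invariant_def c fst_conv snd_conv
 proof (intro conjI allI impI)
  fix k assume k: "k < K"
  show "\<bar>snd (ts ! k)\<bar> <= int 0" using c0(2)[OF k] by simp
  show "range (fst (ts ! k)) \<subseteq> set G" using c0(2)[OF k] by blast
  show "\<alpha> (Head b k, [u, 0, nat (snd (ts ! k) + int zero)])" using initial(2)[OF u g k] c0(2)[OF k] by simp
  fix i assume i: "i < width"
  show "\<alpha> (Sym b k (cell zero (ts ! k) i), [u, 0, i])"
  proof (cases "k = 0")
   case False
   then show ?thesis using initial(3)[OF u g _ k i] c0(3)[OF _ k] by (simp add: cell_def)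
  next
   case True
   show ?thesis
   proof (cases "i < zero")
    case True
    then have "cell zero (ts ! 0) i = Blank" using c0(4) by (simp add: cell_def)
    then show ?thesis using initial(4)[OF u g True] \<open>k = 0\<close> by simp
   next
    case False
    then show ?thesis using c0(5)[OF _ i] \<open>k = 0\<close> by simp
   qed
  qed
 qed (use c0(1) q0 initial(1)[OF u g] in auto)
 have step: "moves (e t) (c t) (c (Suc t)) & invariant u (Suc t) (c (Suc t))" if "invariant u t (c t)" "t < tmax" for t
 proof -
  obtain q rs q' as f where et: "e t = (q, rs, q', as, f)" by (cases "e t")
  have "(q, rs, q', as, f) \<in> set E" "\<alpha> (Entry b (q, rs, q', as, f), [u, t, 0])" using e that(2) et by auto
  from invariant_step[OF that u this] show ?thesis by (simp add: c(2) et)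
 qed
 have inv: "invariant u t (c t)" if "t <= tmax" for t
  using that by (induction t) (use i0 step in auto)
 have "trace (set E) tmax c e" unfolding trace_def using e step inv by auto
 moreover have "fst (c tmax) = qH"
  using inv[of tmax] final_D[OF _ u] unfolding invariant_def by blast
 moreover have "\<forall>t\<le>tmax. \<forall>k<K. \<forall>i<width. \<alpha> (Sym b k (cell zero (snd (c t) ! k) i), [u, t, i])"
  using inv unfolding invariant_def by blast
 ultimately show ?thesis using e c(1) by (intro exI[of _ c] exI[of _ e]) blast
qed

end

text \<open>All variables of a tableau whose guard is off are false, and every rule has a negative
  literal among them. If the guard is on, the variables describe an actual trace, which obeys the
  rules.\<close>

lemma complete:
 fixes g :: "nat => bool" and c :: "nat => nat => config" and e :: "nat => nat => entry"
 assumes val: "\<And>u x y. \<alpha> (Guard b, [u, x, y]) <-> g u"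
  "\<And>k s u t i. \<alpha> (Sym b k s, [u, t, i]) <-> g u & t <= tmax & cell zero (snd (c u t) ! k) i = s"
  "\<And>k u t i. \<alpha> (Head b k, [u, t, i]) <-> g u & t <= tmax & snd (snd (c u t) ! k) = int i - int zero"
  "\<And>q u t x. \<alpha> (State b q, [u, t, x]) <-> g u & t <= tmax & fst (c u t) = q"
  "\<And>a u t x. \<alpha> (Entry b a, [u, t, x]) <-> g u & t < tmax & e u t = a"
  and tr: "\<And>u. g u ==> trace (set E) tmax (c u) (e u) & fst (c u tmax) = qH & fst (c u 0) = q0 &
   length (snd (c u 0)) = K & (\<forall>k<K. snd (snd (c u 0) ! k) = 0) &
   (\<forall>k\<in>{1..<K}. fst (snd (c u 0) ! k) = (%_. Blank)) & (\<forall>i<0. fst (snd (c u 0) ! 0) i = Blank)"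
  and S: "S \<in> set rules"
 shows "holds \<alpha> w width S"
proof -
 have len: "length (snd (c u t)) = K" if "g u" "t <= tmax" for u t
  using trace_extent[of "set E" tmax "c u" "e u" K t 0] tr[OF that(1)] entry_shape that(2) tapes by auto
 have st: "moves (e u t) (c u t) (c u (Suc t))" "e u t \<in> set E" if "g u" "t < tmax" for u t
  using tr[OF that(1)] that(2) by (auto simp: trace_def)
 have fs: "fst (e u t) = fst (c u t)" "fst (snd (snd (e u t))) = fst (c u (Suc t))" if "g u" "t < tmax" for u t
  using st[OF that] by (cases "e u t"; auto)+
 have rd: "fst (snd (e u t)) ! k = read (snd (c u t) ! k)" if "g u" "t < tmax" "k < K" for u t k
  using st(1)[OF that(1,2)] len[of u t] that by (cases "e u t") auto
 have nt: "snd (c u (Suc t)) ! k = act (snd (c u t) ! k) (fst (snd (snd (snd (e u t)))) ! k)"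
  if "g u" "t < tmax" "k < K" for u t k
 proof -
  obtain q rs q' as f where et: "e u t = (q, rs, q', as, f)" by (cases "e u t")
  have "length as = K" using st(2)[OF that(1,2)] entry_shape et by auto
  then show ?thesis using st(1)[OF that(1,2)] len[of u t] that et by auto
 qed
 have cellp: "cell zero tp i = read tp" if "snd tp = int i - int zero" for tp i
  using that by (cases tp) (simp add: cell_def)
 from S show ?thesis
 proof (cases rule: rules_cases)
  case 1
  then show ?thesis using st(2) by (auto simp: choice_rule_def holds_iff val)
 next
  case 2
  then show ?thesis using fs(1) by (auto simp: state_rule_def holds_iff val)
 next
  case 3
  then show ?thesis using fs(2) by (auto simp: next_rule_def holds_iff val)
 next
  case (4 a k s)
  then show ?thesis using rd by (auto simp: read_rule_def holds_iff val cellp)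
 next
  case (5 a k)
  have "snd (act tp (s, m)) = (case m of Left => snd tp - 1 | Stay => snd tp | Right => snd tp + 1)" for tp s m
   by (cases tp) (simp split: move.splits)
  then have sa: "snd (act tp x) = (case snd x of Left => snd tp - 1 | Stay => snd tp | Right => snd tp + 1)" for tp x
   by (cases x) simp
  show ?thesis
   by (cases "snd (fst (snd (snd (snd a))) ! k)") (use 5 nt in \<open>auto simp: move_rule_def holds_iff val sa\<close>)
 next
  case (6 a k)
  then show ?thesis using nt by (auto simp: write_rule_def holds_iff val fst_act cell_def)
 next
  case (7 k s)
  then show ?thesis using nt by (auto simp: copy_rule_def holds_iff val fst_act cell_def)
 next
  case 8
  then show ?thesis using tr by (auto simp: final_rule_def holds_iff val)
 next
  case 9
  then show ?thesis using tr by (auto simp: init_rule_def holds_iff val)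
 next
  case 10
  then show ?thesis using tr by (auto simp: init_rule_def holds_iff val)
 next
  case 11
  then show ?thesis using tr by (auto simp: init_rule_def holds_iff val cell_def)
 next
  case 12
  then show ?thesis using tr by (auto simp: init_rule_def holds_iff val cell_def)
 qed
qed

end

end

section \<open>Linking query tape, input tape and input word\<close>

definition cell_of :: "expr => expr" where "cell_of Z0 = Add Z0 ej"

abbreviation "start_rule b \<equiv> (eOne, [(False, Guard b, [eu, eZero, eZero]), (True, In_word b, [eu, eZero, eZero])], b ~= No_run)"

abbreviation "past_rule b Z0 \<equiv> (eLe ej Z0, [(False, Past b, [eu, eZero, ej]), (True, Past b, [eu, eZero, plus_one ej])], b ~= No_run)"

abbreviation "blank_rule b Z0 \<equiv> (eLe ej Z0, [(False, Past b, [eu, eZero, ej]), (True, Sym b 0 Blank, [eu, eZero, cell_of Z0])], b ~= No_run)"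

abbreviation "word_rule b Z0 s \<equiv> (eLe ej Z0, [(False, In_word b, [eu, eZero, ej]), (False, Sym Main_run 1 s, [eZero, eu, cell_of Z0]),
     (True, if s \<in> range Bit then In_word b else Past b, [eu, eZero, if s \<in> range Bit then plus_one ej else ej])], b ~= No_run)"

abbreviation "put_rule b Z0 s \<equiv> (eLe ej Z0, [(False, In_word b, [eu, eZero, ej]), (False, Sym Main_run 1 s, [eZero, eu, cell_of Z0]),
     (True, Sym b 0 s, [eu, eZero, cell_of Z0])], b ~= No_run)"

text \<open>The query is the word on tape 1 of the main machine at time u, ending at the first cell
  without a bit. \<open>In_word\<close> at j says that all cells before j hold bits,
  \<open>Past\<close> at j that the word has ended at or before j; bits are copied in the first
  case, blanks are put in the second.\<close>

definition link_rules :: "blk => sym list => expr => tag schema list" where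
 "link_rules b G Z0 =
   [start_rule b,
   past_rule b Z0,
   blank_rule b Z0]
   @ map (%s. word_rule b Z0 s) G
   @ map (%s. put_rule b Z0 s) (filter (%s. s \<in> range Bit) G)"

text \<open>The two markers are derived along the cells, the first up to the length of the word and
  the second from there on. Cells left of the origin are left to the initial rules, which make them
  blank.\<close>

lemma link_sound:
 assumes closed: "regs Z0 \<subseteq> {0}" and H: "\<And>S. S \<in> set (link_rules b G Z0) ==> holds \<alpha> w y S"
  and y: "y = Suc (2 * num Z0 (base w))" and u: "u < y" and g: "\<alpha> (Guard b, [u, 0, 0])"
  and tp: "\<And>i. i < y ==> \<alpha> (Sym Main_run 1 (cell (num Z0 (base w)) tp i), [0, u, i])" "range (fst tp) \<subseteq> set G"
   "fst tp (int n) \<notin> range Bit"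
  and i: "num Z0 (base w) <= i" "i < y"
 shows "\<alpha> (Sym b 0 (cell (num Z0 (base w)) (word_tape (tape_word tp)) i), [u, 0, i])"
proof -
 let ?z = "num Z0 (base w)"
 have z: "num Z0 (renv w u t i j) = ?z" for u t i j by (rule num_renv[OF closed])
 obtain t h where th: "tp = (t, h)" by (cases tp)
 define L where "L = (LEAST n. t (int n) \<notin> range Bit)"
 note W = word_tape_word[of t n, folded L_def, OF tp(3)[unfolded th fst_conv]]
 have r: "\<exists>(b, g, es)\<in>set ls. \<alpha> (g, map (%e. num e (renv w u 0 0 j)) es) = b"
  if "(s, ls, out) \<in> set (link_rules b G Z0)" "tru s (renv w u 0 0 j)" "j <= ?z" for s ls out j
  by (rule holdsD[OF H[OF that(1)]]) (use that u y in auto)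
 have start: "\<alpha> (In_word b, [u, 0, 0])"
  using r[of eOne "[(False, Guard b, [eu, eZero, eZero]), (True, In_word b, [eu, eZero, eZero])]" "b ~= No_run" 0] g
  by (simp add: link_rules_def)
 have past: "\<alpha> (Past b, [u, 0, Suc j]) & \<alpha> (Sym b 0 Blank, [u, 0, ?z + j])" if "\<alpha> (Past b, [u, 0, j])" "j <= ?z" for j
  using r[of "eLe ej Z0" "[(False, Past b, [eu, eZero, ej]), (True, Past b, [eu, eZero, plus_one ej])]" "b ~= No_run" j]
   r[of "eLe ej Z0" "[(False, Past b, [eu, eZero, ej]), (True, Sym b 0 Blank, [eu, eZero, cell_of Z0])]" "b ~= No_run" j] that
  by (simp add: link_rules_def z cell_of_def)
 have c: "cell ?z tp (?z + j) = t (int j)" for j by (simp add: cell_def th)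
 have G: "t x \<in> set G" for x using tp(2) th by auto
 have S1: "\<alpha> (Sym Main_run 1 (t (int j)), [0, u, ?z + j])" if "j <= ?z" for j
  using tp(1)[of "?z + j"] c that y by simp
 have word: "\<alpha> (if t (int j) \<in> range Bit then In_word b else Past b, [u, 0, if t (int j) \<in> range Bit then Suc j else j])"
  if "\<alpha> (In_word b, [u, 0, j])" "j <= ?z" for j
 proof -
  let ?s = "t (int j)"
  have "word_rule b Z0 ?s
     \<in> set (link_rules b G Z0)"
   unfolding link_rules_def set_append set_map using G by (intro UnI1 UnI2) blast
  from r[OF this, of j] show ?thesis using that S1 by (auto simp: z cell_of_def split: if_splits)
 qed
 have put: "\<alpha> (Sym b 0 (t (int j)), [u, 0, ?z + j])" if "\<alpha> (In_word b, [u, 0, j])" "j <= ?z" "t (int j) \<in> range Bit" for j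
 proof -
  let ?s = "t (int j)"
  have "put_rule b Z0 ?s \<in> set (link_rules b G Z0)"
   unfolding link_rules_def set_append set_map using G that(3) by (intro UnI2) auto
  from r[OF this, of j] show ?thesis using that S1 by (auto simp: z cell_of_def)
 qed
 have facts: "(j <= L --> \<alpha> (In_word b, [u, 0, j])) & (L <= j --> \<alpha> (Past b, [u, 0, j]))" if "j <= ?z" for j
  using that
 proof (induction j)
  case 0
  show ?case using start word[OF start] W(3) by auto
 next
  case (Suc j)
  have "\<alpha> (In_word b, [u, 0, Suc j])" if "Suc j <= L"
   using word[of j] W(4)[of j] Suc that by simp
  moreover have "\<alpha> (Past b, [u, 0, Suc j])" if "L <= Suc j"
  proof (cases "L <= j")
   case True
   then show ?thesis using past[of j] Suc by simp
  next
   case False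
   then have "L = Suc j" using that by simp
   then show ?thesis using word[of "Suc j"] W(3) calculation Suc.prems by simp
  qed
  ultimately show ?case by blast
 qed
 define j where "j = i - ?z"
 have j: "i = ?z + j" "j <= ?z" using i y by (auto simp: j_def)
 have "cell ?z (word_tape (tape_word tp)) i = (if j < L then t (int j) else Blank)"
  using W(5)[of h "int j"] by (simp add: cell_def j(1) th)
 then show ?thesis using facts[OF j(2)] put[OF _ j(2)] past[OF _ j(2)] W(4)[of j] j(1) by auto
qed

text \<open>Symbols of the query tape occur negatively here, so the assumption \<open>main\<close>
  is needed that none but the actual ones are asserted.\<close>

lemma link_complete:
 assumes closed: "regs Z0 \<subseteq> {0}" and y: "y = Suc (2 * num Z0 (base w))"
  and val: "\<And>u x y. \<alpha> (Guard b, [u, x, y]) ==> g u" "\<And>u x j. \<alpha> (In_word b, [u, x, j]) <-> g u & j <= L u"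
   "\<And>u x j. \<alpha> (Past b, [u, x, j]) <-> g u & L u <= j"
   "\<And>u i s. g u ==> cell (num Z0 (base w)) (word_tape (tape_word (tp u))) i = s ==> \<alpha> (Sym b 0 s, [u, 0, i])"
  and main: "\<And>u i s. g u ==> s \<in> set G ==> i < y ==> \<alpha> (Sym Main_run 1 s, [0, u, i]) ==> s = cell (num Z0 (base w)) (tp u) i"
  and L: "\<And>u. g u ==> L u = (LEAST n. fst (tp u) (int n) \<notin> range Bit)"
  and ex: "\<And>u. g u ==> \<exists>n. fst (tp u) (int n) \<notin> range Bit"
  and S: "S \<in> set (link_rules b G Z0)"
 shows "holds \<alpha> w y S"
proof -
 let ?z = "num Z0 (base w)"
 have z: "num Z0 (renv w u t i j) = ?z" for u t i j by (rule num_renv[OF closed])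
 have W: "fst (tp u) (int (L u)) \<notin> range Bit" "j < L u ==> fst (tp u) (int j) \<in> range Bit"
  "cell ?z (word_tape (tape_word (tp u))) (?z + j) = (if j < L u then fst (tp u) (int j) else Blank)" if gu: "g u" for u j
 proof -
  obtain n where n: "fst (tp u) (int n) \<notin> range Bit" using ex[OF gu] by blast
  note w = word_tape_word[of "fst (tp u)", OF n, folded L[OF gu]]
  show "fst (tp u) (int (L u)) \<notin> range Bit" "j < L u ==> fst (tp u) (int j) \<in> range Bit"
   by (rule w(3), rule w(4))
  show "cell ?z (word_tape (tape_word (tp u))) (?z + j) = (if j < L u then fst (tp u) (int j) else Blank)"
   using w(5)[of "snd (tp u)" "int j"] by (simp add: cell_def)
 qed
 have m: "s = fst (tp u) (int j)" if "g u" "s \<in> set G" "j <= ?z" "\<alpha> (Sym Main_run 1 s, [0, u, ?z + j])" for u s j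
  using main[OF that(1,2) _ that(4)] that(3) y by (simp add: cell_def)
 consider "S = start_rule b"
  | "S = past_rule b Z0"
  | "S = blank_rule b Z0"
  | s where "s \<in> set G" "S = word_rule b Z0 s"
  | s where "s \<in> set G" "s \<in> range Bit" "S = put_rule b Z0 s"
  using S unfolding link_rules_def set_append set_map set_simps Un_iff insert_iff empty_iff image_iff set_filter mem_Collect_eq by blast
 then show ?thesis
 proof cases
  case 1
  then show ?thesis using val(1) by (auto simp: holds_iff val(2))
 next
  case 2
  then show ?thesis by (auto simp: holds_iff val(3))
 next
  case 3
  have "\<alpha> (Sym b 0 Blank, [u, 0, ?z + j])" if "g u" "L u <= j" for u j
   by (rule val(4)) (use W(3)[OF that(1), of j] that in auto)
  then show ?thesis using 3 by (auto simp: holds_iff val(3) z cell_of_def)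
 next
  case (4 s)
  have "\<alpha> (if s \<in> range Bit then In_word b else Past b, [u, 0, if s \<in> range Bit then Suc j else j])"
   if a: "g u" "j <= L u" "j <= ?z" "\<alpha> (Sym Main_run 1 s, [0, u, ?z + j])" for u j
  proof -
   have s: "s = fst (tp u) (int j)" by (rule m[OF a(1) 4(1) a(3,4)])
   show ?thesis
   proof (cases "j = L u")
    case True
    then have "s \<notin> range Bit" using W(1)[OF a(1)] s by simp
    then show ?thesis using True a(1) by (simp add: val(3))
   next
    case False
    then have "j < L u" using a by simp
    then have "s \<in> range Bit" using W(2)[OF a(1)] s by blast
    then show ?thesis using \<open>j < L u\<close> a(1) by (simp add: val(2))
   qed
  qed
  then show ?thesis using 4 by (cases "s \<in> range Bit") (auto simp: holds_iff val(2) z cell_of_def)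
 next
  case (5 s)
  have "\<alpha> (Sym b 0 s, [u, 0, ?z + j])" if a: "g u" "j <= L u" "j <= ?z" "\<alpha> (Sym Main_run 1 s, [0, u, ?z + j])" for u j
  proof -
   have s: "s = fst (tp u) (int j)" by (rule m[OF a(1) 5(1) a(3,4)])
   have "j ~= L u" using W(1)[OF a(1)] s 5(2) by auto
   then show ?thesis using a s by (intro val(4)) (simp_all add: W(3)[OF a(1)])
  qed
  then show ?thesis using 5(3) by (auto simp: holds_iff val(2) z cell_of_def)
 qed
qed

definition input_rules :: "expr => tag schema list" where
 "input_rules Z0 =
   [(eEq eu eZero, [(True, Guard Main_run, [eu, eZero, eZero])], True),
   (Get 0 ej, [(False, Guard Main_run, [eu, eZero, eZero]), (True, Sym Main_run 0 (Bit True), [eu, eZero, cell_of Z0])], True),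
   (eAnd (less_expr ej (Size 0)) (eNot (Get 0 ej)),
    [(False, Guard Main_run, [eu, eZero, eZero]), (True, Sym Main_run 0 (Bit False), [eu, eZero, cell_of Z0])], True),
   (eLe (Size 0) ej, [(False, Guard Main_run, [eu, eZero, eZero]), (True, Sym Main_run 0 Blank, [eu, eZero, cell_of Z0])], True)]"

lemma cell_word_tape: "cell z (word_tape w) (z + j) = (if j < length w then Bit (w ! j) else Blank)"
 by (simp add: cell_def word_tape_def)

lemma input_sound:
 assumes closed: "regs Z0 \<subseteq> {0}" and H: "\<And>S. S \<in> set (input_rules Z0) ==> holds \<alpha> w y S"
  and y: "y = Suc (2 * num Z0 (base w))"
 shows "\<alpha> (Guard Main_run, [0, 0, 0])"
  "num Z0 (base w) <= i ==> i < y ==> \<alpha> (Sym Main_run 0 (cell (num Z0 (base w)) (word_tape w) i), [0, 0, i])"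
proof -
 let ?z = "num Z0 (base w)"
 have z: "num Z0 (renv w u t i j) = ?z" for u t i j by (rule num_renv[OF closed])
 show g: "\<alpha> (Guard Main_run, [0, 0, 0])"
  using holdsD[OF H[of "(eEq eu eZero, [(True, Guard Main_run, [eu, eZero, eZero])], True)"], of 0 0 0 0] y
  by (simp add: input_rules_def)
 assume i: "?z <= i" "i < y"
 define j where "j = i - ?z"
 have j: "i = ?z + j" "j < y" using i by (auto simp: j_def)
 have r: "\<alpha> (Sym Main_run 0 s, [0, 0, i])"
  if "(x, [(False, Guard Main_run, [eu, eZero, eZero]), (True, Sym Main_run 0 s, [eu, eZero, cell_of Z0])], True) \<in> set (input_rules Z0)"
   "tru x (renv w 0 0 0 j)" for s x
  using holdsD[OF H[OF that(1)], of 0 0 0 j] that(2) g j y by (auto simp: z cell_of_def)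
 show "\<alpha> (Sym Main_run 0 (cell ?z (word_tape w) i), [0, 0, i])"
  unfolding j(1) cell_word_tape
  using r[of "Get 0 ej" "Bit True"] r[of "eAnd (less_expr ej (Size 0)) (eNot (Get 0 ej))" "Bit False"] r[of "eLe (Size 0) ej" Blank] j(1)
  by (cases "w ! j") (auto simp: input_rules_def bit_at_def)
qed

lemma input_complete:
 assumes closed: "regs Z0 \<subseteq> {0}"
  and val: "\<And>u x y. \<alpha> (Guard Main_run, [u, x, y]) <-> u = 0"
   "\<And>i s. cell (num Z0 (base w)) (word_tape w) i = s ==> \<alpha> (Sym Main_run 0 s, [0, 0, i])"
  and S: "S \<in> set (input_rules Z0)"
 shows "holds \<alpha> w y S"
proof -
 have z: "num Z0 (renv w u t i j) = num Z0 (base w)" for u t i j by (rule num_renv[OF closed])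
 show ?thesis using S
  by (auto simp: input_rules_def holds_iff val(1) z cell_of_def bit_at_def cell_word_tape)
   (rule ccontr, simp add: val(2) cell_word_tape)+
qed

section \<open>Index bounds, quantified variables and canonical assignments\<close>

text \<open>Indices of literals are drawn from a fixed list of expressions, hence small.\<close>

definition indices :: "expr => expr set" where
 "indices Z0 = {eZero, eu, et, ei, ej, plus_one et, plus_one ei, plus_one ej, cell_of Z0}"

fun existential :: "tag => bool" where
 "existential (Sym b k s) <-> b ~= No_run" | "existential (Head b k) <-> b ~= No_run"
| "existential (State b q) <-> b ~= No_run" | "existential (Entry b e) <-> b ~= No_run"
| "existential (Guard b) <-> b ~= No_run" | "existential (In_word b) <-> b ~= No_run"
| "existential (Past b) <-> b ~= No_run" | "existential Chain <-> False" | "existential Neg_answer <-> True"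
| "existential Dummy <-> True"

definition regular :: "expr => tag schema => bool" where
 "regular Z0 S <-> (case S of (s, ls, out) => regs s \<subseteq> {0, 20, 21, 22, 23} & 0 \<notin> bound_regs s &
   (\<forall>(b, t, es)\<in>set ls. length es = 3 & (out --> existential t) & set es \<subseteq> indices Z0))"

lemma regular_link: "regs Z0 \<subseteq> {0} ==> 0 \<notin> bound_regs Z0 ==> S \<in> set (link_rules b G Z0) ==> regular Z0 S"
 by (auto simp: link_rules_def regular_def indices_def)

lemma regular_input: "regs Z0 \<subseteq> {0} ==> 0 \<notin> bound_regs Z0 ==> S \<in> set (input_rules Z0) ==> regular Z0 S"
 by (auto simp: input_rules_def regular_def indices_def)

lemma (in block) regular_rules:
 assumes "S \<in> set rules"
 shows "regular Z0 S"
proof -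
 have c: "regs T \<subseteq> {0, 20, 21, 22, 23}" "0 \<notin> bound_regs T" "regs Z0 \<subseteq> {0, 20, 21, 22, 23}" "0 \<notin> bound_regs Z0"
  using closed by auto
 have sh: "fst (shifted m) \<in> {ei, plus_one ei}" "snd (shifted m) \<in> {ei, plus_one ei}" for m
  by (cases m; simp)+
 from assms show ?thesis
 proof (cases rule: rules_cases)
  case (5 e k)
  then show ?thesis using c sh[of "snd (fst (snd (snd (snd e))) ! k)"]
   by (auto simp: move_rule_def regular_def indices_def Let_def case_prod_beta)
 qed (use c in \<open>auto simp: choice_rule_def state_rule_def next_rule_def read_rule_def write_rule_def copy_rule_def
   final_rule_def init_rule_def regular_def indices_def\<close>)
qed

definition Yexpr :: "expr => expr" where "Yexpr Z0 = Add (Add Z0 Z0) eOne"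
text \<open>Clause indices are at most 2 * \<open>Z0\<close>, so \<open>cell_of Z0\<close> is at
  most 3 * \<open>Z0\<close> and a successor at most 2 * \<open>Z0\<close> + 1; the summand 2 covers
  both cases.\<close>

definition Zexpr :: "expr => expr" where "Zexpr Z0 = Add (Add Z0 (Add Z0 Z0)) (Const [True, True])"

definition all_tags :: "tag schema list => tag list" where
 "all_tags Ss = remdups (Dummy # concat (map (%(s, ls, out). map (%(b, t, es). t) ls) Ss))"

lemma schemas_regular:
 assumes Z0: "regs Z0 \<subseteq> {0}" "0 \<notin> bound_regs Z0" and reg: "\<And>S. S \<in> set Ss ==> regular Z0 S"
 shows "schemas Ss (all_tags Ss) Dummy existential (Yexpr Z0) (Zexpr Z0)"
proof
 show "distinct (all_tags Ss)" "Dummy \<in> set (all_tags Ss)" by (auto simp: all_tags_def)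
 show "existential Dummy" by simp
 show "regs (Yexpr Z0) \<subseteq> {0}" "regs (Zexpr Z0) \<subseteq> {0}" "0 \<notin> bound_regs (Yexpr Z0)" "0 \<notin> bound_regs (Zexpr Z0)"
  using Z0 by (auto simp: Yexpr_def Zexpr_def)
 show "0 < num (Zexpr Z0) (base w)" for w by (simp add: Zexpr_def)
 fix s ls out assume S: "(s, ls, out) \<in> set Ss"
 note r = reg[OF S, unfolded regular_def prod.case]
 show "regs s \<subseteq> {0, 20, 21, 22, 23} & 0 \<notin> bound_regs s" using r by blast
 fix b t es assume l: "(b, t, es) \<in> set ls"
 have es: "length es = 3" "out --> existential t" "set es \<subseteq> indices Z0" using r l by auto
 have "set (all_tags Ss) = insert Dummy (\<Union>S\<in>set Ss. (%x. fst (snd x)) ` set (fst (snd S)))"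
  unfolding all_tags_def set_remdups by (simp add: case_prod_beta insert_absorb)
 moreover have "t \<in> (\<Union>S\<in>set Ss. (%x. fst (snd x)) ` set (fst (snd S)))"
  by (rule UN_I[OF S], rule image_eqI[of _ _ "(b, t, es)"]) (use l in simp_all)
 ultimately have "t \<in> set (all_tags Ss)" by simp
 then show "t \<in> set (all_tags Ss) & length es = 3 & (out --> existential t)" using es by blast
 fix e assume e: "e \<in> set es"
 then have ei: "e \<in> indices Z0" using es by blast
 then show "regs e \<subseteq> {0, 20, 21, 22, 23} & 0 \<notin> bound_regs e" using Z0 by (auto simp: indices_def cell_of_def)
 fix xs w assume "xs \<in> set (tuples (num (Yexpr Z0) (base w)) 4)"
 then obtain u t i j where xs: "xs = [u, t, i, j]" "set xs \<subseteq> {..<num (Yexpr Z0) (base w)}"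
  by (auto simp: set_n_lists length_Suc_conv numeral_eq_Suc)
 show "num e (clause_env w xs) < num (Zexpr Z0) (base w)"
  using ei xs(2) num_renv[OF Z0(1), of w u t i j] unfolding xs(1) renv_def[symmetric]
  by (auto simp: indices_def cell_of_def Zexpr_def Yexpr_def)
qed

text \<open>Horner's scheme, with coefficients as constant words and the input length as the
  variable.\<close>

lemma poly_expr: "\<exists>e. regs e \<subseteq> {0} & bound_regs e = {} & (\<forall>u. num e u = poly p (length (u 0)))"
proof (induction p)
 case 0
 show ?case by (rule exI[of _ eZero]) simp
next
 case (pCons a p)
 then obtain e where "regs e \<subseteq> {0}" "bound_regs e = {}" "\<And>u. num e u = poly p (length (u 0))" by blast
 then show ?case by (intro exI[of _ "Add (Const (ones a)) (Times (Size 0) e)"]) auto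
qed

fun block_of :: "tag => blk option" where
 "block_of (Sym b k s) = Some b" | "block_of (Head b k) = Some b" | "block_of (State b q) = Some b"
| "block_of (Entry b e) = Some b" | "block_of (Guard b) = Some b" | "block_of (In_word b) = Some b"
| "block_of (Past b) = Some b" | "block_of _ = None"

text \<open>The assignment describing given traces: g tells which tableaux are on, L gives the
  lengths of the query words, neg the times of negative answers and ch the chain.
  \<open>Dummy\<close> is false, as is demanded of \<open>uvar\<close>.\<close>

definition facts :: "(blk => nat => bool) => (blk => nat => nat => config) => (blk => nat => nat => entry) => (blk => nat) =>
  nat => (nat => nat) => (nat => bool) => (nat => bool) => tag \<times> nat list => bool" where
 "facts g c e tm z L neg ch v = (case v of (tag, xs) => (case tag of
   Sym b k s => g b (xs ! 0) & xs ! 1 <= tm b & cell z (snd (c b (xs ! 0) (xs ! 1)) ! k) (xs ! 2) = s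
  | Head b k => g b (xs ! 0) & xs ! 1 <= tm b & snd (snd (c b (xs ! 0) (xs ! 1)) ! k) = int (xs ! 2) - int z
  | State b q => g b (xs ! 0) & xs ! 1 <= tm b & fst (c b (xs ! 0) (xs ! 1)) = q
  | Entry b a => g b (xs ! 0) & xs ! 1 < tm b & e b (xs ! 0) (xs ! 1) = a
  | Guard b => g b (xs ! 0)
  | In_word b => g b (xs ! 0) & xs ! 2 <= L (xs ! 0)
  | Past b => g b (xs ! 0) & L (xs ! 0) <= xs ! 2
  | Neg_answer => neg (xs ! 0) | Chain => ch (xs ! 0) | Dummy => False))"

lemma two_tapes: "well_formed M ==> 2 <= ntapes M"
 by (simp add: well_formed_def)

lemma init_tapes:
 assumes "well_formed M"
 shows "fst (init M w) = start_state M" "length (snd (init M w)) = ntapes M" "k < ntapes M ==> snd (snd (init M w) ! k) = 0"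
  "1 <= k ==> k < ntapes M ==> fst (snd (init M w) ! k) = (%_. Blank)" "snd (init M w) ! 0 = word_tape w"
  "k < ntapes M ==> range (fst (snd (init M w) ! k)) \<subseteq> symbols M"
proof -
 have K: "2 <= ntapes M" by (rule two_tapes[OF assms])
 show "length (snd (init M w)) = ntapes M" using K by (simp add: init_def)
 then show "range (fst (snd (init M w) ! k)) \<subseteq> symbols M" if "k < ntapes M"
  using proper_init[OF assms, of w] that by (simp add: proper_def)
 show "fst (init M w) = start_state M" "snd (init M w) ! 0 = word_tape w" by (simp_all add: init_def)
 have nth: "snd (init M w) ! k = word_tape (if k = 0 then w else [])" if "k < ntapes M" for k
  using that by (cases k) (auto simp: init_def)
 show "snd (snd (init M w) ! k) = 0" if "k < ntapes M" using nth[OF that] by (simp add: word_tape_def)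
 show "fst (snd (init M w) ! k) = (%_. Blank)" if "1 <= k" "k < ntapes M" using nth[OF that(2)] that(1) by (simp add: word_tape_def fun_eq_iff)
qed

lemma no_answers: "trace (entries M {2}) T c e ==> answers {} T c e"
 unfolding trace_def answers_def using entries_no_answers by blast

locale machine_block =
 fixes b :: blk and M :: machine and A :: "nat set" and E :: "entry list" and G :: "sym list" and Qs :: "nat list" and T Z0 :: expr
 assumes wf: "well_formed M" and lists: "set E = entries M A" "set G = symbols M" "set Qs = insert (halting M) (states M)"
  and exprs: "regs T \<subseteq> {0}" "regs Z0 \<subseteq> {0}" "bound_regs T \<subseteq> {1..}" "bound_regs Z0 \<subseteq> {1..}"
begin

sublocale block b E "ntapes M" G Qs "start_state M" "halting M" T Z0
proof
 show "(q, rs, q', as, f) \<in> set E ==> length rs = ntapes M & length as = ntapes M & fst ` set as \<subseteq> set G &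
   q \<in> set Qs & q' \<in> set Qs" for q rs q' as f
  using entries_shape[OF wf, of q rs q' as f A] unfolding lists by (intro conjI)
 show "start_state M \<in> set Qs" using special_states lists by auto
 show "Blank \<in> set G" using lists by (simp add: symbols_def)
 show "2 <= ntapes M" by (rule two_tapes[OF wf])
qed (use exprs in auto)

lemma machine_sound:
 assumes H: "\<And>S. S \<in> set rules ==> holds \<alpha> w (width w) S" and long: "tmax w <= zero w"
  and u: "u < width w" and g: "\<alpha> (Guard b, [u, 0, 0])"
  and v: "\<And>i. zero w <= i ==> i < width w ==> \<alpha> (Sym b 0 (cell (zero w) (word_tape v) i), [u, 0, i])"
 shows "\<exists>c e. trace (entries M A) (tmax w) c e & c 0 = init M v & fst (c (tmax w)) = halting M &
  (\<forall>t<tmax w. \<alpha> (Entry b (e t), [u, t, 0])) &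
  (\<forall>t\<le>tmax w. \<forall>k<ntapes M. \<forall>i<width w. \<alpha> (Sym b k (cell (zero w) (snd (c t) ! k) i), [u, t, i]))"
proof -
 note it = init_tapes[OF wf, where w = v] two_tapes[OF wf]
 have "\<exists>c e. trace (set E) (tmax w) c e & c 0 = (start_state M, snd (init M v)) & fst (c (tmax w)) = halting M &
  (\<forall>t<tmax w. \<alpha> (Entry b (e t), [u, t, 0])) &
  (\<forall>t\<le>tmax w. \<forall>k<ntapes M. \<forall>i<width w. \<alpha> (Sym b k (cell (zero w) (snd (c t) ! k) i), [u, t, i]))"
  by (rule sound[OF H long u g]) (use it v lists in \<open>auto simp: word_tape_def\<close>)
 moreover have "(start_state M, snd (init M v)) = init M v" using it(1) by (metis prod.collapse)
 ultimately show ?thesis unfolding lists by simp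
qed

lemma sound_accepts:
 assumes A: "A = {2}"
  and H: "\<And>S. S \<in> set rules ==> holds \<alpha> w (width w) S" and long: "tmax w <= zero w"
  and u: "u < width w" and g: "\<alpha> (Guard b, [u, 0, 0])"
  and v: "\<And>i. zero w <= i ==> i < width w ==> \<alpha> (Sym b 0 (cell (zero w) (word_tape v) i), [u, 0, i])"
 shows "accepts M {} v"
proof -
 obtain c e where c: "trace (entries M {2}) (tmax w) c e" "c 0 = init M v" "fst (c (tmax w)) = halting M"
  using machine_sound[OF H long u g v] unfolding A by blast
 show ?thesis by (rule trace_accepts[OF wf c no_answers[OF c(1)]])
qed

lemma machine_complete:
 assumes val: "\<And>tag xs. block_of tag = Some b ==> \<alpha> (tag, xs) = facts g c e tm (zero w) L neg ch (tag, xs)"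
  and tm: "tm b = tmax w"
  and tr: "\<And>u. g b u ==> trace (entries M A) (tmax w) (c b u) (e b u) & c b u 0 = init M (v u) & fst (c b u (tmax w)) = halting M"
  and S: "S \<in> set rules"
 shows "holds \<alpha> w (width w) S"
proof (rule complete[where g = "g b" and c = "c b" and e = "e b"])
 fix u assume "g b u"
 note t = tr[OF this]
 note it = init_tapes[OF wf, where w = "v u"] two_tapes[OF wf]
 show "trace (set E) (tmax w) (c b u) (e b u) & fst (c b u (tmax w)) = halting M & fst (c b u 0) = start_state M &
   length (snd (c b u 0)) = ntapes M & (\<forall>k<ntapes M. snd (snd (c b u 0) ! k) = 0) &
   (\<forall>k\<in>{1..<ntapes M}. fst (snd (c b u 0) ! k) = (%_. Blank)) & (\<forall>i<0. fst (snd (c b u 0) ! 0) i = Blank)"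
  using t it lists by (auto simp: word_tape_def)
qed (auto simp: val facts_def tm S)

lemma rules_out: "S \<in> set rules ==> snd (snd S) = (b ~= No_run)"
 by (erule rules_cases) (auto simp: choice_rule_def state_rule_def next_rule_def read_rule_def write_rule_def copy_rule_def
   move_rule_def final_rule_def init_rule_def Let_def case_prod_beta)

end

section \<open>Hardness from tableaux\<close>

lemma machine_lists:
 assumes "well_formed M"
 obtains E G Qs where "set E = entries M A" "set G = symbols M" "set Qs = insert (halting M) (states M)"
proof -
 have "finite (entries M A)" "finite (symbols M)" "finite (insert (halting M) (states M))"
  using finite_entries finite_symbols finite_states assms by auto
 then show thesis using that finite_list by metis
qed

lemma num_Yexpr: "num (Yexpr Z0) (base w) = Suc (2 * num Z0 (base w))"
 by (simp add: Yexpr_def)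

lemma NP_hard:
 assumes \<sigma>: "\<sigma> \<in> {CO, ST}"
 shows "hard_for NP (SF_CA_input_words \<sigma>) (SF_CA \<sigma>)"
 unfolding hard_for_def
proof
 fix X assume "X \<in> NP"
 then obtain M where M: "well_formed M" "poly_time M {}" "recognizes M {} X" by (auto simp: NP_def NP_rel_def)
 obtain p where p: "\<And>w n k c. run M {} (init M w) n k c ==> n <= poly p (length w)"
  using M(2) unfolding poly_time_def by blast
 obtain E G Qs where l: "set E = entries M {2}" "set G = symbols M" "set Qs = insert (halting M) (states M)"
  by (rule machine_lists[OF M(1)])
 \<comment> \<open>One more than the time bound, since a run of length n needs a further entry to
   reach the halting state. The same expression serves as origin, as a head cannot go
   farther.\<close>
 obtain T where T: "regs T \<subseteq> {0}" "bound_regs T = {}" "\<And>u. num T u = poly (p + 1) (length (u 0))"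
  using poly_expr[of "p + 1"] by blast
 interpret machine_block Main_run M "{2}" E G Qs T T
  by unfold_locales (use M l T in auto)
 define Ss where "Ss = rules @ input_rules T"
 interpret F: schemas Ss "all_tags Ss" Dummy existential "Yexpr T" "Zexpr T"
  by (rule schemas_regular) (use T regular_rules regular_input in \<open>auto simp: Ss_def\<close>)
 have X: "(\<exists>\<alpha>. ~ \<alpha> F.uvar & (\<forall>S\<in>set Ss. holds \<alpha> w (num (Yexpr T) (base w)) S)) <-> w \<in> X" for w
 proof
  assume "\<exists>\<alpha>. ~ \<alpha> F.uvar & (\<forall>S\<in>set Ss. holds \<alpha> w (num (Yexpr T) (base w)) S)"
  then obtain \<alpha> where "\<forall>S\<in>set Ss. holds \<alpha> w (width w) S" unfolding num_Yexpr by blast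
  then have r: "\<And>S. S \<in> set rules ==> holds \<alpha> w (width w) S" and i: "\<And>S. S \<in> set (input_rules T) ==> holds \<alpha> w (width w) S"
   by (auto simp: Ss_def)
  note inp = input_sound[OF T(1) i refl]
  have "accepts M {} w" by (rule sound_accepts[OF refl r order_refl _ inp(1) inp(2)]) auto
  then show "w \<in> X" using M(3) by (simp add: recognizes_def)
 next
  assume "w \<in> X"
  then have "accepts M {} w" using M(3) by (simp add: recognizes_def)
  moreover have "n < tmax w" if "run M {} (init M w) n k c" for n k c
   using p[OF that] by (simp add: T(3) base_def)
  ultimately obtain c e where c: "trace (entries M {1, 2}) (tmax w) c e" "c 0 = init M w" "fst (c (tmax w)) = halting M" "answers {} (tmax w) c e"
   using accepts_trace[OF M(1), of "{}" w "tmax w"] by blast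
  define \<alpha> where "\<alpha> = facts (%b u. b = Main_run & u = 0) (%_ _. c) (%_ _. e) (%_. tmax w) (zero w) (%_. 0) (%_. False) (%_. False)"
  have val: "block_of tag = Some Main_run ==> \<alpha> (tag, xs) =
    facts (%b u. b = Main_run & u = 0) (%_ _. c) (%_ _. e) (%_. tmax w) (zero w) (%_. 0) (%_. False) (%_. False) (tag, xs)" for tag xs
   by (simp add: \<alpha>_def)
  have "holds \<alpha> w (width w) S" if S: "S \<in> set Ss" for S
  proof -
   consider "S \<in> set rules" | "S \<in> set (input_rules T)" using S by (auto simp: Ss_def)
   then show ?thesis
   proof cases
    case 1
    show ?thesis
     by (rule machine_complete[where v = "%_. w", OF val _ _ 1])
      (use c trace_no_answers[OF c(1,4)] in auto)
   next
    case 2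
    show ?thesis
     by (rule input_complete[OF T(1) _ _ 2]) (use c init_tapes(5)[OF M(1)] in \<open>auto simp: \<alpha>_def facts_def\<close>)
   qed
  qed
  moreover have "~ \<alpha> F.uvar" by (simp add: F.uvar_def \<alpha>_def facts_def)
  ultimately show "\<exists>\<alpha>. ~ \<alpha> F.uvar & (\<forall>S\<in>set Ss. holds \<alpha> w (num (Yexpr T) (base w)) S)"
   unfolding num_Yexpr by blast
 qed
 show "\<exists>f. poly_time_computable f & (\<forall>w. f w \<in> SF_CA_input_words \<sigma> & (w \<in> X <-> f w \<in> SF_CA \<sigma>))"
  using F.reduction1[OF \<sigma>] unfolding X by blast
qed

text \<open>A positive answer switches on a tableau that proves it. A negative one is merely
  recorded, in an existential variable, for the universal part to attack.\<close>

definition answer_rules :: "entry list => expr => tag schema list" where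
 "answer_rules E T = map (%e. (less_expr et T, [(False, Entry Main_run e, [eZero, et, eZero]), (True, Guard Yes_run, [et, eZero, eZero])], True))
    (filter (%e. flag e = 1) E)
   @ map (%e. (less_expr et T, [(False, Entry Main_run e, [eZero, et, eZero]), (True, Neg_answer, [et, eZero, eZero])], True))
    (filter (%e. flag e = 2) E)"

text \<open>The tableau rules force only the true symbols. Further symbols on the query tape would
  make the linking rules of \<open>No_run\<close> contradictory, and a wrong negative answer could
  then not be refuted.\<close>

definition unique_rules :: "sym list => tag schema list" where
 "unique_rules G = map (%(s, s'). (eOne, [(False, Sym Main_run 1 s, [eZero, et, ei]), (False, Sym Main_run 1 s', [eZero, et, ei])], True))
   (filter (%(s, s'). s ~= s') (List.product G G))"

text \<open>These rules guess a query that is to be refuted.\<close>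

definition chain_rules :: "expr => tag schema list" where
 "chain_rules T = [(eEq et eZero, [(True, Chain, [et, eZero, eZero])], False),
   (less_expr et T, [(False, Chain, [et, eZero, eZero]), (True, Guard No_run, [et, eZero, eZero]), (True, Chain, [plus_one et, eZero, eZero])], False),
   (eEq et T, [(False, Chain, [et, eZero, eZero])], False),
   (eOne, [(False, Guard No_run, [et, eZero, eZero]), (True, Neg_answer, [et, eZero, eZero])], False)]"

lemma regular_extra:
 assumes "regs T \<subseteq> {0}" "0 \<notin> bound_regs T"
 shows "S \<in> set (answer_rules E T) ==> regular Z0 S" "S \<in> set (unique_rules G) ==> regular Z0 S"
  "S \<in> set (chain_rules T) ==> regular Z0 S"
 using assms by (auto simp: answer_rules_def unique_rules_def chain_rules_def regular_def indices_def)

text \<open>The outer assignment describes a computation of M with guessed answers, and runs of N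
  proving the positive ones. An inner assignment satisfying its clauses would exhibit an accepting
  run of N on a query answered no. So all answers are right exactly when no inner assignment
  exists.\<close>

lemma Sigma2_hard:
 assumes \<sigma>: "\<sigma> \<in> {PR, SST}"
 shows "hard_for (Sigma_p 2) (SF_CA_input_words \<sigma>) (SF_CA \<sigma>)"
 unfolding hard_for_def
proof
 fix X assume "X \<in> Sigma_p 2"
 then have "X \<in> (\<Union>B\<in>NP. NP_rel B)" by (simp add: numeral_2_eq_2)
 then obtain B M N where M: "well_formed M" "poly_time M B" "recognizes M B X"
  and N: "well_formed N" "poly_time N {}" "recognizes N {} B" by (auto simp: NP_def NP_rel_def)
 obtain p where p: "\<And>w n k c. run M B (init M w) n k c ==> n <= poly p (length w)"
  using M(2) unfolding poly_time_def by blast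
 obtain p' where p': "\<And>w n k c. run N {} (init N w) n k c ==> n <= poly p' (length w)"
  using N(2) unfolding poly_time_def by blast
 obtain E G Qs where l: "set E = entries M {1, 2}" "set G = symbols M" "set Qs = insert (halting M) (states M)"
  by (rule machine_lists[OF M(1)])
 obtain E' G' Qs' where l': "set E' = entries N {2}" "set G' = symbols N" "set Qs' = insert (halting N) (states N)"
  by (rule machine_lists[OF N(1)])
 obtain T where T: "regs T \<subseteq> {0}" "bound_regs T = {}" "\<And>u. num T u = poly (p + 1) (length (u 0))"
  using poly_expr[of "p + 1"] by blast
 \<comment> \<open>Queries are no longer than the running time of M, so the time bound of N is
   composed with that of M; again one is added for the entry into the halting state.\<close>
 obtain T' where T': "regs T' \<subseteq> {0}" "bound_regs T' = {}" "\<And>u. num T' u = poly (p' \<circ>\<^sub>p (p + 1) + 1) (length (u 0))"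
  using poly_expr[of "p' \<circ>\<^sub>p (p + 1) + 1"] by blast
 \<comment> \<open>One origin for all tableaux, large enough for both time bounds.\<close>
 define Z0 where "Z0 = Add T T'"
 have Z0: "regs Z0 \<subseteq> {0}" "bound_regs Z0 = {}" using T T' by (auto simp: Z0_def)
 interpret MB: machine_block Main_run M "{1, 2}" E G Qs T Z0 by unfold_locales (use M l T Z0 in auto)
 interpret YB: machine_block Yes_run N "{2}" E' G' Qs' T' Z0 by unfold_locales (use N l' T' Z0 in auto)
 interpret NB: machine_block No_run N "{2}" E' G' Qs' T' Z0 by unfold_locales (use N l' T' Z0 in auto)
 define Ss where "Ss = MB.rules @ input_rules Z0 @ YB.rules @ link_rules Yes_run G Z0 @ NB.rules @ link_rules No_run G Z0
  @ answer_rules E T @ unique_rules G @ chain_rules T"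
 have reg: "regular Z0 S" if "S \<in> set Ss" for S
  using that MB.regular_rules YB.regular_rules NB.regular_rules Z0 T(1,2) regular_input regular_link regular_extra
  unfolding Ss_def set_append by (elim UnE) simp_all
 interpret F: schemas Ss "all_tags Ss" Dummy existential "Yexpr Z0" "Zexpr Z0"
  by (rule schemas_regular) (use Z0 reg in auto)
 let ?z = "%w. num Z0 (base w)" and ?t = "%w. num T (base w)" and ?t' = "%w. num T' (base w)"
 let ?y = "%w. Suc (2 * num Z0 (base w))"
 have tz: "?t w <= ?z w" "?t' w <= ?z w" for w by (simp_all add: Z0_def)
 have K: "2 <= ntapes M" by (rule two_tapes[OF M(1)])
 let ?O = "set MB.rules \<union> set (input_rules Z0) \<union> set YB.rules \<union> set (link_rules Yes_run G Z0)
  \<union> set (answer_rules E T) \<union> set (unique_rules G)"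
 let ?I = "set NB.rules \<union> set (link_rules No_run G Z0) \<union> set (chain_rules T)"
 have out: "snd (snd S)" if "S \<in> ?O" for S
  using that
  by (auto simp: MB.rules_out YB.rules_out input_rules_def link_rules_def answer_rules_def unique_rules_def)
 have inn: "~ snd (snd S)" if "S \<in> ?I" for S
  using that by (auto simp: NB.rules_out link_rules_def chain_rules_def)
 have groups: "(\<forall>S\<in>set Ss. snd (snd S) --> Q S) <-> (\<forall>S\<in>?O. Q S)"
  "(\<forall>S\<in>set Ss. ~ snd (snd S) --> Q S) <-> (\<forall>S\<in>?I. Q S)" for Q
  using out inn unfolding Ss_def set_append by blast+
 \<comment> \<open>At time t the head has not yet left cell t, which is blank initially; so the
   query ends there at the latest, and its length is at most t.\<close>
 have query: "fst (snd (c t) ! 1) (int t) \<notin> range Bit & length (tape_word (snd (c t) ! 1)) <= t & range (fst (snd (c t) ! 1)) \<subseteq> symbols M"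
  if c: "trace (entries M {1, 2}) (?t w) c e" "c 0 = init M w" and t: "t <= ?t w" for w c e t
 proof -
  note it = init_tapes[OF M(1), where w = w, folded c(2)]
  have "proper M (c t)" using t
  proof (induction t)
   case (Suc t)
   obtain q rs q' as f where et: "e t = (q, rs, q', as, f)" by (cases "e t")
   have m: "moves (q, rs, q', as, f) (c t) (c (Suc t))" "(q, rs, q', as, f) \<in> entries M {1, 2}"
    using c(1)[unfolded trace_def, rule_format, of t] Suc.prems et by simp_all
   show ?case using proper_act[of M "c t" as q'] entries_shape[OF M(1) m(2)] Suc m(1) by simp
  qed (simp add: c(2) proper_init[OF M(1)])
  then have s: "range (fst (snd (c t) ! 1)) \<subseteq> symbols M" using K by (simp add: proper_def)
  have "fst (snd (c t) ! 1) (int t) = fst (snd (c 0) ! 1) (int t)"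
   using trace_extent[OF c(1), of "ntapes M" t 1] entries_shape(2)[OF M(1)] it(2,3) K t by auto
  also have "\<dots> = Blank" using init_tapes(4)[OF M(1), where w = w and k = 1] K c(2) by simp
  finally have b: "fst (snd (c t) ! 1) (int t) \<notin> range Bit" by auto
  have "length (tape_word (snd (c t) ! 1)) <= t"
   using word_tape_word(1)[where t = "fst (snd (c t) ! 1)" and h = "snd (snd (c t) ! 1)" and n = t, OF b]
    word_tape_word(2)[where t = "fst (snd (c t) ! 1)" and n = t, OF b] by simp
  with b s show ?thesis by blast
 qed
 have time: "n < ?t' w" if r: "run N {} (init N v) n k c" and v: "length v <= ?t w" for n k c v w
 proof -
  have "n <= poly p' (length v)" by (rule p'[OF r])
  also have "\<dots> <= poly p' (?t w)" by (rule poly_mono_nat[OF v])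
  finally show ?thesis by (simp add: T(3) T'(3) base_def poly_pcompose)
 qed
 have X: "(\<exists>\<alpha>. ~ \<alpha> F.uvar & (\<forall>S\<in>set Ss. snd (snd S) --> holds \<alpha> w (num (Yexpr Z0) (base w)) S) &
   (\<forall>\<beta>. (\<forall>v. F.exv v --> \<beta> v = \<alpha> v) --> ~ (\<forall>S\<in>set Ss. ~ snd (snd S) --> holds \<beta> w (num (Yexpr Z0) (base w)) S))) <-> w \<in> X" for w
  unfolding groups num_Yexpr
 proof
  assume "\<exists>\<alpha>. ~ \<alpha> F.uvar & (\<forall>S\<in>?O. holds \<alpha> w (?y w) S) &
   (\<forall>\<beta>. (\<forall>v. F.exv v --> \<beta> v = \<alpha> v) -->
    ~ (\<forall>S\<in>?I. holds \<beta> w (?y w) S))"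
  then obtain \<alpha> where outer: "\<forall>S\<in>?O. holds \<alpha> w (?y w) S"
   and inner: "\<forall>\<beta>. (\<forall>v. F.exv v --> \<beta> v = \<alpha> v) -->
    ~ (\<forall>S\<in>?I. holds \<beta> w (?y w) S)"
   by (elim exE conjE)
  have H: "\<And>S. S \<in> set MB.rules ==> holds \<alpha> w (?y w) S" "\<And>S. S \<in> set (input_rules Z0) ==> holds \<alpha> w (?y w) S"
   "\<And>S. S \<in> set YB.rules ==> holds \<alpha> w (?y w) S" "\<And>S. S \<in> set (link_rules Yes_run G Z0) ==> holds \<alpha> w (?y w) S"
   "\<And>S. S \<in> set (answer_rules E T) ==> holds \<alpha> w (?y w) S" "\<And>S. S \<in> set (unique_rules G) ==> holds \<alpha> w (?y w) S"
   using outer by simp_all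
  note inp = input_sound[OF Z0(1) H(2) refl]
  have "\<exists>c e. trace (entries M {1, 2}) (?t w) c e & c 0 = init M w & fst (c (?t w)) = halting M &
   (\<forall>t<?t w. \<alpha> (Entry Main_run (e t), [0, t, 0])) &
   (\<forall>t\<le>?t w. \<forall>k<ntapes M. \<forall>i<?y w. \<alpha> (Sym Main_run k (cell (?z w) (snd (c t) ! k) i), [0, t, i]))"
   by (rule MB.machine_sound[OF H(1) tz(1) _ inp(1) inp(2)]) auto
  then obtain c e where c: "trace (entries M {1, 2}) (?t w) c e" "c 0 = init M w" "fst (c (?t w)) = halting M"
   and en: "\<forall>t<?t w. \<alpha> (Entry Main_run (e t), [0, t, 0])"
   and sy: "\<forall>t\<le>?t w. \<forall>k<ntapes M. \<forall>i<?y w. \<alpha> (Sym Main_run k (cell (?z w) (snd (c t) ! k) i), [0, t, i])"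
   by (elim exE conjE)
  have mt: "\<alpha> (Sym Main_run 1 (cell (?z w) (snd (c t) ! 1) i), [0, t, i])" if "t < ?t w" "i < ?y w" for t i
   using sy that K by simp
  have q: "fst (snd (c t) ! 1) (int t) \<notin> range Bit" "length (tape_word (snd (c t) ! 1)) <= t" "range (fst (snd (c t) ! 1)) \<subseteq> set G"
   if "t < ?t w" for t using query[OF c(1,2), of t] that l(2) by auto
  have small: "t < ?y w" if "t < ?t w" for t using that tz(1)[of w] by simp
  have "answers B (?t w) c e"
   unfolding answers_def
  proof (intro allI impI conjI)
   fix t assume t: "t < ?t w"
   let ?v = "tape_word (snd (c t) ! 1)"
   have et: "e t \<in> set E" using c(1) t l(1) by (simp add: trace_def)
   {
    assume "flag (e t) = 1"
    then have "(less_expr et T, [(False, Entry Main_run (e t), [eZero, et, eZero]), (True, Guard Yes_run, [et, eZero, eZero])], True)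
      \<in> set (answer_rules E T)" using et unfolding answer_rules_def set_append set_map set_filter by blast
    from holdsD[OF H(5)[OF this], of 0 t 0 0] have g: "\<alpha> (Guard Yes_run, [t, 0, 0])"
     using en t small[OF t] num_renv[OF T(1)] by auto
    have y0: "\<alpha> (Sym Yes_run 0 (cell (?z w) (word_tape ?v) i), [t, 0, i])" if "?z w <= i" "i < ?y w" for i
     by (rule link_sound[OF Z0(1) H(4) refl small[OF t] g mt[OF t] q(3,1)[OF t] that])
    have "accepts N {} ?v" by (rule YB.sound_accepts[OF refl H(3) tz(2) small[OF t] g y0])
    then show "?v \<in> B" using N(3) by (simp add: recognizes_def)
   }
   assume fl: "flag (e t) = 2"
   have "(less_expr et T, [(False, Entry Main_run (e t), [eZero, et, eZero]), (True, Neg_answer, [et, eZero, eZero])], True)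
     \<in> set (answer_rules E T)" using et fl unfolding answer_rules_def set_append set_map set_filter by blast
   from holdsD[OF H(5)[OF this], of 0 t 0 0] have neg: "\<alpha> (Neg_answer, [t, 0, 0])"
    using en t small[OF t] num_renv[OF T(1)] by auto
   show "?v \<notin> B"
   proof
    \<comment> \<open>A query answered no but lying in B has an accepting run of N; from this run an
      inner assignment is built that contradicts \<open>inner\<close>.\<close>
    assume "?v \<in> B"
    then have "accepts N {} ?v" using N(3) by (simp add: recognizes_def)
    moreover have "length ?v <= ?t w" using q(2)[OF t] t by simp
    ultimately have "\<exists>d f. trace (entries N {1, 2}) (?t' w) d f & d 0 = init N ?v & fst (d (?t' w)) = halting N & answers {} (?t' w) d f"
     using accepts_trace[OF N(1), of "{}" ?v "?t' w"] time by blast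
    then obtain d f where d: "trace (entries N {1, 2}) (?t' w) d f" "d 0 = init N ?v" "fst (d (?t' w)) = halting N" "answers {} (?t' w) d f"
     by (elim exE conjE)
    \<comment> \<open>Only the tableau of query t is on, and it contains the accepting run. The
      chain holds up to t and is interrupted there by the guard.\<close>
    define \<beta>' where "\<beta>' = facts (%b u. u = t) (%_ _. d) (%_ _. f) (%_. ?t' w) (?z w)
     (%_. LEAST n. fst (snd (c t) ! 1) (int n) \<notin> range Bit) (%_. False) (%x. x <= t)"
    \<comment> \<open>Existential variables keep the values given by \<alpha>, the others are taken
      from the refutation.\<close>
    define \<beta> where "\<beta> v = (if F.exv v then \<alpha> v else \<beta>' v)" for v
    have bl: "~ F.exv (tag, xs)" if "block_of tag = Some No_run" for tag xs
     using that by (cases tag) (auto simp: F.exv_def)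
    have \<beta>: "\<beta> (tag, xs) = \<beta>' (tag, xs)" if "block_of tag = Some No_run" for tag xs
     using bl[OF that] by (simp add: \<beta>_def)
    note val = \<beta>[unfolded \<beta>'_def]
    have bm: "\<beta> (Sym Main_run k s, xs) = \<alpha> (Sym Main_run k s, xs)" "\<beta> (Neg_answer, xs) = \<alpha> (Neg_answer, xs)"
     "\<beta> (Chain, xs) = (xs ! 0 <= t)" for k s xs by (simp_all add: \<beta>_def F.exv_def \<beta>'_def facts_def)
    have "holds \<beta> w (?y w) S" if "S \<in> set NB.rules" for S
     by (rule NB.machine_complete[where v = "%_. ?v", OF val _ _ that])
      (use d trace_no_answers[OF d(1,4)] in auto)
    moreover have "holds \<beta> w (?y w) S" if "S \<in> set (link_rules No_run G Z0)" for S
    proof (rule link_complete[where g = "%u. u = t" and tp = "%_. snd (c t) ! 1", OF Z0(1) refl _ _ _ _ _ _ _ that])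
     \<comment> \<open>Here the uniqueness rules enter: \<alpha> comes from an arbitrary solution
       and might otherwise assert a second symbol in the cell.\<close>
     show "s = cell (?z w) (snd (c t) ! 1) i"
      if "u = t" "s \<in> set G" "i < ?y w" "\<beta> (Sym Main_run 1 s, [0, u, i])" for u i s
     proof (rule ccontr)
      let ?s = "cell (?z w) (snd (c t) ! 1) i"
      assume ne: "s ~= ?s"
      have "?s \<in> set G" using q(3)[OF t] by (auto simp: cell_def)
      then have "(eOne, [(False, Sym Main_run 1 s, [eZero, et, ei]), (False, Sym Main_run 1 ?s, [eZero, et, ei])], True) \<in> set (unique_rules G)"
       using that(2) ne unfolding unique_rules_def set_map set_filter set_product by (intro image_eqI[of _ _ "(s, ?s)"]) auto
      from holdsD[OF H(6)[OF this], of 0 t i 0] show False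
       using mt[OF t that(3)] that bm(1) small[OF t] by auto
     qed
    qed (use q(1)[OF t] d(2) init_tapes(5)[OF N(1)] in \<open>auto simp: \<beta> \<beta>'_def facts_def\<close>)
    moreover have "holds \<beta> w (?y w) S" if "S \<in> set (chain_rules T)" for S
     using that t neg num_renv[OF T(1)]
     by (auto simp: chain_rules_def holds_iff bm \<beta> \<beta>'_def facts_def)
    ultimately have all: "\<forall>S\<in>?I. holds \<beta> w (?y w) S" by blast
    have "\<forall>v. F.exv v --> \<beta> v = \<alpha> v" by (simp add: \<beta>_def)
    from inner[THEN spec, THEN mp, OF this] all show False by (rule notE)
   qed
  qed
  then have "accepts M B w" by (rule trace_accepts[OF M(1) c])
  then show "w \<in> X" using M(3) by (simp add: recognizes_def)
 next
  assume "w \<in> X"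
  then have "accepts M B w" using M(3) by (simp add: recognizes_def)
  moreover have "n < ?t w" if "run M B (init M w) n k c" for n k c
   using p[OF that] by (simp add: T(3) base_def)
  ultimately have "\<exists>c e. trace (entries M {1, 2}) (?t w) c e & c 0 = init M w & fst (c (?t w)) = halting M & answers B (?t w) c e"
   using accepts_trace[OF M(1), of B w "?t w"] by blast
  then obtain c e where c: "trace (entries M {1, 2}) (?t w) c e" "c 0 = init M w" "fst (c (?t w)) = halting M" "answers B (?t w) c e"
   by (elim exE conjE)
  let ?v = "%t. tape_word (snd (c t) ! 1)"
  have q: "fst (snd (c t) ! 1) (int t) \<notin> range Bit" "length (?v t) <= t" "range (fst (snd (c t) ! 1)) \<subseteq> set G"
   if "t < ?t w" for t using query[OF c(1,2), of t] that l(2) by auto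
  have small: "t < ?y w" if "t < ?t w" for t using that tz(1)[of w] by simp
  \<comment> \<open>The times of positive answers; for each of them an accepting run of N on the
    query is chosen.\<close>
  let ?yes = "%u. u < ?t w & flag (e u) = 1"
  have "\<exists>df. ?yes u --> trace (entries N {1, 2}) (?t' w) (fst df) (snd df) & fst df 0 = init N (?v u) &
    fst (fst df (?t' w)) = halting N & answers {} (?t' w) (fst df) (snd df)" for u
  proof (cases "?yes u")
   case True
   then have "?v u \<in> B" using c(4) by (simp add: answers_def)
   then have "accepts N {} (?v u)" using N(3) by (simp add: recognizes_def)
   moreover have "length (?v u) <= ?t w" using q(2)[of u] True by simp
   ultimately have "\<exists>d f. trace (entries N {1, 2}) (?t' w) d f & d 0 = init N (?v u) & fst (d (?t' w)) = halting N & answers {} (?t' w) d f"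
    using accepts_trace[OF N(1), of "{}" "?v u" "?t' w"] time by blast
   then show ?thesis by auto
  next
   case False
   then show ?thesis by blast
  qed
  then have "\<exists>df. \<forall>u. ?yes u --> trace (entries N {1, 2}) (?t' w) (fst (df u)) (snd (df u)) & fst (df u) 0 = init N (?v u) &
    fst (fst (df u) (?t' w)) = halting N & answers {} (?t' w) (fst (df u)) (snd (df u))" by (intro choice allI)
  then obtain df where df: "\<forall>u. ?yes u --> trace (entries N {1, 2}) (?t' w) (fst (df u)) (snd (df u)) & fst (df u) 0 = init N (?v u) &
    fst (fst (df u) (?t' w)) = halting N & answers {} (?t' w) (fst (df u)) (snd (df u))" by (elim exE)
  \<comment> \<open>The universal tableaux are off in \<alpha>; their variables are not existential,
    so \<beta> may choose them freely anyway.\<close>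
  define g where "g b u = (case b of Main_run => u = 0 | Yes_run => ?yes u | No_run => False)" for b u
  define \<alpha> where "\<alpha> = facts g (%b u. if b = Main_run then c else fst (df u)) (%b u. if b = Main_run then e else snd (df u))
   (%b. if b = Main_run then ?t w else ?t' w) (?z w) (%u. LEAST n. fst (snd (c u) ! 1) (int n) \<notin> range Bit)
   (%u. u < ?t w & flag (e u) = 2) (%_. False)"
  have main: "\<alpha> (Sym Main_run k s, [u, t, i]) <-> u = 0 & t <= ?t w & cell (?z w) (snd (c t) ! k) i = s"
   "\<alpha> (Guard Main_run, [u, x, y]) <-> u = 0" "\<alpha> (Guard Yes_run, [u, x, y]) <-> ?yes u"
   "\<alpha> (Entry Main_run a, [u, t, x]) <-> u = 0 & t < ?t w & e t = a" 
   "\<alpha> (Neg_answer, [u, x, y]) <-> u < ?t w & flag (e u) = 2" for k s u t i x y a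
   by (auto simp: \<alpha>_def facts_def g_def)
  have val: "\<alpha> (tag, xs) = facts g (%b u. if b = Main_run then c else fst (df u)) (%b u. if b = Main_run then e else snd (df u))
   (%b. if b = Main_run then ?t w else ?t' w) (?z w) (%u. LEAST n. fst (snd (c u) ! 1) (int n) \<notin> range Bit)
   (%u. u < ?t w & flag (e u) = 2) (%_. False) (tag, xs)" for tag xs by (simp add: \<alpha>_def)
  have "holds \<alpha> w (?y w) S" if "S \<in> set MB.rules" for S
   by (rule MB.machine_complete[where v = "%_. w", OF val _ _ that])
    (use c in \<open>auto simp: g_def\<close>)
  moreover have "holds \<alpha> w (?y w) S" if "S \<in> set YB.rules" for S
   by (rule YB.machine_complete[where v = ?v, OF val _ _ that])
    (use df trace_no_answers in \<open>auto simp: g_def\<close>)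
  moreover have "holds \<alpha> w (?y w) S" if "S \<in> set (input_rules Z0)" for S
   by (rule input_complete[OF Z0(1) _ _ that]) (use c init_tapes(5)[OF M(1)] in \<open>auto simp: main\<close>)
  moreover have "holds \<alpha> w (?y w) S" if "S \<in> set (link_rules Yes_run G Z0)" for S
   by (rule link_complete[where g = ?yes and tp = "%u. snd (c u) ! 1", OF Z0(1) refl _ _ _ _ _ _ _ that])
    (use q df init_tapes(5)[OF N(1)] in \<open>auto simp: main \<alpha>_def facts_def g_def\<close>)
  moreover have "holds \<alpha> w (?y w) S" if "S \<in> set (answer_rules E T)" for S
   using that num_renv[OF T(1)] by (auto simp: answer_rules_def holds_iff main)
  moreover have "holds \<alpha> w (?y w) S" if "S \<in> set (unique_rules G)" for S
   using that by (auto simp: unique_rules_def holds_iff main)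
  ultimately have outer: "\<forall>S\<in>?O. holds \<alpha> w (?y w) S" by blast
  have inner: "~ (\<forall>S\<in>?I. holds \<beta> w (?y w) S)"
   if \<beta>: "\<forall>v. F.exv v --> \<beta> v = \<alpha> v" for \<beta>
  proof
   assume "\<forall>S\<in>?I. holds \<beta> w (?y w) S"
   then have H: "\<And>S. S \<in> set NB.rules ==> holds \<beta> w (?y w) S" "\<And>S. S \<in> set (link_rules No_run G Z0) ==> holds \<beta> w (?y w) S"
    "\<And>S. S \<in> set (chain_rules T) ==> holds \<beta> w (?y w) S" by simp_all
   have bm: "\<beta> (Sym Main_run k s, xs) = \<alpha> (Sym Main_run k s, xs)" "\<beta> (Neg_answer, xs) = \<alpha> (Neg_answer, xs)" for k s xs
    using \<beta> by (simp_all add: F.exv_def)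
   have tn: "num T (renv w u t i j) = ?t w" for u t i j by (rule num_renv[OF T(1)])
   have r: "\<exists>(b, g, es)\<in>set ls. \<beta> (g, map (%e. num e (renv w 0 t 0 0)) es) = b"
    if "(s, ls, o') \<in> set (chain_rules T)" "tru s (renv w 0 t 0 0)" "t < ?y w" for s ls o' t
    by (rule holdsD[OF H(3)[OF that(1)]]) (use that in auto)
   have y: "?t w < ?y w" using tz(1)[of w] by simp
   have c0: "\<beta> (Chain, [0, 0, 0])"
    using r[of "eEq et eZero" "[(True, Chain, [et, eZero, eZero])]" False 0] by (simp add: chain_rules_def)
   have cs: "\<beta> (Guard No_run, [t, 0, 0]) \<or> \<beta> (Chain, [Suc t, 0, 0])" if "\<beta> (Chain, [t, 0, 0])" "t < ?t w" for t
    using r[of "less_expr et T" "[(False, Chain, [et, eZero, eZero]), (True, Guard No_run, [et, eZero, eZero]), (True, Chain, [plus_one et, eZero, eZero])]" False t]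
     that small[of t] by (auto simp: chain_rules_def tn)
   have ct: "~ \<beta> (Chain, [?t w, 0, 0])"
    using r[of "eEq et T" "[(False, Chain, [et, eZero, eZero])]" False "?t w"] y by (auto simp: chain_rules_def tn)
   have cn: "\<beta> (Neg_answer, [t, 0, 0])" if "\<beta> (Guard No_run, [t, 0, 0])" "t < ?t w" for t
    using r[of eOne "[(False, Guard No_run, [et, eZero, eZero]), (True, Neg_answer, [et, eZero, eZero])]" False t]
     that small[of t] by (auto simp: chain_rules_def)
   \<comment> \<open>The chain holds at 0 but not at the last time, and it can only be interrupted
     where a guard is set.\<close>
   have "\<exists>t<?t w. \<beta> (Guard No_run, [t, 0, 0])"
   proof (rule ccontr)
    assume none: "~ (\<exists>t<?t w. \<beta> (Guard No_run, [t, 0, 0]))"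
    have "t <= ?t w ==> \<beta> (Chain, [t, 0, 0])" for t
    proof (induction t)
     case (Suc t)
     then show ?case using cs[of t] none by auto
    qed (rule c0)
    then show False using ct by blast
   qed
   then obtain t where t: "t < ?t w" "\<beta> (Guard No_run, [t, 0, 0])" by blast
   have "flag (e t) = 2" using cn[OF t(2,1)] by (simp add: bm main)
   then have nB: "?v t \<notin> B" using c(4) t(1) by (simp add: answers_def)
   have mt: "\<beta> (Sym Main_run 1 (cell (?z w) (snd (c t) ! 1) i), [0, t, i])" if "i < ?y w" for i
    using t(1) by (simp add: bm main)
   have n0: "\<beta> (Sym No_run 0 (cell (?z w) (word_tape (?v t)) i), [t, 0, i])" if "?z w <= i" "i < ?y w" for i
    by (rule link_sound[OF Z0(1) H(2) refl small[OF t(1)] t(2) mt q(3,1)[OF t(1)] that])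
   \<comment> \<open>The inner clauses thus prove the query accepted by N, although its negative
     answer is true by the choice of the computation.\<close>
   have "accepts N {} (?v t)" by (rule NB.sound_accepts[OF refl H(1) tz(2) small[OF t(1)] t(2) n0])
   then show False using N(3) nB by (simp add: recognizes_def)
  qed
  have "~ \<alpha> F.uvar" by (simp add: F.uvar_def \<alpha>_def facts_def)
  then show "\<exists>\<alpha>. ~ \<alpha> F.uvar & (\<forall>S\<in>?O. holds \<alpha> w (?y w) S) &
   (\<forall>\<beta>. (\<forall>v. F.exv v --> \<beta> v = \<alpha> v) -->
    ~ (\<forall>S\<in>?I. holds \<beta> w (?y w) S))"
   using outer inner by (intro exI[of _ \<alpha>] conjI allI impI)
 qed
 show "\<exists>f. poly_time_computable f & (\<forall>w. f w \<in> SF_CA_input_words \<sigma> & (w \<in> X <-> f w \<in> SF_CA \<sigma>))"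
  using F.reduction2[OF \<sigma>] unfolding X by blast
qed

theorem theorem7:
  "(\<forall>\<sigma> \<in> {CO, ST}.
      hard_for NP (SF_CA_input_words \<sigma>) (SF_CA \<sigma>) \<and> SF_CA \<sigma> \<in> Theta_p 2) \<and>
   (\<forall>\<sigma> \<in> {PR, SST}.
      hard_for (Sigma_p 2) (SF_CA_input_words \<sigma>) (SF_CA \<sigma>) \<and> SF_CA \<sigma> \<in> Theta_p 3)"
  using NP_hard Sigma2_hard SF_CA_Theta_2 SF_CA_Theta_3 by blast

end
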